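(* Let $n\in\mathbb N$, $1<p<\infty$, $s_1\ge\tau^{n+}_p$ and $s_2\le\tau^{n-}_p$, and consider the spaces $X^{s_1}_p(\mathbb R^n)$ and $Y^{s_2}_p(\mathbb R^n)$ defined below. Then the Fourier transform $F$ maps $X^{s_1}_p(\mathbb R^n)$ continuously into $Y^{s_2}_p(\mathbb R^n)$. This mapping is compact if, and only if, both $s_1>\tau^{n+}_p$ and $s_2<\tau^{n-}_p$.
   Context: The Fourier transform is $(F\varphi)(\xi)=(2\pi)^{-n/2}\int_{\mathbb R^n}e^{-ix\xi}\varphi(x)\,dx$ for $\varphi\in S(\mathbb R^n)$, extended to $S'(\mathbb R^n)$ in the standard way; $g^\vee=F^{-1}g$. Fix $\varphi_0\in S(\mathbb R^n)$ with $\varphi_0=1$ on $|x|\le1$, $\varphi_0=0$ on $|x|\ge3/2$, and $\varphi_k(x)=\varphi_0(2^{-k}x)-\varphi_0(2^{-k+1}x)$, $k\in\mathbb N$. For $s\in\mathbb R$, $0<p,q\le\infty$, $B^s_{p,q}(\mathbb R^n)$ is the set of $f\in S'(\mathbb R^n)$ with $\big(\sum_{j\ge0}2^{jsq}\|(\varphi_j\widehat f)^\vee\,|L_p(\mathbb R^n)\|^q\big)^{1/q}<\infty$ (usual modification if $q=\infty$), and $B^s_p=B^s_{p,p}$. Let $d^n_p=2n(\frac1p-\frac12)$, $\tau^{n+}_p=\max(0,d^n_p)$, $\tau^{n-}_p=\min(0,d^n_p)$. For $1<p<\infty$ define $X^s_p(\mathbb R^n)=L_p(\mathbb R^n)$ if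 $2\le p<\infty$, $s=0$; $X^s_p=B^s_p(\mathbb R^n)$ if $2\le p<\infty$, $s>0$; $X^s_p=B^s_p(\mathbb R^n)$ if $1<p\le2$, $s\ge d^n_p$. Define $Y^s_p(\mathbb R^n)=B^s_p(\mathbb R^n)$ if $2\le p<\infty$, $s\le d^n_p$; $Y^s_p=B^s_p(\mathbb R^n)$ if $1<p\le 2$, $s<0$; $Y^s_p=L_p(\mathbb R^n)$ if $1<p\le2$, $s=0$. *)

theory Defs
  imports "HOL-Analysis.Analysis"
begin

text \<open>Test functions / functions on R^n are complex valued functions on real^'n;
  the dimension n is CARD('n). A (tempered) distribution is a functional on such functions,
  normalised to vanish outside the Schwartz space.\<close>

type_synonym 'n distr = "(real^'n \<Rightarrow> complex) \<Rightarrow> complex"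

definition partial :: "'n::finite \<Rightarrow> (real^'n \<Rightarrow> complex) \<Rightarrow> real^'n \<Rightarrow> complex" where
  "partial i f x = vector_derivative (\<lambda>t::real. f (x + t *\<^sub>R axis i 1)) (at 0)"

primrec pds :: "'n::finite list \<Rightarrow> (real^'n \<Rightarrow> complex) \<Rightarrow> real^'n \<Rightarrow> complex" where
  "pds [] f = f"
| "pds (i # is) f = partial i (pds is f)"

definition smooth :: "(real^'n::finite \<Rightarrow> complex) \<Rightarrow> bool" where
  "smooth f \<longleftrightarrow> (\<forall>is x. pds is f differentiable (at x))"

definition schwartz :: "(real^'n::finite \<Rightarrow> complex) set" where
  "schwartz = {f. smooth f \<and> (\<forall>is (k::nat). \<exists>C. \<forall>x. (1 + norm x) ^ k * norm (pds is f x) \<le> C)}"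

text \<open>Tempered distributions: linear on S, continuous w.r.t. the Schwartz seminorms
  p_{k,m}(phi) = sup_{x, |alpha| <= m} (1+|x|)^k |D^alpha phi(x)|.\<close>
definition tempered :: "'n::finite distr \<Rightarrow> bool" where
  "tempered T \<longleftrightarrow>
     (\<forall>\<phi>. \<phi> \<notin> schwartz \<longrightarrow> T \<phi> = 0) \<and>
     (\<forall>\<phi>\<in>schwartz. \<forall>\<psi>\<in>schwartz. \<forall>c::complex.
        T (\<lambda>x. \<phi> x + \<psi> x) = T \<phi> + T \<psi> \<and> T (\<lambda>x. c * \<phi> x) = c * T \<phi>) \<and>
     (\<exists>C (k::nat) (m::nat). \<forall>\<phi>\<in>schwartz. \<forall>B.
        (\<forall>x is. length is \<le> m \<longrightarrow> (1 + norm x) ^ k * norm (pds is \<phi> x) \<le> B)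
        \<longrightarrow> norm (T \<phi>) \<le> C * B)"

definition FT :: "(real^'n::finite \<Rightarrow> complex) \<Rightarrow> real^'n \<Rightarrow> complex" where
  "FT \<phi> \<xi> = complex_of_real ((2 * pi) powr (- real CARD('n) / 2)) *
      (\<integral>x. cis (- (x \<bullet> \<xi>)) * \<phi> x \<partial>lborel)"

definition IFT :: "(real^'n::finite \<Rightarrow> complex) \<Rightarrow> real^'n \<Rightarrow> complex" where
  "IFT \<phi> \<xi> = complex_of_real ((2 * pi) powr (- real CARD('n) / 2)) *
      (\<integral>x. cis (x \<bullet> \<xi>) * \<phi> x \<partial>lborel)"

definition FTd :: "'n::finite distr \<Rightarrow> 'n distr" where
  "FTd T = (\<lambda>\<phi>. if \<phi> \<in> schwartz then T (FT \<phi>) else 0)"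

definition IFTd :: "'n::finite distr \<Rightarrow> 'n distr" where
  "IFTd T = (\<lambda>\<phi>. if \<phi> \<in> schwartz then T (IFT \<phi>) else 0)"

definition mult_d :: "(real^'n::finite \<Rightarrow> complex) \<Rightarrow> 'n distr \<Rightarrow> 'n distr" where
  "mult_d g T = (\<lambda>\<psi>. if \<psi> \<in> schwartz then T (\<lambda>x. g x * \<psi> x) else 0)"

definition diff_d :: "'n::finite distr \<Rightarrow> 'n distr \<Rightarrow> 'n distr" where
  "diff_d T S = (\<lambda>\<phi>. T \<phi> - S \<phi>)"

definition represents :: "(real^'n::finite \<Rightarrow> complex) \<Rightarrow> 'n distr \<Rightarrow> bool" where
  "represents g T \<longleftrightarrow> (\<forall>\<psi>\<in>schwartz. T \<psi> = (\<integral>x. g x * \<psi> x \<partial>lborel))"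

definition Lp_fun :: "real \<Rightarrow> (real^'n::finite \<Rightarrow> complex) \<Rightarrow> bool" where
  "Lp_fun p g \<longleftrightarrow> g \<in> borel_measurable lborel \<and> integrable lborel (\<lambda>x. norm (g x) powr p)"

definition lpnorm :: "real \<Rightarrow> (real^'n::finite \<Rightarrow> complex) \<Rightarrow> real" where
  "lpnorm p g = (\<integral>x. norm (g x) powr p \<partial>lborel) powr (1 / p)"

definition Lp_dist :: "real \<Rightarrow> 'n::finite distr \<Rightarrow> bool" where
  "Lp_dist p T \<longleftrightarrow> (\<exists>g. Lp_fun p g \<and> represents g T)"

definition Lp_dnorm :: "real \<Rightarrow> 'n::finite distr \<Rightarrow> real" where
  "Lp_dnorm p T = (SOME r. \<exists>g. Lp_fun p g \<and> represents g T \<and> r = lpnorm p g)"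

definition phij :: "(real^'n::finite \<Rightarrow> complex) \<Rightarrow> nat \<Rightarrow> real^'n \<Rightarrow> complex" where
  "phij \<phi>0 j x = (if j = 0 then \<phi>0 x
      else \<phi>0 ((1 / 2 ^ j) *\<^sub>R x) - \<phi>0 ((2 / 2 ^ j) *\<^sub>R x))"

definition besov_piece :: "(real^'n::finite \<Rightarrow> complex) \<Rightarrow> nat \<Rightarrow> 'n distr \<Rightarrow> 'n distr" where
  "besov_piece \<phi>0 j T = IFTd (mult_d (phij \<phi>0 j) (FTd T))"

definition besov_set :: "(real^'n::finite \<Rightarrow> complex) \<Rightarrow> real \<Rightarrow> real \<Rightarrow> 'n distr set" where
  "besov_set \<phi>0 s p = {T. tempered T \<and> (\<forall>j. Lp_dist p (besov_piece \<phi>0 j T)) \<and>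
      summable (\<lambda>j. (2 powr (real j * s) * Lp_dnorm p (besov_piece \<phi>0 j T)) powr p)}"

definition besov_norm :: "(real^'n::finite \<Rightarrow> complex) \<Rightarrow> real \<Rightarrow> real \<Rightarrow> 'n distr \<Rightarrow> real" where
  "besov_norm \<phi>0 s p T =
     (\<Sum>j. (2 powr (real j * s) * Lp_dnorm p (besov_piece \<phi>0 j T)) powr p) powr (1 / p)"

type_synonym 'n space = "'n distr set \<times> ('n distr \<Rightarrow> real)"

definition Lp_space :: "real \<Rightarrow> 'n::finite space" where
  "Lp_space p = ({T. tempered T \<and> Lp_dist p T}, Lp_dnorm p)"

definition Besov_space :: "(real^'n::finite \<Rightarrow> complex) \<Rightarrow> real \<Rightarrow> real \<Rightarrow> 'n space" where
  "Besov_space \<phi>0 s p = (besov_set \<phi>0 s p, besov_norm \<phi>0 s p)"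

definition dnp :: "nat \<Rightarrow> real \<Rightarrow> real" where
  "dnp n p = 2 * real n * (1 / p - 1 / 2)"

definition tau_plus :: "nat \<Rightarrow> real \<Rightarrow> real" where
  "tau_plus n p = max 0 (dnp n p)"

definition tau_minus :: "nat \<Rightarrow> real \<Rightarrow> real" where
  "tau_minus n p = min 0 (dnp n p)"

definition X_space :: "(real^'n::finite \<Rightarrow> complex) \<Rightarrow> real \<Rightarrow> real \<Rightarrow> 'n space" where
  "X_space \<phi>0 p s =
     (if 2 \<le> p \<and> s = 0 then Lp_space p
      else if (2 \<le> p \<and> s > 0) \<or> (1 < p \<and> p \<le> 2 \<and> s \<ge> dnp CARD('n) p) then Besov_space \<phi>0 s p
      else undefined)"

definition Y_space :: "(real^'n::finite \<Rightarrow> complex) \<Rightarrow> real \<Rightarrow> real \<Rightarrow> 'n space" where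
  "Y_space \<phi>0 p s =
     (if (2 \<le> p \<and> s \<le> dnp CARD('n) p) \<or> (1 < p \<and> p \<le> 2 \<and> s < 0) then Besov_space \<phi>0 s p
      else if 1 < p \<and> p \<le> 2 \<and> s = 0 then Lp_space p
      else undefined)"

definition maps_continuously :: "('n::finite distr \<Rightarrow> 'n distr) \<Rightarrow> 'n space \<Rightarrow> 'n space \<Rightarrow> bool" where
  "maps_continuously A X Y \<longleftrightarrow>
     (\<forall>f\<in>fst X. A f \<in> fst Y) \<and>
     (\<forall>fs f. (\<forall>k. fs k \<in> fst X) \<and> f \<in> fst X \<and>
        (\<lambda>k. snd X (diff_d (fs k) f)) \<longlonglongrightarrow> 0 \<longrightarrow>
        (\<lambda>k. snd Y (diff_d (A (fs k)) (A f))) \<longlonglongrightarrow> 0)"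

definition compact_op :: "('n::finite distr \<Rightarrow> 'n distr) \<Rightarrow> 'n space \<Rightarrow> 'n space \<Rightarrow> bool" where
  "compact_op A X Y \<longleftrightarrow>
     (\<forall>fs :: nat \<Rightarrow> 'n distr. (\<forall>k. fs k \<in> fst X) \<and> bounded (range (\<lambda>k. snd X (fs k))) \<longrightarrow>
        (\<exists>r g. strict_mono r \<and> g \<in> fst Y \<and>
           (\<lambda>k. snd Y (diff_d (A (fs (r k))) g)) \<longlonglongrightarrow> 0))"

end

theory Submission
  imports Defs "HOL-Probability.Characteristic_Functions" "HOL-Probability.Sinc_Integral" "HOL-Complex_Analysis.Great_Picard"
begin

text \<open>
  The \<open>j\<close>-th Littlewood--Paley piece of \<open>F f\<close> is the Fourier transform of \<open>f\<close> cut off to a dyadic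
  annulus of volume about \<open>2\<^sup>j\<^sup>n\<close>. For \<open>p \<ge> 2\<close>, interpolating between \<open>L\<^sub>2 \<rightarrow> L\<^sub>2\<close> (Plancherel) and
  \<open>L\<^sub>\<infinity> \<rightarrow> L\<^sub>\<infinity>\<close> on such an annulus costs exactly the factor that the weight \<open>2 powr (j * d)\<close>
  compensates, and the annuli overlap boundedly; hence \<open>F\<close> maps \<open>L\<^sub>p\<close> into the Besov space of order \<open>d\<close>.
  The case \<open>p < 2\<close> is dual. The remaining parameters follow from the monotonicity of the
  Besov scale and from its comparison with \<open>L\<^sub>p\<close>.

  A bounded sequence in a Besov space of positive order has a subsequence that converges in
  \<open>L\<^sub>p\<close> on balls, because its pieces are equicontinuous and its high frequencies are uniformly
  small. Strict inequality on the other side makes the remaining tails uniformly small, which gives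
  compactness. At the endpoints modulations, translations and dilations of a fixed Schwartz function
  stay bounded but have no convergent subsequence of images.
\<close>

text \<open>All estimates concern p-th powers with values in \<open>ennreal\<close>, infinite
  outside the space (\<open>lpE\<close>, \<open>dE\<close>, \<open>bE\<close>), so that they can be
  added and summed without finiteness conditions. The price is a factor \<open>2 powr p\<close> in
  place of the triangle inequality, which convergence does not notice. \<open>Lp_dnorm\<close>
  selects a representing function by choice; it can be computed only once representing functions are
  known to be unique almost everywhere. The integral \<open>FT\<close> makes sense for integrable
  functions only. For p \<ge> 2 the cutoff acts on the input, and an L_p function cut off to a ball
  is integrable. For p < 2 the cutoff acts on the output, and the transform of a non-integrable
  input is obtained as a limit along truncations. The bounds for p < 2 come from a second
  Marcinkiewicz interpolation, between L_1 and L_2, and not from duality of spaces. The two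
  counterexamples at order \<open>dnp\<close> rest on the scaling identity
  \<open>lpE_FT_dilate\<close>: a dilation by t that keeps the L_p norm multiplies the L_p norm of
  the transform by \<open>t powr (- dnp n p)\<close>, which the Besov weight of order
  \<open>dnp\<close> undoes.\<close>

type_synonym 'n cfun = "real^'n \<Rightarrow> complex"

section \<open>Iterated partial derivatives\<close>

text \<open>\<open>partial\<close> is a derivative along a line; expressed through the total
  derivative it inherits the sum, product and chain rules from
  \<open>has_derivative\<close>.\<close>

lemma partial_eq:
  assumes "(f has_derivative D) (at x)"
  shows "partial i f x = D (axis i 1)"
proof -
  have 1: "((%t::real. x + t *\<^sub>R axis i 1) has_derivative (%t. t *\<^sub>R axis i 1)) (at 0)"
    by (auto intro!: derivative_eq_intros)
  have "((%t. f (x + t *\<^sub>R axis i 1)) has_derivative (%t. D (t *\<^sub>R axis i 1))) (at 0)"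
    using has_derivative_compose[OF 1, of f D] assms by simp
  moreover have "(%t. D (t *\<^sub>R axis i 1)) = (%t. t *\<^sub>R D (axis i 1))"
    using has_derivative_linear[OF assms] by (auto simp: linear_scale)
  ultimately show ?thesis
    unfolding partial_def by (intro vector_derivative_at) (simp add: has_vector_derivative_def)
qed

lemma has_derivative_partial:
  fixes f :: "'n::finite cfun"
  assumes "f differentiable (at x)"
  shows "(f has_derivative (%h. \<Sum>i\<in>UNIV. h $ i *\<^sub>R partial i f x)) (at x)"
proof -
  obtain D where D: "(f has_derivative D) (at x)"
    using assms by (auto simp: differentiable_def)
  have "D h = (\<Sum>i\<in>UNIV. h $ i *\<^sub>R partial i f x)" for h
  proof -
    have "D h = D (\<Sum>i\<in>UNIV. h $ i *\<^sub>R axis i 1)"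
      using basis_expansion[of h] by (simp add: scalar_mult_eq_scaleR)
    also have "... = (\<Sum>i\<in>UNIV. h $ i *\<^sub>R D (axis i 1))"
      using has_derivative_linear[OF D] by (simp add: linear_sum linear_scale)
    finally show ?thesis by (simp add: partial_eq[OF D])
  qed
  then have "D = (%h. \<Sum>i\<in>UNIV. h $ i *\<^sub>R partial i f x)" by (rule ext)
  then show ?thesis using D by simp
qed

lemma pds_append: "pds (as @ bs) f = pds as (pds bs f)"
  by (induction as) auto

lemma partial_add:
  assumes "f differentiable (at x)" "g differentiable (at x)"
  shows "partial i (%x. f x + g x) x = partial i f x + partial i g x"
proof -
  obtain D E where *: "(f has_derivative D) (at x)" "(g has_derivative E) (at x)"
    using assms by (auto simp: differentiable_def)
  show ?thesis
    using partial_eq[OF has_derivative_add[OF *]] partial_eq[OF *(1)] partial_eq[OF *(2)] by simp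
qed

lemma partial_mult:
  assumes "f differentiable (at x)" "g differentiable (at x)"
  shows "partial i (%x. f x * g x) x = partial i f x * g x + f x * partial i g x"
proof -
  obtain D E where *: "(f has_derivative D) (at x)" "(g has_derivative E) (at x)"
    using assms by (auto simp: differentiable_def)
  show ?thesis
    using partial_eq[OF has_derivative_mult[OF *]] partial_eq[OF *(1)] partial_eq[OF *(2)] by simp
qed

lemma partial_const [simp]: "partial i (%x. c) = (%x. 0)"
  using partial_eq[OF has_derivative_const] by (auto simp: fun_eq_iff)

lemma pds_zero [simp]: "pds is (%x. 0) = (%x. 0)"
  by (induction "is") auto

lemma smooth_pds: "smooth f ==> smooth (pds is f)"
  unfolding smooth_def by (metis pds_append)

lemma smooth_partial: "smooth f ==> smooth (partial i f)"
  using smooth_pds[of f "[i]"] by simp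

lemma smooth_differentiable: "smooth f ==> f differentiable (at x)"
  unfolding smooth_def by (metis pds.simps(1))

lemma smooth_pds_differentiable: "smooth f ==> pds is f differentiable (at x)"
  unfolding smooth_def by blast

lemma smooth_continuous: "smooth f ==> continuous_on UNIV f"
  by (meson continuous_at_imp_continuous_on differentiable_imp_continuous_within smooth_differentiable)

text \<open>Differentiability is demanded only below the order in question, because
  \<open>smooth_mult\<close> applies this to products whose smoothness is still being
  proved.\<close>

lemma pds_add_upto:
  assumes "\<And>js x. length js < length is ==> pds js f differentiable (at x)"
    and "\<And>js x. length js < length is ==> pds js g differentiable (at x)"
  shows "pds is (%x. f x + g x) = (%x. pds is f x + pds is g x)"
  using assms
proof (induction "is")
  case (Cons i "is")
  have "pds is (%x. f x + g x) = (%x. pds is f x + pds is g x)"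
    using Cons by auto
  then show ?case using Cons.prems by (auto simp: partial_add)
qed auto

lemma pds_add:
  assumes "smooth f" "smooth g"
  shows "pds is (%x. f x + g x) = (%x. pds is f x + pds is g x)"
  using assms by (intro pds_add_upto) (auto simp: smooth_def)

lemma smooth_add:
  assumes "smooth f" "smooth g"
  shows "smooth (%x. f x + g x)"
  using assms unfolding smooth_def by (auto simp: pds_add[OF assms])

text \<open>Strong induction on the order, for all pairs f, g at once: the innermost derivative,
  which is the last list entry, turns the product into a sum of two products of smooth functions
  with one derivative fewer outside.\<close>

lemma smooth_mult:
  fixes f g :: "'n::finite cfun"
  assumes "smooth f" "smooth g"
  shows "smooth (%x. f x * g x)"
proof -
  have "\<forall>f g :: 'n cfun. smooth f \<longrightarrow> smooth g \<longrightarrow> (\<forall>is. length is = m \<longrightarrow> (\<forall>x. pds is (%x. f x * g x) differentiable (at x)))"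
    for m :: nat
  proof (induction m rule: less_induct)
    case (less m)
    show ?case
    proof (intro allI impI)
      fix f g :: "'n cfun" and "is" :: "'n list" and x
      assume sm: "smooth f" "smooth g" and len: "length is = m"
      show "pds is (%x. f x * g x) differentiable (at x)"
      proof (cases "is" rule: rev_cases)
        case Nil
        then show ?thesis using sm by (auto intro: differentiable_mult smooth_differentiable)
      next
        case (snoc js i)
        have IH: "pds as (%x. f x * g x) differentiable (at x)"
          if "smooth f" "smooth g" "length as <= length js" for f g :: "'n cfun" and as x
          using less[of "length as"] that len snoc by auto
        have "pds is (%x. f x * g x) = pds js (partial i (%x. f x * g x))"
          by (simp add: snoc pds_append)
        also have "partial i (%x. f x * g x) = (%x. partial i f x * g x + f x * partial i g x)"
          using sm by (auto simp: partial_mult smooth_differentiable)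
        also have "pds js ... = (%x. pds js (%x. partial i f x * g x) x + pds js (%x. f x * partial i g x) x)"
          using sm by (intro pds_add_upto) (auto intro!: IH simp: smooth_partial)
        finally show ?thesis
          using sm by (auto intro!: differentiable_add IH simp: smooth_partial)
      qed
    qed
  qed
  then show ?thesis using assms unfolding smooth_def by blast
qed

lemma smooth_const: "smooth (%x::real^'n::finite. c)"
proof -
  have "pds is (%x::real^'n. c) = (%x. c) \<or> pds is (%x::real^'n. c) = (%x. 0)" for "is"
    by (induction "is") auto
  then show ?thesis unfolding smooth_def by (metis differentiable_const)
qed

text \<open>Every derivative doubles the number of terms in the Leibniz expansion, hence
  \<open>2 ^ length is\<close>. Bounding all lower derivatives by the same F and G avoids binomial
  coefficients.\<close>

lemma norm_pds_mult_le:
  assumes "smooth f" "smooth g"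
    and "\<And>as. length as <= length is ==> norm (pds as f x) <= F"
    and "\<And>as. length as <= length is ==> norm (pds as g x) <= G"
  shows "norm (pds is (%x. f x * g x) x) <= 2 ^ length is * F * G"
  using assms
proof (induction "is" arbitrary: f g rule: rev_induct)
  case Nil
  have "norm (f x) <= F" "norm (g x) <= G" using Nil(3)[of "[]"] Nil(4)[of "[]"] by auto
  then show ?case by (auto simp: norm_mult intro!: mult_mono order_trans[OF norm_ge_zero])
next
  case (snoc i "is")
  have "pds (is @ [i]) (%x. f x * g x) = pds is (partial i (%x. f x * g x))"
    by (simp add: pds_append)
  also have "partial i (%x. f x * g x) = (%x. partial i f x * g x + f x * partial i g x)"
    using snoc by (auto simp: partial_mult smooth_differentiable)
  also have "pds is ... = (%x. pds is (%x. partial i f x * g x) x + pds is (%x. f x * partial i g x) x)"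
    using snoc by (intro pds_add) (auto intro!: smooth_mult smooth_partial)
  finally have eq: "pds (is @ [i]) (%x. f x * g x) x = pds is (%x. partial i f x * g x) x + pds is (%x. f x * partial i g x) x"
    by simp
  have *: "norm (pds as (partial i f) x) <= F" "norm (pds as (partial i g) x) <= G" if "length as <= length is" for as
    using snoc(4)[of "as @ [i]"] snoc(5)[of "as @ [i]"] that by (auto simp: pds_append)
  have "norm (pds is (%x. partial i f x * g x) x) <= 2 ^ length is * F * G"
    using snoc.prems by (intro snoc.IH) (auto intro!: smooth_partial *)
  moreover have "norm (pds is (%x. f x * partial i g x) x) <= 2 ^ length is * F * G"
    using snoc.prems by (intro snoc.IH) (auto intro!: smooth_partial *)
  ultimately show ?case
    using norm_triangle_ineq[of "pds is (%x. partial i f x * g x) x" "pds is (%x. f x * partial i g x) x"]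
    by (simp add: eq)
qed

lemma pds_cmult:
  assumes "smooth f"
  shows "pds is (%x. c * f x) = (%x. c * pds is f x)"
proof (induction "is")
  case (Cons i "is")
  have "partial i (%x. c * pds is f x) x = c * partial i (pds is f) x" for x
    using partial_mult[of "%x. c" x "pds is f" i] smooth_pds_differentiable[OF assms] by simp
  then show ?case using Cons by auto
qed auto

lemma pds_affine:
  fixes f :: "'n::finite cfun"
  assumes "smooth f"
  shows "pds is (%x. f (c *\<^sub>R x + a)) = (%x. of_real (c ^ length is) * pds is f (c *\<^sub>R x + a))"
proof (induction "is")
  case (Cons i "is")
  show ?case
  proof
    fix x
    obtain D where D: "(pds is f has_derivative D) (at (c *\<^sub>R x + a))"
      using smooth_pds_differentiable[OF assms] by (auto simp: differentiable_def)
    have 1: "((%x. c *\<^sub>R x + a) has_derivative (%h. c *\<^sub>R h)) (at x)"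
      by (auto intro!: derivative_eq_intros)
    have "((%x. of_real (c ^ length is) * pds is f (c *\<^sub>R x + a)) has_derivative (%h. of_real (c ^ length is) * D (c *\<^sub>R h))) (at x)"
      by (rule has_derivative_mult_right) (rule has_derivative_compose[OF 1 D])
    from partial_eq[OF this, of i] show "pds (i # is) (%x. f (c *\<^sub>R x + a)) x = of_real (c ^ length (i # is)) * pds (i # is) f (c *\<^sub>R x + a)"
      using Cons linear_scale[OF has_derivative_linear[OF D], of c "axis i 1"]
      by (simp add: partial_eq[OF D] scaleR_conv_of_real[where 'a = complex])
  qed
qed auto

lemma smooth_affine:
  fixes f :: "'n::finite cfun"
  assumes "smooth f"
  shows "smooth (%x. f (c *\<^sub>R x + a))"
  unfolding smooth_def
proof (intro allI)
  fix "is" x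
  have "(%x. pds is f (c *\<^sub>R x + a)) differentiable (at x)"
    by (rule differentiable_compose[of "pds is f"])
      (auto intro!: derivative_intros smooth_pds_differentiable[OF assms])
  then show "pds is (%x. f (c *\<^sub>R x + a)) differentiable (at x)"
    by (auto simp: pds_affine[OF assms] intro!: derivative_intros)
qed

lemma pds_cnj:
  fixes f :: "'n::finite cfun"
  assumes "smooth f"
  shows "pds is (%x. cnj (f x)) = (%x. cnj (pds is f x))"
proof (induction "is")
  case (Cons i "is")
  show ?case
  proof
    fix x
    obtain D where D: "(pds is f has_derivative D) (at x)"
      using smooth_pds_differentiable[OF assms] by (auto simp: differentiable_def)
    from partial_eq[OF bounded_linear.has_derivative[OF bounded_linear_cnj D]]
    show "pds (i # is) (%x. cnj (f x)) x = cnj (pds (i # is) f x)"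
      using Cons by (simp add: partial_eq[OF D])
  qed
qed auto

lemma smooth_cnj:
  fixes f :: "'n::finite cfun"
  assumes "smooth f"
  shows "smooth (%x. cnj (f x))"
  unfolding smooth_def pds_cnj[OF assms]
proof (intro allI)
  fix "is" x
  obtain D where "(pds is f has_derivative D) (at x)"
    using smooth_pds_differentiable[OF assms] by (auto simp: differentiable_def)
  from bounded_linear.has_derivative[OF bounded_linear_cnj this]
  show "(%x. cnj (pds is f x)) differentiable (at x)"
    by (auto simp: differentiable_def)
qed

lemma pds_coord:
  "pds is (%x::real^'n::finite. complex_of_real (x $ i)) =
    (case is of [] => (%x. complex_of_real (x $ i)) | [j] => (%x. if i = j then 1 else 0) | _ => (%x. 0))"
proof (induction "is" rule: list.induct)
  case (Cons j js)
  have d: "((%x::real^'n. complex_of_real (x $ i)) has_derivative (%h. complex_of_real (h $ i))) (at x)" for x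
    by (intro bounded_linear_imp_has_derivative bounded_linear_compose[OF bounded_linear_of_real bounded_linear_vec_nth])
  have *: "partial j (%x. complex_of_real (x $ i)) = (%x. if i = j then 1 else 0)"
    using partial_eq[OF d] by (auto simp: axis_def)
  show ?case
    using Cons * by (auto simp del: pds.simps simp add: pds.simps(2) split: list.splits)
qed auto

lemma smooth_coord: "smooth (%x::real^'n::finite. complex_of_real (x $ i))"
proof -
  have d: "((%x::real^'n. complex_of_real (x $ i)) has_derivative (%h. complex_of_real (h $ i))) (at x)" for x
    by (intro bounded_linear_imp_has_derivative bounded_linear_compose[OF bounded_linear_of_real bounded_linear_vec_nth])
  show ?thesis
    unfolding smooth_def using d
    by (auto simp: pds_coord differentiable_def[of "%x. complex_of_real (x $ i)"] split: list.splits)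
qed

lemma norm_pds_coord_le: "norm (pds is (%x::real^'n::finite. complex_of_real (x $ i)) x) <= 1 + norm x"
  using component_le_norm_cart[of x i] by (auto simp: pds_coord split: list.splits)

section \<open>The Schwartz space\<close>

text \<open>Stated with a bound as parameter instead of a supremum, because \<open>tempered\<close>
  expresses continuity through such bounds.\<close>

definition sbound :: "nat => nat => ('n::finite cfun) => real => bool" where
  "sbound k m f B \<longleftrightarrow> (\<forall>x is. length is <= m \<longrightarrow> (1 + norm x) ^ k * norm (pds is f x) <= B)"

lemma sbound_nonneg: "sbound k m f B ==> 0 <= B"
proof -
  assume "sbound k m f B"
  then have "(1 + norm (0::real^'a)) ^ k * norm (pds [] f 0) <= B"
    unfolding sbound_def by (metis list.size(3) zero_le)
  then show "0 <= B" by (meson norm_ge_zero order_trans mult_nonneg_nonneg zero_le_power add_nonneg_nonneg zero_le_one)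
qed

lemma sbound_mono:
  assumes "sbound k m f B" "k' <= k" "m' <= m" "B <= B'"
  shows "sbound k' m' f B'"
  unfolding sbound_def
proof (intro allI impI)
  fix x and "is" :: "'a list"
  assume "length is <= m'"
  then have "(1 + norm x) ^ k * norm (pds is f x) <= B"
    using assms unfolding sbound_def by auto
  moreover have "(1 + norm x) ^ k' * norm (pds is f x) <= (1 + norm x) ^ k * norm (pds is f x)"
    using assms by (intro mult_right_mono power_increasing) auto
  ultimately show "(1 + norm x) ^ k' * norm (pds is f x) <= B'" using assms by linarith
qed

lemma sboundD: "sbound k m f B ==> length is <= m ==> (1 + norm x) ^ k * norm (pds is f x) <= B"
  unfolding sbound_def by blast

lemma sboundD': "sbound k m f B ==> length is <= m ==> norm (pds is f x) <= B / (1 + norm x) ^ k"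
  using sboundD[of k m f B "is" x] zero_less_power[of "1 + norm x" k]
  by (simp add: field_simps add_pos_nonneg)

lemma schwartz_smooth: "f \<in> schwartz ==> smooth f"
  by (auto simp: schwartz_def)

lemma schwartz_sbound:
  fixes f :: "'n::finite cfun"
  assumes "f \<in> schwartz"
  obtains B where "sbound k m f B" "B > 0"
proof -
  have "\<forall>is. \<exists>C. \<forall>x. (1 + norm x) ^ k * norm (pds is f x) <= C"
    using assms by (auto simp: schwartz_def)
  then obtain C where C: "\<And>is x. (1 + norm x) ^ k * norm (pds is f x) <= C is"
    by metis
  have fin: "finite {is::'n list. length is <= m}"
    using finite_lists_length_le[of "UNIV::'n set" m] by simp
  \<comment> \<open>\<open>schwartz\<close> gives a constant for each list of derivatives
    separately; only finitely many lists have length at most m, so the sum serves all of them. The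
    added 1 makes it positive.\<close>
  have "sbound k m f (1 + (\<Sum>is\<in>{is::'n list. length is <= m}. \<bar>C is\<bar>))"
    unfolding sbound_def
  proof (intro allI impI)
    fix x and "is" :: "'n list"
    assume "length is <= m"
    then have "\<bar>C is\<bar> <= (\<Sum>is\<in>{is::'n list. length is <= m}. \<bar>C is\<bar>)"
      using fin by (intro member_le_sum) auto
    then show "(1 + norm x) ^ k * norm (pds is f x) <= 1 + (\<Sum>is\<in>{is::'n list. length is <= m}. \<bar>C is\<bar>)"
      using C[of x "is"] by linarith
  qed
  then show ?thesis by (rule that) (auto intro!: add_pos_nonneg sum_nonneg)
qed

lemma schwartzI:
  assumes "smooth f" "\<And>k m. \<exists>B. sbound k m f B"
  shows "f \<in> schwartz"
  unfolding schwartz_def using assms unfolding sbound_def by (auto; meson order_refl)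

lemma sbound_add:
  assumes "smooth f" "smooth g" "sbound k m f A" "sbound k m g B"
  shows "sbound k m (%x. f x + g x) (A + B)"
  unfolding sbound_def pds_add[OF assms(1,2)]
proof (intro allI impI)
  fix x and "is" :: "'a list" assume "length is <= m"
  then have "(1 + norm x) ^ k * norm (pds is f x) + (1 + norm x) ^ k * norm (pds is g x) <= A + B"
    using assms sboundD by (intro add_mono) blast+
  moreover have "(1 + norm x) ^ k * norm (pds is f x + pds is g x)
      <= (1 + norm x) ^ k * (norm (pds is f x) + norm (pds is g x))"
    by (intro mult_left_mono norm_triangle_ineq) auto
  ultimately show "(1 + norm x) ^ k * norm (pds is f x + pds is g x) <= A + B"
    by (simp add: distrib_left)
qed

lemma sbound_cmult:
  assumes "smooth f" "sbound k m f A"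
  shows "sbound k m (%x. c * f x) (norm c * A)"
  using assms(2) unfolding sbound_def pds_cmult[OF assms(1)]
  by (auto simp: norm_mult mult.left_commute mult_left_mono)

lemma sbound_partial: "sbound k (Suc m) f B ==> sbound k m (partial i f) B"
  unfolding sbound_def using pds_append[of _ "[i]" f] by (metis Suc_le_mono length_append_singleton pds.simps)

text \<open>Growth of g of order l is paid for with l powers of decay of f. It covers multiplication
  by a coordinate (l = 1) and by functions with bounded derivatives (l = 0).\<close>

lemma sbound_mult:
  fixes f g :: "'n::finite cfun"
  assumes "smooth f" "smooth g" "sbound k m f B"
    and "\<And>x is. length is <= m ==> norm (pds is g x) <= F * (1 + norm x) ^ l" "k = k' + l" "0 <= F"
  shows "sbound k' m (%x. g x * f x) (2 ^ m * F * B)"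
  unfolding sbound_def
proof (intro allI impI)
  fix x :: "real^'n" and "is" :: "'n list" assume len: "length is <= m"
  have pos: "0 < (1 + norm x) ^ j" for j :: nat by (simp add: add_pos_nonneg)
  have B: "0 <= B" using assms sbound_nonneg by blast
  have "norm (pds is (%x. g x * f x) x) <= 2 ^ length is * (F * (1 + norm x) ^ l) * (B / (1 + norm x) ^ k)"
    using assms len by (intro norm_pds_mult_le sboundD'[OF assms(3)]) auto
  also have "... <= 2 ^ m * (F * (1 + norm x) ^ l) * (B / (1 + norm x) ^ k)"
    using len assms B pos[of k] by (intro mult_right_mono power_increasing mult_nonneg_nonneg) auto
  finally have "(1 + norm x) ^ k' * norm (pds is (%x. g x * f x) x)
      <= (1 + norm x) ^ k' * (2 ^ m * (F * (1 + norm x) ^ l) * (B / (1 + norm x) ^ k))"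
    by (intro mult_left_mono) auto
  also have "... = 2 ^ m * F * B"
    using pos[of k'] pos[of l] pos[of 1] by (simp add: assms(5) power_add field_simps)
  finally show "(1 + norm x) ^ k' * norm (pds is (%x. g x * f x) x) <= 2 ^ m * F * B" .
qed

lemma sbound_coord:
  assumes "smooth f" "sbound (Suc k) m f B"
  shows "sbound k m (%x. complex_of_real (x $ i) * f x) (2 ^ m * B)"
proof -
  have "sbound k m (%x. complex_of_real (x $ i) * f x) (2 ^ m * 1 * B)"
    by (rule sbound_mult[OF assms(1) smooth_coord assms(2), where l = 1]) (auto simp: norm_pds_coord_le)
  then show ?thesis by simp
qed

lemma schwartz_zero: "(%x. 0) \<in> schwartz"
  by (intro schwartzI smooth_const) (auto simp: sbound_def)

lemma schwartz_add: "f \<in> schwartz ==> g \<in> schwartz ==> (%x. f x + g x) \<in> schwartz"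
  by (rule schwartzI) (metis schwartz_sbound schwartz_smooth sbound_add smooth_add)+

lemma smooth_cmult: "smooth f ==> smooth (%x. c * f x)"
  using smooth_mult[OF smooth_const] by blast

lemma schwartz_cmult: "f \<in> schwartz ==> (%x. c * f x) \<in> schwartz"
  by (rule schwartzI) (metis schwartz_sbound schwartz_smooth sbound_cmult smooth_cmult)+

lemma schwartz_diff: "f \<in> schwartz ==> g \<in> schwartz ==> (%x. f x - g x) \<in> schwartz"
  using schwartz_add[of f "%x. (-1) * g x"] schwartz_cmult[of g "-1"] by simp

lemma schwartz_partial: "f \<in> schwartz ==> partial i f \<in> schwartz"
  by (rule schwartzI) (metis schwartz_sbound schwartz_smooth sbound_partial smooth_partial)+

lemma schwartz_coord: "f \<in> schwartz ==> (%x. complex_of_real (x $ i) * f x) \<in> schwartz"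
  by (rule schwartzI) (metis schwartz_sbound schwartz_smooth sbound_coord smooth_mult smooth_coord)+

lemma schwartz_bounded:
  assumes "f \<in> schwartz"
  obtains F where "F > 0" "\<And>x is. length is <= m ==> norm (pds is f x) <= F"
proof -
  obtain B where B: "sbound 0 m f B" "B > 0" using schwartz_sbound[OF assms] by blast
  show ?thesis by (rule that[OF B(2)]) (use sboundD[OF B(1)] in auto)
qed

lemma schwartz_mult:
  assumes "f \<in> schwartz" "g \<in> schwartz"
  shows "(%x. f x * g x) \<in> schwartz"
proof (rule schwartzI)
  show "smooth (%x. f x * g x)" by (rule smooth_mult[OF assms[THEN schwartz_smooth]])
  fix k m
  obtain F where F: "F > 0" "\<And>x is. length is <= m ==> norm (pds is f x) <= F"
    using schwartz_bounded[OF assms(1)] by metis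
  obtain B where B: "sbound k m g B" using schwartz_sbound[OF assms(2)] by metis
  have "sbound k m (%x. f x * g x) (2 ^ m * F * B)"
    by (rule sbound_mult[OF schwartz_smooth[OF assms(2)] schwartz_smooth[OF assms(1)] B, where l = 0])
      (use F in auto)
  then show "\<exists>B. sbound k m (%x. f x * g x) B" by blast
qed

lemma schwartz_cnj:
  assumes "f \<in> schwartz"
  shows "(%x. cnj (f x)) \<in> schwartz"
  using assms by (auto simp: schwartz_def smooth_cnj pds_cnj)

lemma schwartz_affine:
  fixes f :: "'n::finite cfun"
  assumes "f \<in> schwartz" "c ~= 0"
  shows "(%x. f (c *\<^sub>R x + a)) \<in> schwartz"
proof (rule schwartzI)
  have sm: "smooth f" using assms by (auto intro: schwartz_smooth)
  show "smooth (%x. f (c *\<^sub>R x + a))" by (rule smooth_affine[OF sm])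
  fix k m
  \<comment> \<open>Decay in the new variable c x + a has to be turned into decay in x;
    \<open>L\<close> compares the two weights.\<close>
  define L where "L = (1 + norm a) * (1 + 1 / \<bar>c\<bar>)"
  have L: "1 + norm x <= L * (1 + norm (c *\<^sub>R x + a))" for x
  proof -
    have "\<bar>c\<bar> * norm x <= norm (c *\<^sub>R x + a) + norm a"
      using norm_triangle_ineq4[of "c *\<^sub>R x + a" a] by simp
    then have "norm x <= (norm (c *\<^sub>R x + a) + norm a) / \<bar>c\<bar>"
      using assms(2) by (simp add: field_simps)
    also have "... <= (1 + norm a) * (1 + norm (c *\<^sub>R x + a)) / \<bar>c\<bar>"
      by (intro divide_right_mono) (auto simp: algebra_simps)
    finally have 1: "norm x <= (1 + norm a) * (1 / \<bar>c\<bar>) * (1 + norm (c *\<^sub>R x + a))" by (simp add: field_simps)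
    have "1 * 1 <= (1 + norm a) * (1 + norm (c *\<^sub>R x + a))"
      by (intro mult_mono) auto
    moreover have "L * (1 + norm (c *\<^sub>R x + a)) = (1 + norm a) * (1 + norm (c *\<^sub>R x + a))
        + (1 + norm a) * (1 / \<bar>c\<bar>) * (1 + norm (c *\<^sub>R x + a))"
      unfolding L_def by (simp add: algebra_simps)
    ultimately show ?thesis using 1 by linarith
  qed
  have L0: "0 <= L" unfolding L_def by auto
  obtain B where B: "sbound k m f B" "B > 0" using schwartz_sbound[OF assms(1)] by metis
  have "sbound k m (%x. f (c *\<^sub>R x + a)) (L ^ k * max 1 \<bar>c\<bar> ^ m * B)"
    unfolding sbound_def pds_affine[OF sm]
  proof (intro allI impI)
    fix x and "is" :: "'n list" assume len: "length is <= m"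
    have "(1 + norm x) ^ k <= L ^ k * (1 + norm (c *\<^sub>R x + a)) ^ k"
      using L[of x] by (simp flip: power_mult_distrib add: power_mono)
    moreover have "\<bar>c\<bar> ^ length is <= max 1 \<bar>c\<bar> ^ m"
      using power_mono[of "\<bar>c\<bar>" "max 1 \<bar>c\<bar>" "length is"] power_increasing[OF len, of "max 1 \<bar>c\<bar>"] by linarith
    ultimately have "(1 + norm x) ^ k * (\<bar>c\<bar> ^ length is * norm (pds is f (c *\<^sub>R x + a)))
       <= (L ^ k * (1 + norm (c *\<^sub>R x + a)) ^ k) * (max 1 \<bar>c\<bar> ^ m * norm (pds is f (c *\<^sub>R x + a)))"
      using L0 by (intro mult_mono mult_nonneg_nonneg) auto
    also have "... = (L ^ k * max 1 \<bar>c\<bar> ^ m) * ((1 + norm (c *\<^sub>R x + a)) ^ k * norm (pds is f (c *\<^sub>R x + a)))"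
      by simp
    also have "... <= L ^ k * max 1 \<bar>c\<bar> ^ m * B"
      using L0 by (intro mult_left_mono sboundD[OF B(1) len]) auto
    finally show "(1 + norm x) ^ k * norm (of_real (c ^ length is) * pds is f (c *\<^sub>R x + a)) <= L ^ k * max 1 \<bar>c\<bar> ^ m * B"
      by (simp add: norm_mult norm_power power_abs)
  qed
  then show "\<exists>B. sbound k m (%x. f (c *\<^sub>R x + a)) B" by blast
qed

lemma schwartz_uminus: "f \<in> schwartz ==> (%x. f (- x)) \<in> schwartz"
  using schwartz_affine[of f "-1" 0] by simp

lemma schwartz_scale: "f \<in> schwartz ==> c ~= 0 ==> (%x. f (c *\<^sub>R x)) \<in> schwartz"
  using schwartz_affine[of f c 0] by simp

lemma tempered_iff:
  "tempered T \<longleftrightarrow>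
     (\<forall>\<phi>. \<phi> \<notin> schwartz \<longrightarrow> T \<phi> = 0) \<and>
     (\<forall>\<phi>\<in>schwartz. \<forall>\<psi>\<in>schwartz. \<forall>c::complex.
        T (%x. \<phi> x + \<psi> x) = T \<phi> + T \<psi> \<and> T (%x. c * \<phi> x) = c * T \<phi>) \<and>
     (\<exists>C k m. \<forall>\<phi>\<in>schwartz. \<forall>B. sbound k m \<phi> B \<longrightarrow> norm (T \<phi>) <= C * B)"
  unfolding tempered_def sbound_def ..

section \<open>Integration over Euclidean space\<close>

lemma borel_measurable_cis [measurable]:
  "f \<in> borel_measurable M ==> (%x. cis (f x)) \<in> borel_measurable M"
  by (rule borel_measurable_continuous_on[where f = cis]) (auto intro!: continuous_intros)

lemma lborel_Fubini:
  fixes F :: "'a::euclidean_space => 'b::euclidean_space => complex"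
  assumes [measurable]: "case_prod F \<in> borel_measurable (lborel \<Otimes>\<^sub>M lborel)"
    and fin: "(\<integral>\<^sup>+x. \<integral>\<^sup>+y. ennreal (norm (F x y)) \<partial>lborel \<partial>lborel) < \<infinity>"
  shows "(\<integral>x. \<integral>y. F x y \<partial>lborel \<partial>lborel) = (\<integral>y. \<integral>x. F x y \<partial>lborel \<partial>lborel)"
    and "integrable lborel (%x. \<integral>y. F x y \<partial>lborel)"
    and "integrable lborel (%y. \<integral>x. F x y \<partial>lborel)"
proof -
  have int: "integrable (lborel \<Otimes>\<^sub>M lborel) (case_prod F)"
  proof (rule integrableI_bounded)
    have "(\<integral>\<^sup>+z. ennreal (norm (case_prod F z)) \<partial>(lborel \<Otimes>\<^sub>M lborel)) =
      (\<integral>\<^sup>+x. \<integral>\<^sup>+y. ennreal (norm (F x y)) \<partial>lborel \<partial>lborel)"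
      by (subst lborel.nn_integral_fst[symmetric]) auto
    then show "(\<integral>\<^sup>+z. ennreal (norm (case_prod F z)) \<partial>(lborel \<Otimes>\<^sub>M lborel)) < \<infinity>"
      using fin by simp
  qed simp
  show "(\<integral>x. \<integral>y. F x y \<partial>lborel \<partial>lborel) = (\<integral>y. \<integral>x. F x y \<partial>lborel \<partial>lborel)"
    by (rule lborel_pair.Fubini_integral[OF int, symmetric])
  show "integrable lborel (%x. \<integral>y. F x y \<partial>lborel)"
    by (rule lborel_pair.integrable_fst[OF int])
  show "integrable lborel (%y. \<integral>x. F x y \<partial>lborel)"
    by (rule lborel_pair.integrable_snd[OF int])
qed

text \<open>For a bounded kernel the double integral is dominated by the product of the two L_1
  norms. With the kernel \<open>cis (- (x \<bullet> y))\<close> this becomes the multiplication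
  formula for \<open>FT\<close>.\<close>

lemma kernel_Fubini:
  fixes a :: "'a::euclidean_space => complex" and b :: "'b::euclidean_space => complex"
  assumes a: "integrable lborel a" and b: "integrable lborel b"
    and k[measurable]: "case_prod k \<in> borel_measurable (lborel \<Otimes>\<^sub>M lborel)"
    and k1: "\<And>x y. norm (k x y) <= 1"
  shows "(\<integral>x. a x * (\<integral>y. k x y * b y \<partial>lborel) \<partial>lborel) = (\<integral>y. b y * (\<integral>x. k x y * a x \<partial>lborel) \<partial>lborel)"
proof -
  have [measurable]: "a \<in> borel_measurable lborel" "b \<in> borel_measurable lborel" using a b by auto
  have "(\<integral>\<^sup>+x. \<integral>\<^sup>+y. ennreal (norm (a x * (k x y * b y))) \<partial>lborel \<partial>lborel)
     <= (\<integral>\<^sup>+x. \<integral>\<^sup>+y. ennreal (norm (a x)) * ennreal (norm (b y)) \<partial>lborel \<partial>lborel)"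
  proof (intro nn_integral_mono)
    fix x y
    have "norm (a x * (k x y * b y)) <= norm (a x) * (1 * norm (b y))"
      unfolding norm_mult by (intro mult_left_mono mult_right_mono k1) auto
    then show "ennreal (norm (a x * (k x y * b y))) <= ennreal (norm (a x)) * ennreal (norm (b y))"
      by (simp flip: ennreal_mult)
  qed
  also have "... = (\<integral>\<^sup>+x. ennreal (norm (a x)) \<partial>lborel) * (\<integral>\<^sup>+y. ennreal (norm (b y)) \<partial>lborel)"
    by (simp add: nn_integral_cmult nn_integral_multc)
  also have "... < \<infinity>"
    using a b by (simp add: integrable_iff_bounded ennreal_mult_less_top)
  finally have fin: "(\<integral>\<^sup>+x. \<integral>\<^sup>+y. ennreal (norm (a x * (k x y * b y))) \<partial>lborel \<partial>lborel) < \<infinity>" .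
  have "(\<integral>x. a x * (\<integral>y. k x y * b y \<partial>lborel) \<partial>lborel) = (\<integral>x. \<integral>y. a x * (k x y * b y) \<partial>lborel \<partial>lborel)"
    by simp
  also have "... = (\<integral>y. \<integral>x. a x * (k x y * b y) \<partial>lborel \<partial>lborel)"
    by (rule lborel_Fubini(1)[OF _ fin]) simp
  also have "... = (\<integral>y. \<integral>x. b y * (k x y * a x) \<partial>lborel \<partial>lborel)"
    by (simp add: mult.commute mult.left_commute)
  finally show ?thesis by simp
qed

lemma nn_integral_affine:
  fixes f :: "'a::euclidean_space => ennreal"
  assumes [measurable]: "f \<in> borel_measurable borel" and c: "c ~= 0"
  shows "(\<integral>\<^sup>+x. f x \<partial>lborel) = ennreal (\<bar>c\<bar> ^ DIM('a)) * (\<integral>\<^sup>+x. f (t + c *\<^sub>R x) \<partial>lborel)"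
  by (subst lborel_affine[OF c, of t])
     (simp add: nn_integral_density nn_integral_distr nn_integral_cmult)

lemma integrable_affine:
  fixes f :: "'a::euclidean_space => 'b::{banach,second_countable_topology}"
  assumes f: "integrable lborel f" and c: "c ~= 0"
  shows "integrable lborel (%x. f (t + c *\<^sub>R x))"
proof -
  have [measurable]: "f \<in> borel_measurable borel" using f by auto
  have "ennreal (\<bar>c\<bar> ^ DIM('a)) * (\<integral>\<^sup>+x. norm (f (t + c *\<^sub>R x)) \<partial>lborel) < \<infinity>"
    using f nn_integral_affine[OF _ c, of "%x. ennreal (norm (f x))" t] by (auto simp: integrable_iff_bounded)
  then show ?thesis using c by (auto simp: integrable_iff_bounded ennreal_mult_less_top)
qed

lemma integral_affine:
  fixes f :: "'a::euclidean_space => 'b::{banach,second_countable_topology}"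
  assumes f: "integrable lborel f" and c: "c ~= 0"
  shows "(\<integral>x. f x \<partial>lborel) = \<bar>c\<bar> ^ DIM('a) *\<^sub>R (\<integral>x. f (t + c *\<^sub>R x) \<partial>lborel)"
  using c f f[THEN borel_measurable_integrable] integrable_affine[OF f c, of t]
  by (subst lborel_affine[OF c, of t]) (simp add: integral_density integral_distr)

lemma integral_translate:
  fixes f :: "'a::euclidean_space => 'b::{banach,second_countable_topology}"
  assumes f: "integrable lborel f"
  shows "(\<integral>x. f (x + t) \<partial>lborel) = (\<integral>x. f x \<partial>lborel)" "integrable lborel (%x. f (x + t))"
  using integral_affine[OF f, of 1 t] integrable_affine[OF f, of 1 t] by (auto simp: add.commute)

lemma integral_uminus:
  fixes f :: "'a::euclidean_space => 'b::{banach,second_countable_topology}"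
  assumes f: "integrable lborel f"
  shows "(\<integral>x. f (- x) \<partial>lborel) = (\<integral>x. f x \<partial>lborel)" "integrable lborel (%x. f (- x))"
  using integral_affine[OF f, of "-1" 0] integrable_affine[OF f, of "-1" 0] by auto

text \<open>Needed for the Gaussian, whose transform factors into one-dimensional integrals over the
  coordinates.\<close>

lemma integrable_prod_lborel:
  fixes f :: "'a::euclidean_space => real => complex"
  assumes "\<And>b. b \<in> Basis ==> integrable lborel (f b)"
  shows "integrable lborel (%x. \<Prod>b\<in>Basis. f b (x \<bullet> b))"
    and "(\<integral>x. (\<Prod>b\<in>Basis. f b (x \<bullet> b)) \<partial>lborel) = (\<Prod>b\<in>Basis. \<integral>x. f b x \<partial>lborel)"
proof -
  interpret product_sigma_finite "%_::'a. lborel :: real measure" ..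
  have [measurable]: "\<And>b. b \<in> Basis ==> f b \<in> borel_measurable borel" using assms by auto
  have *: "(\<Prod>b\<in>Basis. f b ((\<Sum>c\<in>Basis. x c *\<^sub>R c) \<bullet> b)) = (\<Prod>b\<in>Basis. f b (x b))" for x
    by (intro prod.cong) auto
  have "integrable (distr (\<Pi>\<^sub>M b\<in>Basis. lborel) borel (%f. \<Sum>b\<in>Basis. f b *\<^sub>R b)) (%x::'a. \<Prod>b\<in>Basis. f b (x \<bullet> b))"
    by (subst integrable_distr_eq) (auto simp: * assms intro!: product_integrable_prod)
  then show "integrable lborel (%x. \<Prod>b\<in>Basis. f b (x \<bullet> b))"
    by (subst lborel_eq)
  have "(\<integral>x. (\<Prod>b\<in>Basis. f b (x \<bullet> b)) \<partial>lborel) =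
      (\<integral>x. (\<Prod>b\<in>Basis. f b (x \<bullet> b)) \<partial>(distr (\<Pi>\<^sub>M b\<in>Basis. lborel) borel (%f. \<Sum>b\<in>Basis. f b *\<^sub>R b)))"
    by (subst lborel_eq) (rule refl)
  also have "... = (\<Prod>b\<in>Basis. \<integral>x. f b x \<partial>lborel)"
    by (subst integral_distr) (auto simp: * assms intro!: product_integral_prod)
  finally show "(\<integral>x. (\<Prod>b\<in>Basis. f b (x \<bullet> b)) \<partial>lborel) = (\<Prod>b\<in>Basis. \<integral>x. f b x \<partial>lborel)" .
qed

text \<open>With the exponent \<open>2 * CARD('n)\<close> the weight lies below the product over all
  coordinates of the one-dimensional functions 1 / (1 + t^2), so its integrability needs no polar
  coordinates.\<close>

definition weight :: "real^'n::finite => real" where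
  "weight x = 1 / (1 + norm x) ^ (2 * CARD('n))"

lemma weight_pos: "0 < weight x"
  unfolding weight_def by (simp add: add_pos_nonneg)

lemma weight_le_1: "weight x <= 1"
proof -
  have "1 <= (1 + norm x) ^ (2 * CARD('a))" by (rule one_le_power) simp
  then show ?thesis unfolding weight_def using divide_le_eq_1_pos[of "(1 + norm x) ^ (2 * CARD('a))" 1] by linarith
qed

lemma abs_weight [simp]: "\<bar>weight x\<bar> = weight x"
  by (rule abs_of_pos[OF weight_pos])

lemma weight_measurable [measurable]: "weight \<in> borel_measurable borel"
  unfolding weight_def[abs_def] by measurable

lemma integrable_weight: "integrable lborel (weight :: real^'n::finite => real)"
proof (rule integrableI_bounded)
  have one: "integrable lborel (%x::real. inverse (1 + x\<^sup>2))"
    using integrable_inverse_1_plus_square by (simp add: set_integrable_def)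
  have "ennreal (norm (weight x)) <= (\<Prod>b\<in>Basis. ennreal (inverse (1 + (x \<bullet> b)\<^sup>2)))" for x :: "real^'n"
  proof -
    have "(\<Prod>b\<in>(Basis::(real^'n) set). 1 + (x \<bullet> b)\<^sup>2) <= (\<Prod>b\<in>(Basis::(real^'n) set). (1 + norm x)\<^sup>2)"
    proof (rule prod_mono)
      fix b :: "real^'n" assume "b \<in> Basis"
      then have "(x \<bullet> b)\<^sup>2 <= (norm x)\<^sup>2"
        by (metis Basis_le_norm abs_ge_zero power2_abs power_mono)
      then show "0 <= 1 + (x \<bullet> b)\<^sup>2 \<and> 1 + (x \<bullet> b)\<^sup>2 <= (1 + norm x)\<^sup>2"
        using norm_ge_zero[of x] by (auto simp: power2_sum intro: add_increasing2)
    qed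
    also have "... = (1 + norm x) ^ (2 * CARD('n))"
      by (simp add: power_mult)
    finally have "weight x <= inverse (\<Prod>b\<in>(Basis::(real^'n) set). 1 + (x \<bullet> b)\<^sup>2)"
      unfolding weight_def inverse_eq_divide
      by (intro divide_left_mono mult_pos_pos prod_pos zero_less_power) (auto intro: add_pos_nonneg)
    also have "... = (\<Prod>b\<in>(Basis::(real^'n) set). inverse (1 + (x \<bullet> b)\<^sup>2))"
      using prod_inversef[of "%b. 1 + (x \<bullet> b)\<^sup>2" Basis] by (simp add: comp_def)
    finally show ?thesis
      using weight_pos[of x] by (subst prod_ennreal) (auto intro!: ennreal_leI)
  qed
  then have "(\<integral>\<^sup>+x. ennreal (norm (weight (x::real^'n))) \<partial>lborel) <= (\<integral>\<^sup>+x. (\<Prod>b\<in>(Basis::(real^'n) set). ennreal (inverse (1 + (x \<bullet> b)\<^sup>2))) \<partial>lborel)"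
    by (intro nn_integral_mono) auto
  also have "... = (\<Prod>b\<in>(Basis::(real^'n) set). \<integral>\<^sup>+x. ennreal (inverse (1 + x\<^sup>2)) \<partial>lborel)"
    by (subst nn_integral_lborel_prod) auto
  also have "... < \<infinity>"
    using one by (auto simp: integrable_iff_bounded less_top[symmetric] ennreal_prod_eq_top power_eq_top_ennreal)
  finally show "(\<integral>\<^sup>+x. ennreal (norm (weight (x::real^'n))) \<partial>lborel) < \<infinity>" .
qed simp

lemma schwartz_measurable:
  fixes f :: "'n::finite cfun"
  assumes "f \<in> schwartz"
  shows "f \<in> borel_measurable borel"
  using assms by (intro borel_measurable_continuous_onI smooth_continuous schwartz_smooth)

lemma sbound_weight:
  fixes f :: "'n::finite cfun"
  assumes "sbound (2 * CARD('n)) m f B" "length is <= m"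
  shows "norm (pds is f x) <= B * weight x"
  using sboundD'[OF assms, of x] by (simp add: weight_def)

lemma schwartz_weight:
  fixes f :: "'n::finite cfun"
  assumes "f \<in> schwartz"
  obtains B where "B > 0" "\<And>x. norm (f x) <= B * weight x"
proof -
  obtain B where B: "sbound (2 * CARD('n)) 0 f B" "B > 0" using schwartz_sbound[OF assms] by blast
  show ?thesis by (rule that[OF B(2)]) (use sbound_weight[OF B(1), of "[]"] in auto)
qed

lemma schwartz_integrable:
  fixes f :: "'n::finite cfun"
  assumes "f \<in> schwartz"
  shows "integrable lborel f"
proof -
  obtain B where B: "B > 0" "\<And>x. norm (f x) <= B * weight x" using schwartz_weight[OF assms] by metis
  show ?thesis
  proof (rule Bochner_Integration.integrable_bound[of lborel "%x. B * weight x"])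
    show "AE x in lborel. norm (f x) <= norm (B * weight x)"
      using B by (intro AE_I2) (simp add: abs_mult)
  qed (use schwartz_measurable[OF assms] in \<open>auto simp: integrable_weight\<close>)
qed

text \<open>A mean value estimate that keeps the decay. It dominates the difference quotients in
  \<open>FT_partial\<close> and gives the equicontinuity in \<open>conv_bounds\<close>.\<close>

lemma schwartz_lipschitz:
  fixes f :: "'n::finite cfun"
  assumes f: "f \<in> schwartz"
  obtains C where "C > 0" "\<And>x h. norm h <= 1 ==> norm (f (x + h) - f x) <= C * norm h * weight x"
proof -
  let ?N = "2 * CARD('n)"
  obtain B where B: "sbound ?N 1 f B" "B > 0" using schwartz_sbound[OF f] by metis
  define C where "C = real CARD('n) * B * 2 ^ ?N"
  have "norm (f (x + h) - f x) <= C * norm h * weight x" if h: "norm h <= 1" for x h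
  proof -
    define D where "D y = (%k. \<Sum>i\<in>UNIV. k $ i *\<^sub>R partial i f y)" for y
    have "norm (f (x + h) - f x) <= (C * weight x) * norm (x + h - x)"
    proof (rule differentiable_bound[where S = "cball x 1" and f' = D])
      fix y assume y: "y \<in> cball x 1"
      show "(f has_derivative D y) (at y within cball x 1)"
        unfolding D_def
        by (rule has_derivative_at_withinI[OF has_derivative_partial[OF smooth_differentiable[OF schwartz_smooth[OF f]]]])
      \<comment> \<open>Within distance 1 of x the quantity 1 + norm changes at most by the factor
        2, hence the weight at most by \<open>2 ^ ?N\<close>; this is why h is restricted to the
        unit ball.\<close>
      have "norm x <= norm y + 1"
        using y norm_triangle_ineq[of y "x - y"] by (auto simp: dist_norm)
      then have "(1 + norm x) ^ ?N <= (2 * (1 + norm y)) ^ ?N"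
        by (intro power_mono) (smt (verit) norm_ge_zero)+
      then have w: "weight y <= 2 ^ ?N * weight x"
        unfolding weight_def power_mult_distrib
        by (simp add: pos_divide_le_eq pos_le_divide_eq add_pos_nonneg mult.commute)
      have part: "norm (partial i f y) <= B * (2 ^ ?N * weight x)" for i
        using order_trans[OF sbound_weight[OF B(1), of "[i]" y] mult_left_mono[OF w, of B]] B(2) by simp
      show "onorm (D y) <= C * weight x"
      proof (rule onorm_bound)
        show "0 <= C * weight x" using B weight_pos[of x] by (simp add: C_def)
        fix k :: "real^'n"
        have "norm (D y k) <= (\<Sum>i\<in>UNIV. norm (k $ i *\<^sub>R partial i f y))"
          unfolding D_def by (rule norm_sum)
        also have "... <= (\<Sum>i\<in>(UNIV::'n set). norm k * (B * (2 ^ ?N * weight x)))"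
          using component_le_norm_cart[of k] part
          by (intro sum_mono) (auto intro!: mult_mono)
        finally show "norm (D y k) <= C * weight x * norm k"
          by (simp add: C_def mult_ac)
      qed
    qed (use h in \<open>auto simp: dist_norm\<close>)
    then show ?thesis by (simp add: mult_ac)
  qed
  moreover have "C > 0" using B by (simp add: C_def)
  ultimately show ?thesis using that by blast
qed

section \<open>The Fourier transform on the Schwartz space\<close>

definition ftc :: "'n::finite itself => real" where
  "ftc _ = (2 * pi) powr (- real CARD('n) / 2)"

lemma ftc_pos: "0 < ftc TYPE('n::finite)"
  by (simp add: ftc_def)

lemma FT_eq: "FT \<phi> \<xi> = complex_of_real (ftc TYPE('n)) * (\<integral>x. cis (- (x \<bullet> \<xi>)) * \<phi> x \<partial>lborel)"
  for \<phi> :: "'n::finite cfun"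
  by (simp add: FT_def ftc_def)

lemma IFT_eq: "IFT \<phi> \<xi> = FT \<phi> (- \<xi>)"
  by (simp add: FT_def IFT_def)

lemma integrable_cis_mult:
  assumes "integrable lborel (\<phi> :: 'a::euclidean_space => complex)"
  shows "integrable lborel (%x. cis (x \<bullet> \<xi>) * \<phi> x)" "integrable lborel (%x. cis (- (x \<bullet> \<xi>)) * \<phi> x)"
  by (rule Bochner_Integration.integrable_bound[OF assms]; use assms in \<open>auto simp: norm_mult\<close>)+

lemma norm_FT_le:
  fixes \<phi> :: "'n::finite cfun"
  assumes "integrable lborel \<phi>"
  shows "norm (FT \<phi> \<xi>) <= ftc TYPE('n) * (\<integral>x. norm (\<phi> x) \<partial>lborel)"
proof -
  have "norm (\<integral>x. cis (- (x \<bullet> \<xi>)) * \<phi> x \<partial>lborel) <= (\<integral>x. norm (cis (- (x \<bullet> \<xi>)) * \<phi> x) \<partial>lborel)"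
    by (rule integral_norm_bound)
  then show ?thesis using ftc_pos[where 'n = 'n] by (simp add: FT_eq norm_mult)
qed

lemma FT_measurable:
  fixes \<phi> :: "'n::finite cfun"
  assumes [measurable]: "\<phi> \<in> borel_measurable borel"
  shows "FT \<phi> \<in> borel_measurable borel"
  unfolding FT_eq[abs_def] by measurable

lemma FT_add:
  assumes "integrable lborel f" "integrable lborel g"
  shows "FT (%x. f x + g x) \<xi> = FT f \<xi> + FT g \<xi>"
  using integrable_cis_mult[OF assms(1)] integrable_cis_mult[OF assms(2)] by (simp add: FT_eq algebra_simps)

lemma FT_cmult: "FT (%x. c * f x) \<xi> = c * FT f \<xi>"
proof -
  have "(\<integral>x. cis (- (x \<bullet> \<xi>)) * (c * f x) \<partial>lborel) = (\<integral>x. c * (cis (- (x \<bullet> \<xi>)) * f x) \<partial>lborel)"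
    by (simp add: mult_ac)
  then show ?thesis by (simp add: FT_eq)
qed

lemma FT_diff:
  assumes "integrable lborel f" "integrable lborel g"
  shows "FT (%x. f x - g x) \<xi> = FT f \<xi> - FT g \<xi>"
  using integrable_cis_mult[OF assms(1)] integrable_cis_mult[OF assms(2)] by (simp add: FT_eq algebra_simps)

lemma FT_uminus:
  fixes f :: "'n::finite cfun"
  assumes "integrable lborel f"
  shows "FT (%x. f (- x)) \<xi> = FT f (- \<xi>)"
  using integral_uminus(1)[OF integrable_cis_mult(1)[OF assms, of \<xi>]] by (simp add: FT_eq)

lemma FT_multiplication:
  fixes f g :: "'n::finite cfun"
  assumes "integrable lborel f" "integrable lborel g"
  shows "(\<integral>x. FT f x * g x \<partial>lborel) = (\<integral>x. f x * FT g x \<partial>lborel)"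
proof -
  have "(\<integral>x. FT f x * g x \<partial>lborel) = ftc TYPE('n) * (\<integral>x. g x * (\<integral>y. cis (- (y \<bullet> x)) * f y \<partial>lborel) \<partial>lborel)"
    unfolding FT_eq integral_mult_right_zero[symmetric] by (intro Bochner_Integration.integral_cong) auto
  also have "(\<integral>x. g x * (\<integral>y. cis (- (y \<bullet> x)) * f y \<partial>lborel) \<partial>lborel)
      = (\<integral>y. f y * (\<integral>x. cis (- (y \<bullet> x)) * g x \<partial>lborel) \<partial>lborel)"
    by (rule kernel_Fubini[OF assms(2,1)]) auto
  also have "ftc TYPE('n) * ... = (\<integral>x. f x * FT g x \<partial>lborel)"
    unfolding FT_eq integral_mult_right_zero[symmetric]
    by (intro Bochner_Integration.integral_cong) (auto simp: inner_commute)
  finally show ?thesis .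
qed

lemma norm_cis_minus_linear_le: "norm (cis y - 1 - \<i> * of_real y) <= y\<^sup>2"
proof -
  have "cmod (iexp y - (\<Sum>k\<le>1. (\<i> * y)^k / fact k)) <= \<bar>y\<bar>^(Suc 1) / fact (Suc 1)"
    by (rule iexp_approx1)
  then have "norm (cis y - 1 - \<i> * of_real y) <= \<bar>y\<bar>\<^sup>2 / 2"
    by (simp add: cis_conv_exp diff_diff_eq numeral_2_eq_2)
  then show ?thesis unfolding power2_abs using zero_le_power2[of y] by linarith
qed

text \<open>The Taylor remainder of \<open>cis\<close> is quadratic, so the error is at most the
  square of \<open>norm h\<close> times the second moment of \<phi>, which is finite for a Schwartz
  function. No limit theorem is involved in differentiating under the integral.\<close>

lemma has_derivative_FT:
  fixes \<phi> :: "'n::finite cfun"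
  assumes \<phi>: "\<phi> \<in> schwartz"
  shows "(FT \<phi> has_derivative (%h. \<Sum>i\<in>UNIV. h $ i *\<^sub>R FT (%x. - \<i> * (complex_of_real (x $ i) * \<phi> x)) \<xi>)) (at \<xi>)"
proof -
  define c where "c = complex_of_real (ftc TYPE('n))"
  have S: "(%x. complex_of_real (x $ i) * \<phi> x) \<in> schwartz" for i by (intro schwartz_coord \<phi>)
  have SS: "(%x. complex_of_real (x $ i) * (complex_of_real (x $ i) * \<phi> x)) \<in> schwartz" for i
    by (intro schwartz_coord \<phi>)
  \<comment> \<open>The second moment is a finite sum of integrals of Schwartz functions, one per
    coordinate.\<close>
  have eq: "(norm x)\<^sup>2 * norm (\<phi> x) = (\<Sum>i\<in>UNIV. norm (complex_of_real (x $ i) * (complex_of_real (x $ i) * \<phi> x)))" for x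
    by (simp add: power2_norm_eq_inner inner_vec_def norm_mult sum_distrib_right flip: mult.assoc)
  have i2: "integrable lborel (%x. (norm x)\<^sup>2 * norm (\<phi> x))"
    unfolding eq by (intro Bochner_Integration.integrable_sum integrable_norm schwartz_integrable SS)
  define M where "M = norm c * (\<integral>x. (norm x)\<^sup>2 * norm (\<phi> x) \<partial>lborel)"
  define D where "D h = (\<Sum>i\<in>UNIV. h $ i *\<^sub>R FT (%x. - \<i> * (complex_of_real (x $ i) * \<phi> x)) \<xi>)" for h
  have ci: "integrable lborel (%x. cis (- (x \<bullet> \<xi>)) * \<phi> x)" for \<xi>
    by (intro integrable_cis_mult schwartz_integrable \<phi>)
  have cii: "integrable lborel (%x. cis (- (x \<bullet> \<xi>)) * (complex_of_real (x $ i) * \<phi> x))" for i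
    by (intro integrable_cis_mult schwartz_integrable S)
  have D1: "D h = c * (\<integral>x. cis (- (x \<bullet> \<xi>)) * (- \<i> * of_real (x \<bullet> h) * \<phi> x) \<partial>lborel)"
    and D2: "integrable lborel (%x. cis (- (x \<bullet> \<xi>)) * (- \<i> * of_real (x \<bullet> h) * \<phi> x))" for h
  proof -
    have *: "cis (- (x \<bullet> \<xi>)) * (- \<i> * of_real (x \<bullet> h) * \<phi> x)
      = (\<Sum>i\<in>UNIV. (- \<i> * of_real (h $ i)) * (cis (- (x \<bullet> \<xi>)) * (complex_of_real (x $ i) * \<phi> x)))" for x
      by (simp add: inner_vec_def sum_distrib_left sum_distrib_right sum_negf mult_ac)
    show "integrable lborel (%x. cis (- (x \<bullet> \<xi>)) * (- \<i> * of_real (x \<bullet> h) * \<phi> x))"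
      unfolding * by (intro Bochner_Integration.integrable_sum integrable_mult_right cii)
    have "c * (\<integral>x. cis (- (x \<bullet> \<xi>)) * (- \<i> * of_real (x \<bullet> h) * \<phi> x) \<partial>lborel)
      = c * (\<Sum>i\<in>UNIV. (- \<i> * of_real (h $ i)) * (\<integral>x. cis (- (x \<bullet> \<xi>)) * (complex_of_real (x $ i) * \<phi> x) \<partial>lborel))"
      unfolding * by (subst Bochner_Integration.integral_sum) (auto intro!: integrable_mult_right cii simp del: mult_minus_left)
    also have "... = D h"
      unfolding D_def FT_cmult unfolding FT_eq c_def[symmetric]
      by (simp add: sum_distrib_left scaleR_conv_of_real mult_ac)
    finally show "D h = c * (\<integral>x. cis (- (x \<bullet> \<xi>)) * (- \<i> * of_real (x \<bullet> h) * \<phi> x) \<partial>lborel)" ..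
  qed
  have bound: "norm (FT \<phi> (\<xi> + h) - FT \<phi> \<xi> - D h) <= M * (norm h)\<^sup>2" for h
  proof -
    have "FT \<phi> (\<xi> + h) - FT \<phi> \<xi> - D h
      = c * (\<integral>x. cis (- (x \<bullet> (\<xi> + h))) * \<phi> x - cis (- (x \<bullet> \<xi>)) * \<phi> x - cis (- (x \<bullet> \<xi>)) * (- \<i> * of_real (x \<bullet> h) * \<phi> x) \<partial>lborel)"
      unfolding FT_eq D1 c_def[symmetric]
      by (simp only: Bochner_Integration.integral_diff[OF ci ci] right_diff_distrib
          Bochner_Integration.integral_diff[OF Bochner_Integration.integrable_diff[OF ci ci] D2])
    also have "norm ... <= norm c * (\<integral>x. ((norm h)\<^sup>2 * ((norm x)\<^sup>2 * norm (\<phi> x))) \<partial>lborel)"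
      unfolding norm_mult
    proof (intro mult_left_mono order_trans[OF integral_norm_bound] integral_mono)
      fix x
      have "cis (- (x \<bullet> (\<xi> + h))) * \<phi> x - cis (- (x \<bullet> \<xi>)) * \<phi> x - cis (- (x \<bullet> \<xi>)) * (- \<i> * of_real (x \<bullet> h) * \<phi> x)
        = cis (- (x \<bullet> \<xi>)) * \<phi> x * (cis (- (x \<bullet> h)) - 1 - \<i> * of_real (- (x \<bullet> h)))"
        using cis_mult[of "- (x \<bullet> \<xi>)" "- (x \<bullet> h)"] by (simp add: inner_add_right algebra_simps)
      also have "norm ... <= norm (\<phi> x) * (- (x \<bullet> h))\<^sup>2"
        unfolding norm_mult norm_cis mult_1 by (intro mult_left_mono norm_cis_minus_linear_le) auto
      also have "... <= norm (\<phi> x) * (norm x * norm h)\<^sup>2"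
        by (intro mult_left_mono) (auto simp: abs_le_square_iff[symmetric] Cauchy_Schwarz_ineq2)
      finally show "norm (cis (- (x \<bullet> (\<xi> + h))) * \<phi> x - cis (- (x \<bullet> \<xi>)) * \<phi> x - cis (- (x \<bullet> \<xi>)) * (- \<i> * of_real (x \<bullet> h) * \<phi> x))
        <= (norm h)\<^sup>2 * ((norm x)\<^sup>2 * norm (\<phi> x))"
        by (simp add: power_mult_distrib mult_ac)
      show "integrable lborel (%x. norm (cis (- (x \<bullet> (\<xi> + h))) * \<phi> x - cis (- (x \<bullet> \<xi>)) * \<phi> x - cis (- (x \<bullet> \<xi>)) * (- \<i> * of_real (x \<bullet> h) * \<phi> x)))"
        by (intro integrable_norm Bochner_Integration.integrable_diff ci D2)
    qed (auto intro!: i2)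
    finally show ?thesis unfolding M_def integral_mult_right_zero by (simp only: mult_ac)
  qed
  have "(FT \<phi> has_derivative D) (at \<xi>)"
    unfolding has_derivative_at
  proof (intro conjI)
    show "bounded_linear D"
      unfolding D_def
      by (intro bounded_linear_sum bounded_linear_compose[OF bounded_linear_scaleR_left] bounded_linear_vec_nth)
    show "(%h. norm (FT \<phi> (\<xi> + h) - FT \<phi> \<xi> - D h) / norm h) \<midarrow>0\<rightarrow> 0"
    proof (rule Lim_null_comparison)
      show "\<forall>\<^sub>F h in at 0. norm (norm (FT \<phi> (\<xi> + h) - FT \<phi> \<xi> - D h) / norm h) <= M * norm h"
        unfolding eventually_at
        by (rule exI[of _ 1]) (use bound in \<open>auto simp: divide_le_eq power2_eq_square mult_ac\<close>)
      show "((%h. M * norm h) \<longlongrightarrow> 0) (at 0)"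
        by (auto intro!: tendsto_eq_intros)
    qed
  qed
  then show ?thesis unfolding D_def .
qed

text \<open>Integration by parts in the form of difference quotients: their transforms are known
  explicitly from translation invariance, and \<open>schwartz_lipschitz\<close> provides the
  majorant for passing to the limit. The step lengths \<open>t k\<close> stay in (0, 1] because that
  lemma needs shifts of norm at most 1.\<close>

lemma FT_partial:
  fixes \<phi> :: "'n::finite cfun"
  assumes \<phi>: "\<phi> \<in> schwartz"
  shows "FT (partial i \<phi>) \<xi> = \<i> * of_real (\<xi> $ i) * FT \<phi> \<xi>"
proof -
  define e :: "real^'n" where "e = axis i 1"
  define t where "t k = 1 / real (Suc k)" for k
  have t: "0 < t k" "t k <= 1" for k unfolding t_def by auto
  have t0: "t \<longlonglongrightarrow> 0" unfolding t_def by (rule LIMSEQ_Suc[OF lim_1_over_n])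
  obtain C where C: "C > 0" "\<And>x h. norm h <= 1 ==> norm (\<phi> (x + h) - \<phi> x) <= C * norm h * weight x"
    using schwartz_lipschitz[OF \<phi>] by metis
  define I where "I = (\<integral>x. cis (- (x \<bullet> \<xi>)) * \<phi> x \<partial>lborel)"
  have ci: "integrable lborel (%x. cis (- (x \<bullet> \<xi>)) * \<phi> x)"
    by (intro integrable_cis_mult schwartz_integrable \<phi>)
  have [measurable]: "\<phi> \<in> borel_measurable borel" "partial i \<phi> \<in> borel_measurable borel"
    using schwartz_measurable[OF \<phi>] schwartz_measurable[OF schwartz_partial[OF \<phi>]] .
  have "(%k. \<integral>x. cis (- (x \<bullet> \<xi>)) * ((\<phi> (x + t k *\<^sub>R e) - \<phi> x) / of_real (t k)) \<partial>lborel) \<longlonglongrightarrow>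
      (\<integral>x. cis (- (x \<bullet> \<xi>)) * partial i \<phi> x \<partial>lborel)"
  proof (rule integral_dominated_convergence[where w = "%x. C * weight x"])
    show "integrable lborel (%x::real^'n. C * weight x)" by (intro integrable_mult_right integrable_weight)
    show "AE x in lborel. norm (cis (- (x \<bullet> \<xi>)) * ((\<phi> (x + t k *\<^sub>R e) - \<phi> x) / of_real (t k))) <= C * weight x" for k
    proof (intro AE_I2)
      fix x
      have "norm (\<phi> (x + t k *\<^sub>R e) - \<phi> x) <= C * t k * weight x"
        using C(2)[of "t k *\<^sub>R e" x] t[of k] by (simp add: e_def)
      then show "norm (cis (- (x \<bullet> \<xi>)) * ((\<phi> (x + t k *\<^sub>R e) - \<phi> x) / of_real (t k))) <= C * weight x"
        using t[of k] by (simp add: norm_mult norm_divide divide_le_eq mult_ac)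
    qed
    show "AE x in lborel. (%k. cis (- (x \<bullet> \<xi>)) * ((\<phi> (x + t k *\<^sub>R e) - \<phi> x) / of_real (t k)))
        \<longlonglongrightarrow> cis (- (x \<bullet> \<xi>)) * partial i \<phi> x"
    proof (intro AE_I2 tendsto_mult tendsto_const)
      fix x
      obtain D where D: "(\<phi> has_derivative D) (at x)"
        using smooth_differentiable[OF schwartz_smooth[OF \<phi>]] by (auto simp: differentiable_def)
      have ne: "e ~= 0" "norm e = 1" by (auto simp: e_def axis_eq_0_iff)
      have "((%h. norm (\<phi> (x + h) - \<phi> x - D h) / norm h) \<longlongrightarrow> 0) (at 0)"
        using D unfolding has_derivative_at by blast
      moreover have "filterlim (%k. t k *\<^sub>R e) (at 0) sequentially"
        unfolding filterlim_at using t ne tendsto_scaleR[OF t0 tendsto_const, of e]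
        by (auto simp: less_imp_neq[THEN not_sym])
      ultimately have "(%k. norm (\<phi> (x + t k *\<^sub>R e) - \<phi> x - D (t k *\<^sub>R e)) / norm (t k *\<^sub>R e)) \<longlonglongrightarrow> 0"
        by (rule filterlim_compose)
      moreover have "norm (\<phi> (x + t k *\<^sub>R e) - \<phi> x - D (t k *\<^sub>R e)) / norm (t k *\<^sub>R e)
          = norm ((\<phi> (x + t k *\<^sub>R e) - \<phi> x) / of_real (t k) - partial i \<phi> x)" for k
      proof -
        have "(\<phi> (x + t k *\<^sub>R e) - \<phi> x) / of_real (t k) - partial i \<phi> x
          = (\<phi> (x + t k *\<^sub>R e) - \<phi> x - D (t k *\<^sub>R e)) / of_real (t k)"
          using t[of k] linear_scale[OF has_derivative_linear[OF D], of "t k" e]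
          by (simp add: partial_eq[OF D] e_def scaleR_conv_of_real field_simps)
        then show ?thesis using ne t[of k] by (simp add: norm_divide)
      qed
      ultimately show "(%k. (\<phi> (x + t k *\<^sub>R e) - \<phi> x) / of_real (t k)) \<longlonglongrightarrow> partial i \<phi> x"
        using LIM_zero_cancel tendsto_norm_zero_cancel by fastforce
    qed
  qed auto
  \<comment> \<open>Translation invariance moves the shift from \<phi> to the exponential.\<close>
  moreover have "(\<integral>x. cis (- (x \<bullet> \<xi>)) * ((\<phi> (x + t k *\<^sub>R e) - \<phi> x) / of_real (t k)) \<partial>lborel)
     = (cis (t k * \<xi> $ i) - 1) / of_real (t k) * I" for k
  proof -
    have shift: "(\<integral>x. cis (- (x \<bullet> \<xi>)) * \<phi> (x + t k *\<^sub>R e) \<partial>lborel) = cis (t k * \<xi> $ i) * I"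
      and ishift: "integrable lborel (%x. cis (- (x \<bullet> \<xi>)) * \<phi> (x + t k *\<^sub>R e))"
    proof -
      have *: "cis (- (x \<bullet> \<xi>)) * \<phi> (x + t k *\<^sub>R e) = cis (t k * \<xi> $ i) * (cis (- ((x + t k *\<^sub>R e) \<bullet> \<xi>)) * \<phi> (x + t k *\<^sub>R e))" for x
        by (simp add: e_def inner_add_left inner_axis' mult.assoc[symmetric] cis_mult)
      show "(\<integral>x. cis (- (x \<bullet> \<xi>)) * \<phi> (x + t k *\<^sub>R e) \<partial>lborel) = cis (t k * \<xi> $ i) * I"
        unfolding * I_def integral_mult_right_zero by (subst integral_translate(1)[OF ci]) simp
      show "integrable lborel (%x. cis (- (x \<bullet> \<xi>)) * \<phi> (x + t k *\<^sub>R e))"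
        unfolding * by (intro integrable_mult_right integral_translate(2)[OF ci])
    qed
    have "(\<integral>x. cis (- (x \<bullet> \<xi>)) * ((\<phi> (x + t k *\<^sub>R e) - \<phi> x) / of_real (t k)) \<partial>lborel)
      = (\<integral>x. (cis (- (x \<bullet> \<xi>)) * \<phi> (x + t k *\<^sub>R e) - cis (- (x \<bullet> \<xi>)) * \<phi> x) / of_real (t k) \<partial>lborel)"
      by (simp add: right_diff_distrib)
    also have "... = (cis (t k * \<xi> $ i) * I - I) / of_real (t k)"
      using ci ishift by (simp add: shift I_def)
    finally show ?thesis by (simp add: algebra_simps)
  qed
  moreover have "(%k. (cis (t k * \<xi> $ i) - 1) / of_real (t k) * I) \<longlonglongrightarrow> \<i> * of_real (\<xi> $ i) * I"
  proof (intro tendsto_mult tendsto_const)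
    have "(%k. (cis (t k * \<xi> $ i) - 1) / of_real (t k) - \<i> * of_real (\<xi> $ i)) \<longlonglongrightarrow> 0"
    proof (rule Lim_null_comparison)
      show "(%k. t k * (\<xi> $ i)\<^sup>2) \<longlonglongrightarrow> 0" using tendsto_mult_left_zero[OF t0] .
      show "\<forall>\<^sub>F k in sequentially. norm ((cis (t k * \<xi> $ i) - 1) / of_real (t k) - \<i> * of_real (\<xi> $ i)) <= t k * (\<xi> $ i)\<^sup>2"
      proof (intro always_eventually allI)
        fix k
        have "(cis (t k * \<xi> $ i) - 1) / of_real (t k) - \<i> * of_real (\<xi> $ i) = (cis (t k * \<xi> $ i) - 1 - \<i> * of_real (t k * \<xi> $ i)) / of_real (t k)"
          using t[of k] by (simp add: field_simps)
        moreover have "norm (cis (t k * \<xi> $ i) - 1 - \<i> * of_real (t k * \<xi> $ i)) <= (t k * \<xi> $ i)\<^sup>2"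
          by (rule norm_cis_minus_linear_le)
        ultimately show "norm ((cis (t k * \<xi> $ i) - 1) / of_real (t k) - \<i> * of_real (\<xi> $ i)) <= t k * (\<xi> $ i)\<^sup>2"
          using t[of k] by (simp add: norm_divide divide_le_eq power_mult_distrib power2_eq_square mult_ac del: of_real_mult)
      qed
    qed
    then show "(%k. (cis (t k * \<xi> $ i) - 1) / of_real (t k)) \<longlonglongrightarrow> \<i> * of_real (\<xi> $ i)"
      by (rule LIM_zero_cancel)
  qed
  ultimately have "(\<integral>x. cis (- (x \<bullet> \<xi>)) * partial i \<phi> x \<partial>lborel) = \<i> * of_real (\<xi> $ i) * I"
    by (metis (no_types, lifting) LIMSEQ_unique ext)
  then show ?thesis by (simp add: FT_eq I_def)
qed

text \<open>One more weight is exchanged for derivatives: \<open>norm \<xi>\<close> times the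
  transform is at most the sum of the transforms of the n partial derivatives. Each exchange yields
  n + 1 terms, whence the factor \<open>(1 + real CARD('n)) ^ k\<close>.\<close>

lemma FT_decay:
  fixes \<phi> :: "'n::finite cfun"
  assumes "\<phi> \<in> schwartz" "sbound (2 * CARD('n)) k \<phi> B"
  shows "(1 + norm \<xi>) ^ k * norm (FT \<phi> \<xi>)
    <= (ftc TYPE('n) * (\<integral>x. weight (x::real^'n) \<partial>lborel) * (1 + real CARD('n)) ^ k) * B"
  using assms
proof (induction k arbitrary: \<phi>)
  case 0
  have "norm (FT \<phi> \<xi>) <= ftc TYPE('n) * (\<integral>x. norm (\<phi> x) \<partial>lborel)"
    by (rule norm_FT_le[OF schwartz_integrable[OF 0(1)]])
  also have "(\<integral>x. norm (\<phi> x) \<partial>lborel) <= (\<integral>x. B * weight (x::real^'n) \<partial>lborel)"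
    using sbound_weight[OF 0(2), of "[]"] schwartz_integrable[OF 0(1)] integrable_weight
    by (intro integral_mono) auto
  finally show ?case using ftc_pos[where 'n = 'n] by (simp add: mult_ac)
next
  case (Suc k)
  define A where "A = ftc TYPE('n) * (\<integral>x. weight (x::real^'n) \<partial>lborel) * (1 + real CARD('n)) ^ k"
  have "norm \<xi> * norm (FT \<phi> \<xi>) <= (\<Sum>i\<in>UNIV. \<bar>\<xi> $ i\<bar>) * norm (FT \<phi> \<xi>)"
    by (intro mult_right_mono norm_le_l1_cart) auto
  also have "... = (\<Sum>i\<in>UNIV. norm (FT (partial i \<phi>) \<xi>))"
    by (simp add: FT_partial[OF Suc.prems(1)] norm_mult sum_distrib_right)
  finally have *: "norm (FT \<phi> \<xi>) + norm \<xi> * norm (FT \<phi> \<xi>) <= norm (FT \<phi> \<xi>) + (\<Sum>i\<in>UNIV. norm (FT (partial i \<phi>) \<xi>))"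
    by simp
  have "(1 + norm \<xi>) ^ Suc k * norm (FT \<phi> \<xi>) = (1 + norm \<xi>) ^ k * (norm (FT \<phi> \<xi>) + norm \<xi> * norm (FT \<phi> \<xi>))"
    by (simp add: algebra_simps)
  also have "... <= (1 + norm \<xi>) ^ k * (norm (FT \<phi> \<xi>) + (\<Sum>i\<in>UNIV. norm (FT (partial i \<phi>) \<xi>)))"
    using * by (rule mult_left_mono) simp
  also have "... = (1 + norm \<xi>) ^ k * norm (FT \<phi> \<xi>) + (\<Sum>i\<in>UNIV. (1 + norm \<xi>) ^ k * norm (FT (partial i \<phi>) \<xi>))"
    by (simp add: distrib_left sum_distrib_left)
  also have "... <= A * B + (\<Sum>i\<in>(UNIV::'n set). A * B)"
    unfolding A_def
    by (intro add_mono sum_mono Suc.IH Suc.prems schwartz_partial sbound_partial sbound_mono[OF Suc.prems(2)]) auto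
  also have "... = (A * (1 + real CARD('n))) * B" by (simp add: algebra_simps)
  finally show ?case by (simp add: A_def mult_ac)
qed

text \<open>Each list entry contributes a factor - i x_i, the effect of one derivative of the
  transform on the function inside; see \<open>pds_FT\<close>.\<close>

primrec coord_mult :: "'n::finite list => ('n cfun) => 'n cfun" where
  "coord_mult [] \<phi> = \<phi>"
| "coord_mult (i # is) \<phi> = (%x. - \<i> * (complex_of_real (x $ i) * coord_mult is \<phi> x))"

lemma coord_mult_schwartz: "\<phi> \<in> schwartz ==> coord_mult is \<phi> \<in> schwartz"
proof (induction "is")
  case (Cons i "is")
  then show ?case using schwartz_cmult[OF schwartz_coord[of "coord_mult is \<phi>" i], of "- \<i>"] by simp
qed auto

lemma coord_mult_sbound:
  assumes "\<phi> \<in> schwartz" "sbound (k + length is) m \<phi> B"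
  shows "sbound k m (coord_mult is \<phi>) (2 ^ (m * length is) * B)"
  using assms
proof (induction "is" arbitrary: k)
  case (Cons i "is")
  have S: "coord_mult is \<phi> \<in> schwartz" using Cons.prems coord_mult_schwartz by blast
  have "sbound (Suc k) m (coord_mult is \<phi>) (2 ^ (m * length is) * B)"
    using Cons by auto
  then have "sbound k m (%x. complex_of_real (x $ i) * coord_mult is \<phi> x) (2 ^ m * (2 ^ (m * length is) * B))"
    using S by (intro sbound_coord schwartz_smooth)
  then have "sbound k m (%x. - \<i> * (complex_of_real (x $ i) * coord_mult is \<phi> x)) (norm (- \<i>) * (2 ^ m * (2 ^ (m * length is) * B)))"
    by (intro sbound_cmult schwartz_smooth schwartz_coord S)
  then show ?case by (simp add: power_add mult_ac)
qed auto

lemma pds_FT: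
  assumes "\<phi> \<in> schwartz"
  shows "pds is (FT \<phi>) = FT (coord_mult is \<phi>)"
proof (induction "is")
  case (Cons i "is")
  have "partial i (FT (coord_mult is \<phi>)) \<xi> = FT (coord_mult (i # is) \<phi>) \<xi>" for \<xi>
    using partial_eq[OF has_derivative_FT[OF coord_mult_schwartz[OF assms, of "is"]], of i \<xi>]
    by (simp add: axis_def if_distrib[of "%x. x *\<^sub>R _"] cong: if_cong)
  then show ?case using Cons by auto
qed auto

definition ft_const :: "'n::finite itself => nat => nat => real" where
  "ft_const _ k m = ftc TYPE('n) * (\<integral>x. weight (x::real^'n) \<partial>lborel) * (1 + real CARD('n)) ^ k * 2 ^ (k * m)"

text \<open>The two indices change roles: k weights on the transform need k derivatives of \<phi>,
  and m derivatives of the transform need m weights. The additional \<open>2 * CARD('n)\<close>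
  weights pay for integrability.\<close>

lemma FT_sbound:
  fixes \<phi> :: "'n::finite cfun"
  assumes "\<phi> \<in> schwartz" "sbound (2 * CARD('n) + m) k \<phi> B"
  shows "sbound k m (FT \<phi>) (ft_const TYPE('n) k m * B)"
  unfolding sbound_def pds_FT[OF assms(1)]
proof (intro allI impI)
  fix \<xi> :: "real^'n" and "is" :: "'n list" assume len: "length is <= m"
  have B: "0 <= B" using assms(2) sbound_nonneg by blast
  have "sbound (2 * CARD('n) + length is) k \<phi> B" using assms(2) len by (rule_tac sbound_mono) auto
  then have "sbound (2 * CARD('n)) k (coord_mult is \<phi>) (2 ^ (k * length is) * B)"
    by (rule coord_mult_sbound[OF assms(1)])
  then have "sbound (2 * CARD('n)) k (coord_mult is \<phi>) (2 ^ (k * m) * B)"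
    using len B by (rule_tac sbound_mono) (auto intro!: mult_right_mono power_increasing)
  from FT_decay[OF coord_mult_schwartz[OF assms(1)] this]
  show "(1 + norm \<xi>) ^ k * norm (FT (coord_mult is \<phi>) \<xi>) <= ft_const TYPE('n) k m * B"
    by (simp add: ft_const_def mult_ac)
qed

lemma FT_schwartz:
  fixes \<phi> :: "'n::finite cfun"
  assumes \<phi>: "\<phi> \<in> schwartz"
  shows "FT \<phi> \<in> schwartz"
proof (rule schwartzI)
  show "smooth (FT \<phi>)"
    unfolding smooth_def pds_FT[OF \<phi>]
    using has_derivative_FT[OF coord_mult_schwartz[OF \<phi>]] by (auto simp: differentiable_def simp del: mult_minus_left)
  show "\<exists>B. sbound k m (FT \<phi>) B" for k m
    using FT_sbound[OF \<phi>, of m k] schwartz_sbound[OF \<phi>] by metis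
qed

lemma IFT_schwartz: "\<phi> \<in> schwartz ==> IFT \<phi> \<in> schwartz"
  using schwartz_uminus[OF FT_schwartz[of \<phi>]] by (simp add: IFT_eq[abs_def])

section \<open>Gaussians, inversion and Plancherel's inequality\<close>

lemma integrable_gauss_real: "integrable lborel (%x::real. exp (- x\<^sup>2 / 2))"
proof -
  have "integrable lborel (%x. sqrt (2 * pi) * std_normal_density x)" by simp
  then show ?thesis by (simp add: std_normal_density_def)
qed

text \<open>The characteristic function of the standard normal distribution, freed from the
  normalising factor of the density.\<close>

lemma FT_gauss_real:
  "(\<integral>x. cis (t * x) * complex_of_real (exp (- x\<^sup>2 / 2)) \<partial>lborel) = of_real (sqrt (2 * pi)) * of_real (exp (- t\<^sup>2 / 2))"
proof -
  have "char std_normal_distribution t = (\<integral>x. std_normal_density x *\<^sub>R iexp (t * x) \<partial>lborel)"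
    unfolding char_def by (subst integral_density) auto
  then have "(\<integral>x. std_normal_density x *\<^sub>R iexp (t * x) \<partial>lborel) = complex_of_real (exp (- (t^2) / 2))"
    by (simp add: char_std_normal_distribution)
  moreover have "(\<integral>x. cis (t * x) * complex_of_real (exp (- x\<^sup>2 / 2)) \<partial>lborel)
    = (\<integral>x. of_real (sqrt (2 * pi)) * (std_normal_density x *\<^sub>R iexp (t * x)) \<partial>lborel)"
    by (intro Bochner_Integration.integral_cong) (auto simp: std_normal_density_def cis_conv_exp scaleR_conv_of_real)
  ultimately show ?thesis unfolding integral_mult_right_zero by simp
qed

definition gauss :: "real => real^'n::finite => real" where
  "gauss \<epsilon> x = exp (- (\<epsilon>\<^sup>2 * (norm x)\<^sup>2) / 2)"

lemma gauss_measurable [measurable]: "gauss \<epsilon> \<in> borel_measurable borel"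
  unfolding gauss_def[abs_def] by measurable

lemma gauss_pos: "0 < gauss \<epsilon> x" and gauss_le_1: "gauss \<epsilon> x <= 1"
  by (auto simp: gauss_def)

lemma abs_gauss [simp]: "\<bar>gauss \<epsilon> x\<bar> = gauss \<epsilon> x"
  by (rule abs_of_pos[OF gauss_pos])

lemma gauss_nonneg [simp]: "0 <= gauss \<epsilon> x"
  by (rule less_imp_le[OF gauss_pos])

lemma gauss_1_prod:
  "cis (x \<bullet> \<xi>) * complex_of_real (gauss 1 x) = (\<Prod>b\<in>Basis. cis ((\<xi> \<bullet> b) * (x \<bullet> b)) * complex_of_real (exp (- (x \<bullet> b)\<^sup>2 / 2)))"
  for x \<xi> :: "real^'n::finite"
proof -
  have "(\<Prod>b\<in>A. cis (f b)) = cis (\<Sum>b\<in>A. f b)" if "finite A" for A :: "(real^'n) set" and f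
    using that by (induction A) (auto simp: cis_mult)
  then have 1: "(\<Prod>b\<in>(Basis::(real^'n) set). cis ((\<xi> \<bullet> b) * (x \<bullet> b))) = cis (x \<bullet> \<xi>)"
    by (simp add: euclidean_inner[of x \<xi>] mult.commute)
  have "(norm x)\<^sup>2 = (\<Sum>b\<in>Basis. (x \<bullet> b)\<^sup>2)"
    unfolding power2_norm_eq_inner by (subst euclidean_inner) (simp add: power2_eq_square)
  then have 2: "(\<Prod>b\<in>(Basis::(real^'n) set). exp (- (x \<bullet> b)\<^sup>2 / 2)) = gauss 1 x"
    unfolding gauss_def by (simp add: sum_negf sum_divide_distrib[symmetric] flip: exp_sum)
  show ?thesis by (simp only: prod.distrib 1 2 of_real_prod[symmetric])
qed

lemma integrable_gauss:
  assumes "\<epsilon> ~= 0"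
  shows "integrable lborel (gauss \<epsilon> :: real^'n::finite => real)"
proof -
  have "integrable lborel (%x::real^'n. cis (x \<bullet> 0) * complex_of_real (gauss 1 x))"
    unfolding gauss_1_prod
    by (rule integrable_prod_lborel) (use integrable_of_real[OF integrable_gauss_real] in simp)
  then have "integrable lborel (%x::real^'n. gauss 1 x)"
    using integrable_norm[of lborel "%x::real^'n. complex_of_real (gauss 1 x)"] gauss_pos[of 1]
    by (simp add: abs_of_pos)
  from integrable_affine[OF this assms, of 0]
  show ?thesis by (simp add: gauss_def[abs_def] power_mult_distrib)
qed

lemma FT_gauss:
  fixes z :: "real^'n::finite"
  assumes "\<epsilon> > 0"
  shows "FT (%x. complex_of_real (gauss \<epsilon> x)) z = of_real ((1 / \<epsilon>) ^ CARD('n) * gauss (1 / \<epsilon>) z)"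
proof -
  define w where "w = (1 / \<epsilon>) *\<^sub>R (- z)"
  have i1: "integrable lborel (%x::real^'n. cis (x \<bullet> w) * complex_of_real (gauss 1 x))"
    by (intro integrable_cis_mult integrable_of_real integrable_gauss) simp
  have "(\<integral>x. cis (x \<bullet> w) * complex_of_real (gauss 1 x) \<partial>lborel)
     = (\<Prod>b\<in>(Basis::(real^'n) set). \<integral>x. cis ((w \<bullet> b) * x) * complex_of_real (exp (- x\<^sup>2 / 2)) \<partial>lborel)"
    unfolding gauss_1_prod
  proof (rule integrable_prod_lborel)
    fix b :: "real^'n"
    show "integrable lborel (%x. cis ((w \<bullet> b) * x) * complex_of_real (exp (- x\<^sup>2 / 2)))"
      using integrable_cis_mult(1)[OF integrable_of_real[OF integrable_gauss_real], of "w \<bullet> b"]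
      by (simp add: mult.commute)
  qed
  also have "... = of_real (sqrt (2 * pi) ^ CARD('n)) * (\<Prod>b\<in>(Basis::(real^'n) set). of_real (exp (- (w \<bullet> b)\<^sup>2 / 2)))"
    unfolding FT_gauss_real by (simp add: prod.distrib)
  also have "(\<Prod>b\<in>(Basis::(real^'n) set). of_real (exp (- (w \<bullet> b)\<^sup>2 / 2))) = complex_of_real (gauss 1 w)"
    using gauss_1_prod[of w 0] by simp
  finally have I: "(\<integral>x. cis (x \<bullet> w) * complex_of_real (gauss 1 x) \<partial>lborel) = of_real (sqrt (2 * pi) ^ CARD('n) * gauss 1 w)"
    by simp
  have "(\<integral>x. cis (x \<bullet> w) * complex_of_real (gauss 1 x) \<partial>lborel)
      = \<epsilon> ^ CARD('n) *\<^sub>R (\<integral>x. cis ((0 + \<epsilon> *\<^sub>R x) \<bullet> w) * complex_of_real (gauss 1 (0 + \<epsilon> *\<^sub>R x)) \<partial>lborel)"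
    using integral_affine[OF i1, of \<epsilon> 0] assms by simp
  also have "(\<integral>x. cis ((0 + \<epsilon> *\<^sub>R x) \<bullet> w) * complex_of_real (gauss 1 (0 + \<epsilon> *\<^sub>R x)) \<partial>lborel) =
      (\<integral>x. cis (- (x \<bullet> z)) * complex_of_real (gauss \<epsilon> x) \<partial>lborel)"
    using assms by (intro Bochner_Integration.integral_cong) (auto simp: w_def gauss_def power_mult_distrib)
  finally have II: "(\<integral>x. cis (- (x \<bullet> z)) * complex_of_real (gauss \<epsilon> x) \<partial>lborel)
     = of_real (sqrt (2 * pi) ^ CARD('n) * gauss 1 w / \<epsilon> ^ CARD('n))"
    using I assms by (simp add: scaleR_conv_of_real field_simps)
  have "ftc TYPE('n) * sqrt (2 * pi) ^ CARD('n) = 1"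
    by (simp add: ftc_def powr_half_sqrt[symmetric] powr_realpow[symmetric] powr_powr powr_add[symmetric])
  then have "ftc TYPE('n) * (sqrt (2 * pi) ^ CARD('n) * gauss 1 w / \<epsilon> ^ CARD('n)) = (1 / \<epsilon>) ^ CARD('n) * gauss 1 w"
    by (simp add: power_divide)
  moreover have "gauss 1 w = gauss (1 / \<epsilon>) z"
    by (simp add: gauss_def w_def power_mult_distrib power_divide)
  ultimately show ?thesis unfolding FT_eq II of_real_mult[symmetric] by (simp only:)
qed

text \<open>\<open>FT_gauss\<close> evaluated at the origin. It makes the scaled Gaussians an
  approximate identity with respect to \<open>ftc\<close> times Lebesgue measure.\<close>

lemma gauss_mass:
  assumes "\<epsilon> > 0"
  shows "ftc TYPE('n::finite) * (\<integral>z. (1 / \<epsilon>) ^ CARD('n) * gauss (1 / \<epsilon>) (z::real^'n) \<partial>lborel) = 1"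
proof -
  have "FT (%x::real^'n. complex_of_real (gauss (1 / \<epsilon>) x)) 0 = of_real (\<epsilon> ^ CARD('n))"
    using assms by (subst FT_gauss) (auto simp: gauss_def)
  then have "complex_of_real (ftc TYPE('n) * (\<integral>x. gauss (1 / \<epsilon>) (x::real^'n) \<partial>lborel)) = of_real (\<epsilon> ^ CARD('n))"
    by (simp add: FT_eq)
  then have "ftc TYPE('n) * (\<integral>x. gauss (1 / \<epsilon>) (x::real^'n) \<partial>lborel) = \<epsilon> ^ CARD('n)"
    unfolding of_real_eq_iff .
  then show ?thesis using assms by (simp add: power_divide field_simps)
qed

lemma FT_modulate: "FT (%x. cis (x \<bullet> a) * f x) \<xi> = FT f (\<xi> - a)"
  by (simp add: FT_eq inner_diff_right mult.assoc[symmetric] cis_mult)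

text \<open>The iterated integral does not converge absolutely and cannot be exchanged as it stands.
  A factor \<open>gauss \<epsilon>\<close> makes the exchange legitimate and turns the expression
  into a Gaussian average of \<phi> around - x; then \<epsilon> tends to 0 on both sides by
  dominated convergence.\<close>

lemma FT_inversion:
  fixes \<phi> :: "'n::finite cfun"
  assumes \<phi>: "\<phi> \<in> schwartz"
  shows "FT (FT \<phi>) x = \<phi> (- x)"
proof -
  define \<epsilon> where "\<epsilon> k = 1 / real (Suc k)" for k
  have \<epsilon>: "0 < \<epsilon> k" for k unfolding \<epsilon>_def by auto
  have \<epsilon>0: "\<epsilon> \<longlonglongrightarrow> 0" unfolding \<epsilon>_def by (rule LIMSEQ_Suc[OF lim_1_over_n])
  define c where "c = complex_of_real (ftc TYPE('n))"
  have [measurable]: "\<phi> \<in> borel_measurable borel" "FT \<phi> \<in> borel_measurable borel"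
    using schwartz_measurable[OF \<phi>] schwartz_measurable[OF FT_schwartz[OF \<phi>]] .
  have iF: "integrable lborel (FT \<phi>)" using schwartz_integrable[OF FT_schwartz[OF \<phi>]] .
  obtain B where B: "sbound 0 0 \<phi> B" using schwartz_sbound[OF \<phi>] by metis
  have Bb: "norm (\<phi> y) <= B" for y using sboundD[OF B, of "[]" y] by simp
  have B0: "0 <= B" using sbound_nonneg[OF B] .
  have g1: "integrable lborel (gauss 1 :: real^'n => real)" by (rule integrable_gauss) simp
  have "(%k. c * (\<integral>\<xi>. cis (- (\<xi> \<bullet> x)) * (complex_of_real (gauss (\<epsilon> k) \<xi>) * FT \<phi> \<xi>) \<partial>lborel)) \<longlonglongrightarrow>
     c * (\<integral>\<xi>. cis (- (\<xi> \<bullet> x)) * FT \<phi> \<xi> \<partial>lborel)"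
  proof (intro tendsto_mult tendsto_const integral_dominated_convergence[where w = "%\<xi>. norm (FT \<phi> \<xi>)"])
    show "AE \<xi> in lborel. (%k. cis (- (\<xi> \<bullet> x)) * (complex_of_real (gauss (\<epsilon> k) \<xi>) * FT \<phi> \<xi>)) \<longlonglongrightarrow> cis (- (\<xi> \<bullet> x)) * FT \<phi> \<xi>"
      unfolding gauss_def by (intro AE_I2) (auto intro!: tendsto_eq_intros \<epsilon>0)
    show "AE \<xi> in lborel. norm (cis (- (\<xi> \<bullet> x)) * (complex_of_real (gauss (\<epsilon> k) \<xi>) * FT \<phi> \<xi>)) <= norm (FT \<phi> \<xi>)" for k
      using gauss_le_1 by (intro AE_I2) (auto simp: norm_mult intro!: mult_left_le_one_le)
  qed (auto intro!: integrable_norm iF)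
  moreover have "c * (\<integral>\<xi>. cis (- (\<xi> \<bullet> x)) * (complex_of_real (gauss (\<epsilon> k) \<xi>) * FT \<phi> \<xi>) \<partial>lborel)
      = c * (\<integral>y. complex_of_real (gauss 1 y) * \<phi> (- x + \<epsilon> k *\<^sub>R y) \<partial>lborel)" for k
  proof -
    have ig: "integrable lborel (%\<xi>::real^'n. complex_of_real (gauss (\<epsilon> k) \<xi>))"
      by (intro integrable_of_real integrable_gauss) (use \<epsilon>[of k] in simp)
    have icg: "integrable lborel (%\<xi>. cis (\<xi> \<bullet> (- x)) * complex_of_real (gauss (\<epsilon> k) \<xi>))"
      by (rule integrable_cis_mult[OF ig])
    have "(\<integral>\<xi>. cis (- (\<xi> \<bullet> x)) * (complex_of_real (gauss (\<epsilon> k) \<xi>) * FT \<phi> \<xi>) \<partial>lborel) =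
      (\<integral>\<xi>. (cis (\<xi> \<bullet> (- x)) * complex_of_real (gauss (\<epsilon> k) \<xi>)) * FT \<phi> \<xi> \<partial>lborel)"
      by (simp add: mult.assoc)
    also have "... = (\<integral>y. FT (%\<xi>. cis (\<xi> \<bullet> (- x)) * complex_of_real (gauss (\<epsilon> k) \<xi>)) y * \<phi> y \<partial>lborel)"
      by (rule FT_multiplication[symmetric, OF icg schwartz_integrable[OF \<phi>]])
    also have "... = (\<integral>y. of_real ((1 / \<epsilon> k) ^ CARD('n) * gauss (1 / \<epsilon> k) (y + x)) * \<phi> y \<partial>lborel)"
      unfolding FT_modulate FT_gauss[OF \<epsilon>] by simp
    \<comment> \<open>This substitution turns the moving Gaussian into the fixed
      \<open>gauss 1\<close> and leaves \<epsilon> only in the argument of \<phi>, where continuity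
      takes over.\<close>
    also have "... = \<epsilon> k ^ CARD('n) *\<^sub>R (\<integral>y. of_real ((1 / \<epsilon> k) ^ CARD('n) * gauss (1 / \<epsilon> k) (- x + \<epsilon> k *\<^sub>R y + x)) * \<phi> (- x + \<epsilon> k *\<^sub>R y) \<partial>lborel)"
    proof -
      have "integrable lborel (%y. of_real ((1 / \<epsilon> k) ^ CARD('n) * gauss (1 / \<epsilon> k) (y + x)) * \<phi> y)"
      proof (rule Bochner_Integration.integrable_bound[of lborel "%y. (1 / \<epsilon> k) ^ CARD('n) * norm (\<phi> y)"])
        show "AE y in lborel. norm (of_real ((1 / \<epsilon> k) ^ CARD('n) * gauss (1 / \<epsilon> k) (y + x)) * \<phi> y) <= norm ((1 / \<epsilon> k) ^ CARD('n) * norm (\<phi> y))"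
          using \<epsilon>[of k] gauss_pos[of "1 / \<epsilon> k"] gauss_le_1[of "1 / \<epsilon> k"]
          by (intro AE_I2) (auto simp: norm_mult norm_power norm_divide abs_mult intro!: divide_right_mono mult_left_le_one_le)
      qed (auto intro!: integrable_norm schwartz_integrable[OF \<phi>])
      from integral_affine[OF this, of "\<epsilon> k" "- x"] \<epsilon>[of k] show ?thesis by simp
    qed
    also have "... = (\<integral>y. \<epsilon> k ^ CARD('n) *\<^sub>R (of_real ((1 / \<epsilon> k) ^ CARD('n) * gauss (1 / \<epsilon> k) (- x + \<epsilon> k *\<^sub>R y + x)) * \<phi> (- x + \<epsilon> k *\<^sub>R y)) \<partial>lborel)"
      by (rule integral_scaleR_right[symmetric])
    also have "... = (\<integral>y. complex_of_real (gauss 1 y) * \<phi> (- x + \<epsilon> k *\<^sub>R y) \<partial>lborel)"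
      using \<epsilon>[of k] by (intro Bochner_Integration.integral_cong)
        (auto simp: gauss_def power_mult_distrib power_divide scaleR_conv_of_real[where 'a = complex])
    finally show ?thesis by simp
  qed
  moreover have "(%k. c * (\<integral>y. complex_of_real (gauss 1 y) * \<phi> (- x + \<epsilon> k *\<^sub>R y) \<partial>lborel))
     \<longlonglongrightarrow> c * (\<integral>y. complex_of_real (gauss 1 (y::real^'n)) * \<phi> (- x) \<partial>lborel)"
  proof (intro tendsto_mult tendsto_const integral_dominated_convergence[where w = "%y. B * gauss 1 y"])
    show "AE y in lborel. (%k. complex_of_real (gauss 1 y) * \<phi> (- x + \<epsilon> k *\<^sub>R y)) \<longlonglongrightarrow> complex_of_real (gauss 1 y) * \<phi> (- x)"
    proof (intro AE_I2 tendsto_mult tendsto_const)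
      fix y
      have "isCont \<phi> (- x)"
        using smooth_continuous[OF schwartz_smooth[OF \<phi>]] by (simp add: continuous_on_eq_continuous_at)
      moreover have "(%k. - x + \<epsilon> k *\<^sub>R y) \<longlonglongrightarrow> - x"
        using tendsto_add[OF tendsto_const[of "-x"] tendsto_scaleR[OF \<epsilon>0 tendsto_const[of y]]] by simp
      ultimately show "(%k. \<phi> (- x + \<epsilon> k *\<^sub>R y)) \<longlonglongrightarrow> \<phi> (- x)"
        by (rule isCont_tendsto_compose)
    qed
    show "AE y in lborel. norm (complex_of_real (gauss 1 y) * \<phi> (- x + \<epsilon> k *\<^sub>R y)) <= B * gauss 1 y" for k
      using Bb by (intro AE_I2) (auto simp: norm_mult mult.commute[of B] intro!: mult_left_mono)
  qed (auto intro!: g1)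
  ultimately have "c * (\<integral>\<xi>. cis (- (\<xi> \<bullet> x)) * FT \<phi> \<xi> \<partial>lborel) = c * (\<integral>y. complex_of_real (gauss 1 (y::real^'n)) * \<phi> (- x) \<partial>lborel)"
    by (metis (no_types, lifting) LIMSEQ_unique ext)
  also have "... = complex_of_real (ftc TYPE('n) * (\<integral>y. gauss 1 (y::real^'n) \<partial>lborel)) * \<phi> (- x)"
    by (simp add: c_def)
  also have "... = \<phi> (- x)" using gauss_mass[where \<epsilon> = 1 and 'n = 'n] by simp
  finally show ?thesis by (simp add: FT_eq c_def)
qed

lemma IFT_FT: "\<phi> \<in> schwartz ==> IFT (FT \<phi>) = \<phi>"
  by (simp add: IFT_eq FT_inversion fun_eq_iff)

lemma FT_IFT: "\<phi> \<in> schwartz ==> FT (IFT \<phi>) = \<phi>"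
  using FT_uminus[OF schwartz_integrable[OF FT_schwartz[of \<phi>]]]
  by (simp add: IFT_eq[abs_def] FT_inversion fun_eq_iff)

lemma borel_measurable_cnj [measurable]:
  "f \<in> borel_measurable M ==> (%x. cnj (f x)) \<in> borel_measurable M"
  by (rule borel_measurable_continuous_on[where f = cnj]) (auto intro!: continuous_intros)

lemma cnj_FT: "cnj (FT f \<xi>) = FT (%x. cnj (f x)) (- \<xi>)"
proof -
  have "cnj (\<integral>x. cis (- (x \<bullet> \<xi>)) * f x \<partial>lborel) = (\<integral>x. cnj (cis (- (x \<bullet> \<xi>)) * f x) \<partial>lborel)"
    by (rule Bochner_Integration.integral_cnj[symmetric])
  then show ?thesis by (simp add: FT_eq cis_cnj)
qed

text \<open>Testing \<open>|FT h|\<^sup>2\<close> against a Gaussian turns it into a quadratic form with a positive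
  kernel of mass one, to which Schur's test applies; no density argument is needed.\<close>

lemma Plancherel_le:
  fixes h :: "'n::finite cfun"
  assumes h: "integrable lborel h"
  shows "(\<integral>\<^sup>+\<xi>. ennreal ((norm (FT h \<xi>))\<^sup>2) \<partial>lborel) <= (\<integral>\<^sup>+x. ennreal ((norm (h x))\<^sup>2) \<partial>lborel)"
proof -
  define c where "c = ftc TYPE('n)"
  have c: "0 < c" unfolding c_def by (rule ftc_pos)
  have [measurable]: "h \<in> borel_measurable borel" using h by auto
  have [measurable]: "FT h \<in> borel_measurable borel" by (rule FT_measurable) simp
  have hb: "norm (FT h \<xi>) <= c * (\<integral>x. norm (h x) \<partial>lborel)" for \<xi> unfolding c_def by (rule norm_FT_le[OF h])
  have icnj: "integrable lborel (%x. cnj (h x))" using h by simp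
  have main: "(\<integral>\<^sup>+\<xi>. ennreal ((norm (FT h \<xi>))\<^sup>2 * gauss \<epsilon> \<xi>) \<partial>lborel) <= (\<integral>\<^sup>+x. ennreal ((norm (h x))\<^sup>2) \<partial>lborel)"
    if \<epsilon>: "\<epsilon> > 0" for \<epsilon>
  proof -
    define k where "k z = (1 / \<epsilon>) ^ CARD('n) * gauss (1 / \<epsilon>) (z::real^'n)" for z
    have k0: "0 <= k z" for z using \<epsilon> gauss_pos[of "1 / \<epsilon>" z] by (simp add: k_def)
    have [measurable]: "k \<in> borel_measurable borel" unfolding k_def[abs_def] by measurable
    have ik: "integrable lborel k" unfolding k_def[abs_def] by (intro integrable_mult_right integrable_gauss) (use \<epsilon> in simp)
    have mass: "c * (\<integral>z. k z \<partial>lborel) = 1" unfolding c_def k_def by (rule gauss_mass[OF \<epsilon>])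
    have nnmass: "(\<integral>\<^sup>+z. ennreal (c * k z) \<partial>lborel) = 1"
      using mass c k0 ik by (subst nn_integral_eq_integral) (auto intro!: integrable_mult_right)
    have ksym: "k (x - y) = k (y - x)" for x y by (simp add: k_def gauss_def norm_minus_commute)
    define \<psi> where "\<psi> \<xi> = complex_of_real (gauss \<epsilon> \<xi>) * cnj (FT h \<xi>)" for \<xi>
    have [measurable]: "\<psi> \<in> borel_measurable borel" unfolding \<psi>_def[abs_def] by measurable
    have ig: "integrable lborel (%\<xi>::real^'n. complex_of_real (gauss \<epsilon> \<xi>))"
      by (intro integrable_of_real integrable_gauss) (use \<epsilon> in simp)
    have i\<psi>: "integrable lborel \<psi>"
    proof (rule Bochner_Integration.integrable_bound[of lborel "%\<xi>. (c * (\<integral>x. norm (h x) \<partial>lborel)) * gauss \<epsilon> \<xi>"])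
      show "AE \<xi> in lborel. norm (\<psi> \<xi>) <= norm ((c * (\<integral>x. norm (h x) \<partial>lborel)) * gauss \<epsilon> \<xi>)"
        using hb c gauss_pos[of \<epsilon>] unfolding \<psi>_def
        by (intro AE_I2) (auto simp: norm_mult abs_mult mult.commute[of "gauss _ _"] intro!: mult_right_mono)
    qed (auto intro!: integrable_gauss simp: \<epsilon>[THEN less_imp_neq, THEN not_sym])
    \<comment> \<open>The Gaussian factor on the frequency side becomes a convolution with
      \<open>k\<close> on the space side.\<close>
    have FT\<psi>: "FT \<psi> x = c * (\<integral>y. cnj (h y) * of_real (k (x - y)) \<partial>lborel)" for x
    proof -
      have "FT \<psi> x = c * (\<integral>\<xi>. (cis (\<xi> \<bullet> (- x)) * complex_of_real (gauss \<epsilon> \<xi>)) * cnj (FT h \<xi>) \<partial>lborel)"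
        unfolding FT_eq c_def \<psi>_def by (simp add: mult.assoc)
      also have "(\<integral>\<xi>. (cis (\<xi> \<bullet> (- x)) * complex_of_real (gauss \<epsilon> \<xi>)) * cnj (FT h \<xi>) \<partial>lborel)
         = (\<integral>\<xi>. (cis (\<xi> \<bullet> (- x)) * complex_of_real (gauss \<epsilon> \<xi>)) * FT (%y. cnj (h (- y))) \<xi> \<partial>lborel)"
        using FT_uminus[OF icnj] by (simp add: cnj_FT)
      also have "... = (\<integral>y. FT (%\<xi>. cis (\<xi> \<bullet> (- x)) * complex_of_real (gauss \<epsilon> \<xi>)) y * cnj (h (- y)) \<partial>lborel)"
        by (rule FT_multiplication[symmetric, OF integrable_cis_mult(1)[OF ig] integral_uminus(2)[OF icnj]])
      also have "... = (\<integral>y. of_real (k (y + x)) * cnj (h (- y)) \<partial>lborel)"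
        unfolding FT_modulate FT_gauss[OF \<epsilon>] k_def by simp
      also have "... = (\<integral>y. cnj (h y) * of_real (k (x - y)) \<partial>lborel)"
      proof -
        have "integrable lborel (%y. cnj (h y) * of_real (k (x - y)))"
        proof (rule Bochner_Integration.integrable_bound[of lborel "%y. (1 / \<epsilon>) ^ CARD('n) * norm (h y)"])
          show "AE y in lborel. norm (cnj (h y) * of_real (k (x - y))) <= norm ((1 / \<epsilon>) ^ CARD('n) * norm (h y))"
            using \<epsilon> gauss_le_1[of "1 / \<epsilon>"] unfolding k_def
            by (intro AE_I2) (auto simp: norm_mult norm_power norm_divide abs_mult power_divide intro!: divide_right_mono mult_left_le)
        qed (use h in auto)
        from integral_uminus(1)[OF this] show ?thesis by (simp add: mult.commute add.commute)
      qed
      finally show ?thesis .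
    qed
    have "(\<integral>\<xi>. FT h \<xi> * \<psi> \<xi> \<partial>lborel) = (\<integral>x. h x * FT \<psi> x \<partial>lborel)"
      by (rule FT_multiplication[OF h i\<psi>])
    moreover have "FT h \<xi> * \<psi> \<xi> = of_real ((norm (FT h \<xi>))\<^sup>2 * gauss \<epsilon> \<xi>)" for \<xi>
      unfolding \<psi>_def using complex_norm_square[of "FT h \<xi>"] by (simp add: mult_ac)
    ultimately have eq: "complex_of_real (\<integral>\<xi>. (norm (FT h \<xi>))\<^sup>2 * gauss \<epsilon> \<xi> \<partial>lborel) = (\<integral>x. h x * FT \<psi> x \<partial>lborel)"
      by (simp del: of_real_mult of_real_power)
    have [measurable]: "FT \<psi> \<in> borel_measurable borel" by (rule FT_measurable) simp
    have isq: "integrable lborel (%\<xi>. (norm (FT h \<xi>))\<^sup>2 * gauss \<epsilon> \<xi>)"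
    proof (rule Bochner_Integration.integrable_bound[of lborel "%\<xi>. (c * (\<integral>x. norm (h x) \<partial>lborel))\<^sup>2 * gauss \<epsilon> \<xi>"])
      show "AE \<xi> in lborel. norm ((norm (FT h \<xi>))\<^sup>2 * gauss \<epsilon> \<xi>) <= norm ((c * (\<integral>x. norm (h x) \<partial>lborel))\<^sup>2 * gauss \<epsilon> \<xi>)"
        using hb gauss_pos[of \<epsilon>] by (intro AE_I2) (auto simp: abs_mult abs_of_pos intro!: mult_right_mono power_mono)
    qed (auto intro!: integrable_gauss simp: \<epsilon>[THEN less_imp_neq, THEN not_sym])
    have "(\<integral>\<^sup>+\<xi>. ennreal ((norm (FT h \<xi>))\<^sup>2 * gauss \<epsilon> \<xi>) \<partial>lborel) = ennreal (\<integral>\<xi>. (norm (FT h \<xi>))\<^sup>2 * gauss \<epsilon> \<xi> \<partial>lborel)"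
      by (rule nn_integral_eq_integral[OF isq]) (use gauss_pos[of \<epsilon>] in \<open>auto intro!: AE_I2 mult_nonneg_nonneg\<close>)
    also have "... <= ennreal (norm (\<integral>x. h x * FT \<psi> x \<partial>lborel))"
      unfolding eq[symmetric] by (intro ennreal_leI) simp
    also have "... <= (\<integral>\<^sup>+x. norm (h x * FT \<psi> x) \<partial>lborel)"
    proof (rule integral_norm_bound_ennreal)
      show "integrable lborel (%x. h x * FT \<psi> x)"
      proof (rule Bochner_Integration.integrable_bound[of lborel "%x. (c * (\<integral>x. norm (\<psi> x) \<partial>lborel)) * norm (h x)"])
        show "AE x in lborel. norm (h x * FT \<psi> x) <= norm ((c * (\<integral>x. norm (\<psi> x) \<partial>lborel)) * norm (h x))"
          using norm_FT_le[OF i\<psi>] c unfolding c_def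
          by (intro AE_I2) (auto simp: norm_mult abs_mult mult.commute[of "norm (h _)"] intro!: mult_right_mono)
      qed (use h in auto)
    qed
    also have "... <= (\<integral>\<^sup>+x. \<integral>\<^sup>+y. ennreal (norm (h x)) * ennreal (norm (h y)) * ennreal (c * k (x - y)) \<partial>lborel \<partial>lborel)"
    proof (rule nn_integral_mono)
      fix x
      have "ennreal (norm (\<integral>y. cnj (h y) * of_real (k (x - y)) \<partial>lborel)) <= (\<integral>\<^sup>+y. norm (cnj (h y) * of_real (k (x - y))) \<partial>lborel)"
        by (cases "integrable lborel (%y. cnj (h y) * of_real (k (x - y)))")
          (auto intro: integral_norm_bound_ennreal simp: not_integrable_integral_eq)
      also have "... = (\<integral>\<^sup>+y. ennreal (norm (h y)) * ennreal (k (x - y)) \<partial>lborel)"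
        using k0 by (simp add: norm_mult ennreal_mult)
      finally have "ennreal (norm (h x)) * (ennreal c * ennreal (norm (\<integral>y. cnj (h y) * of_real (k (x - y)) \<partial>lborel)))
        <= ennreal (norm (h x)) * (ennreal c * (\<integral>\<^sup>+y. ennreal (norm (h y)) * ennreal (k (x - y)) \<partial>lborel))"
        by (intro mult_left_mono) auto
      also have "... = (\<integral>\<^sup>+y. ennreal (norm (h x)) * ennreal (norm (h y)) * ennreal (c * k (x - y)) \<partial>lborel)"
        using c k0 by (simp add: nn_integral_cmult[symmetric] ennreal_mult mult_ac)
      finally show "ennreal (norm (h x * FT \<psi> x)) <= (\<integral>\<^sup>+y. ennreal (norm (h x)) * ennreal (norm (h y)) * ennreal (c * k (x - y)) \<partial>lborel)"
        using c by (simp add: FT\<psi> norm_mult ennreal_mult abs_of_pos)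
    qed
    \<comment> \<open>The inequality 2 a b \<le> a^2 + b^2. Since \<open>k\<close> is even and
      \<open>c * k\<close> has mass one, each summand contributes half of the integral of the
      squared modulus of h.\<close>
    also have "... <= (\<integral>\<^sup>+x. \<integral>\<^sup>+y. ennreal (1/2) * (ennreal ((norm (h x))\<^sup>2) * ennreal (c * k (x - y))) +
        ennreal (1/2) * (ennreal ((norm (h y))\<^sup>2) * ennreal (c * k (x - y))) \<partial>lborel \<partial>lborel)"
    proof (intro nn_integral_mono)
      fix x y
      have "norm (h x) * norm (h y) <= (1/2) * (norm (h x))\<^sup>2 + (1/2) * (norm (h y))\<^sup>2"
        using sum_squares_bound[of "norm (h x)" "norm (h y)"] by simp
      then have "norm (h x) * norm (h y) * (c * k (x - y)) <= ((1/2) * (norm (h x))\<^sup>2 + (1/2) * (norm (h y))\<^sup>2) * (c * k (x - y))"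
        using c k0 by (intro mult_right_mono) auto
      also have "... = (1/2) * ((norm (h x))\<^sup>2 * (c * k (x - y))) + (1/2) * ((norm (h y))\<^sup>2 * (c * k (x - y)))"
        by (simp add: algebra_simps)
      finally have "ennreal (norm (h x) * norm (h y) * (c * k (x - y))) <= ennreal ((1/2) * ((norm (h x))\<^sup>2 * (c * k (x - y))) + (1/2) * ((norm (h y))\<^sup>2 * (c * k (x - y))))"
        by (rule ennreal_leI)
      then show "ennreal (norm (h x)) * ennreal (norm (h y)) * ennreal (c * k (x - y)) \<le>
        ennreal (1/2) * (ennreal ((norm (h x))\<^sup>2) * ennreal (c * k (x - y))) + ennreal (1/2) * (ennreal ((norm (h y))\<^sup>2) * ennreal (c * k (x - y)))"
        using c k0[of "x - y"] by (simp only: ennreal_mult ennreal_plus mult_nonneg_nonneg zero_le_power2 norm_ge_zero less_imp_le zero_le_divide_1_iff zero_le_numeral)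
    qed
    also have "... = ennreal (1/2) * (\<integral>\<^sup>+x. \<integral>\<^sup>+y. ennreal ((norm (h x))\<^sup>2) * ennreal (c * k (x - y)) \<partial>lborel \<partial>lborel)
       + ennreal (1/2) * (\<integral>\<^sup>+x. \<integral>\<^sup>+y. ennreal ((norm (h y))\<^sup>2) * ennreal (c * k (x - y)) \<partial>lborel \<partial>lborel)"
      by (simp add: nn_integral_add nn_integral_cmult)
    also have "(\<integral>\<^sup>+x. \<integral>\<^sup>+y. ennreal ((norm (h y))\<^sup>2) * ennreal (c * k (x - y)) \<partial>lborel \<partial>lborel)
       = (\<integral>\<^sup>+y. \<integral>\<^sup>+x. ennreal ((norm (h y))\<^sup>2) * ennreal (c * k (x - y)) \<partial>lborel \<partial>lborel)"
      by (rule lborel_pair.Fubini') measurable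
    also have "... = (\<integral>\<^sup>+x. \<integral>\<^sup>+y. ennreal ((norm (h x))\<^sup>2) * ennreal (c * k (x - y)) \<partial>lborel \<partial>lborel)"
      by (subst ksym) (rule refl)
    also have "(\<integral>\<^sup>+x. \<integral>\<^sup>+y. ennreal ((norm (h x))\<^sup>2) * ennreal (c * k (x - y)) \<partial>lborel \<partial>lborel) = (\<integral>\<^sup>+x. ennreal ((norm (h x))\<^sup>2) \<partial>lborel)"
    proof (intro nn_integral_cong)
      fix x
      have "(\<integral>\<^sup>+y. ennreal (c * k (x - y)) \<partial>lborel) = (\<integral>\<^sup>+y. ennreal (c * k y) \<partial>lborel)"
        using nn_integral_affine[of "%y. ennreal (c * k y)" "-1" x] by simp
      then show "(\<integral>\<^sup>+y. ennreal ((norm (h x))\<^sup>2) * ennreal (c * k (x - y)) \<partial>lborel) = ennreal ((norm (h x))\<^sup>2)"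
        by (simp add: nn_integral_cmult nnmass)
    qed
    also have "ennreal (1/2) * (\<integral>\<^sup>+x. ennreal ((norm (h x))\<^sup>2) \<partial>lborel) + ennreal (1/2) * (\<integral>\<^sup>+x. ennreal ((norm (h x))\<^sup>2) \<partial>lborel)
       = (\<integral>\<^sup>+x. ennreal ((norm (h x))\<^sup>2) \<partial>lborel)"
    proof -
      have "ennreal (1/2) + ennreal (1/2) = 1" by (subst ennreal_plus[symmetric]) auto
      then show ?thesis unfolding distrib_right[symmetric] by simp
    qed
    finally show ?thesis .
  qed
  define \<epsilon> where "\<epsilon> k = 1 / real (Suc k)" for k
  have \<epsilon>: "0 < \<epsilon> k" for k unfolding \<epsilon>_def by auto
  have \<epsilon>0: "\<epsilon> \<longlonglongrightarrow> 0" unfolding \<epsilon>_def by (rule LIMSEQ_Suc[OF lim_1_over_n])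
  \<comment> \<open>Fatou's lemma removes the Gaussian as \<epsilon> tends to 0.\<close>
  have "(\<integral>\<^sup>+\<xi>. ennreal ((norm (FT h \<xi>))\<^sup>2) \<partial>lborel) = (\<integral>\<^sup>+\<xi>. liminf (%k. ennreal ((norm (FT h \<xi>))\<^sup>2 * gauss (\<epsilon> k) \<xi>)) \<partial>lborel)"
  proof (intro nn_integral_cong)
    fix \<xi>
    have "(%k. ennreal ((norm (FT h \<xi>))\<^sup>2 * gauss (\<epsilon> k) \<xi>)) \<longlonglongrightarrow> ennreal ((norm (FT h \<xi>))\<^sup>2)"
      unfolding gauss_def by (intro tendsto_ennrealI) (auto intro!: tendsto_eq_intros \<epsilon>0)
    then show "ennreal ((norm (FT h \<xi>))\<^sup>2) = liminf (%k. ennreal ((norm (FT h \<xi>))\<^sup>2 * gauss (\<epsilon> k) \<xi>))"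
      by (rule lim_imp_Liminf[symmetric, rotated]) simp
  qed
  also have "... <= liminf (%k. \<integral>\<^sup>+\<xi>. ennreal ((norm (FT h \<xi>))\<^sup>2 * gauss (\<epsilon> k) \<xi>) \<partial>lborel)"
    by (rule nn_integral_liminf) simp
  also have "... <= liminf (%k. \<integral>\<^sup>+x. ennreal ((norm (h x))\<^sup>2) \<partial>lborel)"
    by (intro Liminf_mono always_eventually allI main \<epsilon>)
  also have "... = (\<integral>\<^sup>+x. ennreal ((norm (h x))\<^sup>2) \<partial>lborel)"
    by (rule Liminf_const) simp
  finally show ?thesis .
qed

section \<open>Integrals of \<open>p\<close>-th powers\<close>

text \<open>For a > \<delta> the factor \<open>a powr (1 - p)\<close> is at most
  \<open>\<delta> powr (1 - p)\<close>. This pointwise bound takes the place of Hoelder's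
  inequality: integrated against a kernel it separates a term with the mass of the kernel from a
  term with p-th powers, and \<delta> is free to balance them.\<close>

lemma le_add_powr:
  fixes a \<delta> p :: real
  assumes "0 <= a" "0 < \<delta>" "1 <= p"
  shows "a <= \<delta> + \<delta> powr (1 - p) * a powr p"
proof (cases "a <= \<delta>")
  case False
  then have a: "0 < a" using assms by auto
  have "a = a powr (1 - p) * a powr p" using a by (simp flip: powr_add)
  also have "... <= \<delta> powr (1 - p) * a powr p"
    using False assms by (intro mult_right_mono powr_mono2') auto
  finally show ?thesis using assms by linarith
qed (use assms in \<open>auto intro: add_increasing2\<close>)

lemma le_one_add_powr: "0 <= a ==> 1 <= p ==> a <= 1 + a powr p" for a p :: real
  using le_add_powr[of a 1 p] by simp

lemma powr_add_le:
  fixes a b p :: real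
  assumes "0 <= a" "0 <= b" "0 < p"
  shows "(a + b) powr p <= 2 powr p * (a powr p + b powr p)"
proof -
  have "(a + b) powr p <= (2 * max a b) powr p" using assms by (intro powr_mono2) auto
  also have "... = 2 powr p * max a b powr p" using assms by (simp add: powr_mult)
  also have "max a b powr p <= a powr p + b powr p" by (auto simp: max_def)
  finally show ?thesis by simp
qed

definition lpE :: "real => ('n::finite cfun) => ennreal" where
  "lpE p g = (\<integral>\<^sup>+x. ennreal (norm (g x) powr p) \<partial>lborel)"

lemma Lp_fun_iff: "Lp_fun p g \<longleftrightarrow> g \<in> borel_measurable borel \<and> lpE p g < \<infinity>"
  unfolding Lp_fun_def lpE_def by (auto simp: integrable_iff_bounded)

lemma lpnorm_nonneg: "0 <= lpnorm p g"
  by (simp add: lpnorm_def)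

lemma lpE_eq_lpnorm:
  assumes "Lp_fun p g" "0 < p"
  shows "lpE p g = ennreal (lpnorm p g powr p)"
  using assms nn_integral_eq_integral[of lborel "%x. norm (g x) powr p"]
  by (simp add: lpE_def lpnorm_def powr_powr Lp_fun_def integral_nonneg_AE)

lemma lpE_cong_AE: "AE x in lborel. f x = g x ==> lpE p f = lpE p g"
  unfolding lpE_def by (intro nn_integral_cong_AE) auto

lemma lpE_mono: "(\<And>x. norm (f x) <= norm (g x)) ==> 0 <= p ==> lpE p f <= lpE p g"
  unfolding lpE_def by (intro nn_integral_mono ennreal_leI powr_mono2) auto

lemma lpE_add:
  assumes [measurable]: "f \<in> borel_measurable borel" "g \<in> borel_measurable borel" and p: "0 < p"
  shows "lpE p (%x. f x + g x) <= ennreal (2 powr p) * (lpE p f + lpE p g)"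
proof -
  have "lpE p (%x. f x + g x) <= (\<integral>\<^sup>+x. ennreal (2 powr p) * (ennreal (norm (f x) powr p) + ennreal (norm (g x) powr p)) \<partial>lborel)"
    unfolding lpE_def
  proof (intro nn_integral_mono)
    fix x
    have "norm (f x + g x) powr p <= (norm (f x) + norm (g x)) powr p"
      using p by (intro powr_mono2 norm_triangle_ineq) auto
    also have "... <= 2 powr p * (norm (f x) powr p + norm (g x) powr p)"
      using p by (intro powr_add_le) auto
    finally have "ennreal (norm (f x + g x) powr p) <= ennreal (2 powr p * (norm (f x) powr p + norm (g x) powr p))"
      by (rule ennreal_leI)
    then show "ennreal (norm (f x + g x) powr p) <= ennreal (2 powr p) * (ennreal (norm (f x) powr p) + ennreal (norm (g x) powr p))"
      by (simp add: ennreal_mult)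
  qed
  also have "... = ennreal (2 powr p) * (lpE p f + lpE p g)"
    unfolding lpE_def by (simp add: nn_integral_cmult nn_integral_add)
  finally show ?thesis .
qed

lemma lpE_cmult:
  assumes [measurable]: "f \<in> borel_measurable borel"
  shows "lpE p (%x. c * f x) = ennreal (norm c powr p) * lpE p f"
  unfolding lpE_def by (simp add: norm_mult powr_mult ennreal_mult nn_integral_cmult)

lemma lpE_uminus: "lpE p (%x. - f x) = lpE p f"
  by (simp add: lpE_def)

lemma lpE_diff:
  assumes "f \<in> borel_measurable borel" "g \<in> borel_measurable borel" "0 < p"
  shows "lpE p (%x. f x - g x) <= ennreal (2 powr p) * (lpE p f + lpE p g)"
  using lpE_add[OF assms(1) _ assms(3), of "%x. - g x"] assms(2) by (simp add: lpE_uminus)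

lemma lpE_affine:
  fixes f :: "'n::finite cfun"
  assumes [measurable]: "f \<in> borel_measurable borel" and c: "c ~= 0"
  shows "lpE p f = ennreal (\<bar>c\<bar> ^ CARD('n)) * lpE p (%x. f (a + c *\<^sub>R x))"
  unfolding lpE_def using nn_integral_affine[OF _ c, of "%x. ennreal (norm (f x) powr p)" a] by simp

lemma schwartz_lpE:
  fixes f :: "'n::finite cfun"
  assumes f: "f \<in> schwartz" and p: "1 <= p"
  shows "lpE p f < \<infinity>"
proof -
  obtain B where B: "B > 0" "\<And>x. norm (f x) <= B * weight x" using schwartz_weight[OF f] by metis
  have "norm (f x) powr p <= B powr p * weight x" for x
  proof -
    have "norm (f x) powr p <= (B * weight x) powr p" using B p by (intro powr_mono2) auto
    also have "... = B powr p * weight x powr p" using B weight_pos[of x] by (simp add: powr_mult)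
    also have "weight x powr p <= weight x"
      using powr_mono'[of 1 p "weight x"] p weight_pos[of x] weight_le_1[of x] by simp
    finally show ?thesis by (simp add: mult_left_mono)
  qed
  then have "lpE p f <= (\<integral>\<^sup>+x. ennreal (B powr p * weight (x::real^'n)) \<partial>lborel)"
    unfolding lpE_def by (intro nn_integral_mono ennreal_leI) auto
  also have "... < \<infinity>"
    using integrable_mult_right[OF integrable_weight[where 'n = 'n], of "B powr p"]
    unfolding integrable_iff_bounded by (simp add: abs_mult)
  finally show ?thesis .
qed

lemma schwartz_Lp_fun: "f \<in> schwartz ==> 1 <= p ==> Lp_fun p f"
  using schwartz_lpE[of f p] schwartz_measurable[of f] by (simp add: Lp_fun_iff)

section \<open>Functions as tempered distributions\<close>

text \<open>The growth condition under which pairing with g is controlled by a single seminorm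
  without derivatives, the one with \<open>2 * CARD('n)\<close> weights. All L_p functions with p
  \<ge> 1 and all bounded measurable functions satisfy it.\<close>

definition tame :: "('n::finite cfun) => bool" where
  "tame g \<longleftrightarrow> g \<in> borel_measurable borel \<and> integrable lborel (%x. weight x * norm (g x))"

definition distr_of :: "('n::finite cfun) => 'n distr" where
  "distr_of g = (%\<psi>. if \<psi> \<in> schwartz then \<integral>x. g x * \<psi> x \<partial>lborel else 0)"

lemma represents_distr_of: "represents g (distr_of g)"
  by (simp add: represents_def distr_of_def)

lemma tame_measurable: "tame g ==> g \<in> borel_measurable borel"
  by (simp add: tame_def)

lemma Lp_fun_tame:
  fixes g :: "'n::finite cfun"
  assumes g: "Lp_fun p g" and p: "1 <= p"
  shows "tame g"
  unfolding tame_def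
proof
  show [measurable]: "g \<in> borel_measurable borel" using g by (simp add: Lp_fun_iff)
  show "integrable lborel (%x. weight x * norm (g x))"
  proof (rule Bochner_Integration.integrable_bound)
    show "integrable lborel (%x::real^'n. weight x + norm (g x) powr p)"
      using g by (intro Bochner_Integration.integrable_add integrable_weight) (auto simp: Lp_fun_def)
    show "AE x in lborel. norm (weight x * norm (g x)) <= norm (weight x + norm (g x) powr p)"
    proof (intro AE_I2)
      fix x :: "real^'n"
      have "weight x * norm (g x) <= weight x * (1 + norm (g x) powr p)"
        using p weight_pos[of x] by (intro mult_left_mono le_one_add_powr) auto
      also have "... <= weight x + norm (g x) powr p"
        using mult_right_mono[OF weight_le_1[of x], of "norm (g x) powr p"] by (simp add: distrib_left)
      finally show "norm (weight x * norm (g x)) <= norm (weight x + norm (g x) powr p)"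
        using weight_pos[of x] by (simp add: abs_mult)
    qed
  qed simp
qed

lemma schwartz_tame: "f \<in> schwartz ==> tame f"
  using Lp_fun_tame[OF schwartz_Lp_fun[of f 1]] by simp

lemma tame_integrable:
  fixes g :: "'n::finite cfun"
  assumes g: "tame g" and u: "u \<in> borel_measurable borel" "\<And>x. norm (u x) <= B * weight x"
  shows "integrable lborel (%x. g x * u x)"
proof (rule Bochner_Integration.integrable_bound)
  show "integrable lborel (%x. B * (weight x * norm (g x)))"
    using g by (intro integrable_mult_right) (simp add: tame_def)
  show "AE x in lborel. norm (g x * u x) <= norm (B * (weight x * norm (g x)))"
  proof (intro AE_I2)
    fix x
    have "norm (g x) * norm (u x) <= norm (g x) * (B * weight x)" by (intro mult_left_mono u) auto
    then show "norm (g x * u x) <= norm (B * (weight x * norm (g x)))" by (simp add: norm_mult mult_ac)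
  qed
qed (use g u in \<open>auto simp: tame_def\<close>)

lemma tame_schwartz_integrable:
  fixes g :: "'n::finite cfun"
  assumes "tame g" "\<psi> \<in> schwartz"
  shows "integrable lborel (%x. g x * \<psi> x)"
  using tame_integrable[OF assms(1) schwartz_measurable[OF assms(2)]] schwartz_weight[OF assms(2)] by metis

lemma tame_cball_integrable:
  fixes g :: "'n::finite cfun"
  assumes g: "tame g" and u: "u \<in> borel_measurable borel" "\<And>x. norm (u x) <= B" "\<And>x. R < norm x ==> u x = 0"
  shows "integrable lborel (%x. g x * u x)"
proof (rule tame_integrable[OF g u(1)])
  fix x :: "real^'n"
  have B: "0 <= B" using u(2)[of 0] norm_ge_zero[of "u 0"] by linarith
  let ?C = "(1 + \<bar>R\<bar>) ^ (2 * CARD('n))"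
  show "norm (u x) <= (B * ?C) * weight x"
  proof (cases "R < norm x")
    case True
    then show ?thesis using u(3) B weight_pos[of x] by simp
  next
    case False
    then have "(1 + norm x) ^ (2 * CARD('n)) <= ?C" by (intro power_mono) auto
    then have "1 <= ?C * weight x" unfolding weight_def by (simp add: add_pos_nonneg)
    then have "B * 1 <= B * (?C * weight x)" using B by (intro mult_left_mono)
    then show ?thesis using u(2)[of x] by simp
  qed
qed

lemma tame_distr_of_bound:
  fixes g :: "'n::finite cfun"
  assumes g: "tame g" and \<psi>: "\<psi> \<in> schwartz" "sbound (2 * CARD('n)) 0 \<psi> B"
  shows "norm (\<integral>x. g x * \<psi> x \<partial>lborel) <= (\<integral>x. weight x * norm (g x) \<partial>lborel) * B"
proof -
  have b: "norm (\<psi> x) <= B * weight x" for x using sbound_weight[OF \<psi>(2), of "[]"] by simp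
  have "norm (\<integral>x. g x * \<psi> x \<partial>lborel) <= (\<integral>x. norm (g x * \<psi> x) \<partial>lborel)"
    by (rule integral_norm_bound)
  also have "... <= (\<integral>x. B * (weight x * norm (g x)) \<partial>lborel)"
  proof (intro integral_mono integrable_norm tame_schwartz_integrable[OF g \<psi>(1)] integrable_mult_right)
    show "integrable lborel (%x. weight x * norm (g x))" using g by (simp add: tame_def)
    fix x
    have "norm (g x) * norm (\<psi> x) <= norm (g x) * (B * weight x)" by (intro mult_left_mono b) auto
    then show "norm (g x * \<psi> x) <= B * (weight x * norm (g x))" by (simp add: norm_mult mult_ac)
  qed
  finally show ?thesis by (simp add: mult.commute)
qed

lemma tempered_distr_of:
  fixes g :: "'n::finite cfun"
  assumes g: "tame g"
  shows "tempered (distr_of g)"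
  unfolding tempered_iff
proof (intro conjI ballI allI impI)
  fix \<phi> \<psi> :: "'n cfun" and c :: complex
  assume S: "\<phi> \<in> schwartz" "\<psi> \<in> schwartz"
  show "distr_of g (%x. \<phi> x + \<psi> x) = distr_of g \<phi> + distr_of g \<psi>"
    using S tame_schwartz_integrable[OF g S(1)] tame_schwartz_integrable[OF g S(2)]
    by (simp add: distr_of_def schwartz_add distrib_left)
  show "distr_of g (%x. c * \<phi> x) = c * distr_of g \<phi>"
    using S by (simp add: distr_of_def schwartz_cmult mult.left_commute[of _ c])
next
  show "\<exists>C k m. \<forall>\<phi>\<in>schwartz. \<forall>B. sbound k m \<phi> B \<longrightarrow> norm (distr_of g \<phi>) <= C * B"
    using tame_distr_of_bound[OF g] by (intro exI ballI allI impI) (auto simp: distr_of_def)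
qed (auto simp: distr_of_def)

lemma tempered_add: "tempered T ==> \<phi> \<in> schwartz ==> \<psi> \<in> schwartz ==> T (%x. \<phi> x + \<psi> x) = T \<phi> + T \<psi>"
  unfolding tempered_def by blast

lemma tempered_cmult: "tempered T ==> \<phi> \<in> schwartz ==> T (%x. c * \<phi> x) = c * T \<phi>"
  unfolding tempered_def by blast

lemma tempered_diff_arg:
  assumes "tempered T" "\<phi> \<in> schwartz" "\<psi> \<in> schwartz"
  shows "T (%x. \<phi> x - \<psi> x) = T \<phi> - T \<psi>"
  using tempered_add[OF assms(1,2) schwartz_cmult[OF assms(3), of "-1"]] tempered_cmult[OF assms(1,3), of "-1"] by simp

lemma tempered_sum:
  assumes "tempered T" "finite A" "\<And>i. i \<in> A ==> \<phi> i \<in> schwartz"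
  shows "(%x. \<Sum>i\<in>A. \<phi> i x) \<in> schwartz \<and> T (%x. \<Sum>i\<in>A. \<phi> i x) = (\<Sum>i\<in>A. T (\<phi> i))"
  using assms(2,3)
proof (induction A rule: finite_induct)
  case empty
  then show ?case using tempered_cmult[OF assms(1) schwartz_zero, of 0] by (simp add: schwartz_zero)
next
  case (insert i A)
  then show ?case using tempered_add[OF assms(1)] by (simp add: schwartz_add)
qed

lemma tempered_zero_outside: "tempered T ==> \<phi> \<notin> schwartz ==> T \<phi> = 0"
  unfolding tempered_def by blast

lemma tempered_diff_d:
  assumes "tempered T" "tempered S"
  shows "tempered (diff_d T S)"
  unfolding tempered_iff
proof (intro conjI ballI allI impI)
  obtain C k m where 1: "\<forall>\<phi>\<in>schwartz. \<forall>B. sbound k m \<phi> B \<longrightarrow> norm (T \<phi>) <= C * B"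
    using assms(1) unfolding tempered_iff by blast
  obtain C' k' m' where 2: "\<forall>\<phi>\<in>schwartz. \<forall>B. sbound k' m' \<phi> B \<longrightarrow> norm (S \<phi>) <= C' * B"
    using assms(2) unfolding tempered_iff by blast
  have "norm (diff_d T S \<phi>) <= (C + C') * B" if "\<phi> \<in> schwartz" "sbound (max k k') (max m m') \<phi> B" for \<phi> B
  proof -
    have "norm (T \<phi>) <= C * B" using 1 that sbound_mono[OF that(2), of k m B] by auto
    moreover have "norm (S \<phi>) <= C' * B" using 2 that sbound_mono[OF that(2), of k' m' B] by auto
    ultimately show ?thesis
      using norm_triangle_ineq4[of "T \<phi>" "S \<phi>"] by (simp add: diff_d_def distrib_right)
  qed
  then show "\<exists>C k m. \<forall>\<phi>\<in>schwartz. \<forall>B. sbound k m \<phi> B \<longrightarrow> norm (diff_d T S \<phi>) <= C * B" by blast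
qed (use assms in \<open>auto simp: diff_d_def tempered_add tempered_cmult tempered_zero_outside algebra_simps\<close>)

lemma tempered_FTd:
  fixes T :: "'n::finite distr"
  assumes T: "tempered T"
  shows "tempered (FTd T)"
  unfolding tempered_iff
proof (intro conjI ballI allI impI)
  fix \<phi> \<psi> :: "'n cfun" and c :: complex
  assume S: "\<phi> \<in> schwartz" "\<psi> \<in> schwartz"
  have "FT (%x. \<phi> x + \<psi> x) = (%x. FT \<phi> x + FT \<psi> x)" using FT_add[OF schwartz_integrable[OF S(1)] schwartz_integrable[OF S(2)]] by auto
  then show "FTd T (%x. \<phi> x + \<psi> x) = FTd T \<phi> + FTd T \<psi>"
    using S T by (simp add: FTd_def schwartz_add tempered_add FT_schwartz)
  have "FT (%x. c * \<phi> x) = (%x. c * FT \<phi> x)" using FT_cmult[of c \<phi>] by auto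
  then show "FTd T (%x. c * \<phi> x) = c * FTd T \<phi>"
    using S T by (simp add: FTd_def schwartz_cmult tempered_cmult FT_schwartz)
next
  obtain C k m where 1: "\<forall>\<phi>\<in>schwartz. \<forall>B. sbound k m \<phi> B \<longrightarrow> norm (T \<phi>) <= C * B"
    using T unfolding tempered_iff by blast
  have "norm (FTd T \<phi>) <= (C * ft_const TYPE('n) k m) * B" if "\<phi> \<in> schwartz" "sbound (2 * CARD('n) + m) k \<phi> B" for \<phi> B
    using 1 FT_schwartz[OF that(1)] FT_sbound[OF that] that by (auto simp: FTd_def mult.assoc)
  then show "\<exists>C k m. \<forall>\<phi>\<in>schwartz. \<forall>B. sbound k m \<phi> B \<longrightarrow> norm (FTd T \<phi>) <= C * B" by blast
qed (simp add: FTd_def)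

lemma FTd_diff_d: "FTd (diff_d T S) = diff_d (FTd T) (FTd S)"
  by (auto simp: FTd_def diff_d_def)

lemma multiplier_apply:
  assumes "m \<in> schwartz" "\<psi> \<in> schwartz"
  shows "IFTd (mult_d m (FTd T)) \<psi> = T (FT (%x. m x * IFT \<psi> x))"
  using assms by (simp add: IFTd_def mult_d_def FTd_def IFT_schwartz schwartz_mult)

lemma besov_piece_diff_d: "besov_piece \<phi>0 j (diff_d T S) = diff_d (besov_piece \<phi>0 j T) (besov_piece \<phi>0 j S)"
  by (auto simp: besov_piece_def IFTd_def mult_d_def FTd_def diff_d_def)

section \<open>Uniqueness of the representing function\<close>

locale cutoff =
  fixes \<phi>0 :: "'n::finite cfun"
  assumes phi0_schwartz: "\<phi>0 \<in> schwartz"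
    and phi0_1: "norm x <= 1 ==> \<phi>0 x = 1"
    and phi0_0: "3 / 2 <= norm x ==> \<phi>0 x = 0"

begin

abbreviation "piece \<equiv> besov_piece \<phi>0"

abbreviation "phi \<equiv> phij \<phi>0"

text \<open>Passes from Schwartz test functions to continuous ones of compact support. The integral
  of g against a mollified v is a superposition of integrals against translated bumps, all of which
  vanish, and the mollifications converge to a positive multiple of v.\<close>

lemma mollifier_test:
  fixes g :: "'n cfun"
  assumes g: "tame g" and orth: "\<And>\<psi>. \<psi> \<in> schwartz ==> (\<integral>x. g x * \<psi> x \<partial>lborel) = 0"
    and v: "continuous_on UNIV v" "\<And>x. norm (v x) <= M" "\<And>x. R < norm x ==> v x = 0"
  shows "(\<integral>x. g x * v x \<partial>lborel) = 0"
proof -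
  \<comment> \<open>\<phi>0 is complex-valued and its integral might vanish; its squared modulus is
    again Schwartz and has positive mass.\<close>
  define \<rho> where "\<rho> x = \<phi>0 x * cnj (\<phi>0 x)" for x
  have \<rho>S: "\<rho> \<in> schwartz" unfolding \<rho>_def[abs_def] by (intro schwartz_mult schwartz_cnj phi0_schwartz)
  have \<rho>r: "\<rho> x = of_real ((norm (\<phi>0 x))\<^sup>2)" for x unfolding \<rho>_def using complex_norm_square[of "\<phi>0 x"] by simp
  have \<rho>n: "norm (\<rho> x) = (norm (\<phi>0 x))\<^sup>2" for x by (simp add: \<rho>r norm_power)
  have [measurable]: "\<rho> \<in> borel_measurable borel" by (rule schwartz_measurable[OF \<rho>S])
  have [measurable]: "g \<in> borel_measurable borel" by (rule tame_measurable[OF g])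
  have [measurable]: "v \<in> borel_measurable borel" by (rule borel_measurable_continuous_onI[OF v(1)])
  have i\<rho>: "integrable lborel \<rho>" by (rule schwartz_integrable[OF \<rho>S])
  have M: "0 <= M" using v(2)[of 0] norm_ge_zero[of "v 0"] by linarith
  obtain P where P: "0 < P" "\<And>x. norm (\<rho> x) <= P" using schwartz_bounded[OF \<rho>S, of 0] by (metis le_refl list.size(3) pds.simps(1))
  define m where "m = (\<integral>x. (norm (\<phi>0 x))\<^sup>2 \<partial>lborel)"
  have im: "integrable lborel (%x. (norm (\<phi>0 x))\<^sup>2)" using integrable_norm[OF i\<rho>] unfolding \<rho>n .
  have int\<rho>: "(\<integral>x. \<rho> x \<partial>lborel) = of_real m" unfolding m_def \<rho>r by (rule integral_of_real[OF im])
  have m: "0 < m"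
  proof -
    have "0 < measure lborel (cball 0 1 :: (real^'n) set)" by (simp add: content_cball_pos)
    also have "... = (\<integral>x. indicator (cball 0 1 :: (real^'n) set) x \<partial>lborel)" by simp
    also have "... <= m" unfolding m_def
      by (intro integral_mono im integrable_real_indicator)
        (auto simp: indicator_def phi0_1 emeasure_lborel_cball_finite[unfolded infinity_ennreal_def])
    finally show ?thesis .
  qed
  define t where "t k = 1 / real (Suc k)" for k
  have t: "0 < t k" "t k <= 1" for k unfolding t_def by auto
  have t0: "t \<longlonglongrightarrow> 0" unfolding t_def by (rule LIMSEQ_Suc[OF lim_1_over_n])
  define w where "w k x = (\<integral>y. v y * \<rho> ((1 / t k) *\<^sub>R (x - y)) \<partial>lborel)" for k x
  have [measurable]: "w k \<in> borel_measurable borel" for k unfolding w_def[abs_def] by measurable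
  have \<rho>0: "\<rho> ((1 / t k) *\<^sub>R z) = 0" if "2 < norm z" for k z
  proof -
    have "norm z * t k <= norm z * 1" using t[of k] by (intro mult_left_mono) auto
    have "3 / 2 <= norm ((1 / t k) *\<^sub>R z)" using t[of k] that
      by (simp add: pos_le_divide_eq)
    then show ?thesis by (simp add: \<rho>_def phi0_0)
  qed
  \<comment> \<open>After Fubini the inner integral pairs g with a translated and dilated copy of
    \<open>\<rho>\<close>, which is a Schwartz function.\<close>
  have zero: "(\<integral>x. g x * w k x \<partial>lborel) = 0" for k
  proof -
    let ?F = "%x y. g x * (v y * \<rho> ((1 / t k) *\<^sub>R (x - y)))"
    have cb[measurable]: "(cball 0 r :: (real^'n) set) \<in> sets borel" for r by (intro borel_closed closed_cball)
    have "(\<integral>\<^sup>+x. \<integral>\<^sup>+y. ennreal (norm (?F x y)) \<partial>lborel \<partial>lborel) \<le>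
       (\<integral>\<^sup>+x. \<integral>\<^sup>+y. ennreal (norm (g x * indicator (cball 0 (R + 2)) x)) * (ennreal (M * P) * indicator (cball (0::real^'n) R) y) \<partial>lborel \<partial>lborel)"
    proof (intro nn_integral_mono)
      fix x y
      show "ennreal (norm (?F x y)) <= ennreal (norm (g x * indicator (cball 0 (R + 2)) x)) * (ennreal (M * P) * indicator (cball (0::real^'n) R) y)"
      proof (cases "norm y <= R \<and> norm (x - y) <= 2")
        case True
        then have "norm x <= R + 2" using norm_triangle_ineq[of y "x - y"] by simp
        moreover have "norm (?F x y) <= norm (g x) * (M * P)"
          unfolding norm_mult using M P by (intro mult_left_mono mult_mono v) auto
        ultimately show ?thesis using True M P(1) by (auto simp: norm_mult indicator_def simp flip: ennreal_mult intro!: ennreal_leI)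
      next
        case False
        then have "?F x y = 0" using \<rho>0[of "x - y" k] v(3)[of y] by auto
        then show ?thesis by (simp only: norm_zero ennreal_0 zero_le)
      qed
    qed
    also have "... = (\<integral>\<^sup>+x. ennreal (norm (g x * indicator (cball 0 (R + 2)) x)) \<partial>lborel) * (ennreal (M * P) * emeasure lborel (cball 0 R :: (real^'n) set))"
      by (simp add: nn_integral_cmult nn_integral_multc nn_integral_cmult_indicator)
    also have "... < \<infinity>"
    proof -
      have "integrable lborel (%x. g x * indicator (cball 0 (R + 2)) x)"
        by (rule tame_cball_integrable[OF g, where B = 1 and R = "R + 2"]) (auto simp: indicator_def)
      then show ?thesis by (auto simp: integrable_iff_bounded ennreal_mult_less_top emeasure_lborel_cball_finite[unfolded infinity_ennreal_def])
    qed
    finally have fin: "(\<integral>\<^sup>+x. \<integral>\<^sup>+y. ennreal (norm (?F x y)) \<partial>lborel \<partial>lborel) < \<infinity>" .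
    have "(\<integral>x. g x * w k x \<partial>lborel) = (\<integral>x. \<integral>y. ?F x y \<partial>lborel \<partial>lborel)"
      unfolding w_def by simp
    also have "... = (\<integral>y. \<integral>x. ?F x y \<partial>lborel \<partial>lborel)"
      by (rule lborel_Fubini(1)[OF _ fin]) measurable
    also have "... = (\<integral>y. v y * (\<integral>x. g x * \<rho> ((1 / t k) *\<^sub>R (x - y)) \<partial>lborel) \<partial>lborel)"
      by (simp add: mult.left_commute[of "g _"])
    also have "(%y. \<integral>x. g x * \<rho> ((1 / t k) *\<^sub>R (x - y)) \<partial>lborel) = (%y. 0)"
    proof
      fix y
      have "(%x. \<rho> ((1 / t k) *\<^sub>R (x - y))) \<in> schwartz"
        using schwartz_affine[OF \<rho>S, of "1 / t k" "- ((1 / t k) *\<^sub>R y)"] t[of k] by (simp add: scaleR_diff_right)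
      then show "(\<integral>x. g x * \<rho> ((1 / t k) *\<^sub>R (x - y)) \<partial>lborel) = 0" by (rule orth)
    qed
    finally show ?thesis by simp
  qed
  \<comment> \<open>\<open>w'\<close> is \<open>w\<close> after the substitution z = (x - y) / t,
    without the factor t^n. Its size and its support are bounded uniformly in k, so dominated
    convergence applies.\<close>
  define w' where "w' k x = (\<integral>z. v (x - t k *\<^sub>R z) * \<rho> z \<partial>lborel)" for k x
  have bnd: "norm (v (x - t k *\<^sub>R z) * \<rho> z) <= M * norm (\<rho> z)" for x k z
    unfolding norm_mult by (intro mult_right_mono v) auto
  have iv: "integrable lborel (%z. v (x - t k *\<^sub>R z) * \<rho> z)" for x k
    by (rule Bochner_Integration.integrable_bound[of lborel "%z. M * norm (\<rho> z)"])
      (use i\<rho> M bnd in auto)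
  have ww: "w k x = of_real (t k ^ CARD('n)) * w' k x" for k x
  proof -
    have "integrable lborel (%y. v y * \<rho> ((1 / t k) *\<^sub>R (x - y)))"
    proof -
      have "integrable lborel (%y. v (x - t k *\<^sub>R ((1 / t k) *\<^sub>R x + (- (1 / t k)) *\<^sub>R y)) * \<rho> ((1 / t k) *\<^sub>R x + (- (1 / t k)) *\<^sub>R y))"
        by (rule integrable_affine[OF iv]) (use t[of k] in auto)
      then show ?thesis using t[of k] by (simp add: algebra_simps)
    qed
    from integral_affine[OF this, of "- t k" x] show ?thesis
      using t[of k] by (simp add: w_def w'_def scaleR_conv_of_real[where 'a = complex])
  qed
  have w'b: "norm (w' k x) <= M * m" for k x
  proof -
    have "norm (w' k x) <= (\<integral>z. M * norm (\<rho> z) \<partial>lborel)"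
      unfolding w'_def by (intro order_trans[OF integral_norm_bound] integral_mono integrable_norm iv bnd) (use i\<rho> in auto)
    then show ?thesis by (simp add: m_def \<rho>n)
  qed
  have w'0: "w' k x = 0" if "R + 2 < norm x" for k x
  proof -
    have "v (x - t k *\<^sub>R z) * \<rho> z = 0" for z
    proof (cases "norm z < 3 / 2")
      case True
      have "norm x <= norm (x - t k *\<^sub>R z) + norm (t k *\<^sub>R z)"
        using norm_triangle_ineq[of "x - t k *\<^sub>R z" "t k *\<^sub>R z"] by simp
      moreover have "norm (t k *\<^sub>R z) <= 1 * (3 / 2)"
        unfolding norm_scaleR using t[of k] True by (intro mult_mono) auto
      ultimately show ?thesis using v(3)[of "x - t k *\<^sub>R z"] that by simp
    next
      case False then show ?thesis by (simp add: \<rho>_def phi0_0)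
    qed
    then show ?thesis unfolding w'_def by (simp only: Bochner_Integration.integral_zero)
  qed
  have "(\<integral>x. g x * w' k x \<partial>lborel) = 0" for k
  proof -
    have "(\<integral>x. g x * w k x \<partial>lborel) = of_real (t k ^ CARD('n)) * (\<integral>x. g x * w' k x \<partial>lborel)"
      unfolding ww mult.left_commute[of "g _"] by (rule integral_mult_right_zero)
    then show ?thesis using zero[of k] t[of k] by simp
  qed
  moreover have "(%k. \<integral>x. g x * w' k x \<partial>lborel) \<longlonglongrightarrow> (\<integral>x. g x * (v x * of_real m) \<partial>lborel)"
  proof (rule integral_dominated_convergence[where w = "%x. norm (g x * (of_real (M * m) * indicator (cball 0 (R + 2)) x))"])
    show "integrable lborel (%x. norm (g x * (of_real (M * m) * indicator (cball 0 (R + 2)) x)))"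
      by (intro integrable_norm tame_cball_integrable[OF g, where B = "M * m" and R = "R + 2"])
        (use M m in \<open>auto simp: indicator_def abs_mult norm_mult\<close>)
    show "AE x in lborel. norm (g x * w' k x) <= norm (g x * (of_real (M * m) * indicator (cball 0 (R + 2)) x))" for k
      using w'b w'0 M m by (intro AE_I2) (auto simp: norm_mult indicator_def intro!: mult_left_mono)
    show "AE x in lborel. (%k. g x * w' k x) \<longlonglongrightarrow> g x * (v x * of_real m)"
    proof (intro AE_I2 tendsto_mult tendsto_const)
      fix x
      have "(%k. w' k x) \<longlonglongrightarrow> (\<integral>z. v x * \<rho> z \<partial>lborel)"
        unfolding w'_def
      proof (rule integral_dominated_convergence[where w = "%z. M * norm (\<rho> z)"])
        show "AE z in lborel. (%k. v (x - t k *\<^sub>R z) * \<rho> z) \<longlonglongrightarrow> v x * \<rho> z"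
        proof (intro AE_I2 tendsto_mult tendsto_const)
          fix z
          have "isCont v x" using v(1) by (simp add: continuous_on_eq_continuous_at)
          moreover have "(%k. x - t k *\<^sub>R z) \<longlonglongrightarrow> x"
            using tendsto_diff[OF tendsto_const[of x] tendsto_scaleR[OF t0 tendsto_const[of z]]] by simp
          ultimately show "(%k. v (x - t k *\<^sub>R z)) \<longlonglongrightarrow> v x" by (rule isCont_tendsto_compose)
        qed
      qed (use i\<rho> bnd in auto)
      then show "(%k. w' k x) \<longlonglongrightarrow> v x * of_real m" by (simp add: int\<rho>)
    qed
  qed (auto simp: w'_def[abs_def])
  ultimately have "(\<integral>x. g x * (v x * of_real m) \<partial>lborel) = 0"
    using LIMSEQ_unique[OF _ tendsto_const[of 0]] by simp
  then have "(\<integral>x. g x * v x \<partial>lborel) * of_real m = 0"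
    unfolding mult.assoc[symmetric] by (simp only: integral_mult_left_zero)
  then show ?thesis using m by simp
qed

text \<open>By Lusin's theorem the truncations of \<open>cnj g\<close> are almost everywhere limits of continuous
  functions, so \<open>g\<close> may be tested against them.\<close>

lemma orthogonal_imp_AE_zero:
  fixes g :: "'n cfun"
  assumes g: "tame g" and orth: "\<And>\<psi>. \<psi> \<in> schwartz ==> (\<integral>x. g x * \<psi> x \<partial>lborel) = 0"
  shows "AE x in lborel. g x = 0"
proof -
  have [measurable]: "g \<in> borel_measurable borel" by (rule tame_measurable[OF g])
  have "AE x in lborel. norm x <= real N \<and> norm (g x) <= real N \<longrightarrow> g x = 0" for N :: nat
  proof -
    \<comment> \<open>For this truncation of \<open>cnj g\<close> the product
      \<open>g x * w x\<close> is the squared modulus of \<open>w x\<close>, so a vanishing integral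
      forces w = 0 almost everywhere.\<close>
    define w where "w x = (if norm x <= real N \<and> norm (g x) <= real N then cnj (g x) else 0)" for x
    have [measurable]: "w \<in> borel_measurable borel" unfolding w_def[abs_def] by measurable
    have "w \<in> borel_measurable lebesgue" by (simp add: measurable_completion)
    then have "w measurable_on UNIV"
      by (intro lebesgue_measurable_imp_measurable_on) auto
    then obtain Z G where Z: "negligible Z" "\<And>n. continuous_on UNIV (G n)" "\<And>x. x \<notin> Z ==> (%n. G n x) \<longlonglongrightarrow> w x"
      unfolding measurable_on_def by auto
    have AEZ: "AE x in lborel. x \<notin> Z"
      using Z(1) AE_not_in[of Z lebesgue] by (simp add: negligible_iff_null_sets AE_completion_iff)
    \<comment> \<open>\<open>c\<close> cuts off in space and \<open>cp\<close> projects the values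
      into the disc of radius N. Both leave w unchanged, so the functions \<open>v n\<close> still
      converge to w, but now with a common bound and a common compact support.\<close>
    define c where "c x = complex_of_real (max 0 (min 1 (real N + 1 - norm x)))" for x :: "real^'n"
    define cp where "cp = closest_point (cball (0::complex) (real N))"
    have cpc: "continuous_on UNIV cp" unfolding cp_def by (intro continuous_on_closest_point) auto
    have cpb: "norm (cp z) <= real N" for z
      using closest_point_in_set[of "cball (0::complex) (real N)" z] unfolding cp_def by auto
    define v where "v n x = c x * cp (G n x)" for n x
    have vc: "continuous_on UNIV (v n)" for n
      unfolding v_def c_def
      by (intro continuous_intros continuous_on_compose2[OF cpc Z(2)]) auto
    then have [measurable]: "v n \<in> borel_measurable borel" for n by (rule borel_measurable_continuous_onI)
    have vb: "norm (v n x) <= real N" for n x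
    proof -
      have "norm (c x) <= 1" by (simp add: c_def)
      then have "norm (c x) * norm (cp (G n x)) <= 1 * real N" by (intro mult_mono cpb) auto
      then show ?thesis by (simp add: v_def norm_mult)
    qed
    have v0: "v n x = 0" if "real N + 1 < norm x" for n x using that by (simp add: v_def c_def)
    have "(\<integral>x. g x * v n x \<partial>lborel) = 0" for n
      by (rule mollifier_test[OF g orth vc vb v0])
    moreover have "(%n. \<integral>x. g x * v n x \<partial>lborel) \<longlonglongrightarrow> (\<integral>x. g x * w x \<partial>lborel)"
    proof (rule integral_dominated_convergence[where w = "%x. norm (g x * (of_real (real N) * indicator (cball 0 (real N + 1)) x))"])
      show "integrable lborel (%x. norm (g x * (of_real (real N) * indicator (cball 0 (real N + 1)) x)))"
        by (intro integrable_norm tame_cball_integrable[OF g, where B = "real N" and R = "real N + 1"])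
          (auto simp: indicator_def)
      show "AE x in lborel. norm (g x * v n x) <= norm (g x * (of_real (real N) * indicator (cball 0 (real N + 1)) x))" for n
        using vb v0 by (intro AE_I2) (auto simp: norm_mult indicator_def intro!: mult_left_mono)
      show "AE x in lborel. (%n. g x * v n x) \<longlonglongrightarrow> g x * w x"
        using AEZ
      proof eventually_elim
        case (elim x)
        have wN: "norm (w x) <= real N" by (simp add: w_def)
        have "(%n. cp (G n x)) \<longlonglongrightarrow> cp (w x)"
          using cpc Z(3)[OF elim] by (intro isCont_tendsto_compose[of _ cp]) (auto simp: continuous_on_eq_continuous_at)
        moreover have "cp (w x) = w x" unfolding cp_def using wN by (intro closest_point_self) auto
        moreover have "c x * w x = w x" by (simp add: c_def w_def)
        ultimately have "(%n. v n x) \<longlonglongrightarrow> w x"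
          using tendsto_mult[OF tendsto_const[of "c x"]] unfolding v_def by metis
        then show ?case by (intro tendsto_mult tendsto_const)
      qed
    qed simp_all
    ultimately have "(\<integral>x. g x * w x \<partial>lborel) = 0"
      using LIMSEQ_unique[OF _ tendsto_const[of 0]] by simp
    moreover have gw: "g x * w x = of_real ((norm (w x))\<^sup>2)" for x
      using complex_norm_square[of "g x"] by (simp add: w_def)
    ultimately have "complex_of_real (\<integral>x. (norm (w x))\<^sup>2 \<partial>lborel) = 0"
      by (simp del: of_real_power)
    then have "(\<integral>x. (norm (w x))\<^sup>2 \<partial>lborel) = 0" unfolding of_real_eq_0_iff .
    moreover have "integrable lborel (%x. (norm (w x))\<^sup>2)"
    proof -
      have "integrable lborel (%x. g x * w x)"
        by (rule tame_cball_integrable[OF g, where B = "real N" and R = "real N"]) (auto simp: w_def)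
      then have "integrable lborel (%x. norm (g x * w x))" by (rule integrable_norm)
      then show ?thesis unfolding gw by (simp add: norm_power)
    qed
    ultimately have "AE x in lborel. (norm (w x))\<^sup>2 = 0"
      using integral_nonneg_eq_0_iff_AE[of lborel "%x. (norm (w x))\<^sup>2"] by simp
    then show ?thesis by (rule AE_mp) (auto intro!: AE_I2 simp: w_def split: if_splits)
  qed
  then have "AE x in lborel. \<forall>N::nat. norm x <= real N \<and> norm (g x) <= real N \<longrightarrow> g x = 0"
    unfolding AE_all_countable by blast
  then show ?thesis
  proof eventually_elim
    case (elim x)
    obtain N :: nat where "max (norm x) (norm (g x)) <= real N" using real_arch_simple by blast
    then show ?case using elim by auto
  qed
qed

text \<open>Makes the \<open>SOME\<close> in \<open>Lp_dnorm\<close> harmless, and identifies two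
  different descriptions of one distribution in \<open>local_compactness\<close> and
  \<open>compact_lt2\<close>.\<close>

lemma represents_unique:
  fixes g h :: "'n cfun"
  assumes "tame g" "tame h" "represents g T" "represents h T"
  shows "AE x in lborel. g x = h x"
proof -
  have t: "tame (%x. g x - h x)"
    unfolding tame_def
  proof
    have [measurable]: "g \<in> borel_measurable borel" "h \<in> borel_measurable borel"
      using assms by (auto simp: tame_def)
    show "(%x. g x - h x) \<in> borel_measurable borel" by measurable
    show "integrable lborel (%x. weight x * norm (g x - h x))"
    proof (rule Bochner_Integration.integrable_bound[of lborel "%x. weight x * norm (g x) + weight x * norm (h x)"])
      show "integrable lborel (%x. weight x * norm (g x) + weight x * norm (h x))"
        using assms by (simp add: tame_def)
      show "AE x in lborel. norm (weight x * norm (g x - h x)) <= norm (weight x * norm (g x) + weight x * norm (h x))"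
        using weight_pos norm_triangle_ineq4 unfolding distrib_left[symmetric]
        by (intro AE_I2) (auto simp: abs_mult intro!: mult_left_mono intro: less_imp_le)
    qed measurable
  qed
  have "AE x in lborel. g x - h x = 0"
  proof (rule orthogonal_imp_AE_zero[OF t])
    fix \<psi> :: "'n cfun" assume S: "\<psi> \<in> schwartz"
    show "(\<integral>x. (g x - h x) * \<psi> x \<partial>lborel) = 0"
      using assms S tame_schwartz_integrable[OF assms(1) S] tame_schwartz_integrable[OF assms(2) S]
      by (simp add: left_diff_distrib represents_def)
  qed
  then show ?thesis by simp
qed

end

section \<open>Extended norms of distributions\<close>

text \<open>The \<open>p\<close>-th powers of the norms, with value infinity outside the space.\<close>

definition dE :: "real => 'n::finite distr => ennreal" where
  "dE p T = (if Lp_dist p T then ennreal (Lp_dnorm p T powr p) else \<infinity>)"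

definition bE :: "('n::finite cfun) => real => real => 'n distr => ennreal" where
  "bE \<phi>0 s p T = (\<Sum>j. ennreal (2 powr (real j * s * p)) * dE p (besov_piece \<phi>0 j T))"

text \<open>\<open>E\<close> is the p-th power of the norm of \<open>X\<close>. This interface lets
  the criteria for continuity and compactness be proved once for L_p and for Besov spaces.\<close>

definition enormed :: "real => 'n::finite space => ('n distr => ennreal) => bool" where
  "enormed p X E \<longleftrightarrow> (\<forall>T. T \<in> fst X \<longleftrightarrow> tempered T \<and> E T < \<infinity>) \<and>
     (\<forall>T. tempered T \<and> E T < \<infinity> \<longrightarrow> 0 <= snd X T \<and> ennreal (snd X T powr p) = E T)"

context cutoff

begin

abbreviation "BE \<equiv> bE \<phi>0"

lemma dnorm_eq:
  fixes g :: "'n cfun"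
  assumes g: "Lp_fun p g" "represents g T" and p: "1 <= p"
  shows "Lp_dnorm p T = lpnorm p g"
proof -
  have "\<exists>r h. Lp_fun p h \<and> represents h T \<and> r = lpnorm p h" using g by blast
  then have "\<exists>h. Lp_fun p h \<and> represents h T \<and> Lp_dnorm p T = lpnorm p h"
    unfolding Lp_dnorm_def by (rule someI_ex)
  then obtain h where h: "Lp_fun p h" "represents h T" "Lp_dnorm p T = lpnorm p h" by blast
  have "AE x in lborel. h x = g x"
    using represents_unique[OF Lp_fun_tame[OF h(1) p] Lp_fun_tame[OF g(1) p] h(2) g(2)] .
  then have "lpnorm p h = lpnorm p g"
    unfolding lpnorm_def using g h
    by (intro arg_cong[where f = "%x. x powr (1 / p)"] integral_cong_AE) (auto simp: Lp_fun_iff)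
  then show ?thesis using h by simp
qed

lemma dE_eq:
  fixes g :: "'n cfun"
  assumes "Lp_fun p g" "represents g T" "1 <= p"
  shows "dE p T = lpE p g"
  using assms dnorm_eq[OF assms] lpE_eq_lpnorm[OF assms(1)] by (auto simp: dE_def Lp_dist_def)

lemma dE_le:
  fixes g :: "'n cfun"
  assumes "g \<in> borel_measurable borel" "represents g T" "1 <= p"
  shows "dE p T <= lpE p g"
  using assms dE_eq[of p g T] by (cases "lpE p g < \<infinity>") (auto simp: Lp_fun_iff not_less top_unique)

lemma dE_finite:
  fixes T :: "'n distr"
  assumes "dE p T < \<infinity>" "1 <= p"
  obtains g where "Lp_fun p g" "represents g T" "lpE p g = dE p T"
  using assms dE_eq[of p _ T] unfolding dE_def Lp_dist_def by (auto split: if_splits)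

lemma dE_dnorm:
  fixes T :: "'n distr"
  assumes "dE p T < \<infinity>" "1 <= p"
  shows "Lp_dist p T" "0 <= Lp_dnorm p T" "ennreal (Lp_dnorm p T powr p) = dE p T"
proof -
  obtain g where g: "Lp_fun p g" "represents g T" "lpE p g = dE p T" using dE_finite[OF assms] .
  show "Lp_dist p T" using g by (auto simp: Lp_dist_def)
  show "0 <= Lp_dnorm p T" using dnorm_eq[OF g(1,2) assms(2)] lpnorm_nonneg[of p g] by simp
  show "ennreal (Lp_dnorm p T powr p) = dE p T"
    using \<open>Lp_dist p T\<close> by (simp add: dE_def)
qed

lemma dE_diff_d:
  fixes T S :: "'n distr"
  assumes "1 <= p"
  shows "dE p (diff_d T S) <= ennreal (2 powr p) * (dE p T + dE p S)"
proof (cases "dE p T < \<infinity> \<and> dE p S < \<infinity>")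
  case True
  obtain g where g: "Lp_fun p g" "represents g T" "lpE p g = dE p T" using dE_finite True assms by blast
  obtain h where h: "Lp_fun p h" "represents h S" "lpE p h = dE p S" using dE_finite True assms by blast
  have m: "g \<in> borel_measurable borel" "h \<in> borel_measurable borel" using g h by (auto simp: Lp_fun_iff)
  have "represents (%x. g x - h x) (diff_d T S)"
    using g h tame_schwartz_integrable[OF Lp_fun_tame[OF g(1) assms]] tame_schwartz_integrable[OF Lp_fun_tame[OF h(1) assms]]
    by (auto simp: represents_def diff_d_def left_diff_distrib)
  then have "dE p (diff_d T S) <= lpE p (%x. g x - h x)"
    using m assms by (intro dE_le) auto
  also have "... <= ennreal (2 powr p) * (lpE p g + lpE p h)"
    using m assms by (intro lpE_diff) auto
  finally show ?thesis by (simp add: g h)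
next
  case False
  then have "dE p T + dE p S = \<infinity>" by (auto simp: not_less top_unique)
  then show ?thesis by (simp only: ennreal_mult_top infinity_ennreal_def ennreal_eq_0_iff) simp
qed

lemma bE_diff_d:
  fixes T S :: "'n distr"
  assumes "1 <= p"
  shows "BE s p (diff_d T S) <= ennreal (2 powr p) * (BE s p T + BE s p S)"
proof -
  have "BE s p (diff_d T S) <= (\<Sum>j. ennreal (2 powr p) * (ennreal (2 powr (real j * s * p)) * dE p (piece j T)
     + ennreal (2 powr (real j * s * p)) * dE p (piece j S)))"
    unfolding bE_def besov_piece_diff_d
  proof (intro suminf_le)
    fix j
    show "ennreal (2 powr (real j * s * p)) * dE p (diff_d (piece j T) (piece j S)) \<le>
      ennreal (2 powr p) * (ennreal (2 powr (real j * s * p)) * dE p (piece j T)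
       + ennreal (2 powr (real j * s * p)) * dE p (piece j S))"
      using mult_left_mono[OF dE_diff_d[OF assms, of "piece j T" "piece j S"], of "ennreal (2 powr (real j * s * p))"]
      by (simp add: distrib_left mult_ac)
  qed auto
  also have "... = ennreal (2 powr p) * (BE s p T + BE s p S)"
    unfolding bE_def by (simp add: suminf_add[symmetric])
  finally show ?thesis .
qed

lemma enormed_Lp: "1 <= p ==> enormed p (Lp_space p :: 'n space) (dE p)"
  unfolding enormed_def Lp_space_def using dE_dnorm by (auto simp: dE_def)

lemma enormed_Besov:
  assumes p: "1 <= p"
  shows "enormed p (Besov_space \<phi>0 s p) (BE s p)"
  unfolding enormed_def
proof (intro conjI allI)
  have pw: "(2 powr (real j * s) * r) powr p = 2 powr (real j * s * p) * r powr p" if "0 <= r" for j r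
    using that p by (simp add: powr_mult powr_powr)
  have main: "T \<in> besov_set \<phi>0 s p \<and> ennreal (besov_norm \<phi>0 s p T powr p) = BE s p T"
    if T: "tempered T" "BE s p T < \<infinity>" for T
  proof -
    have dfin: "dE p (piece j T) < \<infinity>" for j
    proof (rule ccontr)
      assume "\<not> dE p (piece j T) < \<infinity>"
      then have "ennreal (2 powr (real j * s * p)) * dE p (piece j T) = \<infinity>"
        by (simp add: not_less top_unique ennreal_mult_top)
      moreover have "ennreal (2 powr (real j * s * p)) * dE p (piece j T) <= BE s p T"
        unfolding bE_def using sum_le_suminf[OF summableI, of "{j}" "%j. ennreal (2 powr (real j * s * p)) * dE p (piece j T)"] by simp
      ultimately show False using T by (simp add: top_unique)
    qed
    define a where "a j = (2 powr (real j * s) * Lp_dnorm p (piece j T)) powr p" for j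
    have a: "0 <= a j" for j by (simp add: a_def)
    have aj: "ennreal (a j) = ennreal (2 powr (real j * s * p)) * dE p (piece j T)" for j
      unfolding a_def using dE_dnorm[OF dfin p, of j] by (simp add: pw ennreal_mult)
    have sum: "(\<Sum>j. ennreal (a j)) = BE s p T" by (simp add: bE_def aj)
    then have sm: "summable a" using T a by (intro summable_suminf_not_top) auto
    have eq: "ennreal (\<Sum>j. a j) = BE s p T" using suminf_ennreal2[OF a sm] sum by simp
    have "T \<in> besov_set \<phi>0 s p"
      using T sm dE_dnorm(1)[OF dfin p] by (simp add: besov_set_def a_def[abs_def])
    moreover have "besov_norm \<phi>0 s p T powr p = (\<Sum>j. a j)"
      using p suminf_nonneg[OF sm a] by (simp add: besov_norm_def a_def powr_powr)
    ultimately show ?thesis using eq by simp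
  qed
  fix T :: "'n distr"
  show "T \<in> fst (Besov_space \<phi>0 s p) \<longleftrightarrow> tempered T \<and> BE s p T < \<infinity>"
  proof
    assume "T \<in> fst (Besov_space \<phi>0 s p)"
    then have T: "tempered T" "\<And>j. Lp_dist p (piece j T)"
      "summable (%j. (2 powr (real j * s) * Lp_dnorm p (piece j T)) powr p)"
      by (auto simp: Besov_space_def besov_set_def)
    have dfin: "dE p (piece j T) < \<infinity>" for j using T by (simp add: dE_def)
    have "BE s p T = (\<Sum>j. ennreal ((2 powr (real j * s) * Lp_dnorm p (piece j T)) powr p))"
      unfolding bE_def using dE_dnorm[OF dfin p] by (simp add: pw ennreal_mult)
    also have "... < \<infinity>"
      unfolding infinity_ennreal_def less_top[symmetric] by (rule ennreal_suminf_neq_top[OF T(3)]) simp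
    finally show "tempered T \<and> BE s p T < \<infinity>" using T by simp
  qed (use main in \<open>auto simp: Besov_space_def\<close>)
  show "tempered T \<and> BE s p T < \<infinity> \<longrightarrow> 0 <= snd (Besov_space \<phi>0 s p) T \<and> ennreal (snd (Besov_space \<phi>0 s p) T powr p) = BE s p T"
    using main by (auto simp: Besov_space_def besov_norm_def)
qed

lemma bE_mono:
  assumes "s <= s'" "0 < p"
  shows "BE s p T <= BE s' p T"
  unfolding bE_def using assms
  by (intro suminf_le mult_right_mono ennreal_leI powr_mono mult_left_mono) auto

end

section \<open>From bounds on extended norms to continuity and compactness of operators\<close>

lemma powr_tendsto_0_iff:
  assumes "\<And>k. 0 <= a k" "0 < p"
  shows "(%k. ennreal (a k powr p)) \<longlonglongrightarrow> 0 \<longleftrightarrow> (a :: nat => real) \<longlonglongrightarrow> 0"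
proof
  assume "(%k. ennreal (a k powr p)) \<longlonglongrightarrow> 0"
  then have "(%k. a k powr p) \<longlonglongrightarrow> 0" using tendsto_ennreal_iff[of "%k. a k powr p" sequentially 0] by simp
  then have "(%k. (a k powr p) powr (1 / p)) \<longlonglongrightarrow> 0 powr (1 / p)"
    using assms by (intro tendsto_powr2 tendsto_const) auto
  then show "a \<longlonglongrightarrow> 0" using assms by (simp add: powr_powr)
next
  assume "a \<longlonglongrightarrow> 0"
  then have "(%k. a k powr p) \<longlonglongrightarrow> 0 powr p" using assms by (intro tendsto_powr2 tendsto_const) auto
  then show "(%k. ennreal (a k powr p)) \<longlonglongrightarrow> 0" using assms tendsto_ennrealI[of "%k. a k powr p" 0] by simp
qed

lemma enormed_diff:
  assumes "enormed p X E" "\<And>T S. E (diff_d T S) <= ennreal A * (E T + E S)" "T \<in> fst X" "S \<in> fst X"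
  shows "tempered (diff_d T S)" "E (diff_d T S) < \<infinity>" "diff_d T S \<in> fst X"
proof -
  have T: "tempered T" "E T < \<infinity>" "tempered S" "E S < \<infinity>" using assms unfolding enormed_def by auto
  show 1: "tempered (diff_d T S)" using T by (simp add: tempered_diff_d)
  have "ennreal A * (E T + E S) < \<infinity>" using T by (simp add: ennreal_mult_less_top)
  then show 2: "E (diff_d T S) < \<infinity>" using assms(2)[of T S] by (rule le_less_trans[rotated])
  show "diff_d T S \<in> fst X" using 1 2 assms(1) by (simp add: enormed_def)
qed

text \<open>\<open>FTd\<close> commutes with differences, so the bound applied to
  \<open>diff_d (fs k) f\<close> is already continuity.\<close>

lemma maps_continuouslyI:
  assumes X: "enormed p X E" and Y: "enormed p Y F" and p: "0 < p"
    and dX: "\<And>T S. E (diff_d T S) <= ennreal A * (E T + E S)"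
    and bound: "\<And>T. tempered T ==> E T < \<infinity> ==> F (FTd T) <= ennreal C * E T"
  shows "maps_continuously FTd X Y"
  unfolding maps_continuously_def
proof (intro conjI ballI allI impI)
  have fin: "tempered (FTd T) \<and> F (FTd T) < \<infinity>" if "tempered T" "E T < \<infinity>" for T
  proof -
    have "ennreal C * E T < \<infinity>" using that by (simp add: ennreal_mult_less_top)
    then show ?thesis using bound[OF that] that by (auto simp: tempered_FTd intro: le_less_trans)
  qed
  show "FTd f \<in> fst Y" if "f \<in> fst X" for f
    using that X Y fin unfolding enormed_def by auto
  fix fs f
  assume as: "(\<forall>k. fs k \<in> fst X) \<and> f \<in> fst X \<and> (%k. snd X (diff_d (fs k) f)) \<longlonglongrightarrow> 0"
  have D: "tempered (diff_d (fs k) f)" "E (diff_d (fs k) f) < \<infinity>" for k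
    using enormed_diff[OF X dX] as by auto
  have nX: "0 <= snd X (diff_d (fs k) f)" "ennreal (snd X (diff_d (fs k) f) powr p) = E (diff_d (fs k) f)" for k
    using X D unfolding enormed_def by auto
  have nY: "0 <= snd Y (diff_d (FTd (fs k)) (FTd f))"
    "ennreal (snd Y (diff_d (FTd (fs k)) (FTd f)) powr p) = F (diff_d (FTd (fs k)) (FTd f))" for k
    using Y fin[OF D, of k] unfolding enormed_def by (auto simp: FTd_diff_d)
  have "(%k. E (diff_d (fs k) f)) \<longlonglongrightarrow> 0"
    using powr_tendsto_0_iff[of "%k. snd X (diff_d (fs k) f)" p] as p nX by simp
  then have lim: "(%k. ennreal C * E (diff_d (fs k) f)) \<longlonglongrightarrow> ennreal C * 0"
    by (intro ennreal_tendsto_cmult) auto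
  have "(%k. F (diff_d (FTd (fs k)) (FTd f))) \<longlonglongrightarrow> 0"
    by (rule tendsto_sandwich[OF _ _ tendsto_const[of 0] lim[simplified]])
      (use bound[OF D] in \<open>auto simp: FTd_diff_d\<close>)
  then show "(%k. snd Y (diff_d (FTd (fs k)) (FTd f))) \<longlonglongrightarrow> 0"
    using powr_tendsto_0_iff[of "%k. snd Y (diff_d (FTd (fs k)) (FTd f))" p] nY p by simp
qed

text \<open>The limit is sought on the side of the domain: the compactness arguments produce a weak
  limit f there, and \<open>FTd f\<close> is then the limit of the images. Convergence in the norm
  of X is not asked for.\<close>

lemma compact_opI:
  assumes X: "enormed p X E" and Y: "enormed p Y F" and p: "0 < p"
    and dY: "\<And>T S. F (diff_d T S) <= ennreal A * (F T + F S)"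
    and bound: "\<And>T. tempered T ==> E T < \<infinity> ==> F (FTd T) < \<infinity>"
    and comp: "\<And>fs M. (\<And>k. tempered (fs k)) ==> (\<And>k. E (fs k) <= ennreal M) ==>
      \<exists>r f. strict_mono (r :: nat => nat) \<and> tempered f \<and> E f < \<infinity> \<and> (%k. F (FTd (diff_d (fs (r k)) f))) \<longlonglongrightarrow> 0"
  shows "compact_op FTd X Y"
  unfolding compact_op_def
proof (intro allI impI)
  fix fs :: "nat => 'a distr"
  assume as: "(\<forall>k. fs k \<in> fst X) \<and> bounded (range (%k. snd X (fs k)))"
  then obtain M where M: "\<And>k. \<bar>snd X (fs k)\<bar> <= M" unfolding bounded_iff by auto
  have T: "tempered (fs k)" "E (fs k) < \<infinity>" for k using as X unfolding enormed_def by auto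
  have "E (fs k) <= ennreal (M powr p)" for k
  proof -
    have "0 <= snd X (fs k)" "E (fs k) = ennreal (snd X (fs k) powr p)" using X T unfolding enormed_def by auto
    then show ?thesis using M[of k] p by (auto intro!: ennreal_leI powr_mono2)
  qed
  then have "\<exists>r f. strict_mono (r :: nat => nat) \<and> tempered f \<and> E f < \<infinity> \<and> (%k. F (FTd (diff_d (fs (r k)) f))) \<longlonglongrightarrow> 0"
    by (rule comp[OF T(1)])
  then obtain r f where r: "strict_mono (r :: nat => nat)" "tempered f" "E f < \<infinity>"
    "(%k. F (FTd (diff_d (fs (r k)) f))) \<longlonglongrightarrow> 0" by (elim exE conjE) (rule that)
  have fY: "FTd f \<in> fst Y" "\<And>k. FTd (fs k) \<in> fst Y"
    using Y bound[OF r(2,3)] bound[OF T] r T by (auto simp: enormed_def tempered_FTd)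
  have D: "tempered (diff_d (FTd (fs k)) (FTd f))" "F (diff_d (FTd (fs k)) (FTd f)) < \<infinity>" for k
    using enormed_diff[OF Y dY fY(2) fY(1)] by auto
  have nY: "0 <= snd Y (diff_d (FTd (fs k)) (FTd f))"
    "ennreal (snd Y (diff_d (FTd (fs k)) (FTd f)) powr p) = F (diff_d (FTd (fs k)) (FTd f))" for k
    using Y D unfolding enormed_def by auto
  have "(%k. snd Y (diff_d (FTd (fs (r k))) (FTd f))) \<longlonglongrightarrow> 0"
    using powr_tendsto_0_iff[of "%k. snd Y (diff_d (FTd (fs (r k))) (FTd f))" p] nY p r(4) by (simp add: FTd_diff_d)
  then show "\<exists>r g. strict_mono r \<and> g \<in> fst Y \<and> (%k. snd Y (diff_d (FTd (fs (r k))) g)) \<longlonglongrightarrow> 0"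
    using r(1) fY(1) by blast
qed

lemma compact_opD:
  assumes X: "enormed p X E" and Y: "enormed p Y F" and p: "0 < p"
    and dY: "\<And>T S. F (diff_d T S) <= ennreal A * (F T + F S)"
    and comp: "compact_op FTd X Y" and cont: "maps_continuously FTd X Y"
    and fs: "\<And>k. tempered (fs k)" "\<And>k. E (fs k) <= ennreal M"
  obtains r g where "strict_mono (r :: nat => nat)" "tempered g" "F g < \<infinity>" "(%k. F (diff_d (FTd (fs (r k))) g)) \<longlonglongrightarrow> 0"
proof -
  have fX: "fs k \<in> fst X" "0 <= snd X (fs k)" "ennreal (snd X (fs k) powr p) = E (fs k)" for k
  proof -
    have "E (fs k) < \<infinity>" using fs(2)[of k] by (rule le_less_trans) simp
    then show "fs k \<in> fst X" "0 <= snd X (fs k)" "ennreal (snd X (fs k) powr p) = E (fs k)"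
      using X fs unfolding enormed_def by auto
  qed
  have "bounded (range (%k. snd X (fs k)))"
  proof -
    have "\<bar>snd X (fs k)\<bar> <= (\<bar>M\<bar>) powr (1 / p)" for k
    proof -
      have "ennreal (snd X (fs k) powr p) <= ennreal \<bar>M\<bar>" using fs(2)[of k] fX(3)[of k] by (simp add: order_trans[OF _ ennreal_leI])
      then have "snd X (fs k) powr p <= \<bar>M\<bar>" by (simp add: ennreal_le_iff)
      then have "(snd X (fs k) powr p) powr (1 / p) <= \<bar>M\<bar> powr (1 / p)" using p by (intro powr_mono2) auto
      then show ?thesis using p fX(2)[of k] by (simp add: powr_powr)
    qed
    then show ?thesis unfolding bounded_iff by auto
  qed
  then obtain r g where r: "strict_mono (r :: nat => nat)" "g \<in> fst Y" "(%k. snd Y (diff_d (FTd (fs (r k))) g)) \<longlonglongrightarrow> 0"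
    using comp fX(1) unfolding compact_op_def by blast
  have "FTd (fs k) \<in> fst Y" for k using cont fX(1) unfolding maps_continuously_def by blast
  then have D: "tempered (diff_d (FTd (fs k)) g)" "F (diff_d (FTd (fs k)) g) < \<infinity>" for k
    using enormed_diff[OF Y dY _ r(2)] by auto
  have nY: "0 <= snd Y (diff_d (FTd (fs k)) g)"
    "ennreal (snd Y (diff_d (FTd (fs k)) g) powr p) = F (diff_d (FTd (fs k)) g)" for k
    using Y D unfolding enormed_def by auto
  have "(%k. F (diff_d (FTd (fs (r k))) g)) \<longlonglongrightarrow> 0"
    using powr_tendsto_0_iff[of "%k. snd Y (diff_d (FTd (fs (r k))) g)" p] nY p r(3) by simp
  moreover have "tempered g" "F g < \<infinity>" using r(2) Y unfolding enormed_def by auto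
  ultimately show ?thesis using that r(1) by blast
qed

section \<open>Fourier multipliers and Littlewood--Paley pieces\<close>

text \<open>The kernel is reflected: for \<open>K = FT m\<close> the inverse transform of m is K(-
  x), so \<open>conv (FT m) g\<close> is the Fourier multiplier with symbol m applied to g.\<close>

definition conv :: "('n::finite cfun) => ('n cfun) => 'n cfun" where
  "conv K g y = of_real (ftc TYPE('n)) * (\<integral>x. K (x - y) * g x \<partial>lborel)"

lemma conv_measurable:
  assumes [measurable]: "K \<in> borel_measurable borel" "g \<in> borel_measurable borel"
  shows "conv K g \<in> borel_measurable borel"
  unfolding conv_def[abs_def] by measurable

lemma FT_mult_IFT:
  fixes m \<psi> :: "'n::finite cfun"
  assumes m: "m \<in> schwartz" and \<psi>: "\<psi> \<in> schwartz"
  shows "FT (%\<xi>. m \<xi> * IFT \<psi> \<xi>) x = of_real (ftc TYPE('n)) * (\<integral>y. \<psi> y * FT m (x - y) \<partial>lborel)"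
proof -
  have im: "integrable lborel m" and i\<psi>: "integrable lborel \<psi>" using m \<psi> by (auto intro: schwartz_integrable)
  have "FT (%\<xi>. m \<xi> * IFT \<psi> \<xi>) x = of_real (ftc TYPE('n)) * (\<integral>\<xi>. (cis (\<xi> \<bullet> (- x)) * m \<xi>) * FT (%y. \<psi> (- y)) \<xi> \<partial>lborel)"
    unfolding FT_eq[of "%\<xi>. m \<xi> * IFT \<psi> \<xi>"] by (simp add: IFT_eq FT_uminus[OF i\<psi>] mult.assoc)
  also have "(\<integral>\<xi>. (cis (\<xi> \<bullet> (- x)) * m \<xi>) * FT (%y. \<psi> (- y)) \<xi> \<partial>lborel)
     = (\<integral>y. FT (%\<xi>. cis (\<xi> \<bullet> (- x)) * m \<xi>) y * \<psi> (- y) \<partial>lborel)"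
    by (rule FT_multiplication[symmetric, OF integrable_cis_mult(1)[OF im] integral_uminus(2)[OF i\<psi>]])
  also have "... = (\<integral>y. FT m (y + x) * \<psi> (- y) \<partial>lborel)" by (simp only: FT_modulate) simp
  also have "... = (\<integral>y. \<psi> y * FT m (x - y) \<partial>lborel)"
  proof -
    have "(%y. FT m (x - y)) \<in> schwartz" using schwartz_affine[OF FT_schwartz[OF m], of "-1" x] by simp
    then have "integrable lborel (%y. \<psi> y * FT m (x - y))" by (intro schwartz_integrable schwartz_mult \<psi>)
    from integral_uminus(1)[OF this] show ?thesis by (simp add: mult.commute add.commute)
  qed
  finally show ?thesis .
qed

text \<open>Because of \<open>norm (g x) <= 1 + norm (g x) powr p\<close> the integral splits in
  two: the first part is finite as K and \<psi> are integrable, the second as K is bounded and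
  \<psi> integrable.\<close>

lemma nn_integral_Schwartz_conv_finite:
  fixes g :: "'n::finite cfun"
  assumes g: "Lp_fun p g" and p: "1 <= p" and K: "K \<in> schwartz" and \<psi>: "\<psi> \<in> schwartz"
  shows "(\<integral>\<^sup>+x. \<integral>\<^sup>+y. ennreal (norm (g x * (\<psi> y * K (x - y)))) \<partial>lborel \<partial>lborel) < \<infinity>"
proof -
  have [measurable]: "g \<in> borel_measurable borel" "\<psi> \<in> borel_measurable borel" "K \<in> borel_measurable borel"
    using g schwartz_measurable[OF \<psi>] schwartz_measurable[OF K] by (auto simp: Lp_fun_iff)
  have nK: "(\<integral>\<^sup>+x. ennreal (norm (K x)) \<partial>lborel) < \<infinity>" and n\<psi>: "(\<integral>\<^sup>+x. ennreal (norm (\<psi> x)) \<partial>lborel) < \<infinity>"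
    using schwartz_integrable[OF K] schwartz_integrable[OF \<psi>] by (auto simp: integrable_iff_bounded)
  obtain B where B: "0 < B" "\<And>x. norm (K x) <= B" using schwartz_bounded[OF K, of 0] by (metis le_refl list.size(3) pds.simps(1))
  have "(\<integral>\<^sup>+x. \<integral>\<^sup>+y. ennreal (norm (g x * (\<psi> y * K (x - y)))) \<partial>lborel \<partial>lborel)
    <= (\<integral>\<^sup>+x. \<integral>\<^sup>+y. ennreal (norm (\<psi> y)) * ennreal (norm (K (x - y))) + ennreal (norm (g x) powr p) * (ennreal B * ennreal (norm (\<psi> y))) \<partial>lborel \<partial>lborel)"
  proof (intro nn_integral_mono)
    fix x y
    have "norm (g x) * (norm (\<psi> y) * norm (K (x - y))) <= (1 + norm (g x) powr p) * (norm (\<psi> y) * norm (K (x - y)))"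
      using p by (intro mult_right_mono le_one_add_powr) auto
    also have "... <= norm (\<psi> y) * norm (K (x - y)) + norm (g x) powr p * (B * norm (\<psi> y))"
      using B(2)[of "x - y"] by (auto simp: distrib_right mult.commute[of B] intro!: mult_left_mono)
    finally have "ennreal (norm (g x * (\<psi> y * K (x - y)))) <= ennreal (norm (\<psi> y) * norm (K (x - y)) + norm (g x) powr p * (B * norm (\<psi> y)))"
      by (intro ennreal_leI) (simp add: norm_mult)
    then show "ennreal (norm (g x * (\<psi> y * K (x - y)))) <= ennreal (norm (\<psi> y)) * ennreal (norm (K (x - y))) + ennreal (norm (g x) powr p) * (ennreal B * ennreal (norm (\<psi> y)))"
      using B(1) by (simp add: ennreal_mult)
  qed
  also have "... = (\<integral>\<^sup>+x. \<integral>\<^sup>+y. ennreal (norm (\<psi> y)) * ennreal (norm (K (x - y))) \<partial>lborel \<partial>lborel)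
     + lpE p g * (ennreal B * (\<integral>\<^sup>+y. ennreal (norm (\<psi> y)) \<partial>lborel))"
    unfolding lpE_def by (simp add: nn_integral_add nn_integral_cmult nn_integral_multc)
  also have "(\<integral>\<^sup>+x. \<integral>\<^sup>+y. ennreal (norm (\<psi> y)) * ennreal (norm (K (x - y))) \<partial>lborel \<partial>lborel)
    = (\<integral>\<^sup>+y. \<integral>\<^sup>+x. ennreal (norm (\<psi> y)) * ennreal (norm (K (x - y))) \<partial>lborel \<partial>lborel)"
    by (rule lborel_pair.Fubini') measurable
  also have "... = (\<integral>\<^sup>+y. ennreal (norm (\<psi> y)) * (\<integral>\<^sup>+x. ennreal (norm (K x)) \<partial>lborel) \<partial>lborel)"
  proof (intro nn_integral_cong)
    fix y
    have "(\<integral>\<^sup>+x. ennreal (norm (K (x - y))) \<partial>lborel) = (\<integral>\<^sup>+x. ennreal (norm (K x)) \<partial>lborel)"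
      using nn_integral_affine[of "%x. ennreal (norm (K x))" 1 "- y"] by simp
    then show "(\<integral>\<^sup>+x. ennreal (norm (\<psi> y)) * ennreal (norm (K (x - y))) \<partial>lborel) = ennreal (norm (\<psi> y)) * (\<integral>\<^sup>+x. ennreal (norm (K x)) \<partial>lborel)"
      by (simp add: nn_integral_cmult)
  qed
  also have "... = (\<integral>\<^sup>+y. ennreal (norm (\<psi> y)) \<partial>lborel) * (\<integral>\<^sup>+x. ennreal (norm (K x)) \<partial>lborel)"
    by (simp add: nn_integral_multc)
  finally show ?thesis
    using nK n\<psi> g by (auto simp: Lp_fun_iff ennreal_mult_less_top intro: le_less_trans)
qed

lemma represents_multiplier:
  fixes m g :: "'n::finite cfun"
  assumes m: "m \<in> schwartz" and g: "Lp_fun p g" "represents g T" and p: "1 <= p"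
  shows "represents (conv (FT m) g) (IFTd (mult_d m (FTd T)))"
  unfolding represents_def
proof
  fix \<psi> :: "'n cfun" assume \<psi>: "\<psi> \<in> schwartz"
  define c where "c = complex_of_real (ftc TYPE('n))"
  have K: "FT m \<in> schwartz" by (rule FT_schwartz[OF m])
  have [measurable]: "g \<in> borel_measurable borel" "\<psi> \<in> borel_measurable borel" "FT m \<in> borel_measurable borel"
    using g schwartz_measurable[OF \<psi>] schwartz_measurable[OF K] by (auto simp: Lp_fun_iff)
  have S: "FT (%x. m x * IFT \<psi> x) \<in> schwartz" by (intro FT_schwartz schwartz_mult m IFT_schwartz \<psi>)
  have "IFTd (mult_d m (FTd T)) \<psi> = (\<integral>x. g x * FT (%\<xi>. m \<xi> * IFT \<psi> \<xi>) x \<partial>lborel)"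
    using g S by (simp add: multiplier_apply[OF m \<psi>] represents_def)
  also have "... = (\<integral>x. c * (g x * (\<integral>y. \<psi> y * FT m (x - y) \<partial>lborel)) \<partial>lborel)"
    unfolding FT_mult_IFT[OF m \<psi>] c_def by (simp only: mult_ac)
  also have "... = c * (\<integral>x. \<integral>y. g x * (\<psi> y * FT m (x - y)) \<partial>lborel \<partial>lborel)"
    unfolding integral_mult_right_zero ..
  also have "(\<integral>x. \<integral>y. g x * (\<psi> y * FT m (x - y)) \<partial>lborel \<partial>lborel) = (\<integral>y. \<integral>x. g x * (\<psi> y * FT m (x - y)) \<partial>lborel \<partial>lborel)"
    by (rule lborel_Fubini(1)[OF _ nn_integral_Schwartz_conv_finite[OF g(1) p K \<psi>]]) measurable
  also have "... = (\<integral>y. \<integral>x. \<psi> y * (FT m (x - y) * g x) \<partial>lborel \<partial>lborel)"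
    by (simp only: mult_ac)
  also have "c * ... = (\<integral>y. c * (\<psi> y * (\<integral>x. FT m (x - y) * g x \<partial>lborel)) \<partial>lborel)"
    by simp
  also have "... = (\<integral>y. conv (FT m) g y * \<psi> y \<partial>lborel)"
    unfolding conv_def c_def by (intro Bochner_Integration.integral_cong) auto
  finally show "IFTd (mult_d m (FTd T)) \<psi> = (\<integral>x. conv (FT m) g x * \<psi> x \<partial>lborel)" .
qed

text \<open>Jensen's inequality up to the factor \<open>2 powr p\<close>: choose \<open>\<delta>\<close> so that both terms of
  \<open>le_add_powr\<close> have the same mean.\<close>

lemma norm_integral_powr_le:
  fixes k g :: "'a => complex"
  assumes k: "integrable M k" and [measurable]: "g \<in> borel_measurable M" and p: "1 <= p"
    and fin: "integrable M (%x. norm (k x) * norm (g x) powr p)"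
  shows "norm (\<integral>x. k x * g x \<partial>M) powr p
    <= 2 powr p * (\<integral>x. norm (k x) \<partial>M) powr (p - 1) * (\<integral>x. norm (k x) * norm (g x) powr p \<partial>M)"
proof -
  have [measurable]: "k \<in> borel_measurable M" using k by auto
  define \<kappa> where "\<kappa> = (\<integral>x. norm (k x) \<partial>M)"
  define I where "I = (\<integral>x. norm (k x) * norm (g x) powr p \<partial>M)"
  define a where "a = norm (\<integral>x. k x * g x \<partial>M)"
  have \<kappa>: "0 <= \<kappa>" unfolding \<kappa>_def by (intro integral_nonneg_AE) auto
  have I: "0 <= I" unfolding I_def by (intro integral_nonneg_AE) auto
  have bd: "a <= \<delta> * \<kappa> + \<delta> powr (1 - p) * I" if \<delta>: "0 < \<delta>" for \<delta>
  proof -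
    have pt: "norm (k x * g x) <= \<delta> * norm (k x) + \<delta> powr (1 - p) * (norm (k x) * norm (g x) powr p)" for x
      using mult_left_mono[OF le_add_powr[OF norm_ge_zero[of "g x"] \<delta> p], of "norm (k x)"]
      by (simp add: norm_mult algebra_simps)
    have i: "integrable M (%x. \<delta> * norm (k x) + \<delta> powr (1 - p) * (norm (k x) * norm (g x) powr p))"
      using k fin by (intro Bochner_Integration.integrable_add integrable_mult_right) auto
    have "a <= (\<integral>x. norm (k x * g x) \<partial>M)" unfolding a_def by (rule integral_norm_bound)
    also have "... <= (\<integral>x. \<delta> * norm (k x) + \<delta> powr (1 - p) * (norm (k x) * norm (g x) powr p) \<partial>M)"
      using pt by (intro integral_mono_AE'[OF i] AE_I2) (auto intro: order_trans[OF norm_ge_zero])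
    also have "... = \<delta> * \<kappa> + \<delta> powr (1 - p) * I"
      unfolding \<kappa>_def I_def using k fin by simp
    finally show ?thesis .
  qed
  \<comment> \<open>The balancing choice of \<delta> needs \<kappa> and I positive; if one of them
    is zero, the left side vanishes.\<close>
  show ?thesis
  proof (cases "\<kappa> = 0 \<or> I = 0")
    case True
    have "a = 0"
    proof (cases "\<kappa> = 0")
      case True
      then have "AE x in M. k x = 0"
        unfolding \<kappa>_def using k by (subst (asm) integral_nonneg_eq_0_iff_AE) auto
      then have "AE x in M. k x * g x = 0" by auto
      then have "(\<integral>x. k x * g x \<partial>M) = 0" by (intro integral_eq_zero_AE)
      then show ?thesis by (simp add: a_def)
    next
      case False
      then have \<kappa>0: "0 < \<kappa>" "I = 0" using True \<kappa> by auto
      show ?thesis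
      proof (rule ccontr)
        assume "a ~= 0"
        then have "0 < a" unfolding a_def by simp
        \<comment> \<open>With I = 0 this value of \<delta> gives a \<le> a / 2.\<close>
        from bd[of "a / (2 * \<kappa>)"] this \<kappa>0 show False by simp
      qed
    qed
    then show ?thesis using I \<kappa> unfolding a_def[symmetric] \<kappa>_def[symmetric] I_def[symmetric] by simp
  next
    case False
    then have \<kappa>0: "0 < \<kappa>" and I0: "0 < I" using \<kappa> I by auto
    define \<delta> where "\<delta> = (I / \<kappa>) powr (1 / p)"
    have \<delta>: "0 < \<delta>" unfolding \<delta>_def using \<kappa>0 I0 by simp
    have \<delta>p: "\<delta> powr p = I / \<kappa>" unfolding \<delta>_def using \<kappa>0 I0 p by (simp add: powr_powr)
    have "\<delta> powr (1 - p) * I = \<delta> * \<kappa>"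
      using \<delta> \<kappa>0 I0 by (simp add: powr_diff \<delta>p)
    then have "a <= 2 * (\<delta> * \<kappa>)" using bd[OF \<delta>] by simp
    then have "a powr p <= (2 * (\<delta> * \<kappa>)) powr p" using p unfolding a_def by (intro powr_mono2) auto
    also have "... = 2 powr p * (\<delta> powr p * \<kappa> powr p)" using \<delta> \<kappa>0 by (simp add: powr_mult)
    also have "... = 2 powr p * \<kappa> powr (p - 1) * I" using \<kappa>0 by (simp add: \<delta>p powr_diff)
    finally show ?thesis unfolding a_def \<kappa>_def I_def .
  qed
qed

text \<open>Young's inequality, with the constant 2 inherited from
  \<open>norm_integral_powr_le\<close>: that lemma is applied for fixed y with the density
  \<open>K (x - y)\<close>, and the result is integrated over y by Tonelli.\<close>

lemma lpE_conv_le: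
  fixes K g :: "'n::finite cfun"
  assumes K: "integrable lborel K" and [measurable]: "g \<in> borel_measurable borel" and p: "1 <= p"
  shows "lpE p (conv K g) <= ennreal ((2 * ftc TYPE('n) * (\<integral>x. norm (K x) \<partial>lborel)) powr p) * lpE p g"
proof -
  have [measurable]: "K \<in> borel_measurable borel" using K by auto
  define \<kappa> where "\<kappa> = (\<integral>x. norm (K x) \<partial>lborel)"
  define c where "c = ftc TYPE('n)"
  have c: "0 < c" unfolding c_def by (rule ftc_pos)
  have \<kappa>: "0 <= \<kappa>" unfolding \<kappa>_def by (intro integral_nonneg_AE) auto
  have kn: "(\<integral>\<^sup>+x. ennreal (norm (K x)) \<partial>lborel) = ennreal \<kappa>"
    unfolding \<kappa>_def using K by (intro nn_integral_eq_integral) auto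
  have Ky: "integrable lborel (%x. K (x - y))" "(\<integral>x. norm (K (x - y)) \<partial>lborel) = \<kappa>" for y
    using integral_translate(2)[OF K, of "- y"] integral_translate(1)[OF integrable_norm[OF K], of "- y"] by (auto simp: \<kappa>_def)
  show ?thesis
  proof (cases "\<kappa> = 0")
    case True
    have "conv K g y = 0" for y
    proof -
      have "AE x in lborel. K (x - y) = 0"
        using Ky[of y] True integral_nonneg_eq_0_iff_AE[of lborel "%x. norm (K (x - y))"] by auto
      then have "(\<integral>x. K (x - y) * g x \<partial>lborel) = 0" by (intro integral_eq_zero_AE) auto
      then show ?thesis by (simp add: conv_def)
    qed
    then show ?thesis by (simp add: lpE_def)
  next
    case False
    then have \<kappa>0: "0 < \<kappa>" using \<kappa> by simp
    define J where "J y = (\<integral>\<^sup>+x. ennreal (norm (K (x - y))) * ennreal (norm (g x) powr p) \<partial>lborel)" for y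
    define D where "D = (2 * c) powr p * \<kappa> powr (p - 1)"
    have D: "0 < D" unfolding D_def using c \<kappa>0 by simp
    have pt: "ennreal (norm (conv K g y) powr p) <= ennreal D * J y" for y
    proof (cases "J y < \<infinity>")
      case True
      have J: "J y = (\<integral>\<^sup>+x. ennreal (norm (K (x - y)) * norm (g x) powr p) \<partial>lborel)"
        unfolding J_def by (simp add: ennreal_mult)
      have i: "integrable lborel (%x. norm (K (x - y)) * norm (g x) powr p)"
        using True unfolding J by (intro integrableI_nonneg) auto
      have "norm (\<integral>x. K (x - y) * g x \<partial>lborel) powr p <= 2 powr p * \<kappa> powr (p - 1) * (\<integral>x. norm (K (x - y)) * norm (g x) powr p \<partial>lborel)"
        using norm_integral_powr_le[OF Ky(1) _ p i] by (simp add: Ky(2))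
      then have "c powr p * norm (\<integral>x. K (x - y) * g x \<partial>lborel) powr p <= c powr p * (2 powr p * \<kappa> powr (p - 1) * (\<integral>x. norm (K (x - y)) * norm (g x) powr p \<partial>lborel))"
        by (intro mult_left_mono) auto
      then have "norm (conv K g y) powr p <= D * (\<integral>x. norm (K (x - y)) * norm (g x) powr p \<partial>lborel)"
        using c by (simp add: conv_def norm_mult powr_mult D_def c_def mult_ac)
      then have "ennreal (norm (conv K g y) powr p) <= ennreal D * ennreal (\<integral>x. norm (K (x - y)) * norm (g x) powr p \<partial>lborel)"
        using D by (simp add: ennreal_leI flip: ennreal_mult')
      also have "ennreal (\<integral>x. norm (K (x - y)) * norm (g x) powr p \<partial>lborel) = J y"
        unfolding J by (rule nn_integral_eq_integral[symmetric, OF i]) auto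
      finally show ?thesis .
    next
      case False
      then show ?thesis using D by (simp add: not_less top_unique ennreal_mult_top)
    qed
    have "lpE p (conv K g) <= (\<integral>\<^sup>+y. ennreal D * J y \<partial>lborel)"
      unfolding lpE_def by (intro nn_integral_mono pt)
    also have "... = ennreal D * (\<integral>\<^sup>+y. J y \<partial>lborel)"
      unfolding J_def by (intro nn_integral_cmult) measurable
    also have "(\<integral>\<^sup>+y. J y \<partial>lborel) = (\<integral>\<^sup>+x. \<integral>\<^sup>+y. ennreal (norm (K (x - y))) * ennreal (norm (g x) powr p) \<partial>lborel \<partial>lborel)"
      unfolding J_def by (rule lborel_pair.Fubini') measurable
    also have "... = (\<integral>\<^sup>+x. ennreal \<kappa> * ennreal (norm (g x) powr p) \<partial>lborel)"
    proof (intro nn_integral_cong)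
      fix x
      have "(\<integral>\<^sup>+y. ennreal (norm (K (x - y))) \<partial>lborel) = ennreal \<kappa>"
        using nn_integral_affine[of "%y. ennreal (norm (K y))" "-1" x] kn by simp
      then show "(\<integral>\<^sup>+y. ennreal (norm (K (x - y))) * ennreal (norm (g x) powr p) \<partial>lborel) = ennreal \<kappa> * ennreal (norm (g x) powr p)"
        by (simp add: nn_integral_multc)
    qed
    also have "... = ennreal \<kappa> * lpE p g" unfolding lpE_def by (simp add: nn_integral_cmult)
    finally have "lpE p (conv K g) <= ennreal (D * \<kappa>) * lpE p g"
      using D \<kappa> by (simp add: ennreal_mult mult.assoc)
    moreover have "D * \<kappa> = (2 * c * \<kappa>) powr p"
      unfolding D_def using c \<kappa>0 by (simp add: powr_mult powr_diff)
    ultimately show ?thesis by (simp add: c_def \<kappa>_def)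
  qed
qed

lemma FT_scale:
  fixes f :: "'n::finite cfun"
  assumes f: "integrable lborel f" and t: "0 < t"
  shows "FT (%x. f (t *\<^sub>R x)) \<xi> = of_real ((1 / t) ^ CARD('n)) * FT f ((1 / t) *\<^sub>R \<xi>)"
proof -
  have "integrable lborel (%x. cis (- (x \<bullet> ((1 / t) *\<^sub>R \<xi>))) * f x)" by (rule integrable_cis_mult[OF f])
  from integral_affine[OF this, of t 0] t
  have "(\<integral>x. cis (- (x \<bullet> ((1 / t) *\<^sub>R \<xi>))) * f x \<partial>lborel) = of_real (t ^ CARD('n)) * (\<integral>x. cis (- (x \<bullet> \<xi>)) * f (t *\<^sub>R x) \<partial>lborel)"
    by (simp add: scaleR_conv_of_real[where 'a = complex])
  then show ?thesis using t by (simp add: FT_eq power_divide)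
qed

text \<open>A dilation rescales the transform without changing its L_1 norm; this is why the kernels
  \<open>FT (phi j)\<close> obey a bound independent of j.\<close>

lemma integral_norm_FT_scale:
  fixes f :: "'n::finite cfun"
  assumes f: "f \<in> schwartz" and t: "0 < t"
  shows "(\<integral>\<xi>. norm (FT (%x. f (t *\<^sub>R x)) \<xi>) \<partial>lborel) = (\<integral>\<xi>. norm (FT f \<xi>) \<partial>lborel)"
proof -
  have "integrable lborel (%\<xi>. norm (FT f \<xi>))" by (intro integrable_norm schwartz_integrable FT_schwartz f)
  from integral_affine[OF this, of "1 / t" 0] t
  show ?thesis by (simp add: FT_scale[OF schwartz_integrable[OF f] t] norm_mult norm_power norm_divide)
qed

section \<open>Interpolation for the localised Fourier transform\<close>

lemma nn_integral_powr_below: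
  assumes "0 < q" "0 <= a"
  shows "(\<integral>\<^sup>+t. indicator {0..a} t * ennreal (t powr (q - 1)) \<partial>lborel) = ennreal (a powr q / q)"
proof -
  have "((%x. x powr (q - 1)) has_integral (a powr (q - 1 + 1) / (q - 1 + 1))) {0..a}"
    using assms by (intro has_integral_powr_from_0) auto
  then have "((%x. if x \<in> {0..a} then x powr (q - 1) else 0) has_integral (a powr q / q)) UNIV"
    by (subst has_integral_restrict_UNIV) simp
  then have "(\<integral>\<^sup>+x. ennreal (if x \<in> {0..a} then x powr (q - 1) else 0) \<partial>lborel) = ennreal (a powr q / q)"
    by (intro nn_integral_has_integral_lborel) auto
  then show ?thesis by (rule trans[rotated]) (auto simp: indicator_def intro!: nn_integral_cong)
qed

lemma nn_integral_powr_above: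
  assumes "0 < r" "0 < a"
  shows "(\<integral>\<^sup>+t. indicator {a..} t * ennreal (t powr (- r - 1)) \<partial>lborel) = ennreal (a powr (- r) / r)"
proof -
  have "((%x. x powr (- r - 1)) has_integral (- (a powr (- r - 1 + 1)) / (- r - 1 + 1))) {a..}"
    using assms by (intro has_integral_powr_to_inf) auto
  then have "((%x. if x \<in> {a..} then x powr (- r - 1) else 0) has_integral (a powr (- r) / r)) UNIV"
    by (subst has_integral_restrict_UNIV) simp
  then have "(\<integral>\<^sup>+x. ennreal (if x \<in> {a..} then x powr (- r - 1) else 0) \<partial>lborel) = ennreal (a powr (- r) / r)"
    by (intro nn_integral_has_integral_lborel) auto
  then show ?thesis by (rule trans[rotated]) (auto simp: indicator_def intro!: nn_integral_cong)
qed

text \<open>The distribution function of f is bounded by the integral of a density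
  \<open>g t x\<close>. By Tonelli the t-integral may then be computed for each x separately, where
  it reduces to an elementary power integral.\<close>

lemma lpE_layer_cake_le:
  fixes f :: "'n::finite cfun" and g :: "real => real^'n => ennreal"
  assumes [measurable]: "f \<in> borel_measurable borel" and p: "0 < p"
    and [measurable]: "case_prod g \<in> borel_measurable (lborel \<Otimes>\<^sub>M lborel)"
    and weak: "\<And>t. 0 < t ==> (\<integral>\<^sup>+\<xi>. indicator {t<..} (norm (f \<xi>)) \<partial>lborel) <= (\<integral>\<^sup>+x. g t x \<partial>lborel)"
  shows "lpE p f <= (\<integral>\<^sup>+x. \<integral>\<^sup>+t. indicator {0<..} t * ennreal (p * t powr (p - 1)) * g t x \<partial>lborel \<partial>lborel)"
proof -
  have pt: "ennreal (norm (f \<xi>) powr p) = (\<integral>\<^sup>+t. indicator {0<..} t * ennreal (p * t powr (p - 1)) * indicator {t<..} (norm (f \<xi>)) \<partial>lborel)" for \<xi>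
  proof -
    have "ennreal (norm (f \<xi>) powr p) = ennreal p * ennreal (norm (f \<xi>) powr p / p)"
      using p by (simp flip: ennreal_mult)
    also have "... = ennreal p * (\<integral>\<^sup>+t. indicator {0..norm (f \<xi>)} t * ennreal (t powr (p - 1)) \<partial>lborel)"
      using p by (subst nn_integral_powr_below) auto
    also have "... = (\<integral>\<^sup>+t. ennreal p * (indicator {0..norm (f \<xi>)} t * ennreal (t powr (p - 1))) \<partial>lborel)"
      by (rule nn_integral_cmult[symmetric]) measurable
    also have "... = (\<integral>\<^sup>+t. indicator {0<..} t * ennreal (p * t powr (p - 1)) * indicator {t<..} (norm (f \<xi>)) \<partial>lborel)"
    proof (intro nn_integral_cong_AE)
      have "AE t in lborel. t ~= 0 \<and> t ~= norm (f \<xi>)" using AE_lborel_singleton[of 0] AE_lborel_singleton[of "norm (f \<xi>)"] by auto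
      then show "AE t in lborel. ennreal p * (indicator {0..norm (f \<xi>)} t * ennreal (t powr (p - 1))) =
          indicator {0<..} t * ennreal (p * t powr (p - 1)) * indicator {t<..} (norm (f \<xi>))"
        by eventually_elim (use p in \<open>auto simp: indicator_def ennreal_mult\<close>)
    qed
    finally show ?thesis .
  qed
  have "lpE p f = (\<integral>\<^sup>+\<xi>. \<integral>\<^sup>+t. indicator {0<..} t * ennreal (p * t powr (p - 1)) * indicator {t<..} (norm (f \<xi>)) \<partial>lborel \<partial>lborel)"
    unfolding lpE_def pt ..
  also have "... = (\<integral>\<^sup>+t. \<integral>\<^sup>+\<xi>. indicator {0<..} t * ennreal (p * t powr (p - 1)) * indicator {t<..} (norm (f \<xi>)) \<partial>lborel \<partial>lborel)"
    by (rule lborel_pair.Fubini') (auto simp: indicator_def)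
  also have "... <= (\<integral>\<^sup>+t. \<integral>\<^sup>+x. indicator {0<..} t * ennreal (p * t powr (p - 1)) * g t x \<partial>lborel \<partial>lborel)"
  proof (rule nn_integral_mono)
    fix t :: real
    have "(\<integral>\<^sup>+\<xi>. indicator {0<..} t * ennreal (p * t powr (p - 1)) * indicator {t<..} (norm (f \<xi>)) \<partial>lborel)
      = indicator {0<..} t * ennreal (p * t powr (p - 1)) * (\<integral>\<^sup>+\<xi>. indicator {t<..} (norm (f \<xi>)) \<partial>lborel)"
      by (rule nn_integral_cmult) simp
    also have "... <= indicator {0<..} t * ennreal (p * t powr (p - 1)) * (\<integral>\<^sup>+x. g t x \<partial>lborel)"
      by (cases "0 < t") (auto intro!: mult_left_mono weak)
    also have "... = (\<integral>\<^sup>+x. indicator {0<..} t * ennreal (p * t powr (p - 1)) * g t x \<partial>lborel)"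
      by (rule nn_integral_cmult[symmetric]) measurable
    finally show "(\<integral>\<^sup>+\<xi>. indicator {0<..} t * ennreal (p * t powr (p - 1)) * indicator {t<..} (norm (f \<xi>)) \<partial>lborel)
      <= (\<integral>\<^sup>+x. indicator {0<..} t * ennreal (p * t powr (p - 1)) * g t x \<partial>lborel)" .
  qed
  also have "... = (\<integral>\<^sup>+x. \<integral>\<^sup>+t. indicator {0<..} t * ennreal (p * t powr (p - 1)) * g t x \<partial>lborel \<partial>lborel)"
    by (rule lborel_pair.Fubini') measurable
  finally show ?thesis .
qed

lemma norm_mult_indicator_le: "norm (c * indicator A x :: complex) <= norm c"
  by (auto simp: indicator_def)

text \<open>\<open>h \<mapsto> FT (1\<^sub>B h)\<close> is bounded on \<open>L\<^sub>2\<close> with norm 1 and on \<open>L\<^sub>\<infinity>\<close> with norm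
  \<open>A = ftc * |B|\<close>; the estimate below is the Marcinkiewicz interpolation between the two.\<close>

lemma lpE_FT_localised_gt2:
  fixes h :: "'n::finite cfun"
  assumes h: "integrable lborel h" and h0: "\<And>x. x \<notin> B ==> h x = 0"
    and B: "B \<in> sets borel" "emeasure lborel B = ennreal \<mu>" "0 < \<mu>" and p: "2 < p"
  shows "lpE p (FT h) <= ennreal (4 * p / (p - 2) * (2 * (ftc TYPE('n) * \<mu>)) powr (p - 2)) * lpE p h"
proof -
  have [measurable]: "h \<in> borel_measurable borel" "B \<in> sets borel" using h B by auto
  have [measurable]: "FT h \<in> borel_measurable borel" by (rule FT_measurable) simp
  define A where "A = ftc TYPE('n) * \<mu>"
  have A: "0 < A" unfolding A_def using B ftc_pos[where 'n = 'n] by simp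
  define g where "g t x = ennreal (4 * (norm (h x))\<^sup>2 / t\<^sup>2) * indicator {t<..} (2 * A * norm (h x))" for t x
  have g[measurable]: "case_prod g \<in> borel_measurable (lborel \<Otimes>\<^sub>M lborel)"
    unfolding g_def by (auto simp: indicator_def)
  have "lpE p (FT h) <= (\<integral>\<^sup>+x. \<integral>\<^sup>+t. indicator {0<..} t * ennreal (p * t powr (p - 1)) * g t x \<partial>lborel \<partial>lborel)"
  proof (rule lpE_layer_cake_le[OF _ _ g])
    fix t :: real assume t: "0 < t"
    \<comment> \<open>Where \<open>norm (h x)\<close> is at most t / (2 A), the contribution to the
      transform is at most t / 2 in total. Hence the transform of h exceeds t only where that of the
      large part \<open>hb\<close> exceeds t / 2, and Chebyshev with \<open>Plancherel_le\<close>
      measures that set.\<close>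
    define E where "E = {x. t < 2 * A * norm (h x)}"
    have [measurable]: "E \<in> sets borel" unfolding E_def by measurable
    define hb where "hb x = h x * indicator E x" for x
    define hs where "hs x = h x * indicator (- E) x" for x
    have ib: "integrable lborel hb" and iS: "integrable lborel hs"
      unfolding hb_def[abs_def] hs_def[abs_def]
      by (rule Bochner_Integration.integrable_bound[OF h]; auto simp: norm_mult_indicator_le)+
    have dec: "FT h \<xi> = FT hs \<xi> + FT hb \<xi>" for \<xi>
    proof -
      have "h = (%x. hs x + hb x)" by (auto simp: hs_def hb_def indicator_def)
      then show ?thesis using FT_add[OF iS ib, of \<xi>] by simp
    qed
    have small: "norm (FT hs \<xi>) <= t / 2" for \<xi>
    proof -
      have "(\<integral>x. norm (hs x) \<partial>lborel) <= (\<integral>x. t / (2 * A) * indicator B x \<partial>lborel)"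
      proof (rule integral_mono)
        show "integrable lborel (%x. norm (hs x))" using iS by simp
        show "integrable lborel (%x::real^'n. t / (2 * A) * indicator B x)"
          using B by (intro integrable_mult_right integrable_real_indicator) auto
        show "norm (hs x) <= t / (2 * A) * indicator B x" for x
        proof (cases "x \<in> B")
          case True
          show ?thesis
          proof (cases "x \<in> E")
            case False
            then have "2 * A * norm (h x) <= t" by (auto simp: E_def)
            then show ?thesis using True False A by (simp add: hs_def field_simps)
          qed (use t A True in \<open>auto simp: hs_def\<close>)
        qed (auto simp: hs_def h0)
      qed
      also have "... = t / (2 * A) * \<mu>" using B by (simp add: measure_def)
      finally have "ftc TYPE('n) * (\<integral>x. norm (hs x) \<partial>lborel) <= ftc TYPE('n) * (t / (2 * A) * \<mu>)"
        using ftc_pos[where 'n = 'n] by (intro mult_left_mono) auto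
      also have "... = t / 2" using A B(3) ftc_pos[where 'n = 'n] by (simp add: A_def field_simps)
      finally show ?thesis using norm_FT_le[OF iS, of \<xi>] by linarith
    qed
    have "(\<integral>\<^sup>+\<xi>. indicator {t<..} (norm (FT h \<xi>)) \<partial>lborel) <= (\<integral>\<^sup>+\<xi>. ennreal (4 / t\<^sup>2) * ennreal ((norm (FT hb \<xi>))\<^sup>2) \<partial>lborel)"
    proof (intro nn_integral_mono)
      fix \<xi>
      show "indicator {t<..} (norm (FT h \<xi>)) <= ennreal (4 / t\<^sup>2) * ennreal ((norm (FT hb \<xi>))\<^sup>2)"
      proof (cases "t < norm (FT h \<xi>)")
        case True
        have "norm (FT h \<xi>) <= t / 2 + norm (FT hb \<xi>)"
          using norm_triangle_ineq[of "FT hs \<xi>" "FT hb \<xi>"] small[of \<xi>] by (simp add: dec)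
        then have "t / 2 <= norm (FT hb \<xi>)" using True by simp
        then have "(t / 2)\<^sup>2 <= (norm (FT hb \<xi>))\<^sup>2" using t by (intro power_mono) auto
        then have "1 <= 4 / t\<^sup>2 * (norm (FT hb \<xi>))\<^sup>2" using t by (simp add: field_simps power2_eq_square)
        then show ?thesis using True by (simp add: indicator_def flip: ennreal_mult)
      qed (auto simp: indicator_def)
    qed
    also have "... = ennreal (4 / t\<^sup>2) * (\<integral>\<^sup>+\<xi>. ennreal ((norm (FT hb \<xi>))\<^sup>2) \<partial>lborel)"
    proof (rule nn_integral_cmult)
      have "hb \<in> borel_measurable borel" using ib by auto
      then have [measurable]: "FT hb \<in> borel_measurable borel" by (rule FT_measurable)
      show "(%\<xi>. ennreal ((norm (FT hb \<xi>))\<^sup>2)) \<in> borel_measurable lborel" by measurable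
    qed
    also have "... <= ennreal (4 / t\<^sup>2) * (\<integral>\<^sup>+x. ennreal ((norm (hb x))\<^sup>2) \<partial>lborel)"
      by (intro mult_left_mono Plancherel_le[OF ib]) auto
    also have "... = (\<integral>\<^sup>+x. ennreal (4 / t\<^sup>2) * ennreal ((norm (hb x))\<^sup>2) \<partial>lborel)"
      unfolding hb_def by (rule nn_integral_cmult[symmetric]) measurable
    also have "... = (\<integral>\<^sup>+x. g t x \<partial>lborel)"
      by (intro nn_integral_cong) (auto simp: g_def hb_def E_def indicator_def simp flip: ennreal_mult)
    finally show "(\<integral>\<^sup>+\<xi>. indicator {t<..} (norm (FT h \<xi>)) \<partial>lborel) <= (\<integral>\<^sup>+x. g t x \<partial>lborel)" .
  qed (use p in auto)
  also have "... <= (\<integral>\<^sup>+x. ennreal (4 * p / (p - 2) * (2 * A) powr (p - 2)) * ennreal (norm (h x) powr p) \<partial>lborel)"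
  proof (intro nn_integral_mono)
    fix x
    \<comment> \<open>For fixed x the level t runs only up to \<open>2 * A * norm (h x)\<close>, and
      the remaining power t^(p - 3) is integrable at 0 because p > 2.\<close>
    have "(\<integral>\<^sup>+t. indicator {0<..} t * ennreal (p * t powr (p - 1)) * g t x \<partial>lborel)
      <= (\<integral>\<^sup>+t. ennreal (4 * p * (norm (h x))\<^sup>2) * (indicator {0..2 * A * norm (h x)} t * ennreal (t powr (p - 2 - 1))) \<partial>lborel)"
    proof (intro nn_integral_mono)
      fix t :: real
      show "indicator {0<..} t * ennreal (p * t powr (p - 1)) * g t x
        <= ennreal (4 * p * (norm (h x))\<^sup>2) * (indicator {0..2 * A * norm (h x)} t * ennreal (t powr (p - 2 - 1)))"
      proof (cases "0 < t \<and> t < 2 * A * norm (h x)")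
        case True
        then have "p * t powr (p - 1) * (4 * (norm (h x))\<^sup>2 / t\<^sup>2) = 4 * p * (norm (h x))\<^sup>2 * t powr (p - 2 - 1)"
          using powr_diff[of t "p - 1" 2] by (simp add: powr_numeral)
        then show ?thesis using True p by (simp add: g_def indicator_def flip: ennreal_mult)
      qed (auto simp: g_def indicator_def)
    qed
    also have "... = ennreal (4 * p * (norm (h x))\<^sup>2) * (\<integral>\<^sup>+t. indicator {0..2 * A * norm (h x)} t * ennreal (t powr (p - 2 - 1)) \<partial>lborel)"
      by (rule nn_integral_cmult) measurable
    also have "... = ennreal (4 * p * (norm (h x))\<^sup>2) * ennreal ((2 * A * norm (h x)) powr (p - 2) / (p - 2))"
      using p A by (subst nn_integral_powr_below) auto
    also have "... = ennreal (4 * p / (p - 2) * (2 * A) powr (p - 2)) * ennreal (norm (h x) powr p)"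
    proof -
      have "(norm (h x))\<^sup>2 * norm (h x) powr (p - 2) = norm (h x) powr p"
      proof (cases "h x = 0")
        case False
        then show ?thesis using powr_add[of "norm (h x)" 2 "p - 2"] by (simp add: powr_numeral)
      qed simp
      then have "4 * p * (norm (h x))\<^sup>2 * ((2 * A * norm (h x)) powr (p - 2) / (p - 2)) = 4 * p / (p - 2) * (2 * A) powr (p - 2) * norm (h x) powr p"
        using A by (simp add: powr_mult mult_ac)
      then show ?thesis using p by (simp flip: ennreal_mult)
    qed
    finally show "(\<integral>\<^sup>+t. indicator {0<..} t * ennreal (p * t powr (p - 1)) * g t x \<partial>lborel)
      <= ennreal (4 * p / (p - 2) * (2 * A) powr (p - 2)) * ennreal (norm (h x) powr p)" .
  qed
  also have "... = ennreal (4 * p / (p - 2) * (2 * A) powr (p - 2)) * lpE p h"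
    unfolding lpE_def by (rule nn_integral_cmult) measurable
  finally show ?thesis by (simp add: A_def)
qed

text \<open>At p = 2 the interpolation constant p / (p - 2) blows up, but there the claim is
  \<open>Plancherel_le\<close> itself, with the power of \<mu> equal to 1.\<close>

lemma lpE_FT_localised_ge2:
  fixes p :: real
  assumes "2 <= p"
  obtains C where "0 < C" "\<And>h B \<mu>. integrable lborel h ==> (\<And>x. x \<notin> B ==> h x = 0) ==>
    B \<in> sets borel ==> emeasure lborel B = ennreal \<mu> ==> 0 < \<mu> ==>
    lpE p (FT h :: 'n::finite cfun) <= ennreal (C * \<mu> powr (p - 2)) * lpE p h"
proof (cases "p = 2")
  case True
  have "lpE 2 (FT h :: 'n cfun) <= lpE 2 h" if "integrable lborel h" for h
    using Plancherel_le[OF that] by (simp add: lpE_def powr_numeral)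
  then show ?thesis using True by (intro that[of 1]) auto
next
  case False
  let ?C = "4 * p / (p - 2) * (2 * ftc TYPE('n)) powr (p - 2)"
  have pos: "0 < ?C" using False assms ftc_pos[where 'n = 'n] by simp
  show ?thesis
  proof (rule that[OF pos])
    fix h :: "'n cfun" and B \<mu>
    assume "integrable lborel h" "\<And>x. x \<notin> B ==> h x = 0" "B \<in> sets borel" "emeasure lborel B = ennreal \<mu>" "0 < \<mu>"
    from lpE_FT_localised_gt2[OF this, of p] False assms ftc_pos[where 'n = 'n] \<open>0 < \<mu>\<close>
    show "lpE p (FT h) <= ennreal (?C * \<mu> powr (p - 2)) * lpE p h"
      by (simp add: powr_mult mult_ac)
  qed
qed

text \<open>The dual statement: \<open>h \<mapsto> 1\<^sub>B FT h\<close> has norm 1 on \<open>L\<^sub>2\<close> and norm \<open>A\<close> on \<open>L\<^sub>1\<close>.\<close>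

lemma lpE_localised_FT_lt2:
  fixes h :: "'n::finite cfun"
  assumes h: "integrable lborel h"
    and B: "B \<in> sets borel" "emeasure lborel B = ennreal \<mu>" "0 < \<mu>" and p: "1 < p" "p < 2"
  shows "lpE p (%\<xi>. FT h \<xi> * indicator B \<xi>)
    <= ennreal ((2 * p / (p - 1) + 4 * p / (2 - p)) * (ftc TYPE('n) * \<mu>) powr (2 - p)) * lpE p h"
proof -
  have [measurable]: "h \<in> borel_measurable borel" "B \<in> sets borel" using h B by auto
  have [measurable]: "FT h \<in> borel_measurable borel" by (rule FT_measurable) simp
  define A where "A = ftc TYPE('n) * \<mu>"
  have A: "0 < A" unfolding A_def using B ftc_pos[where 'n = 'n] by simp
  define g where "g t x = ennreal (2 * A * norm (h x) / t) * indicator {A * t<..} (norm (h x))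
    + ennreal (4 * (norm (h x))\<^sup>2 / t\<^sup>2) * indicator {..A * t} (norm (h x))" for t x
  have g[measurable]: "case_prod g \<in> borel_measurable (lborel \<Otimes>\<^sub>M lborel)"
    unfolding g_def by (auto simp: indicator_def)
  have "lpE p (%\<xi>. FT h \<xi> * indicator B \<xi>) <= (\<integral>\<^sup>+x. \<integral>\<^sup>+t. indicator {0<..} t * ennreal (p * t powr (p - 1)) * g t x \<partial>lborel \<partial>lborel)"
  proof (rule lpE_layer_cake_le[OF _ _ g])
    fix t :: real assume t: "0 < t"
    \<comment> \<open>The large part of h is now controlled in L_1 and the small part in L_2; the
      dividing level is A t.\<close>
    define E where "E = {x. A * t < norm (h x)}"
    have [measurable]: "E \<in> sets borel" unfolding E_def by measurable
    define hb where "hb x = h x * indicator E x" for x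
    define hs where "hs x = h x * indicator (- E) x" for x
    have ib: "integrable lborel hb" and iS: "integrable lborel hs"
      unfolding hb_def[abs_def] hs_def[abs_def]
      by (rule Bochner_Integration.integrable_bound[OF h]; auto simp: norm_mult_indicator_le)+
    have [measurable]: "hb \<in> borel_measurable borel" "hs \<in> borel_measurable borel" using ib iS by auto
    have [measurable]: "FT hb \<in> borel_measurable borel" "FT hs \<in> borel_measurable borel" by (rule FT_measurable, simp)+
    have dec: "FT h \<xi> = FT hs \<xi> + FT hb \<xi>" for \<xi>
    proof -
      have "h = (%x. hs x + hb x)" by (auto simp: hs_def hb_def indicator_def)
      then show ?thesis using FT_add[OF iS ib, of \<xi>] by simp
    qed
    define L where "L = ftc TYPE('n) * (\<integral>x. norm (hb x) \<partial>lborel)"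
    have L: "0 <= L" unfolding L_def using ftc_pos[where 'n = 'n] by (intro mult_nonneg_nonneg integral_nonneg_AE) auto
    have Lb: "norm (FT hb \<xi>) <= L" for \<xi> unfolding L_def by (rule norm_FT_le[OF ib])
    \<comment> \<open>Where the transform exceeds t, one of the two parts exceeds t / 2. The
      transform of \<open>hb\<close> is bounded by the constant L and is estimated by Chebyshev with
      exponent 1 on B, that of \<open>hs\<close> with exponent 2 on the whole space.\<close>
    have "(\<integral>\<^sup>+\<xi>. indicator {t<..} (norm (FT h \<xi> * indicator B \<xi>)) \<partial>lborel)
      <= (\<integral>\<^sup>+\<xi>. ennreal (2 / t * L) * indicator B \<xi> + ennreal (4 / t\<^sup>2) * ennreal ((norm (FT hs \<xi>))\<^sup>2) \<partial>lborel)"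
    proof (intro nn_integral_mono)
      fix \<xi>
      show "indicator {t<..} (norm (FT h \<xi> * indicator B \<xi>)) <= ennreal (2 / t * L) * indicator B \<xi> + ennreal (4 / t\<^sup>2) * ennreal ((norm (FT hs \<xi>))\<^sup>2)"
      proof (cases "\<xi> \<in> B \<and> t < norm (FT h \<xi>)")
        case True
        have n: "norm (FT h \<xi>) <= norm (FT hs \<xi>) + L"
          using norm_triangle_ineq[of "FT hs \<xi>" "FT hb \<xi>"] Lb[of \<xi>] by (simp add: dec)
        have "1 <= 2 / t * L + 4 / t\<^sup>2 * (norm (FT hs \<xi>))\<^sup>2"
        proof (cases "t / 2 <= L")
          case True
          then have "1 <= 2 / t * L" using t by (simp add: field_simps)
          then show ?thesis by (auto intro: add_increasing2)
        next
          case False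
          then have "t / 2 <= norm (FT hs \<xi>)" using n True by simp
          then have "(t / 2)\<^sup>2 <= (norm (FT hs \<xi>))\<^sup>2" using t by (intro power_mono) auto
          then have "1 <= 4 / t\<^sup>2 * (norm (FT hs \<xi>))\<^sup>2" using t by (simp add: field_simps power2_eq_square)
          then show ?thesis using L t by (auto intro: add_increasing)
        qed
        then have "ennreal 1 <= ennreal (2 / t * L + 4 / t\<^sup>2 * (norm (FT hs \<xi>))\<^sup>2)" by (rule ennreal_leI)
        also have "... = ennreal (2 / t * L) + ennreal (4 / t\<^sup>2 * (norm (FT hs \<xi>))\<^sup>2)"
          using L t by (intro ennreal_plus) auto
        also have "ennreal (4 / t\<^sup>2 * (norm (FT hs \<xi>))\<^sup>2) = ennreal (4 / t\<^sup>2) * ennreal ((norm (FT hs \<xi>))\<^sup>2)"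
          by (rule ennreal_mult) auto
        finally show ?thesis using True by (simp add: indicator_def)
      qed (use t in \<open>auto simp: indicator_def\<close>)
    qed
    also have "... = ennreal (2 / t * L) * emeasure lborel B + ennreal (4 / t\<^sup>2) * (\<integral>\<^sup>+\<xi>. ennreal ((norm (FT hs \<xi>))\<^sup>2) \<partial>lborel)"
      by (simp add: nn_integral_add nn_integral_cmult nn_integral_cmult_indicator)
    also have "... <= ennreal (2 / t * L) * emeasure lborel B + ennreal (4 / t\<^sup>2) * (\<integral>\<^sup>+x. ennreal ((norm (hs x))\<^sup>2) \<partial>lborel)"
      by (intro add_left_mono mult_left_mono Plancherel_le[OF iS]) auto
    also have "ennreal (2 / t * L) * emeasure lborel B = ennreal (2 * A / t) * ennreal (\<integral>x. norm (hb x) \<partial>lborel)"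
      using B L t A by (simp add: L_def A_def mult_ac integral_nonneg_AE flip: ennreal_mult)
    also have "ennreal (\<integral>x. norm (hb x) \<partial>lborel) = (\<integral>\<^sup>+x. ennreal (norm (hb x)) \<partial>lborel)"
      using ib by (intro nn_integral_eq_integral[symmetric]) auto
    also have "ennreal (2 * A / t) * (\<integral>\<^sup>+x. ennreal (norm (hb x)) \<partial>lborel) + ennreal (4 / t\<^sup>2) * (\<integral>\<^sup>+x. ennreal ((norm (hs x))\<^sup>2) \<partial>lborel)
      = (\<integral>\<^sup>+x. ennreal (2 * A / t) * ennreal (norm (hb x)) + ennreal (4 / t\<^sup>2) * ennreal ((norm (hs x))\<^sup>2) \<partial>lborel)"
      by (simp add: nn_integral_add nn_integral_cmult)
    also have "... = (\<integral>\<^sup>+x. g t x \<partial>lborel)"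
      using t A by (intro nn_integral_cong) (auto simp: g_def hb_def hs_def E_def indicator_def simp flip: ennreal_mult)
    finally show "(\<integral>\<^sup>+\<xi>. indicator {t<..} (norm (FT h \<xi> * indicator B \<xi>)) \<partial>lborel) <= (\<integral>\<^sup>+x. g t x \<partial>lborel)" .
  qed (use p in auto)
  also have "... <= (\<integral>\<^sup>+x. ennreal ((2 * p / (p - 1) + 4 * p / (2 - p)) * A powr (2 - p)) * ennreal (norm (h x) powr p) \<partial>lborel)"
  proof (intro nn_integral_mono)
    fix x
    show "(\<integral>\<^sup>+t. indicator {0<..} t * ennreal (p * t powr (p - 1)) * g t x \<partial>lborel)
      <= ennreal ((2 * p / (p - 1) + 4 * p / (2 - p)) * A powr (2 - p)) * ennreal (norm (h x) powr p)"
    proof (cases "h x = 0")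
      case True
      then have "g t x = 0" for t by (simp add: g_def)
      then show ?thesis by simp
    next
      case False
      define a where "a = norm (h x)"
      have a: "0 < a" using False by (simp add: a_def)
      \<comment> \<open>The two regimes meet at t = a / A. Below it the power t^(p - 2) is
        integrable at 0 since p > 1, above it t^(p - 3) is integrable at infinity since p <
        2.\<close>
      have "(\<integral>\<^sup>+t. indicator {0<..} t * ennreal (p * t powr (p - 1)) * g t x \<partial>lborel)
        <= (\<integral>\<^sup>+t. ennreal (2 * p * A * a) * (indicator {0..a / A} t * ennreal (t powr (p - 1 - 1)))
           + ennreal (4 * p * a\<^sup>2) * (indicator {a / A..} t * ennreal (t powr (- (2 - p) - 1))) \<partial>lborel)"
      proof (intro nn_integral_mono)
        fix t :: real
        show "indicator {0<..} t * ennreal (p * t powr (p - 1)) * g t x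
          <= ennreal (2 * p * A * a) * (indicator {0..a / A} t * ennreal (t powr (p - 1 - 1)))
           + ennreal (4 * p * a\<^sup>2) * (indicator {a / A..} t * ennreal (t powr (- (2 - p) - 1)))"
        proof (cases "0 < t")
          case t: True
          have e1: "p * t powr (p - 1) * (2 * A * a / t) = 2 * p * A * a * t powr (p - 1 - 1)"
            using t powr_diff[of t "p - 1" 1] by simp
          have e2: "p * t powr (p - 1) * (4 * a\<^sup>2 / t\<^sup>2) = 4 * p * a\<^sup>2 * t powr (- (2 - p) - 1)"
            using t powr_diff[of t "p - 1" 2] by (simp add: powr_numeral algebra_simps)
          have "t < a / A \<longleftrightarrow> A * t < a" using A by (simp add: field_simps)
          then show ?thesis
            using t p A a e1 e2 unfolding g_def a_def[symmetric]
            by (cases "A * t < a") (auto simp: indicator_def mult_ac simp flip: ennreal_mult)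
        qed (auto simp: indicator_def)
      qed
      also have "... = ennreal (2 * p * A * a) * (\<integral>\<^sup>+t. indicator {0..a / A} t * ennreal (t powr (p - 1 - 1)) \<partial>lborel)
          + ennreal (4 * p * a\<^sup>2) * (\<integral>\<^sup>+t. indicator {a / A..} t * ennreal (t powr (- (2 - p) - 1)) \<partial>lborel)"
        by (simp add: nn_integral_add nn_integral_cmult)
      also have "... = ennreal (2 * p * A * a) * ennreal ((a / A) powr (p - 1) / (p - 1)) + ennreal (4 * p * a\<^sup>2) * ennreal ((a / A) powr (- (2 - p)) / (2 - p))"
        using p A a by (subst nn_integral_powr_below, simp, simp, subst nn_integral_powr_above) auto
      also have "... = ennreal (2 * p * A * a * ((a / A) powr (p - 1) / (p - 1)) + 4 * p * a\<^sup>2 * ((a / A) powr (- (2 - p)) / (2 - p)))"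
        using p A a by (simp flip: ennreal_mult ennreal_plus)
      also have "2 * p * A * a * ((a / A) powr (p - 1) / (p - 1)) + 4 * p * a\<^sup>2 * ((a / A) powr (- (2 - p)) / (2 - p))
        = (2 * p / (p - 1) + 4 * p / (2 - p)) * A powr (2 - p) * a powr p"
      proof -
        have "A * a * (a / A) powr (p - 1) = A powr (2 - p) * a powr p"
          using A a powr_add[of a 1 "p - 1"] powr_diff[of A 1 "p - 1"] by (simp add: powr_divide)
        moreover have "a\<^sup>2 * (a / A) powr (- (2 - p)) = A powr (2 - p) * a powr p"
          using A a powr_add[of a 2 "- (2 - p)"] powr_minus[of A "2 - p"] by (simp add: powr_divide powr_numeral field_simps)
        ultimately have "2 * p * A * a * ((a / A) powr (p - 1) / (p - 1)) + 4 * p * a\<^sup>2 * ((a / A) powr (- (2 - p)) / (2 - p))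
          = 2 * p / (p - 1) * (A powr (2 - p) * a powr p) + 4 * p / (2 - p) * (A powr (2 - p) * a powr p)"
          by (simp add: mult.assoc times_divide_eq_left)
        then show ?thesis by (simp only: distrib_right mult.assoc)
      qed
      finally show ?thesis using p by (simp add: a_def ennreal_mult)
    qed
  qed
  also have "... = ennreal ((2 * p / (p - 1) + 4 * p / (2 - p)) * A powr (2 - p)) * lpE p h"
    unfolding lpE_def by (rule nn_integral_cmult) measurable
  finally show ?thesis by (simp add: A_def)
qed

section \<open>The dyadic resolution\<close>

lemma pds_const: "pds is (%x::real^'n::finite. c) = (if is = [] then (%x. c) else (%x. 0))"
  by (induction "is") auto

lemma pds_zero_on_open:
  fixes f :: "'n::finite cfun"
  assumes "open U" "\<And>x. x \<in> U ==> f x = 0" "x \<in> U"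
  shows "pds is f x = 0"
  using assms(3)
proof (induction "is" arbitrary: x)
  case (Cons i "is")
  have "(pds is f has_derivative (%h. 0)) (at x)"
    by (rule has_derivative_transform_within_open[OF has_derivative_const[of 0] assms(1) Cons.prems])
      (use Cons.IH in auto)
  from partial_eq[OF this, of i] show ?case by simp
qed (use assms in auto)

lemma ennreal_le_suminf: "f j <= (\<Sum>j. f j)" for f :: "nat => ennreal"
  using sum_le_suminf[OF summableI, of "{j}" f] by simp

lemma suminf_powr2:
  assumes "r < 0"
  obtains C where "0 < C" "(\<Sum>j. ennreal (2 powr (real j * r))) = ennreal C" "summable (%j. 2 powr (real j * r))"
    "(\<Sum>j. 2 powr (real j * r)) = C"
proof -
  have eq: "2 powr (real j * r) = (2 powr r) ^ j" for j
    by (simp add: powr_realpow[symmetric] powr_powr mult.commute)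
  have "2 powr r < 1" using assms powr_less_mono[of r 0 2] by simp
  then have s: "summable (%j. 2 powr (real j * r))" unfolding eq by (intro summable_geometric) auto
  have "0 < (\<Sum>j. 2 powr (real j * r))" by (intro suminf_pos s) auto
  from this suminf_ennreal2[OF powr_ge_zero s] s refl show ?thesis by (rule that)
qed

text \<open>A series weighted by \<open>2 powr (j * r)\<close> is dominated by the supremum of its weighted terms,
  which makes Hoelder's inequality for sums unnecessary.\<close>

lemma lp_series:
  fixes a :: "nat => 'n::finite cfun"
  assumes [measurable]: "\<And>j. a j \<in> borel_measurable borel" and r: "0 < r" and p: "0 < p"
    and W: "summable (%j. 2 powr (real j * - r))" "(\<Sum>j. 2 powr (real j * - r)) = W"
    and fin: "(\<Sum>j. ennreal (2 powr (real j * r * p)) * lpE p (a j)) < \<infinity>"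
  shows "AE x in lborel. summable (%j. norm (a j x))"
    and "(\<integral>\<^sup>+x. ennreal ((\<Sum>j. norm (a j x)) powr p) \<partial>lborel) <= ennreal (W powr p) * (\<Sum>j. ennreal (2 powr (real j * r * p)) * lpE p (a j))"
proof -
  define H where "H x = (\<Sum>j. ennreal (2 powr (real j * r * p) * norm (a j x) powr p))" for x
  have [measurable]: "H \<in> borel_measurable borel" unfolding H_def[abs_def] by measurable
  have intH: "(\<integral>\<^sup>+x. H x \<partial>lborel) = (\<Sum>j. ennreal (2 powr (real j * r * p)) * lpE p (a j))"
    unfolding H_def lpE_def by (subst nn_integral_suminf) (auto simp: ennreal_mult nn_integral_cmult)
  have AEH: "AE x in lborel. H x ~= \<infinity>" using fin intH by (intro nn_integral_PInf_AE) auto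
  have W0: "0 <= W" unfolding W(2)[symmetric] by (intro suminf_nonneg W(1)) auto
  have key: "summable (%j. norm (a j x)) \<and> ennreal ((\<Sum>j. norm (a j x)) powr p) <= ennreal (W powr p) * H x" if Hx: "H x ~= \<infinity>" for x
  proof -
    obtain q where q: "0 <= q" "H x = ennreal q" using Hx by (cases "H x") auto
    have b: "norm (a j x) <= 2 powr (real j * - r) * q powr (1 / p)" for j
    proof -
      have "ennreal (2 powr (real j * r * p) * norm (a j x) powr p) <= H x"
        unfolding H_def by (rule ennreal_le_suminf)
      then have "2 powr (real j * r * p) * norm (a j x) powr p <= q" using q by (simp add: ennreal_le_iff)
      then have "(2 powr (real j * r) * norm (a j x)) powr p <= q" by (simp add: powr_mult powr_powr)
      then have "((2 powr (real j * r) * norm (a j x)) powr p) powr (1 / p) <= q powr (1 / p)"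
        using p by (intro powr_mono2) auto
      then have "2 powr (real j * r) * norm (a j x) <= q powr (1 / p)" using p by (simp add: powr_powr)
      then have "2 powr (real j * - r) * (2 powr (real j * r) * norm (a j x)) <= 2 powr (real j * - r) * q powr (1 / p)"
        by (intro mult_left_mono) auto
      moreover have "2 powr (real j * - r) * (2 powr (real j * r) * norm (a j x)) = norm (a j x)"
        unfolding mult.assoc[symmetric] powr_add[symmetric] by simp
      ultimately show ?thesis by (simp only:)
    qed
    have s2: "summable (%j. 2 powr (real j * - r) * q powr (1 / p))" using W(1) by (rule summable_mult2)
    have s: "summable (%j. norm (a j x))" by (rule summable_comparison_test'[OF s2]) (use b in auto)
    have "(\<Sum>j. norm (a j x)) <= (\<Sum>j. 2 powr (real j * - r) * q powr (1 / p))" by (rule suminf_le[OF b s s2])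
    also have "... = W * q powr (1 / p)" using suminf_mult2[OF W(1), of "q powr (1 / p)"] W(2) by simp
    finally have "(\<Sum>j. norm (a j x)) powr p <= (W * q powr (1 / p)) powr p"
      using p s by (intro powr_mono2 suminf_nonneg) auto
    also have "... = W powr p * q" using W0 q p by (simp add: powr_mult powr_powr)
    finally show ?thesis using s q W0 by (auto simp: ennreal_leI simp flip: ennreal_mult)
  qed
  show "AE x in lborel. summable (%j. norm (a j x))" using AEH by eventually_elim (use key in auto)
  have "(\<integral>\<^sup>+x. ennreal ((\<Sum>j. norm (a j x)) powr p) \<partial>lborel) <= (\<integral>\<^sup>+x. ennreal (W powr p) * H x \<partial>lborel)"
    using AEH by (intro nn_integral_mono_AE) (auto elim!: eventually_mono simp: key)
  also have "... = ennreal (W powr p) * (\<Sum>j. ennreal (2 powr (real j * r * p)) * lpE p (a j))"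
    by (simp add: nn_integral_cmult intH)
  finally show "(\<integral>\<^sup>+x. ennreal ((\<Sum>j. norm (a j x)) powr p) \<partial>lborel) <= ennreal (W powr p) * (\<Sum>j. ennreal (2 powr (real j * r * p)) * lpE p (a j))" .
qed

section \<open>Littlewood-Paley pieces: supports, uniform bounds and comparison with L_p\<close>

context cutoff

begin

lemma phij_schwartz: "phi j \<in> schwartz"
proof (cases "j = 0")
  case True
  then have "phi j = \<phi>0" by (auto simp: phij_def)
  then show ?thesis using phi0_schwartz by simp
next
  case False
  have "(%x. \<phi>0 ((1 / 2 ^ j) *\<^sub>R x) - \<phi>0 ((2 / 2 ^ j) *\<^sub>R x)) \<in> schwartz"
    by (intro schwartz_diff schwartz_scale phi0_schwartz) auto
  then show ?thesis using False by (simp add: phij_def[abs_def])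
qed

lemma phij_sum: "(\<Sum>j\<le>J. phi j x) = \<phi>0 ((1 / 2 ^ J) *\<^sub>R x)"
  by (induction J) (auto simp: phij_def)

lemma phij_0_outside:
  assumes "2 * 2 ^ j < norm x"
  shows "phi j x = 0"
proof -
  have "3 * 2 ^ j <= norm x * 2" "3 * 2 ^ j <= 4 * norm x"
    using assms zero_less_power[of "2::real" j] by linarith+
  then show ?thesis
    using assms phi0_0[of x] phi0_0[of "(1 / 2 ^ j) *\<^sub>R x"] phi0_0[of "(2 / 2 ^ j) *\<^sub>R x"]
    by (auto simp: phij_def pos_le_divide_eq)
qed

lemma phij_0_inside: "0 < j ==> norm x <= 2 ^ j / 2 ==> phi j x = 0"
  using phi0_1[of "(1 / 2 ^ j) *\<^sub>R x"] phi0_1[of "(2 / 2 ^ j) *\<^sub>R x"] norm_ge_zero[of x]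
  by (auto simp: phij_def pos_divide_le_eq)

lemma phi0_bounded:
  obtains P where "1 <= P" "\<And>x. norm (\<phi>0 x) <= P"
proof -
  obtain P where P: "\<And>x is. length is <= 0 ==> norm (pds is \<phi>0 x) <= P" using schwartz_bounded[OF phi0_schwartz, of 0] by metis
  show ?thesis by (rule that[of "max 1 P"]) (use P[of "[]"] in \<open>auto simp: le_max_iff_disj\<close>)
qed

lemma phij_bounded:
  obtains P where "1 <= P" "\<And>j x. norm (phi j x) <= P"
proof -
  obtain P where P: "1 <= P" "\<And>x. norm (\<phi>0 x) <= P" using phi0_bounded by blast
  have "norm (phi j x) <= 2 * P" for j x
  proof (cases "j = 0")
    case True
    then show ?thesis using P(1) P(2)[of x] by (simp add: phij_def)
  next
    case False
    have "norm (phi j x) <= norm (\<phi>0 ((1 / 2 ^ j) *\<^sub>R x)) + norm (\<phi>0 ((2 / 2 ^ j) *\<^sub>R x))"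
      using False by (simp add: phij_def norm_triangle_ineq4)
    also have "... <= P + P" by (intro add_mono P)
    finally show ?thesis by simp
  qed
  then show ?thesis using that[of "2 * P"] P by auto
qed

text \<open>For j > 0 the function \<open>phi j\<close> is a difference of two dilates of \<phi>0,
  and by \<open>integral_norm_FT_scale\<close> each contributes the same L_1 norm as \<phi>0
  itself.\<close>

lemma FT_phij_L1:
  obtains \<kappa> where "0 < \<kappa>" "\<And>j. (\<integral>x. norm (FT (phi j) x) \<partial>lborel) <= \<kappa>"
proof -
  define I where "I = (\<integral>x. norm (FT \<phi>0 x) \<partial>lborel)"
  have I: "0 <= I" unfolding I_def by (intro integral_nonneg_AE) auto
  have "(\<integral>x. norm (FT (phi j) x) \<partial>lborel) <= 2 * I + 1" for j
  proof (cases "j = 0")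
    case True
    then have "phi j = \<phi>0" by (auto simp: phij_def)
    then show ?thesis using I by (simp add: I_def)
  next
    case False
    let ?a = "%x. \<phi>0 ((1 / 2 ^ j) *\<^sub>R x)" and ?b = "%x. \<phi>0 ((2 / 2 ^ j) *\<^sub>R x)"
    have S: "?a \<in> schwartz" "?b \<in> schwartz" by (intro schwartz_scale phi0_schwartz; simp)+
    have ph: "phi j = (%x. ?a x - ?b x)" using False by (auto simp: phij_def)
    have "FT (phi j) x = FT ?a x - FT ?b x" for x
      unfolding ph by (intro FT_diff schwartz_integrable S)
    then have "(\<integral>x. norm (FT (phi j) x) \<partial>lborel) <= (\<integral>x. norm (FT ?a x) + norm (FT ?b x) \<partial>lborel)"
      using schwartz_integrable[OF FT_schwartz[OF S(1)]] schwartz_integrable[OF FT_schwartz[OF S(2)]]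
      by (intro integral_mono) (auto simp: norm_triangle_ineq4)
    also have "... = I + I"
      using schwartz_integrable[OF FT_schwartz[OF S(1)]] schwartz_integrable[OF FT_schwartz[OF S(2)]]
      by (simp add: integral_norm_FT_scale[OF phi0_schwartz] I_def)
    finally show ?thesis by simp
  qed
  then show ?thesis using that[of "2 * I + 1"] I by auto
qed

text \<open>The cutoff differs from 1 only beyond radius 2^J, where one spare power of decay of
  \<psi> is worth the factor 2^-J; hence \<open>Suc k\<close> below. The derivatives of the cutoffs
  are bounded uniformly in J, because dilation by 2^-J only shrinks them.\<close>

lemma partition_limit:
  assumes T: "tempered T" and \<psi>: "\<psi> \<in> schwartz"
  shows "(%J. T (%x. \<phi>0 ((1 / 2 ^ J) *\<^sub>R x) * \<psi> x)) \<longlonglongrightarrow> T \<psi>"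
proof -
  obtain C k m where C: "\<forall>\<phi>\<in>schwartz. \<forall>B. sbound k m \<phi> B \<longrightarrow> norm (T \<phi>) <= C * B"
    using T unfolding tempered_iff by blast
  obtain P where P: "0 < P" "\<And>x is. length is <= m ==> norm (pds is \<phi>0 x) <= P" using schwartz_bounded[OF phi0_schwartz, of m] by metis
  obtain B where B: "sbound (Suc k) m \<psi> B" "B > 0" using schwartz_sbound[OF \<psi>] by metis
  define D where "D = 2 ^ m * (1 + P) * B"
  have bound: "norm (T (%x. \<phi>0 ((1 / 2 ^ J) *\<^sub>R x) * \<psi> x) - T \<psi>) <= C * D * (1 / 2) ^ J" for J :: nat
  proof -
    define \<zeta> where "\<zeta> x = \<phi>0 ((1 / 2 ^ J) *\<^sub>R x) - 1" for x
    define \<theta> where "\<theta> x = \<zeta> x * \<psi> x" for x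
    have sm0: "smooth (%x. \<phi>0 ((1 / 2 ^ J) *\<^sub>R x))" using smooth_affine[OF schwartz_smooth[OF phi0_schwartz], of "1 / 2 ^ J" 0] by simp
    have S0: "(%x. \<phi>0 ((1 / 2 ^ J) *\<^sub>R x) * \<psi> x) \<in> schwartz" by (intro schwartz_mult schwartz_scale phi0_schwartz \<psi>) auto
    have \<theta>eq: "\<theta> = (%x. \<phi>0 ((1 / 2 ^ J) *\<^sub>R x) * \<psi> x - \<psi> x)" by (auto simp: \<theta>_def \<zeta>_def algebra_simps)
    have S\<theta>: "\<theta> \<in> schwartz" unfolding \<theta>eq by (intro schwartz_diff S0 \<psi>)
    have sm\<zeta>: "smooth \<zeta>" unfolding \<zeta>_def[abs_def] using smooth_add[OF sm0 smooth_const, of "-1"] by simp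
    have p\<zeta>: "norm (pds is \<zeta> x) <= 1 + P" if "length is <= m" for "is" x
    proof -
      have "pds is \<zeta> = (%x. pds is (%x. \<phi>0 ((1 / 2 ^ J) *\<^sub>R x)) x + pds is (%x. -1) x)"
        unfolding \<zeta>_def[abs_def] using pds_add[OF sm0 smooth_const, of "is" "-1"] by simp
      also have "pds is (%x. \<phi>0 ((1 / 2 ^ J) *\<^sub>R x)) = (%x. of_real ((1 / 2 ^ J) ^ length is) * pds is \<phi>0 ((1 / 2 ^ J) *\<^sub>R x))"
        using pds_affine[OF schwartz_smooth[OF phi0_schwartz], of "is" "1 / 2 ^ J" 0] by simp
      finally have "norm (pds is \<zeta> x) <= norm (of_real ((1 / 2 ^ J) ^ length is) * pds is \<phi>0 ((1 / 2 ^ J) *\<^sub>R x)) + norm (pds is (%x::real^'n. -1 :: complex) x)"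
        by (simp add: norm_triangle_ineq)
      also have "norm (pds is (%x::real^'n. -1 :: complex) x) <= 1" by (simp add: pds_const)
      also have "norm (of_real ((1 / 2 ^ J) ^ length is) * pds is \<phi>0 ((1 / 2 ^ J) *\<^sub>R x)) <= 1 * P"
        unfolding norm_mult
      proof (intro mult_mono P that)
        have "(1 / 2 ^ J :: real) ^ length is <= 1" by (intro power_le_one) (auto simp: divide_le_eq_1)
        then show "norm (of_real ((1 / 2 ^ J) ^ length is) :: complex) <= 1" by (simp only: norm_of_real) simp
      qed auto
      finally show ?thesis by simp
    qed
    have sb: "sbound (Suc k) m \<theta> D"
      unfolding \<theta>_def[abs_def] D_def
      by (rule sbound_mult[OF schwartz_smooth[OF \<psi>] sm\<zeta> B(1), where l = 0]) (use p\<zeta> P in auto)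
    have z: "pds is \<theta> x = 0" if "norm x < 2 ^ J" for "is" x
    proof (rule pds_zero_on_open[of "ball 0 (2 ^ J)"])
      fix y :: "real^'n" assume "y \<in> ball 0 (2 ^ J)"
      then have "norm ((1 / 2 ^ J) *\<^sub>R y) <= 1" by (simp add: divide_le_eq)
      then show "\<theta> y = 0" by (simp add: \<theta>_def \<zeta>_def phi0_1)
    qed (use that in auto)
    have "sbound k m \<theta> (D * (1 / 2) ^ J)"
      unfolding sbound_def
    proof (intro allI impI)
      fix x and "is" :: "'n list" assume len: "length is <= m"
      have D0: "0 <= D" using sbound_nonneg[OF sb] .
      show "(1 + norm x) ^ k * norm (pds is \<theta> x) <= D * (1 / 2) ^ J"
      proof (cases "norm x < 2 ^ J")
        case True
        then show ?thesis using z D0 by simp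
      next
        case False
        have "2 ^ J * ((1 + norm x) ^ k * norm (pds is \<theta> x)) <= (1 + norm x) * ((1 + norm x) ^ k * norm (pds is \<theta> x))"
          using False by (intro mult_right_mono) auto
        also have "... <= D" using sboundD[OF sb len, of x] by (simp add: mult.assoc)
        finally show ?thesis by (simp add: power_one_over field_simps)
      qed
    qed
    then have "norm (T \<theta>) <= C * (D * (1 / 2) ^ J)" using C S\<theta> by blast
    then show ?thesis using tempered_diff_arg[OF T S0 \<psi>] by (simp add: \<theta>eq mult.assoc)
  qed
  have "(%J. C * D * (1 / 2) ^ J) \<longlonglongrightarrow> 0" by (intro tendsto_mult_right_zero LIMSEQ_power_zero) auto
  then have "(%J. T (%x. \<phi>0 ((1 / 2 ^ J) *\<^sub>R x) * \<psi> x) - T \<psi>) \<longlonglongrightarrow> 0"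
    by (rule Lim_null_comparison[OF always_eventually[OF allI[OF bound]]])
  then show ?thesis by (rule LIM_zero_cancel)
qed

lemma FTd_partition:
  assumes T: "tempered T" and \<psi>: "\<psi> \<in> schwartz"
  shows "(%J. \<Sum>j\<le>J. FTd T (%x. phi j x * \<psi> x)) \<longlonglongrightarrow> FTd T \<psi>"
proof -
  have "(\<Sum>j\<le>J. FTd T (%x. phi j x * \<psi> x)) = FTd T (%x. \<phi>0 ((1 / 2 ^ J) *\<^sub>R x) * \<psi> x)" for J
  proof -
    have "FTd T (%x. \<Sum>j\<le>J. phi j x * \<psi> x) = (\<Sum>j\<le>J. FTd T (%x. phi j x * \<psi> x))"
      using tempered_sum[OF tempered_FTd[OF T], of "{..J}" "%j x. phi j x * \<psi> x"]
        schwartz_mult[OF phij_schwartz \<psi>] by auto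
    then show ?thesis by (simp add: phij_sum flip: sum_distrib_right)
  qed
  then show ?thesis using partition_limit[OF tempered_FTd[OF T] \<psi>] by simp
qed

lemma piece_apply:
  assumes "\<psi> \<in> schwartz"
  shows "piece j T \<psi> = FTd T (%x. phi j x * IFT \<psi> x)"
  using multiplier_apply[OF phij_schwartz assms, of j T] assms
  by (simp add: besov_piece_def FTd_def schwartz_mult phij_schwartz IFT_schwartz)

lemma piece_partition:
  assumes T: "tempered T" and \<psi>: "\<psi> \<in> schwartz"
  shows "(%J. \<Sum>j\<le>J. piece j T \<psi>) \<longlonglongrightarrow> T \<psi>"
proof -
  have "FTd T (IFT \<psi>) = T \<psi>" using \<psi> by (simp add: FTd_def IFT_schwartz FT_IFT)
  then show ?thesis using FTd_partition[OF T IFT_schwartz[OF \<psi>]] \<psi> by (simp add: piece_apply)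
qed

lemma piece_represents:
  assumes "Lp_fun p g" "represents g T" "1 <= p"
  shows "represents (conv (FT (phi j)) g) (piece j T)"
  unfolding besov_piece_def by (rule represents_multiplier[OF phij_schwartz assms])

lemma conv_phij_le:
  assumes p: "1 <= p"
  obtains C where "0 < C" "\<And>j g. g \<in> borel_measurable borel ==> lpE p (conv (FT (phi j)) g) <= ennreal C * lpE p g"
proof -
  obtain \<kappa> where \<kappa>: "0 < \<kappa>" "\<And>j. (\<integral>x. norm (FT (phi j) x) \<partial>lborel) <= \<kappa>" using FT_phij_L1 by blast
  let ?C = "(2 * ftc TYPE('n) * \<kappa>) powr p"
  have "lpE p (conv (FT (phi j)) g) <= ennreal ?C * lpE p g" if "g \<in> borel_measurable borel" for j g
  proof -
    have "lpE p (conv (FT (phi j)) g) <= ennreal ((2 * ftc TYPE('n) * (\<integral>x. norm (FT (phi j) x) \<partial>lborel)) powr p) * lpE p g"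
      by (rule lpE_conv_le[OF schwartz_integrable[OF FT_schwartz[OF phij_schwartz]] that p])
    also have "... <= ennreal ?C * lpE p g"
      using \<kappa> ftc_pos[where 'n = 'n] p
      by (intro mult_right_mono ennreal_leI powr_mono2 mult_left_mono) (auto intro!: mult_nonneg_nonneg integral_nonneg_AE)
    finally show ?thesis .
  qed
  then show ?thesis using that[of ?C] \<kappa> ftc_pos[where 'n = 'n] by simp
qed

text \<open>All pieces are bounded by the same multiple of \<open>dE p T\<close>, and for s < 0 the
  weights form a convergent geometric series.\<close>

lemma Besov_le_Lp:
  assumes p: "1 <= p" and s: "s < 0"
  obtains C where "0 < C" "\<And>T. dE p T < \<infinity> ==> BE s p T <= ennreal C * dE p T"
proof -
  obtain C where C: "0 < C" "\<And>j g. g \<in> borel_measurable borel ==> lpE p (conv (FT (phi j)) g) <= ennreal C * lpE p g"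
    using conv_phij_le[OF p] by blast
  have "s * p < 0" using s p by (simp add: mult_neg_pos)
  then obtain G where G: "0 < G" "(\<Sum>j. ennreal (2 powr (real j * (s * p)))) = ennreal G" using suminf_powr2 by metis
  show ?thesis
  proof (rule that[of "G * C"])
    show "0 < G * C" using G C by simp
    fix T :: "'n distr" assume "dE p T < \<infinity>"
    then obtain g where g: "Lp_fun p g" "represents g T" "lpE p g = dE p T" using dE_finite p by blast
    have gm: "g \<in> borel_measurable borel" using g by (simp add: Lp_fun_iff)
    have "dE p (piece j T) <= ennreal C * dE p T" for j
    proof -
      have "dE p (piece j T) <= lpE p (conv (FT (phi j)) g)"
        by (intro dE_le piece_represents[OF g(1,2) p] conv_measurable gm schwartz_measurable FT_schwartz phij_schwartz p)
      then show ?thesis using C(2)[OF gm, of j] g(3) by simp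
    qed
    then have "BE s p T <= (\<Sum>j. ennreal (2 powr (real j * (s * p))) * (ennreal C * dE p T))"
      unfolding bE_def by (intro suminf_le) (auto intro!: mult_left_mono simp: mult.assoc)
    also have "... = ennreal G * (ennreal C * dE p T)" by (simp add: G(2)[symmetric])
    finally show "BE s p T <= ennreal (G * C) * dE p T" using G C by (simp add: ennreal_mult mult.assoc)
  qed
qed

lemma bE_pieces:
  assumes "BE s p T < \<infinity>" "1 <= p"
  obtains a where "\<forall>j. Lp_fun p (a j)" "\<forall>j. represents (a j) (piece j T)"
    "\<forall>j. lpE p (a j) = dE p (piece j T)" "(\<Sum>j. ennreal (2 powr (real j * s * p)) * lpE p (a j)) = BE s p T"
proof -
  have "dE p (piece j T) < \<infinity>" for j
  proof (rule ccontr)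
    assume "\<not> dE p (piece j T) < \<infinity>"
    then have "ennreal (2 powr (real j * s * p)) * dE p (piece j T) = \<infinity>"
      by (simp add: not_less top_unique ennreal_mult_top)
    moreover have "ennreal (2 powr (real j * s * p)) * dE p (piece j T) <= BE s p T"
      unfolding bE_def by (rule ennreal_le_suminf)
    ultimately show False using assms by (simp add: top_unique)
  qed
  then have "\<forall>j. \<exists>g. Lp_fun p g \<and> represents g (piece j T) \<and> lpE p g = dE p (piece j T)"
    using dE_finite[OF _ assms(2)] by metis
  then obtain a where "\<And>j. Lp_fun p (a j) \<and> represents (a j) (piece j T) \<and> lpE p (a j) = dE p (piece j T)" by metis
  then show ?thesis using that[of a] by (simp add: bE_def)
qed

end

text \<open>The majorant G is the sum of the moduli of the terms, finite almost everywhere and in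
  L_p by \<open>lp_series\<close>. It makes dominated convergence available for the partial sums,
  which is how every series of pieces is summed later on.\<close>

lemma lp_limit:
  fixes a :: "nat => 'n::finite cfun"
  assumes am[measurable]: "\<And>j. a j \<in> borel_measurable borel" and r: "0 < r" and p: "1 <= p"
    and fin: "(\<Sum>j. ennreal (2 powr (real j * r * p)) * lpE p (a j)) < \<infinity>"
  obtains g G where "g \<in> borel_measurable borel" "Lp_fun p G" "AE x in lborel. (%J. \<Sum>j\<le>J. a j x) \<longlonglongrightarrow> g x"
    "AE x in lborel. \<forall>J. norm (\<Sum>j\<le>J. a j x) <= norm (G x)" "AE x in lborel. norm (g x) <= norm (G x)"
proof -
  have "- r < 0" using r by simp
  then obtain W where W: "summable (%j. 2 powr (real j * - r))" "(\<Sum>j. 2 powr (real j * - r)) = W" using suminf_powr2 by metis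
  have p0: "0 < p" using p by simp
  note L = lp_series[OF am r p0 W fin]
  define G where "G x = complex_of_real (\<Sum>j. norm (a j x))" for x
  define g where "g x = lim (%J. \<Sum>j\<le>J. a j x)" for x
  have [measurable]: "(%x. \<Sum>j. norm (a j x)) \<in> borel_measurable borel" by measurable
  have Gm: "G \<in> borel_measurable borel" unfolding G_def[abs_def] by measurable
  have gm: "g \<in> borel_measurable borel" unfolding g_def[abs_def] by (rule borel_measurable_lim_metric) measurable
  have "lpE p G <= ennreal (W powr p) * (\<Sum>j. ennreal (2 powr (real j * r * p)) * lpE p (a j))"
  proof -
    have "lpE p G = (\<integral>\<^sup>+x. ennreal ((\<Sum>j. norm (a j x)) powr p) \<partial>lborel)"
      unfolding lpE_def
      by (rule nn_integral_cong_AE) (use L(1) in \<open>auto elim!: eventually_mono simp: G_def suminf_nonneg\<close>)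
    then show ?thesis using L(2) by simp
  qed
  also have "... < \<infinity>" using fin by (simp add: ennreal_mult_less_top)
  finally have "Lp_fun p G" using Gm by (simp add: Lp_fun_iff)
  moreover have "AE x in lborel. (%J. \<Sum>j\<le>J. a j x) \<longlonglongrightarrow> g x"
    using L(1)
  proof eventually_elim
    case (elim x)
    have "summable (%j. a j x)" using elim by (rule summable_norm_cancel)
    then have "(%J. \<Sum>j\<le>J. a j x) \<longlonglongrightarrow> (\<Sum>j. a j x)" by (rule summable_LIMSEQ')
    then show ?case unfolding g_def by (metis limI)
  qed
  moreover have bd: "AE x in lborel. \<forall>J. norm (\<Sum>j\<le>J. a j x) <= norm (G x)"
    using L(1)
  proof eventually_elim
    case (elim x)
    show ?case
    proof
      fix J
      have "norm (\<Sum>j\<le>J. a j x) <= (\<Sum>j\<le>J. norm (a j x))" by (rule norm_sum)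
      also have "... <= (\<Sum>j. norm (a j x))" using elim by (intro sum_le_suminf) auto
      finally show "norm (\<Sum>j\<le>J. a j x) <= norm (G x)" unfolding G_def by simp
    qed
  qed
  moreover have "AE x in lborel. norm (g x) <= norm (G x)"
    using bd calculation(2)
  proof eventually_elim
    case (elim x)
    show ?case by (rule tendsto_upperbound[OF tendsto_norm[OF elim(2)]]) (use elim in auto)
  qed
  ultimately show ?thesis using that gm by blast
qed

context cutoff

begin

text \<open>Against a Schwartz function the partial sums have two limits: the distribution T by
  \<open>piece_partition\<close>, and the pairing with g by dominated convergence. They must
  agree.\<close>

lemma pieces_sum_represents:
  assumes T: "tempered T" and a: "\<And>j. Lp_fun p (a j)" "\<And>j. represents (a j) (piece j T)" and p: "1 <= p"
    and g: "g \<in> borel_measurable borel" "AE x in lborel. (%J. \<Sum>j\<le>J. a j x) \<longlonglongrightarrow> g x"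
    and G: "Lp_fun p G" "AE x in lborel. \<forall>J. norm (\<Sum>j\<le>J. a j x) <= norm (G x)"
  shows "represents g T"
  unfolding represents_def
proof
  fix \<psi> :: "'n cfun" assume \<psi>: "\<psi> \<in> schwartz"
  have [measurable]: "a j \<in> borel_measurable borel" for j using a(1)[of j] by (simp add: Lp_fun_iff)
  have [measurable]: "g \<in> borel_measurable borel" "\<psi> \<in> borel_measurable borel" using g schwartz_measurable[OF \<psi>] by auto
  have "(%J. \<integral>x. (\<Sum>j\<le>J. a j x) * \<psi> x \<partial>lborel) \<longlonglongrightarrow> (\<integral>x. g x * \<psi> x \<partial>lborel)"
  proof (rule integral_dominated_convergence[where w = "%x. norm (G x * \<psi> x)"])
    show "integrable lborel (%x. norm (G x * \<psi> x))"
      by (intro integrable_norm tame_schwartz_integrable Lp_fun_tame[OF G(1) p] \<psi>)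
    show "AE x in lborel. (%J. (\<Sum>j\<le>J. a j x) * \<psi> x) \<longlonglongrightarrow> g x * \<psi> x"
      using g(2) by eventually_elim (intro tendsto_mult tendsto_const)
    show "AE x in lborel. norm ((\<Sum>j\<le>J. a j x) * \<psi> x) <= norm (G x * \<psi> x)" for J
      using G(2) by eventually_elim (auto simp: norm_mult intro!: mult_right_mono)
  qed measurable
  moreover have "(\<integral>x. (\<Sum>j\<le>J. a j x) * \<psi> x \<partial>lborel) = (\<Sum>j\<le>J. piece j T \<psi>)" for J
  proof -
    have "(\<integral>x. (\<Sum>j\<le>J. a j x) * \<psi> x \<partial>lborel) = (\<Sum>j\<le>J. \<integral>x. a j x * \<psi> x \<partial>lborel)"
      unfolding sum_distrib_right
      by (rule Bochner_Integration.integral_sum) (rule tame_schwartz_integrable[OF Lp_fun_tame[OF a(1) p] \<psi>])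
    then show ?thesis using a(2) \<psi> by (simp add: represents_def)
  qed
  ultimately show "T \<psi> = (\<integral>x. g x * \<psi> x \<partial>lborel)"
    using piece_partition[OF T \<psi>] LIMSEQ_unique by fastforce
qed

text \<open>For s > 0 the pieces are absolutely summable almost everywhere and their sum represents
  T; the constant is the p-th power of the geometric series of the inverse weights.\<close>

lemma Lp_le_Besov:
  assumes p: "1 <= p" and s: "0 < s"
  obtains C where "0 < C" "\<And>T. tempered T ==> BE s p T < \<infinity> ==> dE p T <= ennreal C * BE s p T"
proof -
  have "- s < 0" using s by simp
  then obtain W where W: "0 < W" "summable (%j. 2 powr (real j * - s))" "(\<Sum>j. 2 powr (real j * - s)) = W" using suminf_powr2 by metis
  have p0: "0 < p" using p by simp
  show ?thesis
  proof (rule that[of "W powr p"])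
    show "0 < W powr p" using W by simp
    fix T :: "'n distr" assume T: "tempered T" "BE s p T < \<infinity>"
    obtain a where a0: "\<forall>j. Lp_fun p (a j)" "\<forall>j. represents (a j) (piece j T)"
      and "\<forall>j. lpE p (a j) = dE p (piece j T)"
      and a3: "(\<Sum>j. ennreal (2 powr (real j * s * p)) * lpE p (a j)) = BE s p T" using bE_pieces[OF T(2) p] .
    note a = a0[rule_format]
    have am: "a j \<in> borel_measurable borel" for j using a(1)[of j] by (simp add: Lp_fun_iff)
    have fin: "(\<Sum>j. ennreal (2 powr (real j * s * p)) * lpE p (a j)) < \<infinity>" using T a3 by simp
    note L = lp_series[OF am s p0 W(2,3) fin]
    obtain g G where g: "g \<in> borel_measurable borel" "Lp_fun p G" "AE x in lborel. (%J. \<Sum>j\<le>J. a j x) \<longlonglongrightarrow> g x"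
      "AE x in lborel. \<forall>J. norm (\<Sum>j\<le>J. a j x) <= norm (G x)" "AE x in lborel. norm (g x) <= norm (G x)"
      using lp_limit[OF am s p fin] .
    have "represents g T" by (rule pieces_sum_represents[OF T(1) a(1,2) p g(1,3,2,4)])
    then have "dE p T <= lpE p g" by (intro dE_le g p)
    also have "lpE p g <= (\<integral>\<^sup>+x. ennreal ((\<Sum>j. norm (a j x)) powr p) \<partial>lborel)"
      unfolding lpE_def
    proof (rule nn_integral_mono_AE)
      show "AE x in lborel. ennreal (norm (g x) powr p) <= ennreal ((\<Sum>j. norm (a j x)) powr p)"
        using g(3) L(1)
      proof eventually_elim
        case (elim x)
        have "norm (\<Sum>j\<le>J. a j x) <= (\<Sum>j. norm (a j x))" for J
          by (rule order_trans[OF norm_sum sum_le_suminf[OF elim(2)]]) auto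
        then have "norm (g x) <= (\<Sum>j. norm (a j x))"
          by (intro tendsto_upperbound[OF tendsto_norm[OF elim(1)]]) auto
        then show ?case using p by (intro ennreal_leI powr_mono2) auto
      qed
    qed
    also have "... <= ennreal (W powr p) * BE s p T" using L(2) a3 by simp
    finally show "dE p T <= ennreal (W powr p) * BE s p T" .
  qed
qed

end

section \<open>Annuli of bounded overlap\<close>

text \<open>Wide enough for the support of \<open>phi j\<close> and also for that of the function
  \<open>fat j\<close> which equals 1 there. For j \<le> 1 it is the full ball, since no inner part
  is removed from \<open>fat j\<close> in these bands.\<close>

definition annulus :: "nat => (real^'n::finite) set" where
  "annulus j = {x. norm x <= 4 * 2 ^ j \<and> (j <= 1 \<or> 2 ^ j / 4 < norm x)}"

lemma annulus_measurable [measurable]: "annulus j \<in> sets borel"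
  unfolding annulus_def by measurable

lemma annulus_overlap: "\<exists>k. \<forall>j. x \<in> annulus j \<longrightarrow> j \<in> {k..<k + 4}"
proof -
  obtain j where "norm x < 2 ^ j" using real_arch_pow[of 2 "norm x"] by auto
  then have "norm x <= 4 * 2 ^ j" using zero_less_power[of "2::real" j] by linarith
  then have ex: "\<exists>j. norm x <= 4 * 2 ^ j" by (rule exI)
  \<comment> \<open>k is the first index whose ball of radius 4 * 2^k contains x. The outer bound of
    an annulus containing x forces j \<ge> k, and the inner bound gives 2^j < 16 * 2^k.\<close>
  define k where "k = (LEAST j. norm x <= 4 * 2 ^ j)"
  have k: "norm x <= 4 * 2 ^ k" unfolding k_def using LeastI_ex[OF ex] .
  have "j \<in> {k..<k + 4}" if "x \<in> annulus j" for j
  proof -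
    have "k <= j" unfolding k_def using that by (intro Least_le) (auto simp: annulus_def)
    moreover have "j < k + 4"
    proof (cases "j <= 1")
      case False
      then have "2 ^ j / 4 < norm x" using that by (auto simp: annulus_def)
      then have "(2::real) ^ j < 2 ^ (k + 4)" using k by (simp add: power_add)
      then show ?thesis using power_less_imp_less_exp[of "2::real" j "k + 4"] by simp
    qed auto
    ultimately show ?thesis by simp
  qed
  then show ?thesis by blast
qed

lemma annulus_sum_le: "(\<Sum>j. indicator (annulus j) x) <= (4::ennreal)"
proof -
  obtain k where k: "\<forall>j. x \<in> annulus j \<longrightarrow> j \<in> {k..<k + 4}" using annulus_overlap by blast
  have "(\<Sum>j. indicator (annulus j) x :: ennreal) = (\<Sum>j\<in>{k..<k + 4}. indicator (annulus j) x)"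
    using k by (intro suminf_finite) (auto simp: indicator_def)
  also have "... <= (\<Sum>j\<in>{k..<k + 4}. 1)" by (intro sum_mono) (auto simp: indicator_def)
  finally show ?thesis by simp
qed

text \<open>At most four terms are nonzero, so the sum is at most four times the largest of them,
  and the p-th power of that one occurs on the right.\<close>

lemma annulus_series:
  fixes b :: "nat => complex"
  assumes b: "\<And>j. x \<notin> annulus j ==> b j = 0" and p: "0 < p"
  shows "summable (%j. norm (b j))"
    and "ennreal ((\<Sum>j. norm (b j)) powr p) <= ennreal (4 powr p) * (\<Sum>j. ennreal (norm (b j) powr p))"
proof -
  obtain k where k: "\<forall>j. x \<in> annulus j \<longrightarrow> j \<in> {k..<k + 4}" using annulus_overlap by blast
  have z: "norm (b j) = 0" if "j \<notin> {k..<k + 4}" for j using b k that by auto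
  show "summable (%j. norm (b j))" by (rule summable_finite[of "{k..<k + 4}"]) (use z in auto)
  define M where "M = Max ((%j. norm (b j)) ` {k..<k + 4})"
  have M: "norm (b j) <= M" if "j \<in> {k..<k + 4}" for j unfolding M_def using that by (intro Max_ge) auto
  have "M \<in> (%j. norm (b j)) ` {k..<k + 4}" unfolding M_def by (intro Max_in) auto
  then obtain j where j: "M = norm (b j)" by auto
  have "(\<Sum>j. norm (b j)) = (\<Sum>j\<in>{k..<k + 4}. norm (b j))" by (rule suminf_finite) (use z in auto)
  also have "... <= (\<Sum>j\<in>{k..<k + 4}. M)" by (intro sum_mono M)
  finally have "(\<Sum>j. norm (b j)) <= 4 * M" by simp
  moreover have "0 <= (\<Sum>j. norm (b j))" by (rule suminf_nonneg[OF summable_finite[of "{k..<k + 4}"]]) (use z in auto)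
  ultimately have "(\<Sum>j. norm (b j)) powr p <= (4 * M) powr p" using p by (intro powr_mono2) auto
  also have "... = 4 powr p * norm (b j) powr p" by (simp add: j powr_mult)
  finally have "ennreal ((\<Sum>j. norm (b j)) powr p) <= ennreal (4 powr p) * ennreal (norm (b j) powr p)"
    by (simp add: ennreal_leI flip: ennreal_mult)
  also have "... <= ennreal (4 powr p) * (\<Sum>j. ennreal (norm (b j) powr p))"
    by (intro mult_left_mono ennreal_le_suminf) auto
  finally show "ennreal ((\<Sum>j. norm (b j)) powr p) <= ennreal (4 powr p) * (\<Sum>j. ennreal (norm (b j) powr p))" .
qed

lemma sum_lpE_annulus_le:
  fixes g :: "'n::finite cfun"
  assumes [measurable]: "g \<in> borel_measurable borel" and p: "0 < p"
  shows "(\<Sum>j. lpE p (%x. g x * indicator (annulus j) x)) <= 4 * lpE p g"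
proof -
  have "(\<Sum>j. lpE p (%x. g x * indicator (annulus j) x)) = (\<Sum>j. \<integral>\<^sup>+x. indicator (annulus j) x * ennreal (norm (g x) powr p) \<partial>lborel)"
    unfolding lpE_def by (intro suminf_cong nn_integral_cong) (auto simp: indicator_def)
  also have "... = (\<integral>\<^sup>+x. (\<Sum>j. indicator (annulus j) x * ennreal (norm (g x) powr p)) \<partial>lborel)"
    by (rule nn_integral_suminf[symmetric]) measurable
  also have "... <= (\<integral>\<^sup>+x. 4 * ennreal (norm (g x) powr p) \<partial>lborel)"
    by (intro nn_integral_mono) (auto intro!: mult_right_mono annulus_sum_le)
  also have "... = 4 * lpE p g" unfolding lpE_def by (rule nn_integral_cmult) measurable
  finally show ?thesis .
qed

definition ball_vol :: "'n::finite itself => nat => real" where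
  "ball_vol _ j = unit_ball_vol (real CARD('n)) * (4 * 2 ^ j) ^ CARD('n)"

lemma emeasure_ball_vol: "emeasure lborel (cball 0 (4 * 2 ^ j) :: (real^'n::finite) set) = ennreal (ball_vol TYPE('n) j)"
  unfolding ball_vol_def by (subst emeasure_cball) auto

lemma ball_vol_pos: "0 < ball_vol TYPE('n::finite) j"
  unfolding ball_vol_def by (simp add: unit_ball_vol_pos)

text \<open>The exponent \<open>dnp\<close> is exactly what balances the volume of the \<open>j\<close>-th ball.\<close>

lemma ball_vol_powr:
  assumes p: "0 < p"
  shows "2 powr (real j * dnp CARD('n) p * p) * ball_vol TYPE('n::finite) j powr (p - 2) = ball_vol TYPE('n) 0 powr (p - 2)"
proof -
  have e: "real j * dnp CARD('n) p * p = real j * real CARD('n) * (2 - p)"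
    using p by (simp add: dnp_def field_simps)
  have v: "ball_vol TYPE('n) j = ball_vol TYPE('n) 0 * 2 powr (real j * real CARD('n))"
    by (simp add: ball_vol_def power_mult_distrib powr_realpow[symmetric] powr_powr powr_mult)
  have "ball_vol TYPE('n) j powr (p - 2) = ball_vol TYPE('n) 0 powr (p - 2) * 2 powr (real j * real CARD('n) * (p - 2))"
    unfolding v using ball_vol_pos[where 'n = 'n, of 0] by (subst powr_mult) (auto simp: powr_powr)
  moreover have "(2::real) powr (real j * real CARD('n) * (2 - p)) * 2 powr (real j * real CARD('n) * (p - 2)) = 1"
    by (simp add: powr_add[symmetric] algebra_simps)
  ultimately show ?thesis unfolding e by (simp add: mult_ac)
qed

section \<open>The Fourier transform of \<open>L\<^sub>p\<close> for \<open>p < 2\<close>, localised to a ball\<close>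

text \<open>h need not be integrable, so its transform is approached through the truncations
  \<open>hN\<close>. The localised estimate applied to differences of truncations shows that their
  transforms on B converge, and v is the limit. The last conclusion says that v is the transform of
  h as a distribution, seen by test functions living on B.\<close>

lemma localised_FT_Lp:
  fixes h :: "'n::finite cfun"
  assumes h: "Lp_fun p h" and p: "1 < p" "p < 2"
    and B: "B \<in> sets borel" "emeasure lborel B = ennreal \<mu>" "0 < \<mu>"
  defines "C \<equiv> (2 * p / (p - 1) + 4 * p / (2 - p)) * (ftc TYPE('n) * \<mu>) powr (2 - p)"
  obtains v where "v \<in> borel_measurable borel" "lpE p v <= ennreal C * lpE p h"
    "\<forall>\<theta>\<in>schwartz. (\<forall>x. x \<notin> B \<longrightarrow> \<theta> x = 0) \<longrightarrow> (\<integral>x. h x * FT \<theta> x \<partial>lborel) = (\<integral>x. v x * \<theta> x \<partial>lborel)"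
proof -
  have p1: "1 <= p" "0 < p" using p by auto
  have [measurable]: "h \<in> borel_measurable borel" "B \<in> sets borel" using h B by (auto simp: Lp_fun_iff)
  define hN where "hN N x = (if norm x <= real N \<and> norm (h x) <= real N then h x else 0)" for N x
  have [measurable]: "hN N \<in> borel_measurable borel" for N unfolding hN_def[abs_def] by measurable
  have hN_le: "norm (hN N x) <= norm (h x)" "norm (h x - hN N x) <= norm (h x)" for N x by (auto simp: hN_def)
  have ihN: "integrable lborel (hN N)" for N
  proof -
    have "integrable lborel (%x. h x * indicator {x. norm x <= real N \<and> norm (h x) <= real N} x)"
      by (rule tame_cball_integrable[OF Lp_fun_tame[OF h p1(1)], where B = 1 and R = "real N"]) (auto simp: indicator_def)
    moreover have "(%x. h x * indicator {x. norm x <= real N \<and> norm (h x) <= real N} x) = hN N"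
      by (auto simp: hN_def indicator_def)
    ultimately show ?thesis by simp
  qed
  have hN_lim: "(%N. hN N x) \<longlonglongrightarrow> h x" for x
  proof -
    obtain N0 :: nat where N0: "max (norm x) (norm (h x)) <= real N0" using real_arch_simple by blast
    have "\<forall>\<^sub>F N in sequentially. hN N x = h x"
      unfolding eventually_sequentially by (rule exI[of _ N0]) (use N0 in \<open>auto simp: hN_def\<close>)
    then show ?thesis by (rule tendsto_eventually)
  qed
  have err: "(%N. lpE p (%x. h x - hN N x)) \<longlonglongrightarrow> 0"
  proof -
    have "(%N. \<integral>\<^sup>+x. ennreal (norm (h x - hN N x) powr p) \<partial>lborel) \<longlonglongrightarrow> (\<integral>\<^sup>+x. 0 \<partial>(lborel :: (real^'n) measure))"
    proof (rule nn_integral_dominated_convergence[where w = "%x. ennreal (norm (h x) powr p)"])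
      show "AE x in lborel. ennreal (norm (h x - hN N x) powr p) <= ennreal (norm (h x) powr p)" for N
        using hN_le p1 by (intro AE_I2 ennreal_leI powr_mono2) auto
      show "(\<integral>\<^sup>+x. ennreal (norm (h x) powr p) \<partial>lborel) < \<infinity>" using h by (simp add: Lp_fun_iff lpE_def)
      show "AE x in lborel. (%N. ennreal (norm (h x - hN N x) powr p)) \<longlonglongrightarrow> 0"
      proof (intro AE_I2)
        fix x
        have "(%N. norm (h x - hN N x)) \<longlonglongrightarrow> 0"
          using tendsto_norm[OF tendsto_diff[OF tendsto_const[of "h x"] hN_lim[of x]]] by simp
        then show "(%N. ennreal (norm (h x - hN N x) powr p)) \<longlonglongrightarrow> 0"
          using powr_tendsto_0_iff[of "%N. norm (h x - hN N x)" p] p1 by simp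
      qed
    qed auto
    then show ?thesis by (simp add: lpE_def)
  qed
  \<comment> \<open>The rate is made for \<open>lp_limit\<close> with r = 1: against the weight
    \<open>2 powr (k * p)\<close> there remains \<open>2 powr (- k)\<close>, which is
    summable.\<close>
  have "\<exists>N\<ge>k. lpE p (%x. h x - hN N x) <= ennreal (2 powr (- (real k * (p + 1))))" for k :: nat
  proof -
    have "\<forall>\<^sub>F N in sequentially. lpE p (%x. h x - hN N x) < ennreal (2 powr (- (real k * (p + 1))))"
      using err by (rule order_tendstoD) simp
    then obtain N0 where N0: "\<And>N. N0 <= N ==> lpE p (%x. h x - hN N x) < ennreal (2 powr (- (real k * (p + 1))))"
      unfolding eventually_sequentially by auto
    show ?thesis using N0[of "max k N0"] by (intro exI[of _ "max k N0"]) auto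
  qed
  then obtain N where Nk: "\<And>k. k <= N k" and N: "\<And>k. lpE p (%x. h x - hN (N k) x) <= ennreal (2 powr (- (real k * (p + 1))))" by metis
  have C: "0 <= C" unfolding C_def using p by (intro mult_nonneg_nonneg add_nonneg_nonneg) auto
  define w where "w k x = FT (hN (N k)) x * indicator B x" for k x
  have [measurable]: "FT (hN N) \<in> borel_measurable borel" for N by (rule FT_measurable) simp
  have wm[measurable]: "w k \<in> borel_measurable borel" for k unfolding w_def[abs_def] by measurable
  have wb: "lpE p (w k) <= ennreal C * lpE p h" for k
  proof -
    have "lpE p (w k) <= ennreal C * lpE p (hN (N k))"
      unfolding w_def[abs_def] C_def by (rule lpE_localised_FT_lt2[OF ihN B p])
    also have "... <= ennreal C * lpE p h" using p1 by (intro mult_left_mono lpE_mono hN_le) auto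
    finally show ?thesis .
  qed
  \<comment> \<open>Telescoping: the partial sums of \<open>a\<close> are the functions
    \<open>w k\<close>, so \<open>lp_limit\<close> yields an almost everywhere limit of the
    \<open>w k\<close> together with a common majorant in L_p.\<close>
  define a where "a k x = (case k of 0 => w 0 x | Suc k => w (Suc k) x - w k x)" for k x
  have am: "a k \<in> borel_measurable borel" for k
    unfolding a_def[abs_def] by (cases k) auto
  have asum: "(\<Sum>j\<le>k. a j x) = w k x" for k x by (induction k) (auto simp: a_def)
  have astep: "lpE p (a (Suc k)) <= ennreal (C * 2 powr p * 2 * 2 powr (- (real k * (p + 1))))" for k
  proof -
    have eq: "a (Suc k) x = FT (%x. hN (N (Suc k)) x - hN (N k) x) x * indicator B x" for x
      by (simp add: a_def w_def FT_diff[OF ihN ihN] left_diff_distrib)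
    have "lpE p (%x. hN (N (Suc k)) x - hN (N k) x) = lpE p (%x. (h x - hN (N k) x) - (h x - hN (N (Suc k)) x))"
      by (simp add: algebra_simps)
    also have "... <= ennreal (2 powr p) * (lpE p (%x. h x - hN (N k) x) + lpE p (%x. h x - hN (N (Suc k)) x))"
      using p1 by (intro lpE_diff) auto
    also have "... <= ennreal (2 powr p) * (ennreal (2 powr (- (real k * (p + 1)))) + ennreal (2 powr (- (real k * (p + 1)))))"
    proof (intro mult_left_mono add_mono N)
      have "2 powr (- (real (Suc k) * (p + 1))) <= 2 powr (- (real k * (p + 1)))" using p by (intro powr_mono) (auto simp: algebra_simps)
      then show "lpE p (%x. h x - hN (N (Suc k)) x) <= ennreal (2 powr (- (real k * (p + 1))))"
        using N[of "Suc k"] by (meson ennreal_leI order_trans)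
    qed auto
    also have "... = ennreal (2 powr p * 2 * 2 powr (- (real k * (p + 1))))"
      by (simp flip: ennreal_plus ennreal_mult)
    finally have st: "lpE p (%x. hN (N (Suc k)) x - hN (N k) x) <= ennreal (2 powr p * 2 * 2 powr (- (real k * (p + 1))))" .
    have "lpE p (a (Suc k)) <= ennreal C * lpE p (%x. hN (N (Suc k)) x - hN (N k) x)"
      unfolding eq[abs_def] C_def by (rule lpE_localised_FT_lt2[OF _ B p]) (intro Bochner_Integration.integrable_diff ihN)
    also have "... <= ennreal C * ennreal (2 powr p * 2 * 2 powr (- (real k * (p + 1))))"
      by (intro mult_left_mono st) auto
    also have "... = ennreal (C * (2 powr p * 2 * 2 powr (- (real k * (p + 1)))))"
      by (rule ennreal_mult[symmetric]) (use C in auto)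
    finally show ?thesis by (simp only: mult.assoc)
  qed
  have fin: "(\<Sum>j. ennreal (2 powr (real j * 1 * p)) * lpE p (a j)) < \<infinity>"
  proof -
    define f where "f j = ennreal (2 powr (real j * 1 * p)) * lpE p (a j)" for j
    have f0: "f 0 < \<infinity>"
    proof -
      have "a 0 = w 0" by (auto simp: a_def)
      then have "f 0 <= ennreal C * lpE p h" using wb[of 0] by (simp add: f_def)
      also have "... < \<infinity>" using h by (simp add: Lp_fun_iff ennreal_mult_less_top)
      finally show ?thesis .
    qed
    have "(- 1 :: real) < 0" by simp
    then obtain G where G: "0 < G" "(\<Sum>j. ennreal (2 powr (real j * (- 1)))) = ennreal G" using suminf_powr2 by metis
    have "f (Suc j) <= ennreal (C * 2 powr p * 2 * 2 powr p) * ennreal (2 powr (real j * (- 1)))" for j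
    proof -
      have "f (Suc j) <= ennreal (2 powr (real (Suc j) * 1 * p)) * ennreal (C * 2 powr p * 2 * 2 powr (- (real j * (p + 1))))"
        unfolding f_def by (intro mult_left_mono astep) auto
      also have "... = ennreal (2 powr (real (Suc j) * 1 * p) * (C * 2 powr p * 2 * 2 powr (- (real j * (p + 1)))))"
        using C by (simp flip: ennreal_mult)
      also have "2 powr (real (Suc j) * 1 * p) * (C * 2 powr p * 2 * 2 powr (- (real j * (p + 1)))) =
         (C * 2 powr p * 2) * (2 powr (real (Suc j) * 1 * p) * 2 powr (- (real j * (p + 1))))" by (simp only: mult_ac)
      also have "2 powr (real (Suc j) * 1 * p) * 2 powr (- (real j * (p + 1))) = 2 powr p * 2 powr (real j * (- 1))"
        unfolding powr_add[symmetric] by (simp add: algebra_simps)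
      finally show ?thesis using C by (simp add: mult.assoc flip: ennreal_mult)
    qed
    then have "(\<Sum>j. f (Suc j)) <= (\<Sum>j. ennreal (C * 2 powr p * 2 * 2 powr p) * ennreal (2 powr (real j * (- 1))))"
      by (intro suminf_le) auto
    also have "... < \<infinity>" unfolding ennreal_suminf_cmult G(2) by (simp add: ennreal_mult_less_top)
    finally have "(\<Sum>j. f (Suc j)) < \<infinity>" .
    moreover have "(\<Sum>j. f j) = (\<Sum>j. f (Suc j)) + f 0"
      using suminf_offset[OF summableI, of f 1] by (simp add: add.commute)
    ultimately show ?thesis using f0 unfolding f_def[symmetric] by simp
  qed
  obtain v G where v: "v \<in> borel_measurable borel" "Lp_fun p G" "AE x in lborel. (%J. \<Sum>j\<le>J. a j x) \<longlonglongrightarrow> v x"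
    "AE x in lborel. \<forall>J. norm (\<Sum>j\<le>J. a j x) <= norm (G x)" "AE x in lborel. norm (v x) <= norm (G x)"
    using lp_limit[OF am zero_less_one p1(1) fin] .
  note [measurable] = v(1)
  have lim: "AE x in lborel. (%J. w J x) \<longlonglongrightarrow> v x" and dom: "AE x in lborel. \<forall>J. norm (w J x) <= norm (G x)"
    using v(3,4) by (auto simp: asum)
  \<comment> \<open>By Fatou's lemma from the uniform bound on the \<open>w k\<close>; the majorant
    G would not give the constant C.\<close>
  have "lpE p v <= ennreal C * lpE p h"
  proof -
    have "lpE p v = (\<integral>\<^sup>+x. liminf (%k. ennreal (norm (w k x) powr p)) \<partial>lborel)"
      unfolding lpE_def
    proof (rule nn_integral_cong_AE)
      show "AE x in lborel. ennreal (norm (v x) powr p) = liminf (%k. ennreal (norm (w k x) powr p))"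
        using lim
      proof eventually_elim
        case (elim x)
        have "(%k. norm (w k x) powr p) \<longlonglongrightarrow> norm (v x) powr p"
          using p1 by (intro tendsto_powr2 tendsto_norm elim tendsto_const) auto
        then have "(%k. ennreal (norm (w k x) powr p)) \<longlonglongrightarrow> ennreal (norm (v x) powr p)" by (rule tendsto_ennrealI)
        then show ?case by (rule lim_imp_Liminf[symmetric, rotated]) simp
      qed
    qed
    also have "... <= liminf (%k. \<integral>\<^sup>+x. ennreal (norm (w k x) powr p) \<partial>lborel)"
      by (rule nn_integral_liminf) measurable
    also have "... <= liminf (%k. ennreal C * lpE p h)"
      using wb by (intro Liminf_mono always_eventually allI) (simp add: lpE_def)
    also have "... = ennreal C * lpE p h" by (rule Liminf_const) simp
    finally show ?thesis .
  qed
  moreover have "(\<integral>x. h x * FT \<theta> x \<partial>lborel) = (\<integral>x. v x * \<theta> x \<partial>lborel)"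
    if \<theta>: "\<theta> \<in> schwartz" "\<forall>x. x \<notin> B \<longrightarrow> \<theta> x = 0" for \<theta>
  proof -
    have [measurable]: "\<theta> \<in> borel_measurable borel" "FT \<theta> \<in> borel_measurable borel"
      using schwartz_measurable[OF \<theta>(1)] schwartz_measurable[OF FT_schwartz[OF \<theta>(1)]] .
    have "(%k. \<integral>x. w k x * \<theta> x \<partial>lborel) \<longlonglongrightarrow> (\<integral>x. v x * \<theta> x \<partial>lborel)"
    proof (rule integral_dominated_convergence[where w = "%x. norm (G x * \<theta> x)"])
      show "integrable lborel (%x. norm (G x * \<theta> x))"
        by (intro integrable_norm tame_schwartz_integrable Lp_fun_tame[OF v(2) p1(1)] \<theta>)
      show "AE x in lborel. (%k. w k x * \<theta> x) \<longlonglongrightarrow> v x * \<theta> x"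
        using lim by eventually_elim (intro tendsto_mult tendsto_const)
      show "AE x in lborel. norm (w k x * \<theta> x) <= norm (G x * \<theta> x)" for k
        using dom by eventually_elim (auto simp: norm_mult intro!: mult_right_mono)
    qed measurable
    moreover have "(\<integral>x. w k x * \<theta> x \<partial>lborel) = (\<integral>x. hN (N k) x * FT \<theta> x \<partial>lborel)" for k
    proof -
      have "(\<integral>x. w k x * \<theta> x \<partial>lborel) = (\<integral>x. FT (hN (N k)) x * \<theta> x \<partial>lborel)"
        using \<theta>(2) by (intro Bochner_Integration.integral_cong) (auto simp: w_def indicator_def)
      then show ?thesis using FT_multiplication[OF ihN schwartz_integrable[OF \<theta>(1)]] by simp
    qed
    moreover have "(%k. \<integral>x. hN (N k) x * FT \<theta> x \<partial>lborel) \<longlonglongrightarrow> (\<integral>x. h x * FT \<theta> x \<partial>lborel)"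
    proof (rule integral_dominated_convergence[where w = "%x. norm (h x * FT \<theta> x)"])
      show "integrable lborel (%x. norm (h x * FT \<theta> x))"
        by (intro integrable_norm tame_schwartz_integrable Lp_fun_tame[OF h p1(1)] FT_schwartz \<theta>)
      show "AE x in lborel. (%k. hN (N k) x * FT \<theta> x) \<longlonglongrightarrow> h x * FT \<theta> x"
        by (intro AE_I2 tendsto_mult tendsto_const filterlim_compose[OF hN_lim filterlim_at_top_mono[OF filterlim_ident]])
          (auto simp: Nk)
      show "AE x in lborel. norm (hN (N k) x * FT \<theta> x) <= norm (h x * FT \<theta> x)" for k
        by (intro AE_I2) (auto simp: norm_mult hN_le intro!: mult_right_mono)
    qed measurable
    ultimately show ?thesis by (metis (no_types, lifting) LIMSEQ_unique ext)
  qed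
  ultimately show ?thesis using that v(1) by blast
qed

section \<open>Boundedness of the Fourier transform\<close>

context cutoff

begin

lemma phij_annulus:
  assumes "x \<notin> annulus j"
  shows "phi j x = 0"
proof (cases "norm x <= 4 * 2 ^ j")
  case True
  then have "0 < j" "norm x <= 2 ^ j / 4" using assms by (auto simp: annulus_def)
  moreover from this have "norm x <= 2 ^ j / 2" using norm_ge_zero[of x] by linarith
  ultimately show ?thesis by (intro phij_0_inside)
next
  case False
  then have "2 * 2 ^ j < norm x" using zero_less_power[of "2::real" j] by linarith
  then show ?thesis by (rule phij_0_outside)
qed

lemma annulus_uminus: "- x \<in> annulus j \<longleftrightarrow> x \<in> annulus j"
  by (simp add: annulus_def)

text \<open>Transforming twice is reflection, so cutting the second transform of T with
  \<open>phi j\<close> means cutting g with the reflected \<open>phi j\<close> and transforming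
  once. The cut-off g is integrable, which brings the distribution back to the integral
  \<open>FT\<close>.\<close>

lemma piece_FTd_represents:
  assumes g: "tame g" "represents g T"
  shows "represents (FT (%x. phi j (- x) * g x)) (piece j (FTd T))"
    and "integrable lborel (%x. phi j (- x) * g x)"
proof -
  have i: "integrable lborel (%x. g x * phi j (- x))"
    by (rule tame_schwartz_integrable[OF g(1) schwartz_uminus[OF phij_schwartz]])
  then show i': "integrable lborel (%x. phi j (- x) * g x)" by (simp add: mult.commute)
  show "represents (FT (%x. phi j (- x) * g x)) (piece j (FTd T))"
    unfolding represents_def
  proof
    fix \<psi> :: "'n cfun" assume \<psi>: "\<psi> \<in> schwartz"
    have S: "(%x. phi j x * IFT \<psi> x) \<in> schwartz" by (intro schwartz_mult phij_schwartz IFT_schwartz \<psi>)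
    have "piece j (FTd T) \<psi> = T (FT (FT (%x. phi j x * IFT \<psi> x)))"
      using S by (simp add: piece_apply[OF \<psi>] FTd_def FT_schwartz)
    also have "FT (FT (%x. phi j x * IFT \<psi> x)) = (%x. phi j (- x) * FT \<psi> x)"
      using FT_inversion[OF S] by (auto simp: IFT_eq)
    also have "T ... = (\<integral>x. g x * (phi j (- x) * FT \<psi> x) \<partial>lborel)"
      using g(2) schwartz_mult[OF schwartz_uminus[OF phij_schwartz] FT_schwartz[OF \<psi>]] by (simp add: represents_def)
    also have "... = (\<integral>x. (phi j (- x) * g x) * FT \<psi> x \<partial>lborel)" by (simp only: mult_ac)
    also have "... = (\<integral>x. FT (%x. phi j (- x) * g x) x * \<psi> x \<partial>lborel)"
      by (rule FT_multiplication[symmetric, OF i' schwartz_integrable[OF \<psi>]])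
    finally show "piece j (FTd T) \<psi> = (\<integral>x. FT (%x. phi j (- x) * g x) x * \<psi> x \<partial>lborel)" .
  qed
qed

text \<open>Interpolation on the ball of radius 4 * 2^j, whose volume power is cancelled by the
  weight of order \<open>dnp\<close>. The indicator of the annulus on the right serves twice: for
  summing over j by bounded overlap, and for exploiting local convergence with j fixed in
  \<open>compact_ge2\<close>.\<close>

lemma piece_FTd_le:
  assumes p: "2 <= p"
  obtains C where "0 < C" "\<And>j g T. Lp_fun p g ==> represents g T ==>
    ennreal (2 powr (real j * dnp CARD('n) p * p)) * dE p (piece j (FTd T)) <= ennreal C * lpE p (%x. g x * indicator (annulus j) x)"
proof -
  obtain D where D: "0 < D" "\<And>h B \<mu>. integrable lborel h ==> (\<And>x. x \<notin> B ==> h x = 0) ==>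
    B \<in> sets borel ==> emeasure lborel B = ennreal \<mu> ==> 0 < \<mu> ==>
    lpE p (FT h :: 'n cfun) <= ennreal (D * \<mu> powr (p - 2)) * lpE p h" using lpE_FT_localised_ge2[OF p] by blast
  obtain P where P: "1 <= P" "\<And>j x. norm (phi j x) <= P" using phij_bounded by blast
  define C where "C = D * ball_vol TYPE('n) 0 powr (p - 2) * P powr p"
  show ?thesis
  proof (rule that[of C])
    show "0 < C" unfolding C_def using D P ball_vol_pos[where 'n = 'n, of 0] by (simp add: powr_gt_zero)
    fix j and g :: "'n cfun" and T :: "'n distr"
    assume g: "Lp_fun p g" "represents g T"
    have [measurable]: "g \<in> borel_measurable borel" using g by (simp add: Lp_fun_iff)
    define h where "h x = phi j (- x) * g x" for x
    have tg: "tame g" using Lp_fun_tame[OF g(1)] p by simp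
    have ih: "integrable lborel h" unfolding h_def[abs_def] by (rule piece_FTd_represents(2)[OF tg g(2)])
    have rep: "represents (FT h) (piece j (FTd T))" unfolding h_def[abs_def] by (rule piece_FTd_represents(1)[OF tg g(2)])
    have hm: "h \<in> borel_measurable borel" using ih by auto
    have h0: "h x = 0" if "x \<notin> annulus j" for x using that phij_annulus[of "- x" j] by (simp add: h_def annulus_uminus)
    have "dE p (piece j (FTd T)) <= lpE p (FT h)" using p by (intro dE_le[OF FT_measurable[OF hm] rep]) simp
    also have "... <= ennreal (D * ball_vol TYPE('n) j powr (p - 2)) * lpE p h"
      by (rule D(2)[OF ih _ _ emeasure_ball_vol ball_vol_pos]) (auto intro!: h0 simp: annulus_def)
    also have "... <= ennreal (D * ball_vol TYPE('n) j powr (p - 2)) * (ennreal (P powr p) * lpE p (%x. g x * indicator (annulus j) x))"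
    proof (intro mult_left_mono)
      have "lpE p h <= lpE p (%x. of_real P * (g x * indicator (annulus j) x))"
      proof (rule lpE_mono)
        fix x
        show "norm (h x) <= norm (of_real P * (g x * indicator (annulus j) x))"
          using h0[of x] P(1) P(2)[of j "- x"] by (cases "x \<in> annulus j") (auto simp: h_def norm_mult intro!: mult_right_mono)
      qed (use p in auto)
      also have "... = ennreal (norm (complex_of_real P) powr p) * lpE p (%x. g x * indicator (annulus j) x)"
        by (rule lpE_cmult) measurable
      finally show "lpE p h <= ennreal (P powr p) * lpE p (%x. g x * indicator (annulus j) x)" using P by simp
    qed auto
    finally have "ennreal (2 powr (real j * dnp CARD('n) p * p)) * dE p (piece j (FTd T))
      <= ennreal (2 powr (real j * dnp CARD('n) p * p)) * (ennreal (D * ball_vol TYPE('n) j powr (p - 2)) * (ennreal (P powr p) * lpE p (%x. g x * indicator (annulus j) x)))"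
      by (intro mult_left_mono) auto
    also have "... = ennreal (2 powr (real j * dnp CARD('n) p * p) * (D * ball_vol TYPE('n) j powr (p - 2)) * P powr p) * lpE p (%x. g x * indicator (annulus j) x)"
      using D P by (simp add: mult.assoc ennreal_mult)
    also have "2 powr (real j * dnp CARD('n) p * p) * (D * ball_vol TYPE('n) j powr (p - 2)) * P powr p = C"
      unfolding C_def ball_vol_powr[where 'n = 'n and j = j and p = p, symmetric, OF less_le_trans[OF zero_less_numeral p]] by (simp only: mult_ac)
    finally show "ennreal (2 powr (real j * dnp CARD('n) p * p)) * dE p (piece j (FTd T)) <= ennreal C * lpE p (%x. g x * indicator (annulus j) x)" .
  qed
qed

lemma FTd_Lp_to_Besov:
  assumes p: "2 <= p"
  obtains C where "0 < C" "\<And>T. dE p T < \<infinity> ==> BE (dnp CARD('n) p) p (FTd T) <= ennreal C * dE p T"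
proof -
  obtain C where C: "0 < C" "\<And>j g T. Lp_fun p g ==> represents g T ==>
    ennreal (2 powr (real j * dnp CARD('n) p * p)) * dE p (piece j (FTd T)) <= ennreal C * lpE p (%x. g x * indicator (annulus j) x)"
    using piece_FTd_le[OF p] by blast
  show ?thesis
  proof (rule that[of "C * 4"])
    show "0 < C * 4" using C by simp
    fix T :: "'n distr" assume "dE p T < \<infinity>"
    then obtain g where g: "Lp_fun p g" "represents g T" "lpE p g = dE p T" using dE_finite p by force
    have gm: "g \<in> borel_measurable borel" using g by (simp add: Lp_fun_iff)
    have "BE (dnp CARD('n) p) p (FTd T) <= (\<Sum>j. ennreal C * lpE p (%x. g x * indicator (annulus j) x))"
      unfolding bE_def by (intro suminf_le C(2)[OF g(1,2)]) auto
    also have "... = ennreal C * (\<Sum>j. lpE p (%x. g x * indicator (annulus j) x))" by simp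
    also have "... <= ennreal C * (4 * lpE p g)" using p by (intro mult_left_mono sum_lpE_annulus_le gm) auto
    also have "... = ennreal (C * 4) * dE p T" using C by (simp add: g(3) ennreal_mult mult.assoc)
    finally show "BE (dnp CARD('n) p) p (FTd T) <= ennreal (C * 4) * dE p T" .
  qed
qed

text \<open>Equal to 1 on the support of \<open>phi j\<close> and supported in
  \<open>annulus j\<close>; it localises a function without disturbing its product with
  \<open>phi j\<close>.\<close>

definition fat :: "nat => 'n cfun" where
  "fat j x = \<phi>0 ((1 / 2 ^ Suc j) *\<^sub>R x) - (if j <= 1 then 0 else \<phi>0 ((4 / 2 ^ j) *\<^sub>R x))"

lemma fat_schwartz: "fat j \<in> schwartz"
proof (cases "j <= 1")
  case True
  then have "fat j = (%x. \<phi>0 ((1 / 2 ^ Suc j) *\<^sub>R x))" by (auto simp: fat_def)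
  then show ?thesis using schwartz_scale[OF phi0_schwartz, of "1 / 2 ^ Suc j"] by simp
next
  case False
  then have "fat j = (%x. \<phi>0 ((1 / 2 ^ Suc j) *\<^sub>R x) - \<phi>0 ((4 / 2 ^ j) *\<^sub>R x))" by (auto simp: fat_def)
  then show ?thesis using schwartz_diff[OF schwartz_scale[OF phi0_schwartz, of "1 / 2 ^ Suc j"] schwartz_scale[OF phi0_schwartz, of "4 / 2 ^ j"]] by simp
qed

lemma fat_annulus:
  assumes "x \<notin> annulus j"
  shows "fat j x = 0"
proof (cases "norm x <= 4 * 2 ^ j")
  case True
  then have j: "\<not> j <= 1" "norm x <= 2 ^ j / 4" using assms by (auto simp: annulus_def)
  then have "norm x <= 2 * 2 ^ j" "4 * norm x <= 2 ^ j" using norm_ge_zero[of x] by linarith+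
  then show ?thesis using j phi0_1[of "(1 / 2 ^ Suc j) *\<^sub>R x"] phi0_1[of "(4 / 2 ^ j) *\<^sub>R x"] by (simp add: fat_def pos_divide_le_eq)
next
  case False
  then have "3 * (2 * 2 ^ j) <= norm x * 2" "3 * 2 ^ j <= 4 * norm x * 2" using zero_less_power[of "2::real" j] by linarith+
  then show ?thesis using phi0_0[of "(1 / 2 ^ Suc j) *\<^sub>R x"] phi0_0[of "(4 / 2 ^ j) *\<^sub>R x"] by (simp add: fat_def pos_le_divide_eq)
qed

lemma phij_fat: "phi j x * fat j x = phi j x"
proof (cases "phi j x = 0")
  case False
  have 1: "norm x <= 2 * 2 ^ j" using False phij_0_outside[of j x] by (meson not_le)
  then have "\<phi>0 ((1 / 2 ^ Suc j) *\<^sub>R x) = 1" by (intro phi0_1) (simp add: pos_divide_le_eq)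
  moreover have "\<phi>0 ((4 / 2 ^ j) *\<^sub>R x) = 0" if "\<not> j <= 1"
  proof -
    have "0 < j" using that by simp
    then have "2 ^ j / 2 < norm x" using False phij_0_inside[of j x] by (meson not_le)
    then have "3 * 2 ^ j <= 4 * norm x * 2" using zero_less_power[of "2::real" j] by linarith
    then show ?thesis by (intro phi0_0) (simp add: pos_le_divide_eq)
  qed
  ultimately show ?thesis by (simp add: fat_def)
qed simp

lemma fat_bounded:
  obtains P where "1 <= P" "\<And>j x. norm (fat j x) <= P"
proof -
  obtain P where P: "1 <= P" "\<And>x. norm (\<phi>0 x) <= P" using phi0_bounded by blast
  have "norm (fat j x) <= P + P" for j x
    unfolding fat_def using P by (intro order_trans[OF norm_triangle_ineq4] add_mono) auto
  then show ?thesis using that[of "P + P"] P by auto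
qed

text \<open>Each piece of T is an L_p function; its transform is localised first to a ball by
  \<open>localised_FT_Lp\<close> and then to the annulus by \<open>fat j\<close>. The sum u of these
  functions has boundedly many terms at each point. The last clause expresses that only the pieces
  with j > L reach beyond radius 4 * 2^L; \<open>compact_lt2\<close> reads it as uniform smallness
  at infinity.\<close>

lemma FTd_Besov_function:
  assumes p: "1 < p" "p < 2"
  obtains C where "0 < C" "\<And>T. tempered T ==> BE (dnp CARD('n) p) p T < \<infinity> ==>
    \<exists>u. Lp_fun p u \<and> represents u (FTd T) \<and> lpE p u <= ennreal C * BE (dnp CARD('n) p) p T \<and>
      (\<forall>L. lpE p (%x. u x * indicator {x. 4 * 2 ^ L < norm x} x) \<le>
        ennreal C * (\<Sum>j. if j <= L then 0 else ennreal (2 powr (real j * dnp CARD('n) p * p)) * dE p (piece j T)))"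
proof -
  let ?d = "dnp CARD('n) p"
  define A where "A = (2 * p / (p - 1) + 4 * p / (2 - p)) * ftc TYPE('n) powr (2 - p)"
  have A: "0 < A" unfolding A_def using p ftc_pos[where 'n = 'n] by (intro mult_pos_pos add_pos_pos) auto
  obtain P where P: "1 <= P" "\<And>j x. norm (fat j x) <= P" using fat_bounded by blast
  define V where "V = ball_vol TYPE('n) 0 powr (p - 2)"
  have V: "0 < V" unfolding V_def using ball_vol_pos[where 'n = 'n, of 0] by simp
  \<comment> \<open>The volume factor of the interpolation for p < 2 has the exponent opposite to
    that in \<open>ball_vol_powr\<close>, so it reproduces the Besov weight instead of cancelling
    it.\<close>
  have vol: "ball_vol TYPE('n) j powr (2 - p) = 2 powr (real j * ?d * p) / V" for j
  proof -
    have "ball_vol TYPE('n) j powr (2 - p) * ball_vol TYPE('n) j powr (p - 2) = 1"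
      using ball_vol_pos[where 'n = 'n, of j] by (simp flip: powr_add)
    moreover have "2 powr (real j * ?d * p) * ball_vol TYPE('n) j powr (p - 2) = V"
      unfolding V_def using p by (intro ball_vol_powr) auto
    ultimately show ?thesis using V ball_vol_pos[where 'n = 'n, of j] by (simp add: field_simps) (metis mult.assoc mult.commute mult_1)
  qed
  define C where "C = 4 powr p * (P powr p * (A / V))"
  have p1: "1 <= p" "0 < p" using p by auto
  show ?thesis
  proof (rule that[of C])
    show "0 < C" unfolding C_def using A V P by (simp add: powr_gt_zero)
    fix T :: "'n distr" assume T: "tempered T" "BE ?d p T < \<infinity>"
    obtain a where a0: "\<forall>j. Lp_fun p (a j)" "\<forall>j. represents (a j) (piece j T)"
      and a1: "\<forall>j. lpE p (a j) = dE p (piece j T)"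
      and a3: "(\<Sum>j. ennreal (2 powr (real j * ?d * p)) * lpE p (a j)) = BE ?d p T" using bE_pieces[OF T(2) p1(1)] .
    have cb: "(cball 0 r :: (real^'n) set) \<in> sets borel" for r by (intro borel_closed closed_cball)
    define Q where "Q j v \<longleftrightarrow> v \<in> borel_measurable borel \<and> lpE p v <= ennreal (A / V * 2 powr (real j * ?d * p)) * lpE p (a j) \<and>
      (\<forall>\<theta>\<in>schwartz. (\<forall>x. x \<notin> cball 0 (4 * 2 ^ j) \<longrightarrow> \<theta> x = 0) \<longrightarrow> (\<integral>x. a j x * FT \<theta> x \<partial>lborel) = (\<integral>x. v x * \<theta> x \<partial>lborel))" for j v
    have "\<exists>v. Q j v" for j
    proof -
      obtain v where v: "v \<in> borel_measurable borel"
        "lpE p v <= ennreal ((2 * p / (p - 1) + 4 * p / (2 - p)) * (ftc TYPE('n) * ball_vol TYPE('n) j) powr (2 - p)) * lpE p (a j)"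
        "\<forall>\<theta>\<in>schwartz. (\<forall>x. x \<notin> cball 0 (4 * 2 ^ j) \<longrightarrow> \<theta> x = 0) \<longrightarrow> (\<integral>x. a j x * FT \<theta> x \<partial>lborel) = (\<integral>x. v x * \<theta> x \<partial>lborel)"
        using localised_FT_Lp[OF a0(1)[rule_format] p cb emeasure_ball_vol ball_vol_pos] .
      have eq: "(2 * p / (p - 1) + 4 * p / (2 - p)) * (ftc TYPE('n) * ball_vol TYPE('n) j) powr (2 - p) = A / V * 2 powr (real j * ?d * p)"
        using ftc_pos[where 'n = 'n] ball_vol_pos[where 'n = 'n, of j] by (simp add: A_def powr_mult vol)
      show ?thesis unfolding Q_def by (intro exI[of _ v] conjI v(1) v(2)[unfolded eq] v(3))
    qed
    then obtain v where "\<And>j. Q j (v j)" by metis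
    then have v: "\<And>j. v j \<in> borel_measurable borel" "\<And>j. lpE p (v j) <= ennreal (A / V * 2 powr (real j * ?d * p)) * lpE p (a j)"
      "\<And>j \<theta>. \<theta> \<in> schwartz ==> (\<forall>x. x \<notin> cball 0 (4 * 2 ^ j) \<longrightarrow> \<theta> x = 0) ==> (\<integral>x. a j x * FT \<theta> x \<partial>lborel) = (\<integral>x. v j x * \<theta> x \<partial>lborel)"
      unfolding Q_def by blast+
    define b where "b j x = fat j x * v j x" for j x
    have [measurable]: "fat j \<in> borel_measurable borel" for j by (rule schwartz_measurable[OF fat_schwartz])
    have [measurable]: "v j \<in> borel_measurable borel" for j by (rule v(1))
    have bm[measurable]: "b j \<in> borel_measurable borel" for j unfolding b_def[abs_def] by measurable
    have b0: "b j x = 0" if "x \<notin> annulus j" for j x using fat_annulus[OF that] by (simp add: b_def)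
    have bE: "lpE p (b j) <= ennreal (P powr p * (A / V)) * (ennreal (2 powr (real j * ?d * p)) * dE p (piece j T))" for j
    proof -
      have "lpE p (b j) <= lpE p (%x. of_real P * v j x)"
        using P p1 by (intro lpE_mono) (auto simp: b_def norm_mult intro!: mult_right_mono)
      also have "... = ennreal (P powr p) * lpE p (v j)" using P by (subst lpE_cmult) auto
      also have "... <= ennreal (P powr p) * (ennreal (A / V * 2 powr (real j * ?d * p)) * lpE p (a j))"
        by (intro mult_left_mono v) auto
      also have "... = ennreal (P powr p * (A / V)) * (ennreal (2 powr (real j * ?d * p)) * dE p (piece j T))"
      proof -
        have "ennreal (A / V * 2 powr (real j * ?d * p)) = ennreal (A / V) * ennreal (2 powr (real j * ?d * p))"
          using A V by (intro ennreal_mult) auto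
        moreover have "ennreal (P powr p * (A / V)) = ennreal (P powr p) * ennreal (A / V)"
          using A V by (intro ennreal_mult) auto
        ultimately show ?thesis using a1 by (simp only: mult.assoc)
      qed
      finally show ?thesis .
    qed
    \<comment> \<open>\<open>phi j * \<psi>\<close> is unchanged when \<psi> is multiplied by
      \<open>fat j\<close>, so \<psi> may be replaced by a test function supported in the ball, as
      the property of \<open>v j\<close> requires.\<close>
    have test: "FTd T (%x. phi j x * \<psi> x) = (\<integral>x. b j x * \<psi> x \<partial>lborel)" if \<psi>: "\<psi> \<in> schwartz" for j \<psi>
    proof -
      define \<theta> where "\<theta> x = fat j x * \<psi> x" for x
      have S: "\<theta> \<in> schwartz" unfolding \<theta>_def[abs_def] by (intro schwartz_mult fat_schwartz \<psi>)
      have z: "\<forall>x. x \<notin> cball 0 (4 * 2 ^ j) \<longrightarrow> \<theta> x = 0"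
        using fat_annulus[of _ j] by (auto simp: \<theta>_def annulus_def)
      have "piece j T (FT \<theta>) = FTd T (%x. phi j x * \<theta> x)"
        by (simp add: piece_apply FT_schwartz[OF S] IFT_FT[OF S])
      also have "(%x. phi j x * \<theta> x) = (%x. phi j x * \<psi> x)"
        unfolding \<theta>_def by (simp add: mult.assoc[symmetric] phij_fat)
      finally have "FTd T (%x. phi j x * \<psi> x) = piece j T (FT \<theta>)" by simp
      also have "... = (\<integral>x. a j x * FT \<theta> x \<partial>lborel)" using a0(2) FT_schwartz[OF S] by (simp add: represents_def)
      also have "... = (\<integral>x. v j x * \<theta> x \<partial>lborel)" by (rule v(3)[OF S z])
      finally show ?thesis by (simp add: \<theta>_def b_def mult_ac)
    qed
    define u where "u x = lim (%J. \<Sum>j\<le>J. b j x)" for x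
    define G where "G x = complex_of_real (\<Sum>j. norm (b j x))" for x
    have [measurable]: "(%x. \<Sum>j. norm (b j x)) \<in> borel_measurable borel" by measurable
    have um[measurable]: "u \<in> borel_measurable borel" unfolding u_def[abs_def] by (rule borel_measurable_lim_metric) measurable
    have Gm[measurable]: "G \<in> borel_measurable borel" unfolding G_def[abs_def] by measurable
    note AS = annulus_series[OF b0 p1(2)]
    have partial_le: "norm (\<Sum>j\<le>J. b j x) <= norm (G x)" for J x
    proof -
      have "norm (\<Sum>j\<le>J. b j x) <= (\<Sum>j\<le>J. norm (b j x))" by (rule norm_sum)
      also have "... <= (\<Sum>j. norm (b j x))" by (intro sum_le_suminf AS(1)) auto
      finally show ?thesis unfolding G_def by simp
    qed
    have ulim: "(%J. \<Sum>j\<le>J. b j x) \<longlonglongrightarrow> u x" for x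
    proof -
      have "summable (%j. b j x)" using AS(1) by (rule summable_norm_cancel)
      then have "(%J. \<Sum>j\<le>J. b j x) \<longlonglongrightarrow> (\<Sum>j. b j x)" by (rule summable_LIMSEQ')
      then show ?thesis unfolding u_def by (metis limI)
    qed
    have uG: "norm (u x) <= norm (G x)" for x
      by (rule tendsto_upperbound[OF tendsto_norm[OF ulim]]) (use partial_le in auto)
    have Gpt: "ennreal (norm (G x) powr p) <= ennreal (4 powr p) * (\<Sum>j. ennreal (norm (b j x) powr p))" for x
      using AS(2)[of x] suminf_nonneg[OF AS(1), of x] by (simp add: G_def)
    \<comment> \<open>E is a region and N a set of indices whose annuli miss it. The choice
      \<open>UNIV\<close> and \<open>{}\<close> gives the norm bound, the exterior of a ball with
      \<open>{..L}\<close> the tail bound.\<close>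
    have tail: "lpE p (%x. G x * indicator E x) <= ennreal C * (\<Sum>j. if j \<in> N then 0 else ennreal (2 powr (real j * ?d * p)) * dE p (piece j T))"
      if E[measurable]: "E \<in> sets borel" and EN: "\<And>x j. x \<in> E ==> j \<in> N ==> x \<notin> annulus j" for E N
    proof -
      have "lpE p (%x. G x * indicator E x) <= (\<integral>\<^sup>+x. ennreal (4 powr p) * (\<Sum>j. if j \<in> N then 0 else ennreal (norm (b j x) powr p)) \<partial>lborel)"
        unfolding lpE_def
      proof (intro nn_integral_mono)
        fix x
        show "ennreal (norm (G x * indicator E x) powr p) <= ennreal (4 powr p) * (\<Sum>j. if j \<in> N then 0 else ennreal (norm (b j x) powr p))"
        proof (cases "x \<in> E")
          case True
          have "(\<Sum>j. ennreal (norm (b j x) powr p)) = (\<Sum>j. if j \<in> N then 0 else ennreal (norm (b j x) powr p))"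
            using EN[OF True] b0 by (intro suminf_cong) auto
          then show ?thesis using Gpt[of x] True by simp
        qed simp
      qed
      also have "... = ennreal (4 powr p) * (\<integral>\<^sup>+x. (\<Sum>j. if j \<in> N then 0 else ennreal (norm (b j x) powr p)) \<partial>lborel)"
        by (rule nn_integral_cmult) measurable
      also have "(\<integral>\<^sup>+x. (\<Sum>j. if j \<in> N then 0 else ennreal (norm (b j x) powr p)) \<partial>lborel) = (\<Sum>j. \<integral>\<^sup>+x. (if j \<in> N then 0 else ennreal (norm (b j x) powr p)) \<partial>lborel)"
        by (rule nn_integral_suminf) measurable
      also have "... <= (\<Sum>j. ennreal (P powr p * (A / V)) * (if j \<in> N then 0 else ennreal (2 powr (real j * ?d * p)) * dE p (piece j T)))"
        using bE by (intro suminf_le) (auto simp: lpE_def)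
      also have "... = ennreal (P powr p * (A / V)) * (\<Sum>j. if j \<in> N then 0 else ennreal (2 powr (real j * ?d * p)) * dE p (piece j T))"
        by (rule ennreal_suminf_cmult)
      finally have "lpE p (%x. G x * indicator E x) <= ennreal (4 powr p) * (ennreal (P powr p * (A / V)) * (\<Sum>j. if j \<in> N then 0 else ennreal (2 powr (real j * ?d * p)) * dE p (piece j T)))"
        by (simp add: mult_left_mono)
      moreover have "ennreal C = ennreal (4 powr p) * ennreal (P powr p * (A / V))"
        unfolding C_def using A V by (intro ennreal_mult) auto
      ultimately show ?thesis by (simp only: mult.assoc)
    qed
    have uT: "lpE p (%x. u x * indicator E x) <= lpE p (%x. G x * indicator E x)" for E
      using p1 uG by (intro lpE_mono) (auto simp: norm_mult indicator_def)
    have GE: "lpE p G <= ennreal C * BE ?d p T" using tail[of UNIV "{}"] by (simp add: bE_def)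
    have uE: "lpE p u <= ennreal C * BE ?d p T" using uT[of UNIV] GE by simp
    have fin: "ennreal C * BE ?d p T < \<infinity>" using T by (simp add: ennreal_mult_less_top)
    have Lu: "Lp_fun p u" using uE fin by (auto simp: Lp_fun_iff um intro: le_less_trans)
    have LG: "Lp_fun p G" using GE fin by (auto simp: Lp_fun_iff Gm intro: le_less_trans)
    have "represents u (FTd T)"
      unfolding represents_def
    proof
      fix \<psi> :: "'n cfun" assume \<psi>: "\<psi> \<in> schwartz"
      have [measurable]: "\<psi> \<in> borel_measurable borel" by (rule schwartz_measurable[OF \<psi>])
      have iG: "integrable lborel (%x. norm (G x * \<psi> x))"
        by (intro integrable_norm tame_schwartz_integrable Lp_fun_tame[OF LG p1(1)] \<psi>)
      have "(%J. \<integral>x. (\<Sum>j\<le>J. b j x) * \<psi> x \<partial>lborel) \<longlonglongrightarrow> (\<integral>x. u x * \<psi> x \<partial>lborel)"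
      proof (rule integral_dominated_convergence[where w = "%x. norm (G x * \<psi> x)", OF _ _ iG])
        show "AE x in lborel. (%J. (\<Sum>j\<le>J. b j x) * \<psi> x) \<longlonglongrightarrow> u x * \<psi> x"
          using ulim by (intro AE_I2 tendsto_mult tendsto_const)
        show "AE x in lborel. norm ((\<Sum>j\<le>J. b j x) * \<psi> x) <= norm (G x * \<psi> x)" for J
          using partial_le by (intro AE_I2) (auto simp: norm_mult intro!: mult_right_mono)
      qed measurable
      moreover have "(\<integral>x. (\<Sum>j\<le>J. b j x) * \<psi> x \<partial>lborel) = (\<Sum>j\<le>J. FTd T (%x. phi j x * \<psi> x))" for J
      proof -
        have "integrable lborel (%x. b j x * \<psi> x)" for j
        proof (rule Bochner_Integration.integrable_bound[OF iG])
          show "AE x in lborel. norm (b j x * \<psi> x) <= norm (norm (G x * \<psi> x))"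
          proof (intro AE_I2)
            fix x
            have sx: "summable (%j. norm (b j x))" by (rule AS(1))
            have "norm (b j x) <= (\<Sum>j. norm (b j x))"
              using sum_le_suminf[OF sx, of "{j}"] by simp
            also have "... <= norm (G x)" unfolding G_def by simp
            finally show "norm (b j x * \<psi> x) <= norm (norm (G x * \<psi> x))" by (simp add: norm_mult mult_right_mono)
          qed
        qed measurable
        then show ?thesis unfolding sum_distrib_right by (subst Bochner_Integration.integral_sum) (auto simp: test[OF \<psi>])
      qed
      ultimately show "FTd T \<psi> = (\<integral>x. u x * \<psi> x \<partial>lborel)"
        using FTd_partition[OF T(1) \<psi>] by (metis (no_types, lifting) LIMSEQ_unique ext)
    qed
    moreover have "lpE p (%x. u x * indicator {x. 4 * 2 ^ L < norm x} x) \<le>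
        ennreal C * (\<Sum>j. if j <= L then 0 else ennreal (2 powr (real j * ?d * p)) * dE p (piece j T))" for L
    proof -
      have "lpE p (%x. G x * indicator {x. 4 * 2 ^ L < norm x} x) \<le>
        ennreal C * (\<Sum>j. if j \<in> {..L} then 0 else ennreal (2 powr (real j * ?d * p)) * dE p (piece j T))"
      proof (rule tail)
        fix x :: "real^'n" and j assume x: "x \<in> {x. 4 * 2 ^ L < norm x}" and "j \<in> {..L}"
        then have "(2::real) ^ j <= 2 ^ L" by (intro power_increasing) auto
        moreover have "4 * 2 ^ L < norm x" using x by simp
        ultimately have "4 * 2 ^ j < norm x" by linarith
        then show "x \<notin> annulus j" by (auto simp: annulus_def)
      qed measurable
      then show ?thesis using uT[of "{x. 4 * 2 ^ L < norm x}"] by (auto intro: order_trans)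
    qed
    ultimately show "\<exists>u. Lp_fun p u \<and> represents u (FTd T) \<and> lpE p u <= ennreal C * BE ?d p T \<and>
      (\<forall>L. lpE p (%x. u x * indicator {x. 4 * 2 ^ L < norm x} x) \<le>
        ennreal C * (\<Sum>j. if j <= L then 0 else ennreal (2 powr (real j * ?d * p)) * dE p (piece j T)))"
      using Lu uE by blast
  qed
qed

end

section \<open>Local compactness of bounded sets in Besov spaces\<close>

text \<open>The null sequence y may depend on e. This form fits splittings into a part that
  converges and a part that is merely small uniformly in k.\<close>

lemma ennreal_tendsto_0_approx:
  fixes x :: "nat => ennreal"
  assumes "\<And>e::real. 0 < e ==> \<exists>y. y \<longlonglongrightarrow> 0 \<and> (\<forall>k. x k <= y k + ennreal e)"
  shows "x \<longlonglongrightarrow> 0"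
proof (rule order_tendstoI)
  fix a :: ennreal assume a: "0 < a"
  obtain e :: real where e: "0 < e" "ennreal (2 * e) <= a"
  proof (cases a)
    case (real r)
    then show ?thesis using a that[of "r / 2"] by (auto simp: less_le)
  next
    case top
    then show ?thesis using that[of 1] by simp
  qed
  obtain y where y: "y \<longlonglongrightarrow> 0" "\<And>k. x k <= y k + ennreal e" using assms[OF e(1)] by blast
  have "\<forall>\<^sub>F k in sequentially. y k < ennreal e" using y(1) e by (intro order_tendstoD) auto
  then show "\<forall>\<^sub>F k in sequentially. x k < a"
  proof eventually_elim
    case (elim k)
    have "x k <= y k + ennreal e" by (rule y)
    also have "... < ennreal e + ennreal e" using elim by (intro ennreal_add_left_cancel_less[THEN iffD2, THEN subst[OF add.commute, where P = "%z. z < _"]]) (auto simp: add.commute)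
    also have "... = ennreal (2 * e)" using e by (simp flip: ennreal_plus)
    finally show ?case using e by simp
  qed
qed simp

lemma ennreal_tendsto_0_le:
  fixes x y :: "nat => ennreal"
  assumes "y \<longlonglongrightarrow> 0" "\<And>k. x k <= ennreal C * y k"
  shows "x \<longlonglongrightarrow> 0"
proof -
  have "(%k. ennreal C * y k) \<longlonglongrightarrow> ennreal C * 0" using assms(1) by (intro ennreal_tendsto_cmult) auto
  then show ?thesis by (intro tendsto_sandwich[OF _ _ tendsto_const[of 0], of x _ "%k. ennreal C * y k"]) (use assms in auto)
qed

text \<open>Dominated convergence for the counting measure. In the applications r is negative
  because of a strict inequality between the order and its endpoint.\<close>

lemma suminf_weighted_tendsto_0:
  fixes x :: "nat => nat => ennreal"
  assumes r: "r < 0" and b: "\<And>k j. x k j <= ennreal N" and lim: "\<And>j. (%k. x k j) \<longlonglongrightarrow> 0"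
  shows "(%k. \<Sum>j. ennreal (2 powr (real j * r)) * x k j) \<longlonglongrightarrow> 0"
proof -
  obtain G where G: "(\<Sum>j. ennreal (2 powr (real j * r))) = ennreal G" using suminf_powr2[OF r] by metis
  have "(%k. \<integral>\<^sup>+j. ennreal (2 powr (real j * r)) * x k j \<partial>count_space UNIV) \<longlonglongrightarrow> (\<integral>\<^sup>+j. 0 \<partial>(count_space UNIV :: nat measure))"
  proof (rule nn_integral_dominated_convergence[where w = "%j. ennreal (2 powr (real j * r)) * ennreal N"])
    show "(\<integral>\<^sup>+j. ennreal (2 powr (real j * r)) * ennreal N \<partial>count_space UNIV) < \<infinity>"
      by (simp add: nn_integral_count_space_nat G ennreal_mult_less_top)
    show "AE j in count_space UNIV. (%k. ennreal (2 powr (real j * r)) * x k j) \<longlonglongrightarrow> 0"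
    proof (intro AE_I2)
      fix j :: nat
      show "(%k. ennreal (2 powr (real j * r)) * x k j) \<longlonglongrightarrow> 0"
        by (rule ennreal_tendsto_0_le[OF lim[of j], of _ "2 powr (real j * r)"]) simp
    qed
  qed (auto intro!: mult_left_mono b)
  then show ?thesis by (simp add: nn_integral_count_space_nat)
qed

text \<open>Near the origin local convergence helps, far away the decay of \<psi>. By
  \<open>le_add_powr\<close> the pairing is bounded by p-th powers of h plus \<delta> times the
  modulus of \<psi>, and the latter is small by the choice of \<delta>.\<close>

lemma weak_null:
  fixes h :: "nat => 'n::finite cfun"
  assumes [measurable]: "\<And>k. h k \<in> borel_measurable borel" and p: "1 <= p" and N: "\<And>k. lpE p (h k) <= ennreal N" "0 <= N"
    and loc: "\<And>R. (%k. lpE p (%x. h k x * indicator (cball 0 R) x)) \<longlonglongrightarrow> 0" and \<psi>: "\<psi> \<in> schwartz"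
  shows "(%k. \<integral>\<^sup>+x. ennreal (norm (h k x * \<psi> x)) \<partial>lborel) \<longlonglongrightarrow> 0"
proof (rule ennreal_tendsto_0_approx)
  fix e :: real assume e: "0 < e"
  have [measurable]: "\<psi> \<in> borel_measurable borel" by (rule schwartz_measurable[OF \<psi>])
  obtain P where P: "sbound 1 0 \<psi> P" "0 < P" using schwartz_sbound[OF \<psi>] by metis
  have Pb: "norm (\<psi> x) <= P / (1 + norm x)" for x using sboundD'[OF P(1), of "[]" x] by simp
  have P1: "norm (\<psi> x) <= P" for x using sboundD[OF P(1), of "[]" x] mult_right_mono[of 1 "1 + norm x" "norm (\<psi> x)"] by simp
  define I where "I = (\<integral>x. norm (\<psi> x) \<partial>lborel)"
  have I: "0 <= I" unfolding I_def by (intro integral_nonneg_AE) auto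
  have nI: "(\<integral>\<^sup>+x. ennreal (norm (\<psi> x)) \<partial>lborel) = ennreal I"
    unfolding I_def using schwartz_integrable[OF \<psi>] by (intro nn_integral_eq_integral) auto
  define \<delta> where "\<delta> = e / (2 * (I + 1))"
  have \<delta>: "0 < \<delta>" unfolding \<delta>_def using e I by simp
  have \<delta>I: "\<delta> * I <= e / 2" unfolding \<delta>_def using e I by (simp add: field_simps)
  define D where "D = \<delta> powr (1 - p)"
  have D: "0 < D" unfolding D_def using \<delta> by simp
  \<comment> \<open>Beyond radius R the function \<psi> is at most P / (1 + R); this R brings the
    corresponding term below e / 2.\<close>
  define R where "R = 2 * D * P * N / e"
  have R: "0 <= R" unfolding R_def using D P N e by simp
  have RN: "D * (P / (1 + R)) * N <= e / 2"
  proof -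
    have "D * P * N <= e / 2 * (1 + R)" unfolding R_def using e D P N by (simp add: field_simps)
    then show ?thesis using R by (simp add: field_simps)
  qed
  have "(\<integral>\<^sup>+x. ennreal (norm (h k x * \<psi> x)) \<partial>lborel) <= ennreal (D * P) * lpE p (%x. h k x * indicator (cball 0 R) x) + ennreal e" for k
  proof -
    have "(\<integral>\<^sup>+x. ennreal (norm (h k x * \<psi> x)) \<partial>lborel) <= (\<integral>\<^sup>+x. ennreal \<delta> * ennreal (norm (\<psi> x)) + (ennreal (D * P) * ennreal (norm (h k x * indicator (cball 0 R) x) powr p)
      + ennreal (D * (P / (1 + R))) * ennreal (norm (h k x) powr p)) \<partial>lborel)"
    proof (intro nn_integral_mono)
      fix x
      have "norm (h k x) * norm (\<psi> x) <= (\<delta> + D * norm (h k x) powr p) * norm (\<psi> x)"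
        unfolding D_def by (intro mult_right_mono le_add_powr \<delta> p) auto
      also have "... = \<delta> * norm (\<psi> x) + D * norm (\<psi> x) * norm (h k x) powr p" by (simp add: algebra_simps)
      also have "D * norm (\<psi> x) * norm (h k x) powr p <= D * P * norm (h k x * indicator (cball 0 R) x) powr p + D * (P / (1 + R)) * norm (h k x) powr p"
      proof (cases "norm x <= R")
        case True
        have "D * norm (\<psi> x) * norm (h k x) powr p <= D * P * norm (h k x) powr p" using D by (intro mult_right_mono mult_left_mono P1) auto
        moreover have "0 <= D * (P / (1 + R)) * norm (h k x) powr p" using D P R by simp
        ultimately show ?thesis using True by simp
      next
        case False
        have "norm (\<psi> x) <= P / (1 + R)" using Pb[of x] False R P by (elim order_trans) (auto intro!: divide_left_mono)
        then have "D * norm (\<psi> x) * norm (h k x) powr p <= D * (P / (1 + R)) * norm (h k x) powr p" using D by (intro mult_right_mono mult_left_mono) auto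
        then show ?thesis using False by simp
      qed
      finally have "ennreal (norm (h k x * \<psi> x)) <= ennreal (\<delta> * norm (\<psi> x) + (D * P * norm (h k x * indicator (cball 0 R) x) powr p + D * (P / (1 + R)) * norm (h k x) powr p))"
        by (intro ennreal_leI) (simp add: norm_mult)
      also have "... = ennreal (\<delta> * norm (\<psi> x)) + (ennreal (D * P * norm (h k x * indicator (cball 0 R) x) powr p) + ennreal (D * (P / (1 + R)) * norm (h k x) powr p))"
        using D P R \<delta> by (subst ennreal_plus, simp, simp, subst ennreal_plus) auto
      also have "... = ennreal \<delta> * ennreal (norm (\<psi> x)) + (ennreal (D * P) * ennreal (norm (h k x * indicator (cball 0 R) x) powr p) + ennreal (D * (P / (1 + R))) * ennreal (norm (h k x) powr p))"
        using D P R \<delta> by (subst (1 2 3) ennreal_mult) auto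
      finally show "ennreal (norm (h k x * \<psi> x)) <= ..." .
    qed
    also have "... = ennreal \<delta> * ennreal I + (ennreal (D * P) * lpE p (%x. h k x * indicator (cball 0 R) x) + ennreal (D * (P / (1 + R))) * lpE p (h k))"
    proof -
      have [measurable]: "(cball 0 R :: (real^'n) set) \<in> sets borel" by (intro borel_closed closed_cball)
      show ?thesis unfolding lpE_def nI[symmetric] by (simp add: nn_integral_add nn_integral_cmult)
    qed
    also have "... <= ennreal (e / 2) + (ennreal (D * P) * lpE p (%x. h k x * indicator (cball 0 R) x) + ennreal (e / 2))"
    proof (intro add_mono order_refl)
      show "ennreal \<delta> * ennreal I <= ennreal (e / 2)" using \<delta>I \<delta> I by (simp add: ennreal_leI flip: ennreal_mult)
      have "ennreal (D * (P / (1 + R))) * lpE p (h k) <= ennreal (D * (P / (1 + R))) * ennreal N" by (intro mult_left_mono N) auto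
      also have "... = ennreal (D * (P / (1 + R)) * N)" using D P R N by (intro ennreal_mult[symmetric]) auto
      also have "... <= ennreal (e / 2)" by (intro ennreal_leI RN)
      finally show "ennreal (D * (P / (1 + R))) * lpE p (h k) <= ennreal (e / 2)" .
    qed
    also have "... = ennreal (D * P) * lpE p (%x. h k x * indicator (cball 0 R) x) + (ennreal (e / 2) + ennreal (e / 2))" by (simp only: add_ac)
    also have "ennreal (e / 2) + ennreal (e / 2) = ennreal e" using e by (simp flip: ennreal_plus)
    finally show ?thesis .
  qed
  moreover have "(%k. ennreal (D * P) * lpE p (%x. h k x * indicator (cball 0 R) x)) \<longlonglongrightarrow> 0"
    by (rule ennreal_tendsto_0_le[OF loc[of R], of _ "D * P"]) simp
  ultimately show "\<exists>y. y \<longlonglongrightarrow> 0 \<and> (\<forall>k. (\<integral>\<^sup>+x. ennreal (norm (h k x * \<psi> x)) \<partial>lborel) <= y k + ennreal e)" by blast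
qed

lemma norm_conv_le:
  fixes g :: "'n::finite cfun"
  assumes g: "Lp_fun p g" and p: "1 <= p" and K: "K \<in> borel_measurable borel" "\<And>x. norm (K x) <= B * weight x" and B: "0 <= B"
    and M: "lpE p g <= ennreal M" "0 <= M"
  shows "norm (\<integral>x. K (x - y) * g x \<partial>lborel) <= B * ((\<integral>x. weight (x::real^'n) \<partial>lborel) + M)"
    and "integrable lborel (%x. K (x - y) * g x)"
proof -
  have [measurable]: "g \<in> borel_measurable borel" "K \<in> borel_measurable borel" using g K by (auto simp: Lp_fun_iff)
  have iw: "integrable lborel (%x::real^'n. weight (x - y))" "(\<integral>x. weight (x - y :: real^'n) \<partial>lborel) = (\<integral>x. weight (x::real^'n) \<partial>lborel)"
    using integral_translate[OF integrable_weight, of "- y"] by auto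
  have ig: "integrable lborel (%x. norm (g x) powr p)" using g by (simp add: Lp_fun_def)
  have gM: "(\<integral>x. norm (g x) powr p \<partial>lborel) <= M"
  proof -
    have "ennreal (\<integral>x. norm (g x) powr p \<partial>lborel) = lpE p g" unfolding lpE_def by (rule nn_integral_eq_integral[symmetric, OF ig]) auto
    then show ?thesis using M ennreal_le_iff[of M "\<integral>x. norm (g x) powr p \<partial>lborel"] by simp
  qed
  have ib: "integrable lborel (%x. B * (weight (x - y) + norm (g x) powr p))"
    using iw ig by (intro integrable_mult_right Bochner_Integration.integrable_add)
  have pt: "norm (K (x - y) * g x) <= B * (weight (x - y) + norm (g x) powr p)" for x
  proof -
    have "norm (K (x - y)) * norm (g x) <= (B * weight (x - y)) * (1 + norm (g x) powr p)"
      using B weight_pos[of "x - y"] by (intro mult_mono K le_one_add_powr p) auto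
    also have "... <= B * (weight (x - y) + norm (g x) powr p)"
      using mult_right_mono[OF weight_le_1[of "x - y"], of "norm (g x) powr p"] B
      by (simp add: mult.assoc distrib_left mult_left_mono)
    finally show ?thesis by (simp add: norm_mult)
  qed
  show i: "integrable lborel (%x. K (x - y) * g x)"
    by (rule Bochner_Integration.integrable_bound[OF ib]) (use pt in \<open>auto intro!: AE_I2 order_trans[OF pt]\<close>)
  have "norm (\<integral>x. K (x - y) * g x \<partial>lborel) <= (\<integral>x. norm (K (x - y) * g x) \<partial>lborel)" by (rule integral_norm_bound)
  also have "... <= (\<integral>x. B * (weight (x - y) + norm (g x) powr p) \<partial>lborel)"
    by (intro integral_mono integrable_norm i ib pt)
  also have "... = B * ((\<integral>x. weight (x::real^'n) \<partial>lborel) + (\<integral>x. norm (g x) powr p \<partial>lborel))" using iw ig by simp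
  also have "... <= B * ((\<integral>x. weight (x::real^'n) \<partial>lborel) + M)" using gM B by (intro mult_left_mono) auto
  finally show "norm (\<integral>x. K (x - y) * g x \<partial>lborel) <= B * ((\<integral>x. weight (x::real^'n) \<partial>lborel) + M)" .
qed

text \<open>The constant depends on g only through the bound M on its norm. Convolution thus turns a
  bounded set in L_p into a uniformly bounded and equi-Lipschitz family, the input of an
  Arzela-Ascoli argument.\<close>

lemma conv_bounds:
  fixes K :: "'n::finite cfun"
  assumes K: "K \<in> schwartz" and p: "1 <= p" and M: "0 <= M"
  obtains D where "0 < D" "\<And>g y. Lp_fun p g ==> lpE p g <= ennreal M ==> norm (conv K g y) <= D"
    "\<And>g y z. Lp_fun p g ==> lpE p g <= ennreal M ==> norm (z - y) <= 1 ==> norm (conv K g z - conv K g y) <= D * norm (z - y)"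
proof -
  obtain B where B: "0 < B" "\<And>x. norm (K x) <= B * weight x" using schwartz_weight[OF K] by metis
  obtain C where C: "0 < C" "\<And>x h. norm h <= 1 ==> norm (K (x + h) - K x) <= C * norm h * weight x" using schwartz_lipschitz[OF K] by metis
  have [measurable]: "K \<in> borel_measurable borel" by (rule schwartz_measurable[OF K])
  define J where "J = (\<integral>x. weight (x::real^'n) \<partial>lborel) + M + 1"
  have "0 <= (\<integral>x. weight (x::real^'n) \<partial>lborel)" by (intro integral_nonneg_AE AE_I2 less_imp_le weight_pos)
  then have J: "0 < J" "(\<integral>x. weight (x::real^'n) \<partial>lborel) + M <= J" unfolding J_def using M by auto
  define c where "c = ftc TYPE('n)"
  have c: "0 < c" unfolding c_def by (rule ftc_pos)
  define D where "D = c * (B + C) * J"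
  show ?thesis
  proof (rule that[of D])
    show "0 < D" unfolding D_def using c B C J by simp
    fix g :: "'n cfun" and y z
    assume g: "Lp_fun p g" "lpE p g <= ennreal M"
    have "norm (\<integral>x. K (x - y) * g x \<partial>lborel) <= B * ((\<integral>x. weight (x::real^'n) \<partial>lborel) + M)"
      by (rule norm_conv_le(1)[OF g(1) p _ B(2) less_imp_le[OF B(1)] g(2) M]) simp
    also have "... <= (B + C) * J" using B C J M \<open>0 <= (\<integral>x. weight (x::real^'n) \<partial>lborel)\<close> by (intro mult_mono) auto
    finally have "c * norm (\<integral>x. K (x - y) * g x \<partial>lborel) <= c * ((B + C) * J)" using c by (intro mult_left_mono) auto
    then show "norm (conv K g y) <= D" using c by (simp add: conv_def norm_mult c_def D_def mult.assoc)
    assume zy: "norm (z - y) <= 1"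
    define H where "H x = K (x + (y - z)) - K x" for x
    have [measurable]: "H \<in> borel_measurable borel" unfolding H_def[abs_def] by measurable
    have Hb: "norm (H x) <= (C * norm (z - y)) * weight x" for x
      using C(2)[of "y - z" x] zy by (simp add: H_def norm_minus_commute)
    have C0: "0 <= C * norm (z - y)" using C by simp
    have i: "integrable lborel (%x. K (x - y) * g x)" for y
      by (rule norm_conv_le(2)[OF g(1) p _ B(2) less_imp_le[OF B(1)] g(2) M]) simp
    have "conv K g z - conv K g y = of_real c * (\<integral>x. H (x - y) * g x \<partial>lborel)"
    proof -
      have "(\<integral>x. H (x - y) * g x \<partial>lborel) = (\<integral>x. K (x - z) * g x - K (x - y) * g x \<partial>lborel)"
        unfolding H_def by (intro Bochner_Integration.integral_cong) (auto simp: algebra_simps)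
      also have "... = (\<integral>x. K (x - z) * g x \<partial>lborel) - (\<integral>x. K (x - y) * g x \<partial>lborel)" using i by simp
      finally show ?thesis by (simp add: conv_def c_def right_diff_distrib)
    qed
    moreover have "norm (\<integral>x. H (x - y) * g x \<partial>lborel) <= (C * norm (z - y)) * ((\<integral>x. weight (x::real^'n) \<partial>lborel) + M)"
      by (rule norm_conv_le(1)[OF g(1) p _ Hb C0 g(2) M]) simp
    ultimately have "norm (conv K g z - conv K g y) <= c * ((C * norm (z - y)) * ((\<integral>x. weight (x::real^'n) \<partial>lborel) + M))"
      using c by (simp add: norm_mult mult_left_mono)
    also have "... <= c * (((B + C) * norm (z - y)) * J)" using c B C J M \<open>0 <= (\<integral>x. weight (x::real^'n) \<partial>lborel)\<close> by (intro mult_left_mono mult_mono) auto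
    finally show "norm (conv K g z - conv K g y) <= D * norm (z - y)" by (simp add: D_def mult_ac)
  qed
qed

text \<open>A diagonal argument on a countable dense set, in all bands at once, extended to every
  point by the Lipschitz bound. Pointwise convergence is enough, as the uniform bounds allow
  dominated convergence on balls.\<close>

lemma pointwise_convergent_subseq:
  fixes F :: "nat => nat => 'n::finite cfun"
  assumes D: "\<And>j. 0 < D j" "\<And>k j x. norm (F k j x) <= D j" "\<And>k j x y. norm (y - x) <= 1 ==> norm (F k j y - F k j x) <= D j * norm (y - x)"
  obtains r where "strict_mono (r :: nat => nat)" "\<And>j x. convergent (%k. F (r k) j x)"
proof -
  obtain S :: "(real^'n) set" where S: "countable S" "\<And>X. open X ==> X ~= {} ==> \<exists>d\<in>S. d \<in> X"
    by (rule countable_dense_setE) blast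
  \<comment> \<open>Division by \<open>D j\<close> gives all bands the common bound 1, so one
    extraction over the pairs of a band and a dense point suffices.\<close>
  define G where "G k z = F k (fst z) (snd z) / of_real (D (fst z))" for k z
  have "countable (UNIV \<times> S :: (nat \<times> (real^'n)) set)" using S by auto
  moreover have "norm (G k z) <= 1" for k z unfolding G_def using D(2)[of k "fst z" "snd z"] D(1)[of "fst z"] by (simp add: norm_divide)
  ultimately obtain r where r: "strict_mono (r :: nat => nat)" "\<And>z. z \<in> UNIV \<times> S ==> \<exists>l. (%k. G (r k) z) \<longlonglongrightarrow> l"
    using function_convergent_subsequence[of "UNIV \<times> S" G 1] by metis
  have conv: "convergent (%k. F (r k) j d)" if d: "d \<in> S" for j d
  proof -
    obtain l where "(%k. G (r k) (j, d)) \<longlonglongrightarrow> l" using r(2)[of "(j, d)"] d by auto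
    then have "(%k. of_real (D j) * G (r k) (j, d)) \<longlonglongrightarrow> of_real (D j) * l" by (intro tendsto_mult tendsto_const)
    moreover have "of_real (D j) * G (r k) (j, d) = F (r k) j d" for k using D(1)[of j] by (simp add: G_def)
    ultimately show ?thesis by (auto simp: convergent_def)
  qed
  have "convergent (%k. F (r k) j x)" for j x
  proof -
    have "Cauchy (%k. F (r k) j x)"
    proof (rule metric_CauchyI)
      fix e :: real assume e: "0 < e"
      define \<delta> where "\<delta> = min 1 (e / (4 * D j))"
      have \<delta>: "0 < \<delta>" "\<delta> <= 1" "D j * \<delta> <= e / 4"
      proof -
        show "0 < \<delta>" "\<delta> <= 1" unfolding \<delta>_def using e D(1)[of j] by auto
        have "\<delta> <= e / (4 * D j)" unfolding \<delta>_def by simp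
        then show "D j * \<delta> <= e / 4" using D(1)[of j] by (simp add: field_simps)
      qed
      obtain d where d: "d \<in> S" "d \<in> ball x \<delta>" using S(2)[of "ball x \<delta>"] \<delta> by auto
      have xd: "norm (x - d) <= \<delta>" using d by (simp add: dist_norm)
      have near: "norm (F k j x - F k j d) <= e / 4" for k
      proof -
        have "norm (F k j x - F k j d) <= D j * norm (x - d)" using xd \<delta> by (intro D(3)) linarith
        also have "... <= D j * \<delta>" using xd D(1)[of j] by (intro mult_left_mono) auto
        finally show ?thesis using \<delta> by simp
      qed
      have "Cauchy (%k. F (r k) j d)" using conv[OF d(1)] by (rule convergent_Cauchy)
      then obtain K where K: "\<And>m n. K <= m ==> K <= n ==> dist (F (r m) j d) (F (r n) j d) < e / 2"
        using metric_CauchyD[of _ "e / 2"] e by (metis half_gt_zero)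
      have "dist (F (r m) j x) (F (r n) j x) < e" if "K <= m" "K <= n" for m n
      proof -
        have "dist (F (r m) j x) (F (r n) j x) <= dist (F (r m) j x) (F (r m) j d) + dist (F (r m) j d) (F (r n) j d) + dist (F (r n) j d) (F (r n) j x)"
          by (metis add_right_mono dist_triangle order_trans)
        also have "... < e / 4 + e / 2 + e / 4"
          using near[of "r m"] near[of "r n"] K[OF that] by (auto simp: dist_norm norm_minus_commute intro!: add_le_less_mono add_less_le_mono)
        finally show ?thesis by simp
      qed
      then show "\<exists>K. \<forall>m\<ge>K. \<forall>n\<ge>K. dist (F (r m) j x) (F (r n) j x) < e" by blast
    qed
    then show ?thesis by (rule Cauchy_convergent)
  qed
  then show ?thesis using that r(1) by blast
qed

lemma ennreal_suminf_shift_le: "(\<Sum>j. f (j + L)) <= (\<Sum>j. f j)" for f :: "nat => ennreal"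
  using suminf_offset[OF summableI, of f L] by simp

lemma powr_norm_tendsto:
  fixes a :: "nat => complex"
  assumes "a \<longlonglongrightarrow> b" "0 < p"
  shows "(%k. ennreal (norm (a k) powr p)) \<longlonglongrightarrow> ennreal (norm b powr p)"
  using assms by (intro tendsto_ennrealI tendsto_powr2 tendsto_norm tendsto_const) auto

context cutoff

begin

text \<open>A subsequence converges pointwise in every band, and the limits of the pieces are summed
  to g. On a ball finitely many bands converge by dominated convergence, while the others are small
  uniformly in k because s > 0. Weak convergence finally shows that the pieces of f are the limits
  of the pieces, which gives f the same norm bound.\<close>

lemma local_compactness:
  fixes fs :: "nat => 'n distr"
  assumes p: "1 <= p" and s: "0 < s" and M: "0 <= M" and fs: "\<And>k. tempered (fs k)" "\<And>k. BE s p (fs k) <= ennreal M"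
  obtains r f \<gamma> g N where "strict_mono (r :: nat => nat)" "tempered f" "BE s p f <= ennreal M"
    "\<forall>k. Lp_fun p (\<gamma> k)" "\<forall>k. represents (\<gamma> k) (fs (r k))" "Lp_fun p g" "represents g f" "0 <= N"
    "\<forall>k. lpE p (%x. \<gamma> k x - g x) <= ennreal N"
    "\<forall>R. (%k. lpE p (%x. (\<gamma> k x - g x) * indicator (cball 0 R) x)) \<longlonglongrightarrow> 0"
proof -
  have p0: "0 < p" using p by simp
  obtain C where C: "0 < C" "\<And>T. tempered T ==> BE s p T < \<infinity> ==> dE p T <= ennreal C * BE s p T"
    using Lp_le_Besov[OF p s] by blast
  define M1 where "M1 = C * M"
  have M1: "0 <= M1" unfolding M1_def using C M by simp
  have "\<exists>g. Lp_fun p g \<and> represents g (fs k) \<and> lpE p g <= ennreal M1" for k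
  proof -
    have fin: "BE s p (fs k) < \<infinity>" using fs(2)[of k] by (rule le_less_trans) simp
    have "dE p (fs k) <= ennreal C * BE s p (fs k)" by (rule C(2)[OF fs(1) fin])
    also have "... <= ennreal C * ennreal M" by (intro mult_left_mono fs) auto
    also have "... = ennreal M1" unfolding M1_def using C M by (intro ennreal_mult[symmetric]) auto
    finally have d: "dE p (fs k) <= ennreal M1" .
    then have "dE p (fs k) < \<infinity>" by (rule le_less_trans) simp
    then obtain g where "Lp_fun p g" "represents g (fs k)" "lpE p g = dE p (fs k)" using dE_finite p by blast
    then show ?thesis using d by metis
  qed
  then obtain \<gamma> where \<gamma>: "\<And>k. Lp_fun p (\<gamma> k)" "\<And>k. represents (\<gamma> k) (fs k)" "\<And>k. lpE p (\<gamma> k) <= ennreal M1" by metis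
  have \<gamma>m[measurable]: "\<gamma> k \<in> borel_measurable borel" for k using \<gamma>(1)[of k] by (simp add: Lp_fun_iff)
  define K where "K j = FT (phi j)" for j
  have KS: "K j \<in> schwartz" for j unfolding K_def by (intro FT_schwartz phij_schwartz)
  have Km[measurable]: "K j \<in> borel_measurable borel" for j by (rule schwartz_measurable[OF KS])
  define F where "F k j = conv (K j) (\<gamma> k)" for k j
  have Fm[measurable]: "F k j \<in> borel_measurable borel" for k j unfolding F_def by (rule conv_measurable) auto
  have Frep: "represents (F k j) (piece j (fs k))" for k j unfolding F_def K_def by (rule piece_represents[OF \<gamma>(1,2) p])
  obtain C' where C': "0 < C'" "\<And>j g. g \<in> borel_measurable borel ==> lpE p (conv (FT (phi j)) g) <= ennreal C' * lpE p g"
    using conv_phij_le[OF p] by blast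
  have FL: "Lp_fun p (F k j)" for k j
  proof -
    have "lpE p (F k j) <= ennreal C' * lpE p (\<gamma> k)" unfolding F_def K_def by (rule C'(2)) simp
    also have "... < \<infinity>" using \<gamma>(1)[of k] by (simp add: Lp_fun_iff ennreal_mult_less_top)
    finally show ?thesis by (simp add: Lp_fun_iff)
  qed
  have FE: "(\<Sum>j. ennreal (2 powr (real j * s * p)) * lpE p (F k j)) <= ennreal M" for k
    using fs(2)[of k] unfolding bE_def by (simp add: dE_eq[OF FL Frep p])
  have Ffin: "(\<Sum>j. ennreal (2 powr (real j * s * p)) * lpE p (F k j)) < \<infinity>" for k
    using FE[of k] by (rule le_less_trans) simp
  define Q where "Q j D \<longleftrightarrow> 0 < D \<and> (\<forall>g y. Lp_fun p g \<longrightarrow> lpE p g <= ennreal M1 \<longrightarrow> norm (conv (K j) g y) <= D) \<and>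
    (\<forall>g y z. Lp_fun p g \<longrightarrow> lpE p g <= ennreal M1 \<longrightarrow> norm (z - y) <= 1 \<longrightarrow> norm (conv (K j) g z - conv (K j) g y) <= D * norm (z - y))" for j D
  have "\<exists>D. Q j D" for j
  proof (rule conv_bounds[OF KS p M1, of j])
    fix D assume "0 < D" and "\<And>g y. Lp_fun p g ==> lpE p g <= ennreal M1 ==> norm (conv (K j) g y) <= D"
      and "\<And>g y z. Lp_fun p g ==> lpE p g <= ennreal M1 ==> norm (z - y) <= 1 ==> norm (conv (K j) g z - conv (K j) g y) <= D * norm (z - y)"
    then show "\<exists>D. Q j D" unfolding Q_def by (intro exI[of _ D] conjI allI impI) auto
  qed
  then obtain D where DQ: "\<And>j. Q j (D j)" by metis
  have D: "\<And>j. 0 < D j" "\<And>k j x. norm (F k j x) <= D j" "\<And>k j x y. norm (y - x) <= 1 ==> norm (F k j y - F k j x) <= D j * norm (y - x)"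
    using DQ \<gamma> unfolding Q_def F_def by blast+
  obtain r where r: "strict_mono (r :: nat => nat)" "\<And>j x. convergent (%k. F (r k) j x)" by (rule pointwise_convergent_subseq[where D = D and F = F, OF D]) blast+
  define b where "b j x = lim (%k. F (r k) j x)" for j x
  have bl: "(%k. F (r k) j x) \<longlonglongrightarrow> b j x" for j x unfolding b_def using r(2) by (simp add: convergent_LIMSEQ_iff)
  have bm[measurable]: "b j \<in> borel_measurable borel" for j
    by (rule borel_measurable_LIMSEQ_metric[of "%k. F (r k) j"]) (use bl in auto)
  have bD: "norm (b j x) <= D j" for j x
    by (rule tendsto_upperbound[OF tendsto_norm[OF bl]]) (use D(2) in auto)
  \<comment> \<open>Fatou's lemma is applied to finite partial sums in j; the bound for the series
    follows because it does not depend on J.\<close>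
  have bE: "(\<Sum>j. ennreal (2 powr (real j * s * p)) * lpE p (b j)) <= ennreal M"
  proof (rule suminf_le_const[OF summableI])
    fix J
    have eq: "(\<Sum>j<J. ennreal (2 powr (real j * s * p)) * lpE p (a j)) = (\<integral>\<^sup>+x. (\<Sum>j<J. ennreal (2 powr (real j * s * p)) * ennreal (norm (a j x) powr p)) \<partial>lborel)"
      if [measurable]: "\<And>j. a j \<in> borel_measurable borel" for a :: "nat => 'n cfun"
      unfolding lpE_def by (subst nn_integral_sum) (auto simp: nn_integral_cmult)
    have "(\<Sum>j<J. ennreal (2 powr (real j * s * p)) * lpE p (b j)) =
      (\<integral>\<^sup>+x. liminf (%k. \<Sum>j<J. ennreal (2 powr (real j * s * p)) * ennreal (norm (F (r k) j x) powr p)) \<partial>lborel)"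
      unfolding eq[OF bm]
    proof (intro nn_integral_cong)
      fix x
      have "(%k. \<Sum>j<J. ennreal (2 powr (real j * s * p)) * ennreal (norm (F (r k) j x) powr p)) \<longlonglongrightarrow>
        (\<Sum>j<J. ennreal (2 powr (real j * s * p)) * ennreal (norm (b j x) powr p))"
        by (intro tendsto_sum ennreal_tendsto_cmult powr_norm_tendsto bl p0) auto
      then show "(\<Sum>j<J. ennreal (2 powr (real j * s * p)) * ennreal (norm (b j x) powr p)) =
         liminf (%k. \<Sum>j<J. ennreal (2 powr (real j * s * p)) * ennreal (norm (F (r k) j x) powr p))"
        by (rule lim_imp_Liminf[symmetric, rotated]) simp
    qed
    also have "... <= liminf (%k. \<integral>\<^sup>+x. (\<Sum>j<J. ennreal (2 powr (real j * s * p)) * ennreal (norm (F (r k) j x) powr p)) \<partial>lborel)"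
      by (rule nn_integral_liminf) measurable
    also have "... <= liminf (%k. ennreal M)"
    proof (intro Liminf_mono always_eventually allI)
      fix k
      have "(\<integral>\<^sup>+x. (\<Sum>j<J. ennreal (2 powr (real j * s * p)) * ennreal (norm (F (r k) j x) powr p)) \<partial>lborel) = (\<Sum>j<J. ennreal (2 powr (real j * s * p)) * lpE p (F (r k) j))"
        by (rule eq[OF Fm, symmetric])
      also have "... <= (\<Sum>j. ennreal (2 powr (real j * s * p)) * lpE p (F (r k) j))" by (rule sum_le_suminf[OF summableI]) auto
      also have "... <= ennreal M" by (rule FE)
      finally show "(\<integral>\<^sup>+x. (\<Sum>j<J. ennreal (2 powr (real j * s * p)) * ennreal (norm (F (r k) j x) powr p)) \<partial>lborel) <= ennreal M" .
    qed
    also have "... = ennreal M" by (rule Liminf_const) simp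
    finally show "(\<Sum>j<J. ennreal (2 powr (real j * s * p)) * lpE p (b j)) <= ennreal M" .
  qed
  have bfin: "(\<Sum>j. ennreal (2 powr (real j * s * p)) * lpE p (b j)) < \<infinity>" using bE by (rule le_less_trans) simp
  obtain g G where g: "g \<in> borel_measurable borel" "Lp_fun p G" "AE x in lborel. (%J. \<Sum>j\<le>J. b j x) \<longlonglongrightarrow> g x"
    "AE x in lborel. \<forall>J. norm (\<Sum>j\<le>J. b j x) <= norm (G x)" "AE x in lborel. norm (g x) <= norm (G x)"
    using lp_limit[OF bm s p bfin] .
  note [measurable] = g(1)
  have Lg: "Lp_fun p g"
  proof -
    have "lpE p g <= lpE p G" unfolding lpE_def
      by (rule nn_integral_mono_AE) (use g(5) p0 in \<open>auto elim!: eventually_mono intro!: ennreal_leI powr_mono2\<close>)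
    then show ?thesis using g(1,2) by (auto simp: Lp_fun_iff intro: le_less_trans)
  qed
  define h where "h k x = \<gamma> (r k) x - g x" for k x
  have hm[measurable]: "h k \<in> borel_measurable borel" for k unfolding h_def[abs_def] by measurable
  define c where "c k j x = F (r k) j x - b j x" for k j x
  have cm[measurable]: "c k j \<in> borel_measurable borel" for k j unfolding c_def[abs_def] by measurable
  \<comment> \<open>The pieces of \<open>fs (r k)\<close> sum up to some representing function g',
    which \<open>represents_unique\<close> identifies with \<open>\<gamma> (r k)\<close>.\<close>
  have hsum: "AE x in lborel. (%J. \<Sum>j\<le>J. c k j x) \<longlonglongrightarrow> h k x" for k
  proof -
    obtain g' G' where g': "g' \<in> borel_measurable borel" "Lp_fun p G'" "AE x in lborel. (%J. \<Sum>j\<le>J. F (r k) j x) \<longlonglongrightarrow> g' x"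
      "AE x in lborel. \<forall>J. norm (\<Sum>j\<le>J. F (r k) j x) <= norm (G' x)" "AE x in lborel. norm (g' x) <= norm (G' x)"
      using lp_limit[OF Fm s p Ffin, of "r k"] .
    have rep: "represents g' (fs (r k))" by (rule pieces_sum_represents[OF fs(1) FL Frep p g'(1,3,2,4)])
    have "lpE p g' <= lpE p G'" unfolding lpE_def
      by (rule nn_integral_mono_AE) (use g'(5) p0 in \<open>auto elim!: eventually_mono intro!: ennreal_leI powr_mono2\<close>)
    then have "Lp_fun p g'" using g'(1,2) by (auto simp: Lp_fun_iff intro: le_less_trans)
    then have "AE x in lborel. g' x = \<gamma> (r k) x"
      by (intro represents_unique[OF _ _ rep \<gamma>(2)] Lp_fun_tame[OF _ p] \<gamma>(1))
    then show ?thesis using g'(3) g(3)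
    proof eventually_elim
      case (elim x)
      have "(%J. (\<Sum>j\<le>J. F (r k) j x) - (\<Sum>j\<le>J. b j x)) \<longlonglongrightarrow> g' x - g x" by (intro tendsto_diff elim)
      then show ?case using elim(1) by (simp add: c_def h_def sum_subtractf)
    qed
  qed
  define M2 where "M2 = 2 powr p * (M + M)"
  have M2: "0 <= M2" unfolding M2_def using M by simp
  have cE: "(\<Sum>j. ennreal (2 powr (real j * s * p)) * lpE p (c k j)) <= ennreal M2" for k
  proof -
    have "(\<Sum>j. ennreal (2 powr (real j * s * p)) * lpE p (c k j)) <= (\<Sum>j. ennreal (2 powr p) * (ennreal (2 powr (real j * s * p)) * lpE p (F (r k) j) + ennreal (2 powr (real j * s * p)) * lpE p (b j)))"
    proof (intro suminf_le)
      fix j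
      have "lpE p (c k j) <= ennreal (2 powr p) * (lpE p (F (r k) j) + lpE p (b j))" unfolding c_def[abs_def] by (rule lpE_diff[OF Fm bm p0])
      from mult_left_mono[OF this, of "ennreal (2 powr (real j * s * p))"]
      show "ennreal (2 powr (real j * s * p)) * lpE p (c k j) <= ennreal (2 powr p) * (ennreal (2 powr (real j * s * p)) * lpE p (F (r k) j) + ennreal (2 powr (real j * s * p)) * lpE p (b j))"
        by (simp add: distrib_left mult_ac)
    qed auto
    also have "... = ennreal (2 powr p) * ((\<Sum>j. ennreal (2 powr (real j * s * p)) * lpE p (F (r k) j)) + (\<Sum>j. ennreal (2 powr (real j * s * p)) * lpE p (b j)))"
      by (simp add: suminf_add[symmetric])
    also have "... <= ennreal (2 powr p) * (ennreal M + ennreal M)" by (intro mult_left_mono add_mono FE bE) auto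
    also have "... = ennreal M2"
      unfolding M2_def by (simp only: ennreal_mult[OF powr_ge_zero add_nonneg_nonneg[OF M M]] ennreal_plus[OF M M])
    finally show ?thesis .
  qed
  obtain W where W: "0 < W" "summable (%j. 2 powr (real j * - s))" "(\<Sum>j. 2 powr (real j * - s)) = W" using suminf_powr2[of "- s"] s by (metis neg_less_0_iff_less)
  have local: "(%k. lpE p (%x. h k x * indicator (cball 0 R) x)) \<longlonglongrightarrow> 0" for R
  proof (rule ennreal_tendsto_0_approx)
    fix e :: real assume e: "0 < e"
    let ?B = "cball 0 R :: (real^'n) set"
    have [measurable]: "?B \<in> sets borel" by (intro borel_closed closed_cball)
    \<comment> \<open>Collects the constants of the tail estimate: \<open>2 powr p\<close> from
      splitting off the head, \<open>W powr p\<close> from \<open>lp_series\<close> and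
      \<open>M2\<close> from the norm bound on the pieces \<open>c k j\<close>.\<close>
    define A where "A = 2 powr p * W powr p * M2"
    have "\<exists>L::nat. A * 2 powr (real L * (- (s * p))) <= e"
    proof -
      have "- (s * p) < 0" using s p0 by simp
      then have "summable (%L. 2 powr (real L * (- (s * p))))" using suminf_powr2 by metis
      then have "(%L. 2 powr (real L * (- (s * p)))) \<longlonglongrightarrow> 0" by (rule summable_LIMSEQ_zero)
      then have "(%L. A * 2 powr (real L * (- (s * p)))) \<longlonglongrightarrow> 0" by (rule tendsto_mult_right_zero)
      then have "\<forall>\<^sub>F L in sequentially. A * 2 powr (real L * (- (s * p))) < e" using e by (intro order_tendstoD) auto
      then obtain L where "A * 2 powr (real L * (- (s * p))) < e" unfolding eventually_sequentially by auto
      then show ?thesis by (intro exI[of _ L]) simp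
    qed
    then obtain L :: nat where L: "A * 2 powr (real L * (- (s * p))) <= e" by blast
    \<comment> \<open>\<open>hd\<close> consists of the first L bands on the ball, \<open>tl\<close>
      is a majorant for the remaining ones.\<close>
    define hd where "hd k x = (\<Sum>j<L. c k j x) * indicator ?B x" for k x
    have hdm[measurable]: "hd k \<in> borel_measurable borel" for k unfolding hd_def[abs_def] by measurable
    define tl where "tl k x = complex_of_real (\<Sum>j. norm (c k (j + L) x))" for k x
    have tlm[measurable]: "tl k \<in> borel_measurable borel" for k
    proof -
      have "(%x. \<Sum>j. norm (c k (j + L) x)) \<in> borel_measurable borel" by measurable
      then show ?thesis unfolding tl_def[abs_def] by measurable
    qed
    \<comment> \<open>Starting the series at L gains the factor \<open>2 powr (- L * s * p)\<close>
      from the weights; this is where s > 0 makes the high bands small uniformly in k.\<close>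
    have shift: "(\<Sum>j. ennreal (2 powr (real j * s * p)) * lpE p (c k (j + L))) <= ennreal (2 powr (real L * (- (s * p)))) * ennreal M2" for k
    proof -
      have "ennreal (2 powr (real j * s * p)) * lpE p (c k (j + L)) = ennreal (2 powr (real L * (- (s * p)))) * (ennreal (2 powr (real (j + L) * s * p)) * lpE p (c k (j + L)))" for j
      proof -
        have "2 powr (real j * s * p) = 2 powr (real L * (- (s * p))) * 2 powr (real (j + L) * s * p)"
          unfolding powr_add[symmetric] by (simp add: algebra_simps)
        then show ?thesis by (simp add: ennreal_mult mult.assoc)
      qed
      then have "(\<Sum>j. ennreal (2 powr (real j * s * p)) * lpE p (c k (j + L))) = ennreal (2 powr (real L * (- (s * p)))) * (\<Sum>j. ennreal (2 powr (real (j + L) * s * p)) * lpE p (c k (j + L)))"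
        by simp
      also have "(\<Sum>j. ennreal (2 powr (real (j + L) * s * p)) * lpE p (c k (j + L))) <= (\<Sum>j. ennreal (2 powr (real j * s * p)) * lpE p (c k j))"
        by (rule ennreal_suminf_shift_le[of "%j. ennreal (2 powr (real j * s * p)) * lpE p (c k j)" L])
      also have "... <= ennreal M2" by (rule cE)
      finally show ?thesis by (simp add: mult_left_mono)
    qed
    have sfin: "(\<Sum>j. ennreal (2 powr (real j * s * p)) * lpE p (c k (j + L))) < \<infinity>" for k
      using shift[of k] by (rule le_less_trans) (simp add: ennreal_mult_less_top)
    have tlE: "lpE p (tl k) <= ennreal (W powr p * (2 powr (real L * (- (s * p))) * M2))" and sm: "AE x in lborel. summable (%j. norm (c k (j + L) x))" for k
    proof -
      have cmL: "\<And>j. c k (j + L) \<in> borel_measurable borel" by (rule cm)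
      note LS = lp_series[OF cmL s p0 W(2,3) sfin]
      show "AE x in lborel. summable (%j. norm (c k (j + L) x))" by (rule LS(1))
      have "lpE p (tl k) = (\<integral>\<^sup>+x. ennreal ((\<Sum>j. norm (c k (j + L) x)) powr p) \<partial>lborel)"
        unfolding lpE_def by (rule nn_integral_cong_AE) (use LS(1) in \<open>auto elim!: eventually_mono simp: tl_def suminf_nonneg\<close>)
      also have "... <= ennreal (W powr p) * (\<Sum>j. ennreal (2 powr (real j * s * p)) * lpE p (c k (j + L)))" by (rule LS(2))
      also have "... <= ennreal (W powr p) * (ennreal (2 powr (real L * (- (s * p)))) * ennreal M2)" by (intro mult_left_mono shift) auto
      also have "... = ennreal (W powr p * (2 powr (real L * (- (s * p))) * M2))" using M2 by (simp add: ennreal_mult)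
      finally show "lpE p (tl k) <= ennreal (W powr p * (2 powr (real L * (- (s * p))) * M2))" .
    qed
    have "lpE p (%x. h k x * indicator ?B x) <= ennreal (2 powr p) * lpE p (hd k) + ennreal e" for k
    proof -
      have "lpE p (%x. h k x * indicator ?B x) <= lpE p (%x. of_real (norm (hd k x)) + tl k x)"
        unfolding lpE_def
      proof (rule nn_integral_mono_AE)
        show "AE x in lborel. ennreal (norm (h k x * indicator ?B x) powr p) <= ennreal (norm (of_real (norm (hd k x)) + tl k x) powr p)"
          using hsum[of k] sm[of k]
        proof eventually_elim
          case (elim x)
          define t where "t = (\<Sum>j. norm (c k (j + L) x))"
          have t: "0 <= t" unfolding t_def by (intro suminf_nonneg elim) auto
          have "norm (h k x) <= norm (\<Sum>j<L. c k j x) + t"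
          proof (rule tendsto_upperbound[OF tendsto_norm[OF elim(1)]])
            have "norm (\<Sum>j\<le>J. c k j x) <= norm (\<Sum>j<L. c k j x) + t" if "L <= J" for J
            proof -
              have "(\<Sum>j\<le>J. c k j x) = (\<Sum>j<L. c k j x) + (\<Sum>j\<in>{L..J}. c k j x)"
              proof -
                have "{..J} = {..<L} \<union> {L..J}" "{..<L} \<inter> {L..J} = {}" using that by auto
                then show ?thesis using sum.union_disjoint[of "{..<L}" "{L..J}" "%j. c k j x"] by (simp only: finite_lessThan finite_atLeastAtMost)
              qed
              also have "(\<Sum>j\<in>{L..J}. c k j x) = (\<Sum>j\<le>J - L. c k (j + L) x)"
                using sum.shift_bounds_cl_nat_ivl[of "%j. c k j x" 0 L "J - L"] that by (simp add: atLeast0AtMost)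
              finally have "norm (\<Sum>j\<le>J. c k j x) <= norm (\<Sum>j<L. c k j x) + norm (\<Sum>j\<le>J - L. c k (j + L) x)" by (simp add: norm_triangle_ineq)
              also have "norm (\<Sum>j\<le>J - L. c k (j + L) x) <= t"
                unfolding t_def by (rule order_trans[OF norm_sum sum_le_suminf[OF elim(2)]]) auto
              finally show ?thesis by simp
            qed
            then show "\<forall>\<^sub>F J in sequentially. norm (\<Sum>j\<le>J. c k j x) <= norm (\<Sum>j<L. c k j x) + t"
              unfolding eventually_sequentially by blast
          qed simp
          moreover have "norm (of_real (norm (hd k x)) + tl k x) = norm (hd k x) + t"
            unfolding tl_def t_def[symmetric] using t by (simp flip: of_real_add)
          ultimately have "norm (h k x * indicator ?B x) <= norm (of_real (norm (hd k x)) + tl k x)"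
            using t by (cases "x \<in> ?B") (auto simp: hd_def)
          then show ?case using p0 by (intro ennreal_leI powr_mono2) auto
        qed
      qed
      also have "... <= ennreal (2 powr p) * (lpE p (%x. of_real (norm (hd k x))) + lpE p (tl k))"
        by (rule lpE_add[OF _ tlm p0]) measurable
      also have "lpE p (%x. of_real (norm (hd k x))) = lpE p (hd k)" by (simp add: lpE_def)
      also have "ennreal (2 powr p) * (lpE p (hd k) + lpE p (tl k)) <= ennreal (2 powr p) * lpE p (hd k) + ennreal e"
      proof -
        have "ennreal (2 powr p) * lpE p (tl k) <= ennreal (2 powr p) * ennreal (W powr p * (2 powr (real L * (- (s * p))) * M2))" by (intro mult_left_mono tlE) auto
        also have "... = ennreal (A * 2 powr (real L * (- (s * p))))" unfolding A_def using M2 by (simp add: mult_ac flip: ennreal_mult)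
        also have "... <= ennreal e" by (intro ennreal_leI L)
        finally show ?thesis by (simp add: distrib_left add_left_mono)
      qed
      finally show ?thesis .
    qed
    moreover have "(%k. ennreal (2 powr p) * lpE p (hd k)) \<longlonglongrightarrow> 0"
    proof -
      have "(%k. \<integral>\<^sup>+x. ennreal (norm (hd k x) powr p) \<partial>lborel) \<longlonglongrightarrow> (\<integral>\<^sup>+x. 0 \<partial>(lborel :: (real^'n) measure))"
      proof (rule nn_integral_dominated_convergence[where w = "%x. ennreal ((\<Sum>j<L. 2 * D j) powr p) * indicator ?B x"])
        show "(\<integral>\<^sup>+x. ennreal ((\<Sum>j<L. 2 * D j) powr p) * indicator ?B x \<partial>lborel) < \<infinity>"
          by (simp add: nn_integral_cmult_indicator ennreal_mult_less_top emeasure_lborel_cball_finite[unfolded infinity_ennreal_def])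
        show "AE x in lborel. ennreal (norm (hd k x) powr p) <= ennreal ((\<Sum>j<L. 2 * D j) powr p) * indicator ?B x" for k
        proof (intro AE_I2)
          fix x
          have "norm (\<Sum>j<L. c k j x) <= (\<Sum>j<L. 2 * D j)"
          proof (rule order_trans[OF norm_sum sum_mono])
            fix j
            show "norm (c k j x) <= 2 * D j" unfolding c_def using norm_triangle_ineq4[of "F (r k) j x" "b j x"] D(2)[of "r k" j x] bD[of j x] by linarith
          qed
          then have "norm (\<Sum>j<L. c k j x) powr p <= (\<Sum>j<L. 2 * D j) powr p" using p0 by (intro powr_mono2) auto
          then show "ennreal (norm (hd k x) powr p) <= ennreal ((\<Sum>j<L. 2 * D j) powr p) * indicator ?B x"
            by (cases "x \<in> ?B") (auto simp: hd_def ennreal_leI)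
        qed
        show "AE x in lborel. (%k. ennreal (norm (hd k x) powr p)) \<longlonglongrightarrow> 0"
        proof (intro AE_I2)
          fix x
          have "(%k. (\<Sum>j<L. F (r k) j x - b j x) * indicator ?B x) \<longlonglongrightarrow> (\<Sum>j<L. b j x - b j x) * indicator ?B x"
            by (intro tendsto_mult tendsto_sum tendsto_diff bl tendsto_const)
          then have "(%k. hd k x) \<longlonglongrightarrow> 0" by (simp add: hd_def c_def)
          from powr_norm_tendsto[OF this p0] show "(%k. ennreal (norm (hd k x) powr p)) \<longlonglongrightarrow> 0" using p0 by simp
        qed
      qed measurable
      then have "(%k. lpE p (hd k)) \<longlonglongrightarrow> 0" by (simp add: lpE_def)
      then show ?thesis by (rule ennreal_tendsto_0_le[of _ _ "2 powr p"]) simp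
    qed
    ultimately show "\<exists>y. y \<longlonglongrightarrow> 0 \<and> (\<forall>k. lpE p (%x. h k x * indicator ?B x) <= y k + ennreal e)" by blast
  qed
  define N where "N = 2 powr p * (M1 + enn2real (lpE p g))"
  have N0: "0 <= N" unfolding N_def using M1 by simp
  have hN: "lpE p (h k) <= ennreal N" for k
  proof -
    have "lpE p (h k) <= ennreal (2 powr p) * (lpE p (\<gamma> (r k)) + lpE p g)" unfolding h_def[abs_def] by (rule lpE_diff[OF \<gamma>m g(1) p0])
    also have "... <= ennreal (2 powr p) * (ennreal M1 + lpE p g)" by (intro mult_left_mono add_mono \<gamma>) auto
    also have "lpE p g = ennreal (enn2real (lpE p g))" using Lg by (simp add: Lp_fun_iff less_top)
    also have "ennreal (2 powr p) * (ennreal M1 + ennreal (enn2real (lpE p g))) = ennreal N"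
      unfolding N_def using M1 by (simp add: ennreal_mult)
    finally show ?thesis .
  qed
  define f where "f = distr_of g"
  have tf: "tempered f" unfolding f_def by (rule tempered_distr_of[OF Lp_fun_tame[OF Lg p]])
  have repf: "represents g f" unfolding f_def by (rule represents_distr_of)
  \<comment> \<open>For fixed y a convolution is a pairing with one Schwartz function, so
    \<open>weak_null\<close> passes to the limit in each band.\<close>
  have convg: "conv (K j) g = b j" for j
  proof
    fix y
    define \<psi> where "\<psi> x = K j (x - y)" for x
    have S: "\<psi> \<in> schwartz" unfolding \<psi>_def[abs_def] using schwartz_affine[OF KS[of j], where c = 1 and a = "- y"] by simp
    have i: "integrable lborel (%x. u x * \<psi> x)" if "Lp_fun p u" for u by (rule tame_schwartz_integrable[OF Lp_fun_tame[OF that p] S])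
    have wn: "(%k. \<integral>\<^sup>+x. ennreal (norm (h k x * \<psi> x)) \<partial>lborel) \<longlonglongrightarrow> 0"
      by (rule weak_null[OF hm p hN N0 local S])
    have "(%k. ennreal (norm ((\<integral>x. \<gamma> (r k) x * \<psi> x \<partial>lborel) - (\<integral>x. g x * \<psi> x \<partial>lborel)))) \<longlonglongrightarrow> 0"
    proof (rule tendsto_sandwich[OF _ _ tendsto_const[of 0] wn])
      show "\<forall>\<^sub>F k in sequentially. ennreal (norm ((\<integral>x. \<gamma> (r k) x * \<psi> x \<partial>lborel) - (\<integral>x. g x * \<psi> x \<partial>lborel))) <= (\<integral>\<^sup>+x. ennreal (norm (h k x * \<psi> x)) \<partial>lborel)"
      proof (intro always_eventually allI)
        fix k
        have "(\<integral>x. \<gamma> (r k) x * \<psi> x \<partial>lborel) - (\<integral>x. g x * \<psi> x \<partial>lborel) = (\<integral>x. h k x * \<psi> x \<partial>lborel)"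
          using i[OF \<gamma>(1)] i[OF Lg] by (simp add: h_def left_diff_distrib)
        moreover have "integrable lborel (%x. h k x * \<psi> x)" using i[OF \<gamma>(1)] i[OF Lg] by (simp add: h_def left_diff_distrib)
        ultimately show "ennreal (norm ((\<integral>x. \<gamma> (r k) x * \<psi> x \<partial>lborel) - (\<integral>x. g x * \<psi> x \<partial>lborel))) <= (\<integral>\<^sup>+x. ennreal (norm (h k x * \<psi> x)) \<partial>lborel)"
          by (simp add: integral_norm_bound_ennreal)
      qed
    qed simp
    then have "(%k. norm ((\<integral>x. \<gamma> (r k) x * \<psi> x \<partial>lborel) - (\<integral>x. g x * \<psi> x \<partial>lborel))) \<longlonglongrightarrow> 0"
      using tendsto_ennreal_iff[of "%k. norm ((\<integral>x. \<gamma> (r k) x * \<psi> x \<partial>lborel) - (\<integral>x. g x * \<psi> x \<partial>lborel))" sequentially 0] by simp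
    then have "(%k. \<integral>x. \<gamma> (r k) x * \<psi> x \<partial>lborel) \<longlonglongrightarrow> (\<integral>x. g x * \<psi> x \<partial>lborel)"
      by (rule LIM_zero_cancel[OF tendsto_norm_zero_cancel])
    then have "(%k. of_real (ftc TYPE('n)) * (\<integral>x. \<gamma> (r k) x * \<psi> x \<partial>lborel)) \<longlonglongrightarrow> of_real (ftc TYPE('n)) * (\<integral>x. g x * \<psi> x \<partial>lborel)"
      by (intro tendsto_mult tendsto_const)
    then have "(%k. F (r k) j y) \<longlonglongrightarrow> conv (K j) g y" by (simp add: F_def conv_def \<psi>_def mult.commute)
    then show "conv (K j) g y = b j y" using bl LIMSEQ_unique by blast
  qed
  have "BE s p f <= ennreal M"
  proof -
    have "dE p (piece j f) <= lpE p (b j)" for j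
      using dE_le[OF _ piece_represents[OF Lg repf p, of j] p] bm[of j] convg[of j] by (simp add: K_def)
    then have "BE s p f <= (\<Sum>j. ennreal (2 powr (real j * s * p)) * lpE p (b j))"
      unfolding bE_def by (intro suminf_le mult_left_mono) auto
    then show ?thesis using bE by (rule order_trans)
  qed
  have hN': "lpE p (%x. \<gamma> (r k) x - g x) <= ennreal N" for k using hN[of k] by (simp add: h_def[abs_def])
  from r(1) tf \<open>BE s p f <= ennreal M\<close> _ _ Lg repf N0 show ?thesis
    by (rule that[of r f "%k. \<gamma> (r k)" g N]) (use \<gamma> hN' local in \<open>auto simp: h_def\<close>)
qed

end

section \<open>Compactness\<close>

lemma represents_diff:
  assumes "tame g" "tame h" "represents g T" "represents h S"
  shows "represents (%x. g x - h x) (diff_d T S)"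
  using assms tame_schwartz_integrable[OF assms(1)] tame_schwartz_integrable[OF assms(2)]
  by (auto simp: represents_def diff_d_def left_diff_distrib)

lemma bounded_tame:
  fixes u :: "'n::finite cfun"
  assumes [measurable]: "u \<in> borel_measurable borel" and b: "\<And>x. norm (u x) <= B"
  shows "tame u"
  unfolding tame_def
proof
  show "integrable lborel (%x. weight x * norm (u x))"
  proof (rule Bochner_Integration.integrable_bound)
    show "integrable lborel (%x::real^'n. weight x * B)" by (intro integrable_mult_left integrable_weight)
    show "AE x in lborel. norm (weight x * norm (u x)) <= norm (weight x * B)"
    proof (intro AE_I2)
      fix x
      have "weight x * norm (u x) <= weight x * B" using weight_pos[of x] by (intro mult_left_mono b) auto
      moreover have "0 <= B" using b[of x] norm_ge_zero[of "u x"] by linarith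
      ultimately show "norm (weight x * norm (u x)) <= norm (weight x * B)" using weight_pos[of x] by (simp add: abs_mult)
    qed
  qed measurable
qed simp

context cutoff

begin

text \<open>The pieces of \<open>FTd\<close>, weighted at the endpoint order \<open>dnp\<close>, are
  bounded uniformly in k and j, and for fixed j they tend to 0 because an annulus is bounded and h
  converges locally. The surplus \<open>dnp - s2\<close> provides summable weights.\<close>

lemma compact_ge2:
  fixes fs :: "nat => 'n distr"
  assumes p: "2 <= p" and s1: "0 < s1" and s2: "s2 < dnp CARD('n) p"
    and fs: "\<And>k. tempered (fs k)" "\<And>k. BE s1 p (fs k) <= ennreal M"
  shows "\<exists>r f. strict_mono (r :: nat => nat) \<and> tempered f \<and> BE s1 p f < \<infinity> \<and>
    (%k. BE s2 p (FTd (diff_d (fs (r k)) f))) \<longlonglongrightarrow> 0"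
proof -
  have p1: "1 <= p" "0 < p" using p by auto
  let ?M = "max 0 M"
  have fs': "BE s1 p (fs k) <= ennreal ?M" for k by (rule order_trans[OF fs(2)]) (rule ennreal_leI, simp)
  have M0: "0 <= ?M" by simp
  obtain r f \<gamma> g N where R: "strict_mono (r :: nat => nat)" "tempered f" "BE s1 p f <= ennreal ?M"
    "\<forall>k. Lp_fun p (\<gamma> k)" "\<forall>k. represents (\<gamma> k) (fs (r k))" "Lp_fun p g" "represents g f" "0 <= N"
    "\<forall>k. lpE p (%x. \<gamma> k x - g x) <= ennreal N"
    "\<forall>R. (%k. lpE p (%x. (\<gamma> k x - g x) * indicator (cball 0 R) x)) \<longlonglongrightarrow> 0"
    using local_compactness[OF p1(1) s1 M0 fs(1) fs'] .
  have bf: "BE s1 p f < \<infinity>" using R(3) by (rule le_less_trans) simp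
  define h where "h k x = \<gamma> k x - g x" for k x
  have [measurable]: "\<gamma> k \<in> borel_measurable borel" "g \<in> borel_measurable borel" for k using R(4,6) by (auto simp: Lp_fun_iff)
  have hm[measurable]: "h k \<in> borel_measurable borel" for k unfolding h_def[abs_def] by measurable
  have hN: "lpE p (h k) <= ennreal N" for k using R(9) by (simp add: h_def[abs_def])
  have hL: "Lp_fun p (h k)" for k using hN[of k] by (auto simp: Lp_fun_iff intro: le_less_trans)
  have rep: "represents (h k) (diff_d (fs (r k)) f)" for k
    unfolding h_def[abs_def] using R by (intro represents_diff Lp_fun_tame[OF _ p1(1)]) auto
  obtain C where C: "0 < C" "\<And>j g T. Lp_fun p g ==> represents g T ==>
    ennreal (2 powr (real j * dnp CARD('n) p * p)) * dE p (piece j (FTd T)) <= ennreal C * lpE p (%x. g x * indicator (annulus j) x)"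
    using piece_FTd_le[OF p] by blast
  define x where "x k j = ennreal (2 powr (real j * dnp CARD('n) p * p)) * dE p (piece j (FTd (diff_d (fs (r k)) f)))" for k j
  have xle: "x k j <= ennreal C * lpE p (%y. h k y * indicator (annulus j) y)" for k j
    unfolding x_def by (rule C(2)[OF hL rep])
  have xb: "x k j <= ennreal (C * N)" for k j
  proof -
    have "lpE p (%y. h k y * indicator (annulus j) y) <= lpE p (h k)" using p1 by (intro lpE_mono norm_mult_indicator_le) auto
    then have "x k j <= ennreal C * ennreal N" using xle[of k j] hN[of k] by (meson mult_left_mono order_trans zero_le)
    then show ?thesis using C R(8) by (simp add: ennreal_mult)
  qed
  have xl: "(%k. x k j) \<longlonglongrightarrow> 0" for j
  proof (rule ennreal_tendsto_0_le[of "%k. lpE p (%y. h k y * indicator (cball 0 (4 * 2 ^ j)) y)" _ C])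
    show "(%k. lpE p (%y. h k y * indicator (cball 0 (4 * 2 ^ j)) y)) \<longlonglongrightarrow> 0" using R(10) by (simp add: h_def)
    fix k
    have "lpE p (%y. h k y * indicator (annulus j) y) <= lpE p (%y. h k y * indicator (cball 0 (4 * 2 ^ j)) y)"
      using p1 by (intro lpE_mono) (auto simp: indicator_def annulus_def)
    then show "x k j <= ennreal C * lpE p (%y. h k y * indicator (cball 0 (4 * 2 ^ j)) y)" using xle[of k j] by (meson mult_left_mono order_trans zero_le)
  qed
  have "(s2 - dnp CARD('n) p) * p < 0" using s2 p1 by (simp add: mult_neg_pos)
  from suminf_weighted_tendsto_0[OF this xb xl]
  have "(%k. \<Sum>j. ennreal (2 powr (real j * ((s2 - dnp CARD('n) p) * p))) * x k j) \<longlonglongrightarrow> 0" .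
  moreover have "(\<Sum>j. ennreal (2 powr (real j * ((s2 - dnp CARD('n) p) * p))) * x k j) = BE s2 p (FTd (diff_d (fs (r k)) f))" for k
  proof -
    have "ennreal (2 powr (real j * ((s2 - dnp CARD('n) p) * p))) * ennreal (2 powr (real j * dnp CARD('n) p * p)) = ennreal (2 powr (real j * s2 * p))" for j
      unfolding ennreal_mult[OF powr_ge_zero powr_ge_zero, symmetric] powr_add[symmetric] by (simp add: algebra_simps)
    then show ?thesis unfolding bE_def x_def by (simp add: mult.assoc[symmetric])
  qed
  ultimately have "(%k. BE s2 p (FTd (diff_d (fs (r k)) f))) \<longlonglongrightarrow> 0" by simp
  then show ?thesis using R(1,2) bf by blast
qed

text \<open>Away from a large ball, \<open>conv K u\<close> only sees the tails of \<open>K\<close> and of \<open>u\<close>.\<close>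

lemma lpE_conv_outside_le:
  fixes K u :: "'n cfun"
  assumes K: "K \<in> schwartz" and u: "Lp_fun p u" and p: "1 <= p"
  shows "lpE p (%y. conv K u y * indicator (- cball 0 (R0 + R1)) y)
    <= ennreal (2 powr p) * (ennreal ((2 * ftc TYPE('n) * (\<integral>x. norm (K x) \<partial>lborel)) powr p) * lpE p (%x. u x * indicator {x. R0 < norm x} x)
       + ennreal ((2 * ftc TYPE('n) * (\<integral>x. norm (K x * indicator (- cball 0 R1) x) \<partial>lborel)) powr p) * lpE p u)"
proof -
  have p0: "0 < p" using p by simp
  have [measurable]: "K \<in> borel_measurable borel" "u \<in> borel_measurable borel" using schwartz_measurable[OF K] u by (auto simp: Lp_fun_iff)
  have cb[measurable]: "(cball 0 r :: (real^'n) set) \<in> sets borel" for r by (intro borel_closed closed_cball)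
  define K1 where "K1 x = K x * indicator (cball 0 R1) x" for x
  define K2 where "K2 x = K x * indicator (- cball 0 R1) x" for x
  define v where "v x = u x * indicator {x. R0 < norm x} x" for x
  have [measurable]: "K1 \<in> borel_measurable borel" "K2 \<in> borel_measurable borel" "v \<in> borel_measurable borel"
    unfolding K1_def[abs_def] K2_def[abs_def] v_def[abs_def] by measurable
  have iK: "integrable lborel K" by (rule schwartz_integrable[OF K])
  have i1: "integrable lborel K1" and i2: "integrable lborel K2"
    unfolding K1_def[abs_def] K2_def[abs_def] by (rule Bochner_Integration.integrable_bound[OF iK]; auto simp: norm_mult_indicator_le)+
  obtain B where B: "0 < B" "\<And>x. norm (K x) <= B * weight x" using schwartz_weight[OF K] by metis
  obtain N where N: "0 <= N" "lpE p u <= ennreal N" using u by (cases "lpE p u") (auto simp: Lp_fun_iff)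
  have eq: "conv K u y = conv K1 v y + conv K2 u y" if y: "R0 + R1 < norm y" for y
  proof -
    have n1: "norm (K1 x) <= B * weight x" "norm (K2 x) <= B * weight x" for x
      unfolding K1_def K2_def by (rule order_trans[OF norm_mult_indicator_le B(2)])+
    have j1: "integrable lborel (%x. K1 (x - y) * u x)" "integrable lborel (%x. K2 (x - y) * u x)"
      by (rule norm_conv_le(2)[OF u p _ n1(1) less_imp_le[OF B(1)] N(2,1)], simp) (rule norm_conv_le(2)[OF u p _ n1(2) less_imp_le[OF B(1)] N(2,1)], simp)
    have eq: "K1 (x - y) * v x = K1 (x - y) * u x" for x
    proof (cases "norm (x - y) <= R1")
      case True
      have "norm y <= norm x + norm (x - y)" using norm_triangle_ineq4[of x "x - y"] by simp
      then have "R0 < norm x" using True y by linarith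
      then show ?thesis by (simp add: v_def)
    next
      case False
      then show ?thesis by (simp add: K1_def)
    qed
    have "K (x - y) * u x = K1 (x - y) * u x + K2 (x - y) * u x" for x by (simp add: K1_def K2_def indicator_def)
    then show ?thesis unfolding conv_def eq using j1 by (simp add: distrib_left)
  qed
  have "lpE p (%y. conv K u y * indicator (- cball 0 (R0 + R1)) y) <= lpE p (%y. conv K1 v y + conv K2 u y)"
    using p0 eq by (intro lpE_mono) (auto simp: indicator_def)
  also have "... <= ennreal (2 powr p) * (lpE p (conv K1 v) + lpE p (conv K2 u))"
    by (rule lpE_add[OF _ _ p0]) (rule conv_measurable; simp)+
  also have "... <= ennreal (2 powr p) * (ennreal ((2 * ftc TYPE('n) * (\<integral>x. norm (K x) \<partial>lborel)) powr p) * lpE p v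
      + ennreal ((2 * ftc TYPE('n) * (\<integral>x. norm (K2 x) \<partial>lborel)) powr p) * lpE p u)"
  proof (intro mult_left_mono add_mono)
    have "lpE p (conv K1 v) <= ennreal ((2 * ftc TYPE('n) * (\<integral>x. norm (K1 x) \<partial>lborel)) powr p) * lpE p v" by (rule lpE_conv_le[OF i1 _ p]) simp
    also have "... <= ennreal ((2 * ftc TYPE('n) * (\<integral>x. norm (K x) \<partial>lborel)) powr p) * lpE p v"
    proof (intro mult_right_mono ennreal_leI powr_mono2 mult_left_mono)
      show "(\<integral>x. norm (K1 x) \<partial>lborel) <= (\<integral>x. norm (K x) \<partial>lborel)"
      proof (rule integral_mono)
        show "norm (K1 x) <= norm (K x)" for x unfolding K1_def by (rule norm_mult_indicator_le)
      qed (use i1 iK in auto)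
    qed (use ftc_pos[where 'n = 'n] p0 in \<open>auto intro!: mult_nonneg_nonneg integral_nonneg_AE\<close>)
    finally show "lpE p (conv K1 v) <= ennreal ((2 * ftc TYPE('n) * (\<integral>x. norm (K x) \<partial>lborel)) powr p) * lpE p v" .
    show "lpE p (conv K2 u) <= ennreal ((2 * ftc TYPE('n) * (\<integral>x. norm (K2 x) \<partial>lborel)) powr p) * lpE p u" by (rule lpE_conv_le[OF i2 _ p]) simp
  qed auto
  finally show ?thesis by (simp add: v_def[abs_def] K2_def)
qed

lemma kernel_tail_tendsto_0:
  fixes K :: "'n cfun"
  assumes iK: "integrable lborel K"
  shows "(%m. \<integral>x. norm (K x * indicator (- cball 0 (real m)) x) \<partial>lborel) \<longlonglongrightarrow> 0"
proof -
  have [measurable]: "K \<in> borel_measurable borel" using iK by auto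
  have cb[measurable]: "(cball 0 r :: (real^'n) set) \<in> sets borel" for r by (intro borel_closed closed_cball)
  have "(%m. \<integral>x. norm (K x * indicator (- cball 0 (real m)) x) \<partial>lborel) \<longlonglongrightarrow> (\<integral>x. 0 \<partial>(lborel :: (real^'n) measure))"
  proof (rule integral_dominated_convergence[where w = "%x. norm (K x)"])
    show "AE x in lborel. (%m. norm (K x * indicator (- cball 0 (real m)) x)) \<longlonglongrightarrow> 0"
    proof (intro AE_I2 tendsto_eventually)
      fix x :: "real^'n"
      obtain m0 :: nat where "norm x <= real m0" using real_arch_simple by blast
      then show "\<forall>\<^sub>F m in sequentially. norm (K x * indicator (- cball 0 (real m)) x) = 0"
        unfolding eventually_sequentially by (intro exI[of _ m0]) auto
    qed
  qed (use iK in \<open>auto intro!: AE_I2 simp: indicator_def\<close>)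
  then show ?thesis by simp
qed

text \<open>A piece of \<open>FTd (T k)\<close> has two descriptions, equal almost everywhere. As a
  convolution of \<open>u k\<close> it is small outside a large ball, uniformly in k. As the
  transform of the integrable function \<open>phi j (- x) * h k x\<close> it is bounded by an L_1
  norm that tends to 0, which settles the inside of the ball. The order s2 < 0 then sums the
  bands.\<close>

lemma compact_lt2:
  fixes fs :: "nat => 'n distr"
  assumes p: "1 < p" "p < 2" and s1: "dnp CARD('n) p < s1" and s2: "s2 < 0"
    and fs: "\<And>k. tempered (fs k)" "\<And>k. BE s1 p (fs k) <= ennreal M"
  shows "\<exists>r f. strict_mono (r :: nat => nat) \<and> tempered f \<and> BE s1 p f < \<infinity> \<and>
    (%k. BE s2 p (FTd (diff_d (fs (r k)) f))) \<longlonglongrightarrow> 0"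
proof -
  have p1: "1 <= p" "0 < p" using p by auto
  let ?d = "dnp CARD('n) p"
  have "0 < ?d" unfolding dnp_def using p by (simp add: field_simps)
  then have s10: "0 < s1" using s1 by simp
  let ?M = "max 0 M"
  have fs': "BE s1 p (fs k) <= ennreal ?M" for k by (rule order_trans[OF fs(2)]) (rule ennreal_leI, simp)
  have M0: "0 <= ?M" by simp
  obtain r f \<gamma> g N where R: "strict_mono (r :: nat => nat)" "tempered f" "BE s1 p f <= ennreal ?M"
    "\<forall>k. Lp_fun p (\<gamma> k)" "\<forall>k. represents (\<gamma> k) (fs (r k))" "Lp_fun p g" "represents g f" "0 <= N"
    "\<forall>k. lpE p (%x. \<gamma> k x - g x) <= ennreal N"
    "\<forall>R. (%k. lpE p (%x. (\<gamma> k x - g x) * indicator (cball 0 R) x)) \<longlonglongrightarrow> 0"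
    using local_compactness[OF p1(1) s10 M0 fs(1) fs'] .
  have bf: "BE s1 p f < \<infinity>" using R(3) by (rule le_less_trans) simp
  define h where "h k x = \<gamma> k x - g x" for k x
  have [measurable]: "\<gamma> k \<in> borel_measurable borel" "g \<in> borel_measurable borel" for k using R(4,6) by (auto simp: Lp_fun_iff)
  have hm[measurable]: "h k \<in> borel_measurable borel" for k unfolding h_def[abs_def] by measurable
  have hN: "lpE p (h k) <= ennreal N" for k using R(9) by (simp add: h_def[abs_def])
  have hloc: "(%k. lpE p (%x. h k x * indicator (cball 0 Q) x)) \<longlonglongrightarrow> 0" for Q using R(10) by (simp add: h_def)
  have hL: "Lp_fun p (h k)" for k using hN[of k] by (auto simp: Lp_fun_iff intro: le_less_trans)
  define T where "T k = diff_d (fs (r k)) f" for k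
  have rep: "represents (h k) (T k)" for k
    unfolding h_def[abs_def] T_def using R by (intro represents_diff Lp_fun_tame[OF _ p1(1)]) auto
  have tT: "tempered (T k)" for k unfolding T_def by (intro tempered_diff_d fs R)
  define M2 where "M2 = 2 powr p * (?M + ?M)"
  have M2: "0 <= M2" unfolding M2_def by simp
  have TE: "BE s1 p (T k) <= ennreal M2" for k
  proof -
    have "BE s1 p (T k) <= ennreal (2 powr p) * (BE s1 p (fs (r k)) + BE s1 p f)" unfolding T_def by (rule bE_diff_d[OF p1(1)])
    also have "... <= ennreal (2 powr p) * (ennreal ?M + ennreal ?M)" by (intro mult_left_mono add_mono fs' R) auto
    also have "... = ennreal M2"
      unfolding M2_def by (simp only: ennreal_mult[OF powr_ge_zero add_nonneg_nonneg[OF M0 M0]] ennreal_plus[OF M0 M0])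
    finally show ?thesis .
  qed
  have TEd: "BE ?d p (T k) <= ennreal M2" for k using bE_mono[of ?d s1 p "T k"] s1 p1 TE[of k] by (auto intro: order_trans)
  have TEfin: "BE ?d p (T k) < \<infinity>" for k using TEd[of k] by (rule le_less_trans) simp
  obtain C where C: "0 < C" "\<And>T. tempered T ==> BE ?d p T < \<infinity> ==>
    \<exists>u. Lp_fun p u \<and> represents u (FTd T) \<and> lpE p u <= ennreal C * BE ?d p T \<and>
      (\<forall>L. lpE p (%x. u x * indicator {x. 4 * 2 ^ L < norm x} x) \<le>
        ennreal C * (\<Sum>j. if j <= L then 0 else ennreal (2 powr (real j * ?d * p)) * dE p (piece j T)))"
    using FTd_Besov_function[OF p] by blast
  define Q where "Q k u \<longleftrightarrow> Lp_fun p u \<and> represents u (FTd (T k)) \<and> lpE p u <= ennreal C * BE ?d p (T k) \<and>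
      (\<forall>L. lpE p (%x. u x * indicator {x. 4 * 2 ^ L < norm x} x) \<le>
        ennreal C * (\<Sum>j. if j <= L then 0 else ennreal (2 powr (real j * ?d * p)) * dE p (piece j (T k))))" for k u
  have "\<exists>u. Q k u" for k unfolding Q_def by (rule C(2)[OF tT TEfin])
  then obtain u where uQ: "\<And>k. Q k (u k)" by metis
  have uL: "Lp_fun p (u k)" and urep: "represents (u k) (FTd (T k))" for k using uQ[of k] by (auto simp: Q_def)
  have um[measurable]: "u k \<in> borel_measurable borel" for k using uL[of k] by (simp add: Lp_fun_iff)
  have uE: "lpE p (u k) <= ennreal (C * M2)" for k
  proof -
    have "lpE p (u k) <= ennreal C * BE ?d p (T k)" using uQ[of k] by (simp add: Q_def)
    also have "... <= ennreal C * ennreal M2" by (intro mult_left_mono TEd) auto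
    finally show ?thesis using C M2 by (simp add: ennreal_mult)
  qed
  \<comment> \<open>Only bands above L reach beyond 4 * 2^L, and there the surplus of regularity s1
    - d gains the factor \<open>2 powr (- L * (s1 - d) * p)\<close>, uniformly in k.\<close>
  have utail: "lpE p (%x. u k x * indicator {x. 4 * 2 ^ L < norm x} x) <= ennreal (C * (2 powr (real L * (- ((s1 - ?d) * p))) * M2))" for k L
  proof -
    have "(if j <= L then 0 else ennreal (2 powr (real j * ?d * p)) * dE p (piece j (T k)))
      <= ennreal (2 powr (real L * (- ((s1 - ?d) * p)))) * (ennreal (2 powr (real j * s1 * p)) * dE p (piece j (T k)))" for j
    proof (cases "j <= L")
      case False
      have "real L * ((s1 - ?d) * p) <= real j * ((s1 - ?d) * p)" using False s1 p1 by (intro mult_right_mono) auto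
      then have "2 powr (real j * ?d * p) <= 2 powr (real L * (- ((s1 - ?d) * p)) + real j * s1 * p)" by (intro powr_mono) (auto simp: algebra_simps)
      then have "ennreal (2 powr (real j * ?d * p)) <= ennreal (2 powr (real L * (- ((s1 - ?d) * p)))) * ennreal (2 powr (real j * s1 * p))"
        unfolding ennreal_mult[OF powr_ge_zero powr_ge_zero, symmetric] powr_add[symmetric] by (rule ennreal_leI)
      from mult_right_mono[OF this, of "dE p (piece j (T k))"] show ?thesis using False by (simp add: mult.assoc)
    qed simp
    then have "(\<Sum>j. if j <= L then 0 else ennreal (2 powr (real j * ?d * p)) * dE p (piece j (T k)))
      <= (\<Sum>j. ennreal (2 powr (real L * (- ((s1 - ?d) * p)))) * (ennreal (2 powr (real j * s1 * p)) * dE p (piece j (T k))))"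
      by (intro suminf_le) auto
    also have "... = ennreal (2 powr (real L * (- ((s1 - ?d) * p)))) * BE s1 p (T k)" unfolding bE_def by (rule ennreal_suminf_cmult)
    also have "... <= ennreal (2 powr (real L * (- ((s1 - ?d) * p)))) * ennreal M2" by (intro mult_left_mono TE) auto
    also have "... = ennreal (2 powr (real L * (- ((s1 - ?d) * p))) * M2)" using M2 by (intro ennreal_mult[symmetric]) auto
    finally have "ennreal C * (\<Sum>j. if j <= L then 0 else ennreal (2 powr (real j * ?d * p)) * dE p (piece j (T k)))
      <= ennreal C * ennreal (2 powr (real L * (- ((s1 - ?d) * p))) * M2)" by (intro mult_left_mono) auto
    also have "... = ennreal (C * (2 powr (real L * (- ((s1 - ?d) * p))) * M2))" using M2 C by (intro ennreal_mult[symmetric]) auto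
    finally show ?thesis using uQ[of k] unfolding Q_def by (meson order_trans)
  qed
  obtain C' where C': "0 < C'" "\<And>j g. g \<in> borel_measurable borel ==> lpE p (conv (FT (phi j)) g) <= ennreal C' * lpE p g"
    using conv_phij_le[OF p1(1)] by blast
  define w where "w k j = conv (FT (phi j)) (u k)" for k j
  have wm[measurable]: "w k j \<in> borel_measurable borel" for k j unfolding w_def by (intro conv_measurable um schwartz_measurable FT_schwartz phij_schwartz)
  have wrep: "represents (w k j) (piece j (FTd (T k)))" for k j unfolding w_def by (rule piece_represents[OF uL urep p1(1)])
  have wE: "lpE p (w k j) <= ennreal (C' * (C * M2))" for k j
  proof -
    have "lpE p (w k j) <= ennreal C' * lpE p (u k)" unfolding w_def by (rule C'(2)[OF um])
    also have "... <= ennreal C' * ennreal (C * M2)" by (intro mult_left_mono uE) auto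
    finally show ?thesis using C' C M2 by (simp add: ennreal_mult)
  qed
  have wL: "Lp_fun p (w k j)" for k j using wE[of k j] by (auto simp: Lp_fun_iff intro: le_less_trans)
  have xw: "dE p (piece j (FTd (T k))) = lpE p (w k j)" for k j by (rule dE_eq[OF wL wrep p1(1)])
  have lim: "(%k. lpE p (w k j)) \<longlonglongrightarrow> 0" for j
  proof (rule ennreal_tendsto_0_approx)
    fix e :: real assume e: "0 < e"
    define K where "K = FT (phi j)"
    have KS: "K \<in> schwartz" unfolding K_def by (intro FT_schwartz phij_schwartz)
    define A where "A = (2 * ftc TYPE('n) * (\<integral>x. norm (K x) \<partial>lborel)) powr p"
    have A: "0 <= A" by (simp add: A_def)
    \<comment> \<open>One factor \<open>2 powr p\<close> comes from
      \<open>lpE_conv_outside_le\<close>, the other from splitting \<open>w k j\<close> at the ball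
      E below.\<close>
    define B where "B = 2 powr p * 2 powr p"
    have B: "0 < B" by (simp add: B_def)
    have "\<exists>L::nat. B * A * (C * (2 powr (real L * (- ((s1 - ?d) * p))) * M2)) <= e / 2"
    proof -
      have "- ((s1 - ?d) * p) < 0" using s1 p1 by simp
      then have "summable (%L. 2 powr (real L * (- ((s1 - ?d) * p))))" using suminf_powr2 by metis
      then have "(%L. 2 powr (real L * (- ((s1 - ?d) * p)))) \<longlonglongrightarrow> 0" by (rule summable_LIMSEQ_zero)
      then have "(%L. B * A * (C * (2 powr (real L * (- ((s1 - ?d) * p))) * M2))) \<longlonglongrightarrow> B * A * (C * (0 * M2))"
        by (intro tendsto_mult tendsto_const)
      then have "\<forall>\<^sub>F L in sequentially. B * A * (C * (2 powr (real L * (- ((s1 - ?d) * p))) * M2)) < e / 2" using e by (intro order_tendstoD) auto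
      then obtain L where "B * A * (C * (2 powr (real L * (- ((s1 - ?d) * p))) * M2)) < e / 2" unfolding eventually_sequentially by auto
      then show ?thesis by (intro exI[of _ L]) simp
    qed
    then obtain L :: nat where L: "B * A * (C * (2 powr (real L * (- ((s1 - ?d) * p))) * M2)) <= e / 2" by blast
    define \<kappa> where "\<kappa> m = (2 * ftc TYPE('n) * (\<integral>x. norm (K x * indicator (- cball 0 (real m)) x) \<partial>lborel)) powr p" for m :: nat
    have "\<exists>m. B * \<kappa> m * (C * M2) <= e / 2"
    proof -
      have "(%m. 2 * ftc TYPE('n) * (\<integral>x. norm (K x * indicator (- cball 0 (real m)) x) \<partial>lborel)) \<longlonglongrightarrow> 2 * ftc TYPE('n) * 0"
        by (intro tendsto_mult tendsto_const kernel_tail_tendsto_0 schwartz_integrable KS)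
      then have "\<kappa> \<longlonglongrightarrow> (2 * ftc TYPE('n) * 0) powr p" unfolding \<kappa>_def[abs_def]
        using p1 ftc_pos[where 'n = 'n] by (intro tendsto_powr2 tendsto_const) (auto intro!: always_eventually mult_nonneg_nonneg integral_nonneg_AE)
      then have "(%m. B * \<kappa> m * (C * M2)) \<longlonglongrightarrow> B * ((2 * ftc TYPE('n) * 0) powr p) * (C * M2)" by (intro tendsto_mult tendsto_const)
      then have "\<forall>\<^sub>F m in sequentially. B * \<kappa> m * (C * M2) < e / 2" using e p1 by (intro order_tendstoD) auto
      then obtain m where "B * \<kappa> m * (C * M2) < e / 2" unfolding eventually_sequentially by auto
      then show ?thesis by (intro exI[of _ m]) simp
    qed
    then obtain m where m: "B * \<kappa> m * (C * M2) <= e / 2" by blast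
    \<comment> \<open>The radius is the sum of the radius beyond which all \<open>u k\<close> are
      small and the radius beyond which the kernel is small.\<close>
    define E where "E = (cball 0 (4 * 2 ^ L + real m) :: (real^'n) set)"
    have [measurable]: "E \<in> sets borel" unfolding E_def by (intro borel_closed closed_cball)
    have out: "ennreal (2 powr p) * lpE p (%y. w k j y * indicator (- E) y) <= ennreal e" for k
    proof -
      have "lpE p (%y. w k j y * indicator (- E) y) <= ennreal (2 powr p) * (ennreal A * lpE p (%x. u k x * indicator {x. 4 * 2 ^ L < norm x} x) + ennreal (\<kappa> m) * lpE p (u k))"
        unfolding w_def E_def A_def \<kappa>_def K_def by (rule lpE_conv_outside_le[OF FT_schwartz[OF phij_schwartz] uL p1(1)])
      also have "... <= ennreal (2 powr p) * (ennreal A * ennreal (C * (2 powr (real L * (- ((s1 - ?d) * p))) * M2)) + ennreal (\<kappa> m) * ennreal (C * M2))"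
        by (intro mult_left_mono add_mono utail uE) auto
      finally have "ennreal (2 powr p) * lpE p (%y. w k j y * indicator (- E) y) <= ennreal (2 powr p) * (ennreal (2 powr p) * (ennreal A * ennreal (C * (2 powr (real L * (- ((s1 - ?d) * p))) * M2)) + ennreal (\<kappa> m) * ennreal (C * M2)))"
        by (intro mult_left_mono) auto
      also have "... = ennreal (B * A * (C * (2 powr (real L * (- ((s1 - ?d) * p))) * M2)) + B * \<kappa> m * (C * M2))"
      proof -
        have a0: "0 <= C * (2 powr (real L * (- ((s1 - ?d) * p))) * M2)" "0 <= C * M2" "0 <= \<kappa> m" using C M2 by (auto simp: \<kappa>_def)
        have "ennreal A * ennreal (C * (2 powr (real L * (- ((s1 - ?d) * p))) * M2)) + ennreal (\<kappa> m) * ennreal (C * M2)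
           = ennreal (A * (C * (2 powr (real L * (- ((s1 - ?d) * p))) * M2)) + \<kappa> m * (C * M2))"
          by (simp only: ennreal_mult[OF A a0(1)] ennreal_mult[OF a0(3,2)] ennreal_plus[OF mult_nonneg_nonneg[OF A a0(1)] mult_nonneg_nonneg[OF a0(3,2)]])
        moreover have "0 <= A * (C * (2 powr (real L * (- ((s1 - ?d) * p))) * M2)) + \<kappa> m * (C * M2)" by (rule add_nonneg_nonneg[OF mult_nonneg_nonneg[OF A a0(1)] mult_nonneg_nonneg[OF a0(3,2)]])
        ultimately have "ennreal (2 powr p) * (ennreal (2 powr p) * (ennreal A * ennreal (C * (2 powr (real L * (- ((s1 - ?d) * p))) * M2)) + ennreal (\<kappa> m) * ennreal (C * M2)))
          = ennreal (2 powr p * (2 powr p * (A * (C * (2 powr (real L * (- ((s1 - ?d) * p))) * M2)) + \<kappa> m * (C * M2))))"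
          by (simp only: ennreal_mult[OF powr_ge_zero] mult_nonneg_nonneg[OF powr_ge_zero])
        then show ?thesis by (simp add: B_def distrib_left mult.assoc)
      qed
      also have "... <= ennreal e" using L m by (intro ennreal_leI) linarith
      finally show ?thesis .
    qed
    define I where "I k = (\<integral>x. norm (phi j (- x) * h k x) \<partial>lborel)" for k
    have ih: "integrable lborel (%x. phi j (- x) * h k x)" for k by (rule piece_FTd_represents(2)[OF Lp_fun_tame[OF hL p1(1)] rep])
    have I0: "0 <= I k" for k unfolding I_def by (intro integral_nonneg_AE) auto
    have Ilim: "I \<longlonglongrightarrow> 0"
    proof -
      have "(%k. \<integral>\<^sup>+x. ennreal (norm (h k x * phi j (- x))) \<partial>lborel) \<longlonglongrightarrow> 0"
        by (rule weak_null[OF hm p1(1) hN R(8) hloc schwartz_uminus[OF phij_schwartz]])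
      moreover have "(\<integral>\<^sup>+x. ennreal (norm (h k x * phi j (- x))) \<partial>lborel) = ennreal (I k)" for k
        unfolding I_def using ih[of k] by (subst nn_integral_eq_integral[symmetric]) (auto simp: mult.commute)
      ultimately show ?thesis using tendsto_ennreal_iff[of I sequentially 0] I0 by simp
    qed
    have ins: "lpE p (%y. w k j y * indicator E y) <= ennreal ((ftc TYPE('n) * I k) powr p) * emeasure lborel E" for k
    proof -
      \<comment> \<open>The second description of the piece; its supremum is at most
        \<open>ftc\<close> times I k, so its L_p norm on the bounded set E tends to 0.\<close>
      define w' where "w' = FT (%x. phi j (- x) * h k x)"
      have w'b: "norm (w' y) <= ftc TYPE('n) * I k" for y unfolding w'_def I_def by (rule norm_FT_le[OF ih])
      have w'm[measurable]: "w' \<in> borel_measurable borel" unfolding w'_def by (rule FT_measurable) (use ih[of k] in auto)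
      have "represents w' (piece j (FTd (T k)))" unfolding w'_def by (rule piece_FTd_represents(1)[OF Lp_fun_tame[OF hL p1(1)] rep])
      then have "AE y in lborel. w k j y = w' y"
        by (intro represents_unique[OF Lp_fun_tame[OF wL p1(1)] bounded_tame[OF w'm w'b] wrep])
      then have "lpE p (%y. w k j y * indicator E y) = lpE p (%y. w' y * indicator E y)"
        by (intro lpE_cong_AE) (auto elim!: eventually_mono)
      also have "... <= (\<integral>\<^sup>+y. ennreal ((ftc TYPE('n) * I k) powr p) * indicator E y \<partial>lborel)"
        unfolding lpE_def
      proof (intro nn_integral_mono)
        fix y
        show "ennreal (norm (w' y * indicator E y) powr p) <= ennreal ((ftc TYPE('n) * I k) powr p) * indicator E y"
          using w'b[of y] p1 by (cases "y \<in> E") (auto intro!: ennreal_leI powr_mono2)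
      qed
      also have "... = ennreal ((ftc TYPE('n) * I k) powr p) * emeasure lborel E" by (rule nn_integral_cmult_indicator) simp
      finally show ?thesis .
    qed
    have "lpE p (w k j) <= ennreal (2 powr p) * (ennreal ((ftc TYPE('n) * I k) powr p) * emeasure lborel E) + ennreal e" for k
    proof -
      have "lpE p (w k j) = lpE p (%y. w k j y * indicator E y + w k j y * indicator (- E) y)"
        unfolding lpE_def by (intro nn_integral_cong) (auto simp: indicator_def)
      also have "... <= ennreal (2 powr p) * (lpE p (%y. w k j y * indicator E y) + lpE p (%y. w k j y * indicator (- E) y))"
        by (rule lpE_add[OF _ _ p1(2)]) measurable
      also have "... = ennreal (2 powr p) * lpE p (%y. w k j y * indicator E y) + ennreal (2 powr p) * lpE p (%y. w k j y * indicator (- E) y)"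
        by (rule distrib_left)
      also have "... <= ennreal (2 powr p) * (ennreal ((ftc TYPE('n) * I k) powr p) * emeasure lborel E) + ennreal e"
        by (intro add_mono mult_left_mono ins out) auto
      finally show ?thesis .
    qed
    moreover have "(%k. ennreal (2 powr p) * (ennreal ((ftc TYPE('n) * I k) powr p) * emeasure lborel E)) \<longlonglongrightarrow> 0"
    proof -
      obtain \<mu> where \<mu>: "emeasure lborel E = ennreal \<mu>" "0 <= \<mu>"
        using emeasure_lborel_cball_finite[of "0::real^'n" "4 * 2 ^ L + real m"] unfolding E_def by (cases "emeasure lborel (cball 0 (4 * 2 ^ L + real m) :: (real^'n) set)") auto
      have "(%k. ftc TYPE('n) * I k) \<longlonglongrightarrow> 0" by (rule tendsto_mult_right_zero[OF Ilim])
      then have "(%k. ennreal ((ftc TYPE('n) * I k) powr p)) \<longlonglongrightarrow> 0"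
        using powr_tendsto_0_iff[of "%k. ftc TYPE('n) * I k" p] I0 ftc_pos[where 'n = 'n] p1 by simp
      then show ?thesis
        by (rule ennreal_tendsto_0_le[of _ _ "2 powr p * \<mu>"]) (use \<mu> in \<open>simp add: ennreal_mult mult_ac\<close>)
    qed
    ultimately show "\<exists>y. y \<longlonglongrightarrow> 0 \<and> (\<forall>k. lpE p (w k j) <= y k + ennreal e)" by blast
  qed
  have "s2 * p < 0" using s2 p1 by (simp add: mult_neg_pos)
  from suminf_weighted_tendsto_0[OF this wE lim]
  have "(%k. \<Sum>j. ennreal (2 powr (real j * (s2 * p))) * lpE p (w k j)) \<longlonglongrightarrow> 0" .
  moreover have "(\<Sum>j. ennreal (2 powr (real j * (s2 * p))) * lpE p (w k j)) = BE s2 p (FTd (diff_d (fs (r k)) f))" for k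
    unfolding bE_def T_def[symmetric] xw by (simp add: mult.assoc)
  ultimately have "(%k. BE s2 p (FTd (diff_d (fs (r k)) f))) \<longlonglongrightarrow> 0" by simp
  then show ?thesis using R(1,2) bf by blast
qed

end

section \<open>Failure of compactness at the endpoints\<close>

lemma FT_translate:
  fixes f :: "'n::finite cfun"
  assumes f: "f \<in> schwartz"
  shows "FT (%x. f (x + a)) \<xi> = cis (\<xi> \<bullet> a) * FT f \<xi>"
proof -
  have i: "integrable lborel (%x. cis (- (x \<bullet> \<xi>)) * f x)" by (intro integrable_cis_mult schwartz_integrable f)
  have "(\<integral>x. cis (- (x \<bullet> \<xi>)) * f (x + a) \<partial>lborel) = (\<integral>x. cis (\<xi> \<bullet> a) * (cis (- ((x + a) \<bullet> \<xi>)) * f (x + a)) \<partial>lborel)"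
    by (intro Bochner_Integration.integral_cong refl) (simp add: inner_commute[of _ \<xi>] inner_add_right cis_mult flip: mult.assoc)
  also have "... = cis (\<xi> \<bullet> a) * (\<integral>x. cis (- (x \<bullet> \<xi>)) * f x \<partial>lborel)"
    using integral_translate(1)[OF i, of a] by simp
  finally show ?thesis by (simp add: FT_eq)
qed

text \<open>Modulation is translation on the other side of the transform, which avoids
  differentiating \<open>cis\<close>.\<close>

lemma schwartz_modulate:
  fixes f :: "'n::finite cfun"
  assumes f: "f \<in> schwartz"
  shows "(%x. cis (x \<bullet> a) * f x) \<in> schwartz"
proof -
  have "(%x. cis (x \<bullet> a) * f x) = FT (%x. IFT f (x + a))"
    by (rule ext) (simp add: FT_translate[OF IFT_schwartz[OF f]] FT_IFT[OF f])
  moreover have "(%x. IFT f (x + a)) \<in> schwartz" using schwartz_affine[OF IFT_schwartz[OF f], of 1 a] by simp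
  ultimately show ?thesis using FT_schwartz by metis
qed

text \<open>For Schwartz functions this is the decay of \<open>FT w\<close> along one coordinate
  axis.\<close>

lemma Riemann_Lebesgue_axis:
  fixes w :: "'n::finite cfun"
  assumes w: "w \<in> schwartz"
  shows "(%k. \<integral>x. cis (x \<bullet> (real k *\<^sub>R axis i 1)) * w x \<partial>lborel) \<longlonglongrightarrow> 0"
proof -
  obtain C where C: "\<And>x. (1 + norm x) ^ 1 * norm (pds [] (FT w) x) <= C"
    using FT_schwartz[OF w] unfolding schwartz_def by blast
  have "(%k. FT w (- (real k *\<^sub>R axis i 1))) \<longlonglongrightarrow> 0"
  proof (rule Lim_null_comparison[OF always_eventually[OF allI]])
    fix k
    show "norm (FT w (- (real k *\<^sub>R axis i 1))) <= C * inverse (real (Suc k))"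
      using C[of "- (real k *\<^sub>R axis i 1)"] by (simp add: norm_axis_1 field_simps)
    show "(%k. C * inverse (real (Suc k))) \<longlonglongrightarrow> 0"
      using tendsto_mult[OF tendsto_const LIMSEQ_inverse_real_of_nat, of C] by simp
  qed
  then have "(%k. inverse (of_real (ftc TYPE('n))) * FT w (- (real k *\<^sub>R axis i 1))) \<longlonglongrightarrow> inverse (of_real (ftc TYPE('n))) * 0"
    by (intro tendsto_mult tendsto_const)
  then show ?thesis using ftc_pos[where 'n = 'n] by (simp add: FT_eq flip: mult.assoc)
qed

lemma FT_zero: "FT (%x. 0) \<xi> = 0"
  by (simp add: FT_eq)

lemma schwartz_FT_nonzero:
  fixes w :: "'n::finite cfun"
  assumes w: "w \<in> schwartz" "w x ~= 0"
  obtains z where "FT w z ~= 0"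
proof -
  have "FT w ~= (%x. 0)"
  proof
    assume "FT w = (%x. 0)"
    then show False using FT_inversion[OF w(1), of "- x"] w(2) FT_zero[of "- x"] by simp
  qed
  then show ?thesis using that by auto
qed

text \<open>A Schwartz function that vanishes almost everywhere has zero transform, and then
  vanishes everywhere by inversion.\<close>

lemma schwartz_lpE_pos:
  fixes w :: "'n::finite cfun"
  assumes w: "w \<in> schwartz" "w x ~= 0"
  shows "0 < lpE p w"
proof (rule ccontr)
  have [measurable]: "w \<in> borel_measurable borel" by (rule schwartz_measurable[OF w(1)])
  assume "\<not> 0 < lpE p w"
  then have "AE x in lborel. ennreal (norm (w x) powr p) = 0" unfolding lpE_def by (subst (asm) zero_less_iff_neq_zero) (simp add: nn_integral_0_iff_AE)
  then have ae: "AE x in lborel. w x = 0" by eventually_elim simp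
  have "FT w \<xi> = 0" for \<xi>
  proof -
    have "(\<integral>x. cis (- (x \<bullet> \<xi>)) * w x \<partial>lborel) = 0"
      by (rule integral_eq_zero_AE) (use ae in \<open>auto elim: eventually_mono\<close>)
    then show ?thesis by (simp add: FT_eq)
  qed
  then show False using schwartz_FT_nonzero[OF w] by blast
qed

lemma FTd_distr_of:
  fixes f :: "'n::finite cfun"
  assumes f: "f \<in> schwartz"
  shows "FTd (distr_of f) = distr_of (FT f)"
  using FT_multiplication[OF schwartz_integrable[OF f] schwartz_integrable] by (auto simp: FTd_def distr_of_def FT_schwartz)

lemma lpE_dilate:
  fixes w :: "'n::finite cfun"
  assumes [measurable]: "w \<in> borel_measurable borel" and t: "0 < t" and p: "0 < p"
  shows "lpE p (%x. of_real (t powr (- real CARD('n) / p)) * w ((1 / t) *\<^sub>R x)) = lpE p w"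
proof -
  have "(t powr (- real CARD('n) / p)) powr p = t powr (- real CARD('n))" using p by (simp add: powr_powr)
  also have "... = \<bar>1 / t\<bar> ^ CARD('n)" using t by (simp add: powr_minus powr_realpow power_one_over inverse_eq_divide)
  finally have "(t powr (- real CARD('n) / p)) powr p = \<bar>1 / t\<bar> ^ CARD('n)" .
  then show ?thesis using lpE_affine[of w "1 / t" p 0] t by (subst lpE_cmult) auto
qed

text \<open>The prefactor keeps the L_p norm of u under the dilation, as in
  \<open>lpE_dilate\<close>. Its transform then scales by a power of t whose exponent is exactly
  minus \<open>dnp\<close>; so at the endpoint order a whole family of dilates has the same weighted
  norm.\<close>

lemma lpE_FT_dilate:
  fixes u :: "'n::finite cfun"
  assumes u: "u \<in> schwartz" and t: "0 < t" and p: "0 < p"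
  shows "ennreal (t powr (dnp CARD('n) p * p)) * lpE p (FT (%x. of_real (t powr (- real CARD('n) / p)) * u ((1 / t) *\<^sub>R x))) = lpE p (FT u)"
proof -
  let ?n = "real CARD('n)"
  have [measurable]: "FT u \<in> borel_measurable borel" by (rule schwartz_measurable[OF FT_schwartz[OF u]])
  define c where "c = t powr (- ?n / p) * t ^ CARD('n)"
  have c: "c = t powr (?n - ?n / p)" unfolding c_def using t by (simp add: powr_diff powr_minus powr_realpow field_simps)
  have "FT (%x. of_real (t powr (- ?n / p)) * u ((1 / t) *\<^sub>R x)) = (%\<xi>. of_real c * FT u (t *\<^sub>R \<xi>))"
    using FT_scale[OF schwartz_integrable[OF u], of "1 / t"] t by (intro ext) (simp add: FT_cmult c_def)
  then have "lpE p (FT (%x. of_real (t powr (- ?n / p)) * u ((1 / t) *\<^sub>R x))) = ennreal (norm (of_real c :: complex) powr p) * lpE p (%\<xi>. FT u (t *\<^sub>R \<xi>))"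
    by (simp add: lpE_cmult)
  moreover have "t powr (dnp CARD('n) p * p) * norm (of_real c :: complex) powr p = t ^ CARD('n)"
  proof -
    have "dnp CARD('n) p * p + (?n - ?n / p) * p = ?n" using p by (simp add: dnp_def field_simps)
    then show ?thesis unfolding c using t by (simp add: powr_powr powr_realpow flip: powr_add)
  qed
  ultimately have "ennreal (t powr (dnp CARD('n) p * p)) * lpE p (FT (%x. of_real (t powr (- ?n / p)) * u ((1 / t) *\<^sub>R x))) = ennreal (t ^ CARD('n)) * lpE p (%\<xi>. FT u (t *\<^sub>R \<xi>))"
    by (metis ennreal_mult mult.assoc powr_ge_zero)
  also have "... = lpE p (FT u)" using lpE_affine[of "FT u" t p 0] t by simp
  finally show ?thesis .
qed

context cutoff

begin

lemma dE_distr_of: "f \<in> schwartz ==> 1 <= p ==> dE p (distr_of f :: 'n distr) = lpE p f"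
  by (rule dE_eq[OF schwartz_Lp_fun represents_distr_of])

lemma piece_FTd_schwartz:
  assumes "f \<in> schwartz" "1 <= p"
  shows "dE p (piece j (FTd (distr_of f))) = lpE p (FT (%x. phi j (- x) * f x))"
  by (rule dE_eq[OF schwartz_Lp_fun[OF FT_schwartz[OF schwartz_mult[OF schwartz_uminus[OF phij_schwartz]]]] piece_FTd_represents(1)[OF schwartz_tame represents_distr_of]])
    (use assms in auto)

lemma piece_FTd_apply:
  assumes "\<psi> \<in> schwartz"
  shows "piece j (FTd T) \<psi> = FTd T (FT (%x. phi j x * IFT \<psi> x))"
  using assms by (simp add: piece_apply FTd_def schwartz_mult phij_schwartz IFT_schwartz)

text \<open>Norm convergence implies convergence against test functions, so G agrees on Schwartz
  functions with the weak limit 0. Finitely many differences may have infinite norm; the shift by K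
  discards them.\<close>

lemma dE_limit_eq_0:
  fixes S :: "nat => 'n distr"
  assumes p: "1 <= p" and lim: "(%k. dE p (diff_d (S k) G)) \<longlonglongrightarrow> 0" and null: "\<And>\<psi>. \<psi> \<in> schwartz ==> (%k. S k \<psi>) \<longlonglongrightarrow> 0"
    and \<psi>: "\<psi> \<in> schwartz"
  shows "G \<psi> = 0"
proof -
  have "\<forall>\<^sub>F k in sequentially. dE p (diff_d (S k) G) < 1" by (rule order_tendstoD[OF lim]) simp
  then obtain K where K: "\<And>k. K <= k ==> dE p (diff_d (S k) G) < 1" unfolding eventually_sequentially by blast
  have "\<exists>h. Lp_fun p h \<and> represents h (diff_d (S (k + K)) G) \<and> lpE p h = dE p (diff_d (S (k + K)) G)" for k
  proof -
    have "dE p (diff_d (S (k + K)) G) < \<infinity>" using K[of "k + K"] by (rule less_trans[of _ 1]) simp_all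
    then show ?thesis using dE_finite[OF _ p] by metis
  qed
  then obtain h where h: "\<And>k. Lp_fun p (h k)" "\<And>k. represents (h k) (diff_d (S (k + K)) G)" "\<And>k. lpE p (h k) = dE p (diff_d (S (k + K)) G)" by metis
  have hm[measurable]: "h k \<in> borel_measurable borel" for k using h(1)[of k] by (simp add: Lp_fun_iff)
  have hl: "(%k. lpE p (h k)) \<longlonglongrightarrow> 0" unfolding h(3) by (rule LIMSEQ_ignore_initial_segment[OF lim])
  have "lpE p (h k) <= ennreal 1" for k using less_imp_le[OF K[of "k + K"]] by (simp add: h(3))
  moreover have "(%k. lpE p (%x. h k x * indicator (cball 0 R) x)) \<longlonglongrightarrow> 0" for R
  proof (rule ennreal_tendsto_0_le[OF hl, of _ 1])
    fix k
    show "lpE p (%x. h k x * indicator (cball 0 R) x) <= ennreal 1 * lpE p (h k)"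
      using p lpE_mono[of "%x. h k x * indicator (cball 0 R) x" "h k" p] by (simp add: norm_mult_indicator_le)
  qed
  ultimately have "(%k. \<integral>\<^sup>+x. ennreal (norm (h k x * \<psi> x)) \<partial>lborel) \<longlonglongrightarrow> 0" by (intro weak_null[where N = 1, OF hm p _ _ _ \<psi>]) auto
  then have "(%k. ennreal (norm (\<integral>x. h k x * \<psi> x \<partial>lborel))) \<longlonglongrightarrow> 0"
  proof (rule ennreal_tendsto_0_le[of _ _ 1])
    fix k
    have "integrable lborel (%x. h k x * \<psi> x)" by (rule tame_schwartz_integrable[OF Lp_fun_tame[OF h(1) p] \<psi>])
    then show "ennreal (norm (\<integral>x. h k x * \<psi> x \<partial>lborel)) <= ennreal 1 * (\<integral>\<^sup>+x. ennreal (norm (h k x * \<psi> x)) \<partial>lborel)"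
      by (simp add: integral_norm_bound_ennreal)
  qed
  then have "(%k. norm (\<integral>x. h k x * \<psi> x \<partial>lborel)) \<longlonglongrightarrow> 0"
    using tendsto_ennreal_iff[of "%k. norm (\<integral>x. h k x * \<psi> x \<partial>lborel)" sequentially 0] by simp
  then have "(%k. diff_d (S (k + K)) G \<psi>) \<longlonglongrightarrow> 0"
    using h(2) \<psi> by (subst tendsto_norm_zero_iff[symmetric]) (simp add: represents_def)
  from tendsto_diff[OF LIMSEQ_ignore_initial_segment[OF null[OF \<psi>], of K] this] show ?thesis
    by (simp add: diff_d_def LIMSEQ_const_iff)
qed

text \<open>A compact image sequence that vanishes weakly would have to vanish in norm. The map \<open>D\<close> is either
  the identity or the projection to the lowest frequency band.\<close>

lemma weakly_null_not_compact:
  fixes fs :: "nat => 'n distr" and D :: "'n distr => 'n distr"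
  assumes X: "enormed p X E" and Y: "enormed p Y F" and p: "1 <= p"
    and dY: "\<And>T S. F (diff_d T S) <= ennreal A * (F T + F S)"
    and cont: "maps_continuously FTd X Y"
    and fs: "\<And>k. tempered (fs k)" "\<And>k. E (fs k) <= ennreal M"
    and D: "\<And>T S. D (diff_d T S) = diff_d (D T) (D S)" "\<And>T. tempered T ==> dE p (D T) <= ennreal C * F T"
      "\<And>T \<psi>. tempered T ==> \<psi> \<notin> schwartz ==> D T \<psi> = 0"
    and null: "\<And>\<psi>. \<psi> \<in> schwartz ==> (%k. D (FTd (fs k)) \<psi>) \<longlonglongrightarrow> 0"
    and c: "0 < c" "\<forall>\<^sub>F k in sequentially. c <= dE p (D (FTd (fs k)))"
  shows "\<not> compact_op FTd X Y"
proof
  assume comp: "compact_op FTd X Y"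
  have p0: "0 < p" using p by simp
  obtain r g where r: "strict_mono (r :: nat => nat)" "tempered g" "(%k. F (diff_d (FTd (fs (r k))) g)) \<longlonglongrightarrow> 0"
    by (rule compact_opD[where E = E and F = F and A = A and M = M and fs = fs, OF X Y p0 dY comp cont fs])
  have lim: "(%k. dE p (diff_d (D (FTd (fs (r k)))) (D g))) \<longlonglongrightarrow> 0"
    by (rule ennreal_tendsto_0_le[OF r(3), of _ C]) (use D(2)[OF tempered_diff_d[OF tempered_FTd[OF fs(1)] r(2)]] in \<open>simp add: D(1)\<close>)
  have "D g \<psi> = 0" for \<psi>
  proof (cases "\<psi> \<in> schwartz")
    case True
    show ?thesis by (rule dE_limit_eq_0[where S = "%k. D (FTd (fs (r k)))", OF p lim _ True]) (use LIMSEQ_subseq_LIMSEQ[OF null r(1)] in \<open>simp add: o_def\<close>)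
  qed (use D(3) r(2) in blast)
  then have "diff_d T (D g) = T" for T by (auto simp: diff_d_def)
  with lim have "(%k. dE p (D (FTd (fs (r k))))) \<longlonglongrightarrow> 0" by simp
  from tendsto_lowerbound[OF this eventually_subseq[OF r(1) c(2)]] c(1) show False by simp
qed

section \<open>The lowest frequency band and modulated test functions\<close>

lemma dE_piece_0_le_bE: "dE p (piece 0 T) <= ennreal 1 * BE s p T"
  using ennreal_le_suminf[of "%j. ennreal (2 powr (real j * s * p)) * dE p (piece j T)" 0] by (simp add: bE_def)

lemma dE_piece_0_le_dE:
  assumes p: "1 <= p"
  obtains C where "\<And>T :: 'n distr. dE p (piece 0 T) <= ennreal C * dE p T"
proof -
  obtain C where C: "0 < C" "\<And>j g. g \<in> borel_measurable borel ==> lpE p (conv (FT (phi j)) g) <= ennreal C * lpE p g"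
    using conv_phij_le[OF p] by blast
  have "dE p (piece 0 T) <= ennreal C * dE p T" for T :: "'n distr"
  proof (cases "dE p T < \<infinity>")
    case True
    then obtain g where g: "Lp_fun p g" "represents g T" "lpE p g = dE p T" using dE_finite p by blast
    have m: "g \<in> borel_measurable borel" using g(1) by (simp add: Lp_fun_iff)
    have "dE p (piece 0 T) <= lpE p (conv (FT (phi 0)) g)"
      by (rule dE_le[OF conv_measurable[OF schwartz_measurable[OF FT_schwartz[OF phij_schwartz]] m] piece_represents[OF g(1,2) p] p])
    also have "... <= ennreal C * dE p T" using C(2)[OF m] g(3) by simp
    finally show ?thesis .
  next
    case False
    then show ?thesis using C(1) by (simp add: not_less top_unique ennreal_mult_top)
  qed
  then show ?thesis by (rule that)
qed

lemma besov_piece_zero_outside: "\<psi> \<notin> schwartz ==> piece j T \<psi> = 0"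
  by (simp add: besov_piece_def IFTd_def)

text \<open>Modulations of \<phi>0 with growing frequency; \<open>undefined\<close> merely names
  some coordinate direction.\<close>

definition wave :: "nat => 'n cfun" where
  "wave k x = cis (x \<bullet> (real k *\<^sub>R axis undefined 1)) * \<phi>0 x"

lemma wave_schwartz: "wave k \<in> schwartz"
  unfolding wave_def[abs_def] by (rule schwartz_modulate[OF phi0_schwartz])

lemma lpE_wave: "lpE p (wave k) = lpE p \<phi>0"
  by (simp add: lpE_def wave_def norm_mult)

lemma lpE_FT_mult_wave:
  assumes w: "w \<in> schwartz"
  shows "lpE p (FT (%x. w x * wave k x)) = lpE p (FT (%x. w x * \<phi>0 x))"
proof -
  have m: "FT (%x. w x * \<phi>0 x) \<in> borel_measurable borel" by (intro schwartz_measurable FT_schwartz schwartz_mult w phi0_schwartz)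
  have "FT (%x. w x * wave k x) = (%\<xi>. FT (%x. w x * \<phi>0 x) (\<xi> - real k *\<^sub>R axis undefined 1))"
    using FT_modulate[of "real k *\<^sub>R axis undefined 1" "%x. w x * \<phi>0 x"] by (intro ext) (simp add: wave_def mult.left_commute)
  then show ?thesis using lpE_affine[OF m, of 1 p "- (real k *\<^sub>R axis undefined 1)"] by simp
qed

lemma wave_weakly_null:
  assumes \<psi>: "\<psi> \<in> schwartz"
  shows "(%k. distr_of (wave k) \<psi>) \<longlonglongrightarrow> 0"
  using Riemann_Lebesgue_axis[OF schwartz_mult[OF phi0_schwartz \<psi>], of undefined] \<psi> by (simp add: distr_of_def wave_def mult.assoc)

lemma phi0_at_0: "\<phi>0 0 = 1"
  by (rule phi0_1) simp

text \<open>Modulation leaves the L_p norm unchanged and translates the transform of the product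
  with a fixed cutoff, so the lowest piece of the image also keeps its norm. The waves are weakly
  null by Riemann-Lebesgue. Projecting to the lowest band makes the argument independent of
  s.\<close>

lemma not_compact_ge2_s1:
  assumes p: "1 <= p" and cont: "maps_continuously FTd (Lp_space p) (Besov_space \<phi>0 s p)"
  shows "\<not> compact_op FTd (Lp_space p) (Besov_space \<phi>0 s p)"
proof (rule weakly_null_not_compact[where F = "BE s p" and A = "2 powr p" and D = "piece 0" and C = 1, OF enormed_Lp[OF p] enormed_Besov[OF p] p bE_diff_d[OF p] cont])
  show "tempered (distr_of (wave k))" for k by (intro tempered_distr_of schwartz_tame wave_schwartz)
  show "dE p (distr_of (wave k)) <= ennreal (enn2real (lpE p \<phi>0))" for k
    using schwartz_lpE[OF phi0_schwartz p] by (simp add: dE_distr_of[OF wave_schwartz p] lpE_wave less_top)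
  show "dE p (piece 0 T) <= ennreal 1 * BE s p T" for T by (rule dE_piece_0_le_bE)
  show "(%k. piece 0 (FTd (distr_of (wave k))) \<psi>) \<longlonglongrightarrow> 0" if \<psi>: "\<psi> \<in> schwartz" for \<psi>
  proof -
    have "FT (%x. phi 0 x * IFT \<psi> x) \<in> schwartz" by (intro FT_schwartz schwartz_mult phij_schwartz IFT_schwartz \<psi>)
    then show ?thesis using wave_weakly_null[OF FT_schwartz] unfolding piece_FTd_apply[OF \<psi>] by (simp add: FTd_def)
  qed
  let ?w = "%x. phi 0 (- x) * \<phi>0 x"
  have wS: "?w \<in> schwartz" by (intro schwartz_mult schwartz_uminus phij_schwartz phi0_schwartz)
  have "?w 0 ~= 0" by (simp add: phij_def phi0_at_0)
  from schwartz_FT_nonzero[OF wS this] obtain z where "FT ?w z ~= 0" .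
  then show "0 < lpE p (FT ?w)" by (rule schwartz_lpE_pos[OF FT_schwartz[OF wS]])
  show "\<forall>\<^sub>F k in sequentially. lpE p (FT ?w) <= dE p (piece 0 (FTd (distr_of (wave k))))"
    by (simp add: piece_FTd_schwartz[OF wave_schwartz p] lpE_FT_mult_wave[OF schwartz_uminus[OF phij_schwartz]])
qed (auto simp: besov_piece_diff_d besov_piece_zero_outside)

text \<open>The sequence consists of the transforms of the waves. Its Besov norm does not depend on
  k, since every piece is only translated, and a second transform returns the reflected waves, whose
  L_p norm is constant.\<close>

lemma not_compact_lt2_s2:
  assumes p: "1 <= p" and cont: "maps_continuously FTd (Besov_space \<phi>0 s p) (Lp_space p)"
  shows "\<not> compact_op FTd (Besov_space \<phi>0 s p) (Lp_space p)"
proof -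
  define E0 where "E0 = BE s p (FTd (distr_of \<phi>0))"
  have "(\<Sum>j. ennreal (2 powr (real j * s * p)) * dE p (piece j (FTd (distr_of \<phi>0))))
    = (\<Sum>j\<in>{..1}. ennreal (2 powr (real j * s * p)) * dE p (piece j (FTd (distr_of \<phi>0))))"
  proof (rule suminf_finite)
    fix j :: nat
    assume "j \<notin> {..1}"
    then have j: "2 <= j" by simp
    \<comment> \<open>\<phi>0 vanishes beyond radius 3 / 2, while for j \<ge> 2 the function
      \<open>phi j\<close> vanishes on the ball of radius 2; so only the bands 0 and 1 contribute
      and the norm is finite.\<close>
    have z: "phi j (- x) * \<phi>0 x = 0" for x
    proof (cases "3 / 2 <= norm x")
      case False
      have "(2::real) ^ 2 <= 2 ^ j" using j by (intro power_increasing) auto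
      then show ?thesis using phij_0_inside[of j "- x"] j False by simp
    qed (simp add: phi0_0)
    have "FT (%x. phi j (- x) * \<phi>0 x) = (%x. 0)" unfolding z by (rule ext) (rule FT_zero)
    then show "ennreal (2 powr (real j * s * p)) * dE p (piece j (FTd (distr_of \<phi>0))) = 0"
      using p by (simp add: piece_FTd_schwartz[OF phi0_schwartz p] lpE_def)
  qed simp
  also have "... < \<infinity>"
    using schwartz_lpE[OF FT_schwartz[OF schwartz_mult[OF schwartz_uminus[OF phij_schwartz] phi0_schwartz]] p]
    by (simp add: piece_FTd_schwartz[OF phi0_schwartz p] ennreal_mult_less_top)
  finally have E0: "E0 < \<infinity>" by (simp add: E0_def bE_def)
  show ?thesis
  proof (rule weakly_null_not_compact[where F = "dE p" and A = "2 powr p" and D = "%T. T" and C = 1, OF enormed_Besov[OF p] enormed_Lp[OF p] p dE_diff_d[OF p] cont])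
    show "tempered (FTd (distr_of (wave k)))" for k by (intro tempered_FTd tempered_distr_of schwartz_tame wave_schwartz)
    have "BE s p (FTd (distr_of (wave k))) = E0" for k
      unfolding E0_def bE_def
      by (simp add: piece_FTd_schwartz[OF wave_schwartz p] piece_FTd_schwartz[OF phi0_schwartz p] lpE_FT_mult_wave[OF schwartz_uminus[OF phij_schwartz]])
    then show "BE s p (FTd (distr_of (wave k))) <= ennreal (enn2real E0)" for k using E0 by (simp add: less_top)
    show "(%k. FTd (FTd (distr_of (wave k))) \<psi>) \<longlonglongrightarrow> 0" if \<psi>: "\<psi> \<in> schwartz" for \<psi>
      using wave_weakly_null[OF FT_schwartz[OF FT_schwartz[OF \<psi>]]] \<psi> by (simp add: FTd_def FT_schwartz)
    show "0 < lpE p \<phi>0" by (rule schwartz_lpE_pos[OF phi0_schwartz, of 0]) (simp add: phi0_at_0)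
    have "dE p (FTd (FTd (distr_of (wave k)))) = lpE p \<phi>0" for k
    proof -
      have "FTd (FTd (distr_of (wave k))) = distr_of (FT (FT (wave k)))" by (simp add: FTd_distr_of wave_schwartz FT_schwartz)
      then have "dE p (FTd (FTd (distr_of (wave k)))) = lpE p (%x. wave k (- x))"
        using dE_distr_of[OF FT_schwartz[OF FT_schwartz[OF wave_schwartz]] p, of k] by (simp add: FT_inversion[OF wave_schwartz, abs_def])
      also have "... = lpE p (wave k)" using lpE_affine[OF schwartz_measurable[OF wave_schwartz], of "-1" p k 0] by simp
      finally show ?thesis by (simp add: lpE_wave)
    qed
    then show "\<forall>\<^sub>F k in sequentially. lpE p \<phi>0 <= dE p (FTd (FTd (distr_of (wave k))))" by simp
  qed (auto intro: tempered_zero_outside)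
qed

end

section \<open>Dilated test functions at the endpoint order\<close>

context cutoff

begin

text \<open>\<phi>0 drops from 1 to 0 between radii 1 and 3 / 2, so the transitions at the scales
  2^(k-1) and 2^k leave a gap between 3/4 * 2^k and 2^k, in which a single band carries
  everything.\<close>

lemma phij_thin_annulus:
  assumes "3 / 4 <= norm ((1 / 2 ^ k) *\<^sub>R x)" "norm ((1 / 2 ^ k) *\<^sub>R x) <= 1"
  shows "phi j (- x) = (if j = k then 1 else 0)"
proof -
  have x: "3 / 4 * 2 ^ k <= norm x" "norm x <= 2 ^ k" using assms by (simp_all add: field_simps)
  consider "j < k" | "j = k" | "k < j" by linarith
  then show ?thesis
  proof cases
    case 1
    then have "(2::real) ^ Suc j <= 2 ^ k" by (intro power_increasing) auto
    then have "3 / 2 * 2 ^ j <= norm x" using x by simp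
    then have "3 / 2 <= norm ((1 / 2 ^ j) *\<^sub>R (- x))" "3 / 2 <= norm ((2 / 2 ^ j) *\<^sub>R (- x))" using norm_ge_zero[of x] by (simp_all add: field_simps del: norm_ge_zero)
    then show ?thesis using 1 by (cases "j = 0") (auto simp: phij_def phi0_0)
  next
    case 2
    have a: "norm ((1 / 2 ^ k) *\<^sub>R (- x)) <= 1" "3 / 2 <= norm ((2 / 2 ^ k) *\<^sub>R (- x))" using x by (simp_all add: field_simps)
    then show ?thesis using 2 phi0_1[OF a(1)] phi0_0[OF a(2)] by (cases "k = 0") (auto simp: phij_def)
  next
    case 3
    then have "(2::real) ^ Suc k <= 2 ^ j" by (intro power_increasing) auto
    then show ?thesis using 3 x phij_0_inside[of j "- x"] by simp
  qed
qed

lemma two_power_powr: "(2 ^ k :: real) powr a = 2 powr (real k * a)"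
  by (simp add: powr_powr flip: powr_realpow)

text \<open>The functions \<open>h k\<close> are dilates of one bump, normalised in L_p and each
  living in a single band; by \<open>lpE_FT_dilate\<close> their transforms have constant Besov norm
  of order \<open>dnp\<close>. The second transform returns the reflected \<open>h k\<close>, which
  flatten out: the supremum tends to 0, so they are weakly null, but they are of ever lower
  frequency, and the projection to the lowest band asymptotically leaves them unchanged.\<close>

lemma not_compact_lt2_s1:
  assumes p: "1 <= p" and Y: "enormed p Y F" and dY: "\<And>T S. F (diff_d T S) <= ennreal A * (F T + F S)"
    and low: "\<And>T. dE p (piece 0 T) <= ennreal C * F T"
    and cont: "maps_continuously FTd (Besov_space \<phi>0 (dnp CARD('n) p) p) Y"
  shows "\<not> compact_op FTd (Besov_space \<phi>0 (dnp CARD('n) p) p) Y"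
proof -
  let ?d = "dnp CARD('n) p"
  have p0: "0 < p" using p by simp
  define a where "a = (axis undefined 1 :: real^'n)"
  have na: "norm a = 1" by (simp add: a_def norm_axis_1)
  \<comment> \<open>A bump around (7 / 8) a of radius 3 / 32, which fits between the spheres of
    radii 3 / 4 and 1 and hence into the gap of \<open>phij_thin_annulus\<close>.\<close>
  define \<eta> where "\<eta> x = \<phi>0 (16 *\<^sub>R x + (- 14) *\<^sub>R a)" for x
  have \<eta>S: "\<eta> \<in> schwartz" unfolding \<eta>_def[abs_def] by (rule schwartz_affine[OF phi0_schwartz]) simp
  have \<eta>1: "\<eta> ((7 / 8) *\<^sub>R a) ~= 0" by (simp add: \<eta>_def phi0_at_0 flip: scaleR_add_left)
  have \<eta>supp: "3 / 4 <= norm x \<and> norm x <= 1" if "\<eta> x ~= 0" for x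
  proof -
    have "norm (16 *\<^sub>R x + (- 14) *\<^sub>R a) < 3 / 2" using that phi0_0 unfolding \<eta>_def by force
    moreover have "norm (16 *\<^sub>R x) <= norm (16 *\<^sub>R x + (- 14) *\<^sub>R a) + norm ((- 14) *\<^sub>R a)"
      using norm_triangle_ineq4[of "16 *\<^sub>R x + (- 14) *\<^sub>R a" "(- 14) *\<^sub>R a"] by simp
    moreover have "norm ((- 14) *\<^sub>R a) <= norm (16 *\<^sub>R x + (- 14) *\<^sub>R a) + norm (16 *\<^sub>R x)"
      using norm_triangle_ineq4[of "16 *\<^sub>R x + (- 14) *\<^sub>R a" "16 *\<^sub>R x"] by simp
    ultimately show ?thesis using na by simp
  qed
  define c where "c k = (2 ^ k :: real) powr (- real CARD('n) / p)" for k :: nat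
  define h where "h k x = of_real (c k) * \<eta> ((1 / 2 ^ k) *\<^sub>R x)" for k x
  have hS: "h k \<in> schwartz" for k unfolding h_def[abs_def] by (intro schwartz_cmult schwartz_scale \<eta>S) simp
  \<comment> \<open>The lowest piece of the image of the k-th function is, up to an L_p-preserving
    dilation, the transform of \<open>q k\<close>. In this scale the cutoff \<phi>0 is stretched by
    2^k and disappears in the limit.\<close>
  define q where "q k x = \<phi>0 (- ((1 / 2 ^ k) *\<^sub>R x)) * FT \<eta> x" for k x
  have qS: "q k \<in> schwartz" for k unfolding q_def[abs_def]
    by (intro schwartz_mult schwartz_scale[OF schwartz_uminus[OF phi0_schwartz]] FT_schwartz \<eta>S) simp
  have qm[measurable]: "FT (q k) \<in> borel_measurable borel" for k by (rule schwartz_measurable[OF FT_schwartz[OF qS]])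
  obtain P where P: "1 <= P" "\<And>j x. norm (phi j x) <= P" using phij_bounded by blast
  have phiP: "norm (\<phi>0 x) <= P" for x using P(2)[of 0 x] by (simp add: phij_def)
  have lowk: "dE p (piece 0 (FTd (FTd (distr_of (h k))))) = lpE p (FT (q k))" for k
  proof -
    define t :: real where "t = 2 ^ k"
    have t: "0 < t" by (simp add: t_def)
    define u where "u x = of_real (c k * t ^ CARD('n)) * q k x" for x
    have uS: "u \<in> schwartz" unfolding u_def[abs_def] by (intro schwartz_cmult qS)
    have hk: "FT (h k) x = of_real (c k * t ^ CARD('n)) * FT \<eta> (t *\<^sub>R x)" for x
      unfolding h_def[abs_def] t_def[symmetric] using FT_scale[OF schwartz_integrable[OF \<eta>S], of "1 / t" x] t by (simp add: FT_cmult)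
    have "(%x. phi 0 (- x) * FT (h k) x) = (%x. u (t *\<^sub>R x))"
      unfolding hk u_def q_def t_def[symmetric] using t by (simp add: phij_def mult.left_commute)
    then have "FT (%x. phi 0 (- x) * FT (h k) x) = (%\<xi>. of_real (c k) * FT (q k) ((1 / t) *\<^sub>R \<xi>))"
      using FT_scale[OF schwartz_integrable[OF uS] t] t by (intro ext) (simp add: u_def[abs_def] FT_cmult power_one_over)
    then show ?thesis
      using lpE_dilate[OF qm t p0, of k] by (simp add: FTd_distr_of[OF hS] piece_FTd_schwartz[OF FT_schwartz[OF hS] p] c_def t_def)
  qed
  have qlim: "(%k. FT (q k) x) \<longlonglongrightarrow> \<eta> (- x)" for x
  proof -
    have i: "integrable lborel (FT \<eta>)" by (intro schwartz_integrable FT_schwartz \<eta>S)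
    have [measurable]: "FT \<eta> \<in> borel_measurable borel" using i by auto
    have [measurable]: "q k \<in> borel_measurable borel" for k by (rule schwartz_measurable[OF qS])
    have "(%k. \<integral>y. cis (- (y \<bullet> x)) * q k y \<partial>lborel) \<longlonglongrightarrow> (\<integral>y. cis (- (y \<bullet> x)) * FT \<eta> y \<partial>lborel)"
    proof (rule integral_dominated_convergence[where w = "%y. P * norm (FT \<eta> y)"])
      show "AE y in lborel. (%k. cis (- (y \<bullet> x)) * q k y) \<longlonglongrightarrow> cis (- (y \<bullet> x)) * FT \<eta> y"
      proof (intro AE_I2 tendsto_mult tendsto_const tendsto_eventually)
        fix y :: "real^'n"
        obtain K where K: "norm y < 2 ^ K" using real_arch_pow[of 2 "norm y"] by auto
        have "q k y = FT \<eta> y" if "K <= k" for k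
        proof -
          have "(2::real) ^ K <= 2 ^ k" using that by (intro power_increasing) auto
          then have "norm y <= 2 ^ k" using K by linarith
          then have "\<phi>0 (- ((1 / 2 ^ k) *\<^sub>R y)) = 1" by (intro phi0_1) (simp add: field_simps)
          then show ?thesis by (simp add: q_def)
        qed
        then show "\<forall>\<^sub>F k in sequentially. q k y = FT \<eta> y" unfolding eventually_sequentially by blast
      qed
      show "AE y in lborel. norm (cis (- (y \<bullet> x)) * q k y) <= P * norm (FT \<eta> y)" for k
        using phiP by (intro AE_I2) (simp add: norm_mult q_def mult_right_mono)
    qed (use i in auto)
    then have "(%k. FT (q k) x) \<longlonglongrightarrow> FT (FT \<eta>) x" unfolding FT_eq by (intro tendsto_mult tendsto_const)
    then show ?thesis by (simp add: FT_inversion[OF \<eta>S])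
  qed
  have "0 < lpE p (%x. \<eta> (- x))" by (rule schwartz_lpE_pos[OF schwartz_uminus[OF \<eta>S], of "- ((7 / 8) *\<^sub>R a)"]) (use \<eta>1 in simp)
  then obtain \<epsilon> where \<epsilon>: "0 < \<epsilon>" "\<epsilon> < lpE p (%x. \<eta> (- x))" using dense by blast
  \<comment> \<open>Fatou's lemma turns the pointwise convergence of \<open>FT (q k)\<close> into a
    lower bound for the norms, all that is needed here.\<close>
  have "lpE p (%x. \<eta> (- x)) = (\<integral>\<^sup>+x. liminf (%k. ennreal (norm (FT (q k) x) powr p)) \<partial>lborel)"
    unfolding lpE_def by (simp add: lim_imp_Liminf[OF _ powr_norm_tendsto[OF qlim p0]])
  also have "... <= liminf (%k. lpE p (FT (q k)))" unfolding lpE_def by (rule nn_integral_liminf) simp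
  finally have ev: "\<forall>\<^sub>F k in sequentially. \<epsilon> < lpE p (FT (q k))" using \<epsilon>(2) by (intro less_LiminfD) simp
  show ?thesis
  proof (rule weakly_null_not_compact[where F = F and A = A and D = "piece 0" and C = C, OF enormed_Besov[OF p] Y p dY cont])
    show "tempered (FTd (distr_of (h k)))" for k by (intro tempered_FTd tempered_distr_of schwartz_tame hS)
    show "BE ?d p (FTd (distr_of (h k))) <= ennreal (enn2real (lpE p (FT \<eta>)))" for k
    proof -
      have e: "phi j (- x) * h k x = (if j = k then h k x else 0)" for j x
      proof (cases "\<eta> ((1 / 2 ^ k) *\<^sub>R x) = 0")
        case False
        with \<eta>supp have "phi j (- x) = (if j = k then 1 else 0)" by (intro phij_thin_annulus) blast+
        then show ?thesis by simp
      qed (simp add: h_def)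
      have "BE ?d p (FTd (distr_of (h k))) = (\<Sum>j\<in>{k}. ennreal (2 powr (real j * ?d * p)) * lpE p (FT (%x. if j = k then h k x else 0)))"
        unfolding bE_def piece_FTd_schwartz[OF hS p] e using p0
        by (intro suminf_finite) (auto simp: FT_zero lpE_def)
      also have "... = ennreal ((2 ^ k) powr (?d * p)) * lpE p (FT (h k))" by (simp add: two_power_powr mult.assoc)
      also have "... = lpE p (FT \<eta>)" using lpE_FT_dilate[OF \<eta>S _ p0, of "2 ^ k"] by (simp add: h_def[abs_def] c_def)
      finally show ?thesis using schwartz_lpE[OF FT_schwartz[OF \<eta>S] p] by (simp add: less_top)
    qed
    show "(%k. piece 0 (FTd (FTd (distr_of (h k)))) \<psi>) \<longlonglongrightarrow> 0" if \<psi>: "\<psi> \<in> schwartz" for \<psi>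
    proof -
      define \<chi>' where "\<chi>' = FT (FT (FT (%x. phi 0 x * IFT \<psi> x)))"
      have S1: "FT (%x. phi 0 x * IFT \<psi> x) \<in> schwartz" by (intro FT_schwartz schwartz_mult phij_schwartz IFT_schwartz \<psi>)
      have S: "\<chi>' \<in> schwartz" unfolding \<chi>'_def by (intro FT_schwartz S1)
      have eq: "piece 0 (FTd (FTd (distr_of (h k)))) \<psi> = (\<integral>x. h k x * \<chi>' x \<partial>lborel)" for k
        unfolding piece_FTd_apply[OF \<psi>] using S1 S by (simp add: FTd_def distr_of_def FT_schwartz \<chi>'_def)
      \<comment> \<open>The supremum of \<open>h k\<close> is at most \<open>c k * P\<close> and
        \<open>\<chi>'\<close> is integrable; c k tends to 0 geometrically.\<close>
      have "norm (\<integral>x. h k x * \<chi>' x \<partial>lborel) <= c k * (P * (\<integral>x. norm (\<chi>' x) \<partial>lborel))" for k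
      proof -
        have i: "integrable lborel (%x. h k x * \<chi>' x)" "integrable lborel \<chi>'" by (intro schwartz_integrable schwartz_mult hS S)+
        have "norm (\<integral>x. h k x * \<chi>' x \<partial>lborel) <= (\<integral>x. norm (h k x * \<chi>' x) \<partial>lborel)" by (rule integral_norm_bound)
        also have "... <= (\<integral>x. c k * (P * norm (\<chi>' x)) \<partial>lborel)"
        proof (rule integral_mono)
          show "norm (h k x * \<chi>' x) <= c k * (P * norm (\<chi>' x))" for x
            using phiP by (simp add: norm_mult h_def \<eta>_def c_def mult_left_mono mult_right_mono mult.assoc)
        qed (use i in auto)
        finally show ?thesis by simp
      qed
      moreover have "(%k. c k * (P * (\<integral>x. norm (\<chi>' x) \<partial>lborel))) \<longlonglongrightarrow> 0"
      proof -
        have ck: "c k = (2 powr (- real CARD('n) / p)) ^ k" for k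
          unfolding c_def two_power_powr by (subst powr_realpow[symmetric]) (simp_all add: powr_powr mult.commute)
        have "(2::real) powr (- real CARD('n) / p) < 1" using p0 by (simp add: powr_less_one)
        then have "(%k. c k) \<longlonglongrightarrow> 0" unfolding ck by (intro LIMSEQ_realpow_zero) auto
        from tendsto_mult[OF this tendsto_const] show ?thesis by simp
      qed
      ultimately show ?thesis unfolding eq by (rule Lim_null_comparison[OF always_eventually[OF allI]])
    qed
    show "0 < \<epsilon>" by fact
    show "\<forall>\<^sub>F k in sequentially. \<epsilon> <= dE p (piece 0 (FTd (FTd (distr_of (h k)))))"
      unfolding lowk using ev by eventually_elim simp
  qed (auto simp: besov_piece_diff_d besov_piece_zero_outside low)
qed

text \<open>The converse use of the quasi-triangle inequality: T is recovered from T - S and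
  S.\<close>

lemma dE_triangle:
  fixes T S :: "'n distr"
  assumes p: "1 <= p"
  shows "dE p T <= ennreal (2 powr p) * (dE p (diff_d T S) + dE p S)"
proof (cases "dE p (diff_d T S) < \<infinity> \<and> dE p S < \<infinity>")
  case True
  obtain g where g: "Lp_fun p g" "represents g (diff_d T S)" "lpE p g = dE p (diff_d T S)" using dE_finite[OF _ p] True by blast
  obtain h where h: "Lp_fun p h" "represents h S" "lpE p h = dE p S" using dE_finite[OF _ p] True by blast
  have m: "g \<in> borel_measurable borel" "h \<in> borel_measurable borel" using g h by (auto simp: Lp_fun_iff)
  have "represents (%x. g x + h x) T"
    unfolding represents_def
  proof
    fix \<psi> :: "'n cfun"
    assume \<psi>: "\<psi> \<in> schwartz"
    have "T \<psi> = diff_d T S \<psi> + S \<psi>" by (simp add: diff_d_def)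
    also have "... = (\<integral>x. g x * \<psi> x \<partial>lborel) + (\<integral>x. h x * \<psi> x \<partial>lborel)" using g h \<psi> by (simp add: represents_def)
    also have "... = (\<integral>x. (g x + h x) * \<psi> x \<partial>lborel)"
      using tame_schwartz_integrable[OF Lp_fun_tame[OF g(1) p] \<psi>] tame_schwartz_integrable[OF Lp_fun_tame[OF h(1) p] \<psi>] by (simp add: distrib_right)
    finally show "T \<psi> = (\<integral>x. (g x + h x) * \<psi> x \<partial>lborel)" .
  qed
  then have "dE p T <= lpE p (%x. g x + h x)" using m by (intro dE_le[OF _ _ p]) auto
  also have "... <= ennreal (2 powr p) * (lpE p g + lpE p h)" using p by (intro lpE_add m) auto
  finally show ?thesis using g h by simp
next
  case False
  then have "dE p (diff_d T S) + dE p S = top" by (auto simp: not_less top_unique)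
  then show ?thesis by (simp only: ennreal_mult_top) (simp add: ennreal_mult_top)
qed

text \<open>The functions \<open>hk\<close> shrink to the origin. Their transforms
  \<open>fs k\<close> have constant L_p norm and only a zeroth piece, so every Besov norm is
  constant as well. After the second transform the k-th piece keeps a constant weighted norm of
  order \<open>dnp\<close>, whereas the weighted pieces of any limit must tend to 0: the mass
  escapes to high frequencies.\<close>

lemma not_compact_ge2_s2:
  assumes p: "1 <= p" and X: "enormed p X E" and E: "E = dE p \<or> E = BE s p"
    and cont: "maps_continuously FTd X (Besov_space \<phi>0 (dnp CARD('n) p) p)"
  shows "\<not> compact_op FTd X (Besov_space \<phi>0 (dnp CARD('n) p) p)"
proof
  assume comp: "compact_op FTd X (Besov_space \<phi>0 (dnp CARD('n) p) p)"
  let ?d = "dnp CARD('n) p"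
  have p0: "0 < p" using p by simp
  define e where "e = (axis undefined 1 :: real^'n)"
  have ne: "norm e = 1" by (simp add: e_def norm_axis_1)
  \<comment> \<open>The support lies within radius 3 / 8. All its shrunken copies stay where
    \<open>phi 0\<close> equals 1 and the other bands vanish.\<close>
  define w where "w x = \<phi>0 (4 *\<^sub>R x)" for x
  have wS: "w \<in> schwartz" unfolding w_def[abs_def] by (intro schwartz_scale phi0_schwartz) simp
  have "w 0 ~= 0" by (simp add: w_def phi0_at_0)
  from schwartz_FT_nonzero[OF wS this] obtain z where z: "FT w z ~= 0" .
  \<comment> \<open>The modulation moves the point z, where the transform of w is nonzero, to the
    unit vector e.\<close>
  define h where "h x = cis (x \<bullet> (e - z)) * w x" for x
  have hS: "h \<in> schwartz" unfolding h_def[abs_def] by (rule schwartz_modulate[OF wS])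
  have fe: "FT h e ~= 0" unfolding h_def[abs_def] FT_modulate using z by simp
  have hsupp: "norm x <= 1 / 2" if "h x ~= 0" for x using that phi0_0[of "4 *\<^sub>R x"] by (force simp: h_def w_def)
  define c where "c k = (2 ^ k :: real) powr (- real CARD('n) / p)" for k :: nat
  define hk where "hk k x = of_real (c k * (2 ^ k) ^ CARD('n)) * h (2 ^ k *\<^sub>R x)" for k x
  have hkS: "hk k \<in> schwartz" for k unfolding hk_def[abs_def] by (intro schwartz_cmult schwartz_scale hS) simp
  have FThk: "FT (hk k) = (%\<xi>. of_real (c k) * FT h ((1 / 2 ^ k) *\<^sub>R \<xi>))" for k
    unfolding hk_def[abs_def] using FT_scale[OF schwartz_integrable[OF hS], of "2 ^ k"] by (intro ext) (simp add: FT_cmult power_one_over)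
  have lpk: "lpE p (FT (hk k)) = lpE p (FT h)" for k
    unfolding FThk c_def by (rule lpE_dilate[OF schwartz_measurable[OF FT_schwartz[OF hS]] _ p0]) simp
  define fs where "fs k = FTd (distr_of (hk k))" for k
  have ft: "tempered (fs k)" for k unfolding fs_def by (intro tempered_FTd tempered_distr_of schwartz_tame hkS)
  have fsE: "E (fs k) <= ennreal (enn2real (lpE p (FT h)))" for k
  proof -
    have "dE p (fs k) = lpE p (FT h)" by (simp add: fs_def FTd_distr_of[OF hkS] dE_distr_of[OF FT_schwartz[OF hkS] p] lpk)
    moreover have "BE s p (fs k) = lpE p (FT h)"
    proof -
      have e: "phi j (- x) * hk k x = (if j = 0 then hk k x else 0)" for j x
      proof (cases "hk k x = 0")
        case False
        then have "norm (2 ^ k *\<^sub>R x) <= 1 / 2" by (intro hsupp) (auto simp: hk_def)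
        moreover have "norm x <= norm (2 ^ k *\<^sub>R x)" using mult_right_mono[of 1 "2 ^ k" "norm x"] by simp
        ultimately have x: "norm x <= 1 / 2" by linarith
        have "(1::real) <= 2 ^ j" by simp
        with x have "norm (- x) <= 2 ^ j / 2" unfolding norm_minus_cancel by linarith
        then show ?thesis using x phij_0_inside[of j "- x"] phi0_1[of "- x"] by (cases "j = 0") (simp_all add: phij_def)
      qed simp
      have "BE s p (fs k) = (\<Sum>j\<in>{0}. ennreal (2 powr (real j * s * p)) * lpE p (FT (%x. if j = 0 then hk k x else 0)))"
        unfolding bE_def fs_def piece_FTd_schwartz[OF hkS p] e using p0
        by (intro suminf_finite) (auto simp: FT_zero lpE_def)
      then show ?thesis by (simp add: lpk)
    qed
    ultimately show ?thesis using E schwartz_lpE[OF FT_schwartz[OF hS] p] by (auto simp: less_top)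
  qed
  \<comment> \<open>The k-th band and \<open>FT (hk k)\<close> live on the same scale 2^k, so for k
    > 0 their product is a dilate of one function u. At e the bracket equals 1 - 0, hence u is not
    identically zero.\<close>
  define u where "u x = (\<phi>0 (- x) - \<phi>0 (- (2 *\<^sub>R x))) * FT h x" for x
  have uS: "u \<in> schwartz" unfolding u_def[abs_def]
    by (intro schwartz_mult schwartz_diff schwartz_uminus[OF phi0_schwartz] schwartz_scale[OF schwartz_uminus[OF phi0_schwartz]] FT_schwartz hS) simp
  have "u e ~= 0" using fe ne phi0_1[of "- e"] phi0_0[of "- (2 *\<^sub>R e)"] by (simp add: u_def)
  from schwartz_FT_nonzero[OF uS this] obtain y where "FT u y ~= 0" .
  then have upos: "0 < lpE p (FT u)" by (rule schwartz_lpE_pos[OF FT_schwartz[OF uS]])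
  have main: "ennreal (2 powr (real k * ?d * p)) * dE p (piece k (FTd (fs k))) = lpE p (FT u)" if "0 < k" for k
  proof -
    have "(%x. phi k (- x) * FT (hk k) x) = (%x. of_real (c k) * u ((1 / 2 ^ k) *\<^sub>R x))"
      using that by (simp add: FThk phij_def u_def mult.left_commute)
    then have "dE p (piece k (FTd (fs k))) = lpE p (FT (%x. of_real (c k) * u ((1 / 2 ^ k) *\<^sub>R x)))"
      by (simp add: fs_def FTd_distr_of[OF hkS] piece_FTd_schwartz[OF FT_schwartz[OF hkS] p])
    then show ?thesis using lpE_FT_dilate[OF uS _ p0, of "2 ^ k"] by (simp add: c_def two_power_powr mult.assoc)
  qed
  obtain r g where r: "strict_mono (r :: nat => nat)" "tempered g" "BE ?d p g < \<infinity>" "(%k. BE ?d p (diff_d (FTd (fs (r k))) g)) \<longlonglongrightarrow> 0"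
    by (rule compact_opD[where E = E and F = "BE ?d p" and A = "2 powr p" and fs = fs and M = "enn2real (lpE p (FT h))",
      OF X enormed_Besov[OF p] p0 bE_diff_d[OF p] comp cont ft fsE])
  define a where "a T j = ennreal (2 powr (real j * ?d * p)) * dE p (piece j T)" for T j
  have al: "a T j <= BE ?d p T" for T j unfolding a_def bE_def by (rule ennreal_le_suminf)
  \<comment> \<open>The weighted pieces of g are the terms of a convergent series.\<close>
  have "a g \<longlonglongrightarrow> 0"
  proof -
    have fin: "a g j < \<infinity>" for j by (rule le_less_trans[OF al r(3)])
    then have eq: "a g j = ennreal (enn2real (a g j))" for j by (simp add: less_top)
    have "(\<Sum>j. ennreal (enn2real (a g j))) ~= top" using r(3) unfolding eq[symmetric] by (simp add: a_def bE_def)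
    then have "summable (%j. enn2real (a g j))" by (intro summable_suminf_not_top) auto
    then have "(%j. ennreal (enn2real (a g j))) \<longlonglongrightarrow> ennreal 0" by (intro tendsto_ennrealI summable_LIMSEQ_zero)
    then show ?thesis unfolding eq[symmetric] by simp
  qed
  then have "(%k. a g (r k)) \<longlonglongrightarrow> 0" using LIMSEQ_subseq_LIMSEQ[OF _ r(1)] by (force simp: o_def)
  from tendsto_add[OF r(4) this] have lim: "(%k. BE ?d p (diff_d (FTd (fs (r k))) g) + a g (r k)) \<longlonglongrightarrow> 0" by simp
  have "(%k. a (FTd (fs (r k))) (r k)) \<longlonglongrightarrow> 0"
  proof (rule ennreal_tendsto_0_le[OF lim, of _ "2 powr p"])
    fix k
    let ?T = "FTd (fs (r k))" and ?w = "ennreal (2 powr (real (r k) * ?d * p))"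
    have "a ?T (r k) <= ?w * (ennreal (2 powr p) * (dE p (diff_d (piece (r k) ?T) (piece (r k) g)) + dE p (piece (r k) g)))"
      unfolding a_def by (intro mult_left_mono dE_triangle[OF p]) auto
    also have "... = ennreal (2 powr p) * (a (diff_d ?T g) (r k) + a g (r k))"
      by (simp add: a_def besov_piece_diff_d distrib_left mult.left_commute)
    also have "... <= ennreal (2 powr p) * (BE ?d p (diff_d ?T g) + a g (r k))" by (intro mult_left_mono add_mono al) auto
    finally show "a ?T (r k) <= ennreal (2 powr p) * (BE ?d p (diff_d ?T g) + a g (r k))" .
  qed
  moreover have "\<forall>\<^sub>F k in sequentially. lpE p (FT u) <= a (FTd (fs (r k))) (r k)"
    unfolding eventually_sequentially
  proof (intro exI[of _ 1] allI impI)
    fix k :: nat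
    assume "1 <= k"
    \<comment> \<open>\<open>main\<close> requires a positive band index, as \<open>phi 0\<close> is
      not a difference of dilates; r k \<ge> k provides it from k = 1 on.\<close>
    then have "0 < r k" using seq_suble[OF r(1), of k] by linarith
    then show "lpE p (FT u) <= a (FTd (fs (r k))) (r k)" by (simp add: a_def main)
  qed
  ultimately have "lpE p (FT u) <= 0" by (rule tendsto_lowerbound) simp
  then show False using upos by simp
qed

section \<open>The mapping theorem\<close>

text \<open>The transform is factored as X into L_p, L_p into the Besov space of order
  \<open>dnp\<close>, and from there down to order s2; the outer two maps are identities.\<close>

lemma mapping_ge2:
  assumes p: "2 <= p" and s1: "0 <= s1" and s2: "s2 <= dnp CARD('n) p"
  shows "maps_continuously FTd (X_space \<phi>0 p s1) (Y_space \<phi>0 p s2) \<and>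
    (compact_op FTd (X_space \<phi>0 p s1) (Y_space \<phi>0 p s2) \<longleftrightarrow> 0 < s1 \<and> s2 < dnp CARD('n) p)"
proof -
  let ?d = "dnp CARD('n) p"
  have p1: "1 <= p" "0 < p" using p by auto
  define E where "E = (if s1 = 0 then dE p else BE s1 p)"
  define X where "X = (if s1 = 0 then Lp_space p else Besov_space \<phi>0 s1 p)"
  have XY: "X_space \<phi>0 p s1 = X" "Y_space \<phi>0 p s2 = Besov_space \<phi>0 s2 p"
    using p s1 s2 by (auto simp: X_space_def Y_space_def X_def)
  have XE: "enormed p X E" by (simp add: X_def E_def enormed_Lp[OF p1(1)] enormed_Besov[OF p1(1)])
  have dX: "E (diff_d T S) <= ennreal (2 powr p) * (E T + E S)" for T S
    by (simp add: E_def dE_diff_d[OF p1(1)] bE_diff_d[OF p1(1)])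
  obtain C1 where C1: "0 < C1" "\<And>T. dE p T < \<infinity> ==> BE ?d p (FTd T) <= ennreal C1 * dE p T"
    using FTd_Lp_to_Besov[OF p] by blast
  have "\<exists>C2. 0 < C2 \<and> (\<forall>T. tempered T \<longrightarrow> E T < \<infinity> \<longrightarrow> dE p T <= ennreal C2 * E T)"
  proof (cases "s1 = 0")
    case True
    then show ?thesis by (intro exI[of _ 1]) (simp add: E_def)
  next
    case False
    with s1 have "0 < s1" by simp
    obtain C where "0 < C" "\<And>T. tempered T ==> BE s1 p T < \<infinity> ==> dE p T <= ennreal C * BE s1 p T"
      using Lp_le_Besov[OF p1(1) \<open>0 < s1\<close>] by blast
    then show ?thesis using False by (auto simp: E_def)
  qed
  then obtain C2 where C2: "0 < C2" "\<And>T. tempered T ==> E T < \<infinity> ==> dE p T <= ennreal C2 * E T" by blast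
  have bound: "BE s2 p (FTd T) <= ennreal (C1 * C2) * E T" if T: "tempered T" "E T < \<infinity>" for T
  proof -
    have "dE p T < \<infinity>" using C2(2)[OF T] T(2) by (auto intro: le_less_trans simp: ennreal_mult_less_top)
    then have "BE s2 p (FTd T) <= ennreal C1 * dE p T" by (rule order_trans[OF bE_mono[OF s2 p1(2)] C1(2)])
    also have "... <= ennreal C1 * (ennreal C2 * E T)" by (intro mult_left_mono C2 T) auto
    also have "... = ennreal (C1 * C2) * E T" using C1(1) C2(1) by (simp add: ennreal_mult mult.assoc)
    finally show ?thesis .
  qed
  have cont: "maps_continuously FTd X (Besov_space \<phi>0 s2 p)"
    by (rule maps_continuouslyI[where E = E and F = "BE s2 p", OF XE enormed_Besov[OF p1(1)] p1(2) dX bound])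
  have "compact_op FTd X (Besov_space \<phi>0 s2 p)" if "0 < s1" "s2 < ?d"
  proof (rule compact_opI[where E = E and F = "BE s2 p" and A = "2 powr p", OF XE enormed_Besov[OF p1(1)] p1(2) bE_diff_d[OF p1(1)]])
    show "BE s2 p (FTd T) < \<infinity>" if T: "tempered T" "E T < \<infinity>" for T
      using le_less_trans[OF bound[OF T]] T(2) by (simp add: ennreal_mult_less_top)
    have "E = BE s1 p" using that by (simp add: E_def)
    then show "\<exists>r f. strict_mono (r :: nat => nat) \<and> tempered f \<and> E f < \<infinity> \<and> (%k. BE s2 p (FTd (diff_d (fs (r k)) f))) \<longlonglongrightarrow> 0"
      if "\<And>k. tempered (fs k)" "\<And>k. E (fs k) <= ennreal M" for fs :: "nat => 'n distr" and M
      using compact_ge2[OF p \<open>0 < s1\<close> \<open>s2 < ?d\<close>, of fs M] that by simp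
  qed
  moreover have "\<not> compact_op FTd X (Besov_space \<phi>0 s2 p)" if "s1 = 0"
    using not_compact_ge2_s1[OF p1(1)] cont that by (simp add: X_def)
  moreover have "\<not> compact_op FTd X (Besov_space \<phi>0 s2 p)" if "s2 = ?d"
    using not_compact_ge2_s2[OF p1(1) XE, of s1] cont that by (simp add: E_def)
  ultimately show ?thesis unfolding XY using cont s1 s2 by fastforce
qed

text \<open>Factored in the opposite order: from s1 down to the Besov space of order
  \<open>dnp\<close>, then by the transform into L_p, then into Y. The source is a Besov space even
  at its endpoint, so both endpoint cases differ from those of \<open>mapping_ge2\<close>.\<close>

lemma mapping_lt2:
  assumes p: "1 < p" "p < 2" and s1: "dnp CARD('n) p <= s1" and s2: "s2 <= 0"
  shows "maps_continuously FTd (X_space \<phi>0 p s1) (Y_space \<phi>0 p s2) \<and>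
    (compact_op FTd (X_space \<phi>0 p s1) (Y_space \<phi>0 p s2) \<longleftrightarrow> dnp CARD('n) p < s1 \<and> s2 < 0)"
proof -
  let ?d = "dnp CARD('n) p"
  have p1: "1 <= p" "0 < p" using p by auto
  define F where "F = (if s2 = 0 then dE p else BE s2 p)"
  define Y where "Y = (if s2 = 0 then Lp_space p else Besov_space \<phi>0 s2 p)"
  have XY: "X_space \<phi>0 p s1 = Besov_space \<phi>0 s1 p" "Y_space \<phi>0 p s2 = Y"
    using p s1 s2 by (auto simp: X_space_def Y_space_def Y_def)
  have YF: "enormed p Y F" by (simp add: Y_def F_def enormed_Lp[OF p1(1)] enormed_Besov[OF p1(1)])
  have dY: "F (diff_d T S) <= ennreal (2 powr p) * (F T + F S)" for T S
    by (simp add: F_def dE_diff_d[OF p1(1)] bE_diff_d[OF p1(1)])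
  obtain C1 where C1: "0 < C1" "\<And>T. tempered T ==> BE ?d p T < \<infinity> ==>
      \<exists>u. Lp_fun p u \<and> represents u (FTd T) \<and> lpE p u <= ennreal C1 * BE ?d p T"
    using FTd_Besov_function[OF p] by (metis (no_types, lifting))
  have "\<exists>C2. 0 < C2 \<and> (\<forall>T. dE p T < \<infinity> \<longrightarrow> F T <= ennreal C2 * dE p T)"
  proof (cases "s2 = 0")
    case True
    then show ?thesis by (intro exI[of _ 1]) (simp add: F_def)
  next
    case False
    with s2 have "s2 < 0" by simp
    obtain C where "0 < C" "\<And>T. dE p T < \<infinity> ==> BE s2 p T <= ennreal C * dE p T" using Besov_le_Lp[OF p1(1) \<open>s2 < 0\<close>] by blast
    then show ?thesis using False by (auto simp: F_def)
  qed
  then obtain C2 where C2: "0 < C2" "\<And>T. dE p T < \<infinity> ==> F T <= ennreal C2 * dE p T" by blast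
  have bound: "F (FTd T) <= ennreal (C2 * C1) * BE s1 p T" if T: "tempered T" "BE s1 p T < \<infinity>" for T
  proof -
    have m: "BE ?d p T <= BE s1 p T" by (rule bE_mono[OF s1 p1(2)])
    obtain u where u: "Lp_fun p u" "represents u (FTd T)" "lpE p u <= ennreal C1 * BE ?d p T"
      using C1(2)[OF T(1) le_less_trans[OF m T(2)]] by blast
    have e: "dE p (FTd T) = lpE p u" by (rule dE_eq[OF u(1,2) p1(1)])
    have "F (FTd T) <= ennreal C2 * dE p (FTd T)" using u(1) by (intro C2) (simp add: e Lp_fun_iff)
    also have "... <= ennreal C2 * (ennreal C1 * BE s1 p T)" unfolding e by (intro mult_left_mono order_trans[OF u(3)] m) auto
    also have "... = ennreal (C2 * C1) * BE s1 p T" using C1(1) C2(1) by (simp add: ennreal_mult mult.assoc)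
    finally show ?thesis .
  qed
  have cont: "maps_continuously FTd (Besov_space \<phi>0 s1 p) Y"
    by (rule maps_continuouslyI[where E = "BE s1 p" and F = F, OF enormed_Besov[OF p1(1)] YF p1(2) bE_diff_d[OF p1(1)] bound])
  have "compact_op FTd (Besov_space \<phi>0 s1 p) Y" if "?d < s1" "s2 < 0"
  proof (rule compact_opI[where E = "BE s1 p" and F = F and A = "2 powr p", OF enormed_Besov[OF p1(1)] YF p1(2) dY])
    show "F (FTd T) < \<infinity>" if T: "tempered T" "BE s1 p T < \<infinity>" for T
      using le_less_trans[OF bound[OF T]] T(2) by (simp add: ennreal_mult_less_top)
    have "F = BE s2 p" using that by (simp add: F_def)
    then show "\<exists>r f. strict_mono (r :: nat => nat) \<and> tempered f \<and> BE s1 p f < \<infinity> \<and> (%k. F (FTd (diff_d (fs (r k)) f))) \<longlonglongrightarrow> 0"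
      if "\<And>k. tempered (fs k)" "\<And>k. BE s1 p (fs k) <= ennreal M" for fs :: "nat => 'n distr" and M
      using compact_lt2[OF p \<open>?d < s1\<close> \<open>s2 < 0\<close>, of fs M] that by simp
  qed
  moreover have "\<not> compact_op FTd (Besov_space \<phi>0 s1 p) Y" if "s2 = 0"
    using not_compact_lt2_s2[OF p1(1)] cont that by (simp add: Y_def)
  moreover have "\<not> compact_op FTd (Besov_space \<phi>0 s1 p) Y" if "s1 = ?d"
  proof -
    obtain C where "\<And>T :: 'n distr. dE p (piece 0 T) <= ennreal C * dE p T" using dE_piece_0_le_dE[OF p1(1)] by blast
    then have "\<exists>C. \<forall>T :: 'n distr. dE p (piece 0 T) <= ennreal C * F T"
      using dE_piece_0_le_bE unfolding F_def by (cases "s2 = 0") (auto intro: exI[of _ C] exI[of _ 1])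
    then obtain C where "\<And>T :: 'n distr. dE p (piece 0 T) <= ennreal C * F T" by blast
    from not_compact_lt2_s1[where F = F and A = "2 powr p" and C = C, OF p1(1) YF dY this] cont that show ?thesis by simp
  qed
  ultimately show ?thesis unfolding XY using cont s1 s2 by fastforce
qed

end

theorem theorem3p2:
  fixes \<phi>0 :: "real^'n::finite \<Rightarrow> complex" and p s1 s2 :: real
  assumes "\<phi>0 \<in> schwartz"
    and "\<forall>x. norm x \<le> 1 \<longrightarrow> \<phi>0 x = 1"
    and "\<forall>x. norm x \<ge> 3 / 2 \<longrightarrow> \<phi>0 x = 0"
    and "1 < p"
    and "s1 \<ge> tau_plus CARD('n) p"
    and "s2 \<le> tau_minus CARD('n) p"
  shows "maps_continuously FTd (X_space \<phi>0 p s1) (Y_space \<phi>0 p s2) \<and>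
         (compact_op FTd (X_space \<phi>0 p s1) (Y_space \<phi>0 p s2) \<longleftrightarrow>
            s1 > tau_plus CARD('n) p \<and> s2 < tau_minus CARD('n) p)"
proof -
  interpret cutoff \<phi>0 using assms by unfold_locales auto
  show ?thesis
  proof (cases "2 \<le> p")
    case True
    \<comment> \<open>The exponent p = 2 belongs to this case; there \<open>dnp\<close> is 0 and
      both thresholds coincide.\<close>
    then have "dnp CARD('n) p \<le> 0" unfolding dnp_def by (intro mult_nonneg_nonpos) (auto simp: field_simps)
    then have t: "tau_plus CARD('n) p = 0" "tau_minus CARD('n) p = dnp CARD('n) p" by (auto simp: tau_plus_def tau_minus_def)
    show ?thesis using mapping_ge2[OF True] assms(5,6) unfolding t by blast
  next
    case False
    then have "0 < dnp CARD('n) p" unfolding dnp_def using assms(4) by (intro mult_pos_pos) (auto simp: field_simps)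
    then have t: "tau_plus CARD('n) p = dnp CARD('n) p" "tau_minus CARD('n) p = 0" by (auto simp: tau_plus_def tau_minus_def)
    show ?thesis using mapping_lt2[OF assms(4)] False assms(5,6) unfolding t by (simp add: not_le)
  qed
qed

end
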